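(* Consider a function $V:\mathbb R^n\times\mathbb R\to\mathbb R$, $(x,y)\mapsto V(x,y)$, such that $V(x,y)=V(|x|,y)$ (that is, $V$ is spherically symmetric with respect to $x$). Let $\delta>0$ be a constant and take $\gamma>\frac n2\left(\frac{\delta}{1+\delta}\right)$, where $\delta$ is assumed to be small enough so that $0<\gamma<1$. Suppose also that there exist functions $h\in L^2(\mathbb R^n)$ and $g\in L^{\frac{2(1+\delta)}{\delta}}(\mathbb R^n)$ such that $$|V(x,y)|\le C\left(|h(x)|+|y|^{1+\delta}\right),\qquad\left|\frac{\partial}{\partial y}V(x,y)\right|\le C\left(|g(x)|+|y|^\delta\right)$$ for some constant $C>0$. Then there exist $0<\epsilon<1$ and $0<\rho_\epsilon<1$ such that there is a radial solution $u\in\mathcal H^{2,2}_r(a)$, where $a(t)=\frac1\kappa t^{\gamma/2}$, to the equation $$\frac1\kappa(-\Delta)^{\gamma/2}u=-u+V(x,u),\qquad \kappa>0,$$ whenever $\|h\|_{L^2(\mathbb R^n)}<\rho_\epsilon$. Moreover, $u$ belongs to $L^{2(1+\delta)}_r(\mathbb R^n)$ and $\|u\|_{L^{2(1+\delta)}_r(\mathbb R^n)}\le\epsilon$.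
   Context: $\mathcal F$ denotes the Fourier transform on $\mathbb R^n$, and $(-\Delta)^{\gamma/2}u=\mathcal F^{-1}(|\xi|^\gamma\mathcal F u)$. For $a(t)=\frac1\kappa t^{\gamma/2}$, $t\ge0$, the space $\mathcal H^{2,2}(a)$ is $\{u\in L^2(\mathbb R^n):\mathcal F^{-1}((1+a(|\xi|^2))\mathcal F u)\in L^2(\mathbb R^n)\}$, and $\mathcal H^{2,2}_r(a)$ is its subspace of spherically symmetric functions. $L^q_r(\mathbb R^n)$ is the closure in $L^q(\mathbb R^n)$ of the spherically symmetric functions in $C_0^\infty(\mathbb R^n)$, with the $L^q$ norm. $V(x,u)$ denotes the function $x\mapsto V(x,u(x))$. *)

theory Defs
  imports "HOL-Analysis.Analysis"
begin

text \<open>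
  \<open>\<real>\<^sup>n\<close> is a type \<open>'a :: euclidean_space\<close> with \<open>n = DIM('a)\<close>. Elements of \<open>L\<^sup>p\<close> are represented by
  Lebesgue measurable functions, not by equivalence classes.
\<close>

definition Lp_space :: "real \<Rightarrow> ('a::euclidean_space \<Rightarrow> 'b::real_normed_vector) set" where
  "Lp_space p = {f. f \<in> borel_measurable lebesgue \<and> integrable lebesgue (\<lambda>x. norm (f x) powr p)}"

definition Lp_norm :: "real \<Rightarrow> ('a::euclidean_space \<Rightarrow> 'b::real_normed_vector) \<Rightarrow> real" where
  "Lp_norm p f = (\<integral>x. norm (f x) powr p \<partial>lebesgue) powr (1 / p)"

definition spherically_symmetric :: "('a::euclidean_space \<Rightarrow> 'b) \<Rightarrow> bool" where
  "spherically_symmetric f \<longleftrightarrow> (\<forall>x x'. norm x = norm x' \<longrightarrow> f x = f x')"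

primrec k_times_cont_diff :: "nat \<Rightarrow> ('a::euclidean_space \<Rightarrow> 'b::real_normed_vector) \<Rightarrow> bool" where
  "k_times_cont_diff 0 f \<longleftrightarrow> continuous_on UNIV f"
| "k_times_cont_diff (Suc k) f \<longleftrightarrow>
     (\<forall>x. f differentiable (at x)) \<and> (\<forall>v. k_times_cont_diff k (\<lambda>x. frechet_derivative f (at x) v))"

definition test_function :: "('a::euclidean_space \<Rightarrow> 'b::real_normed_vector) \<Rightarrow> bool" where
  "test_function f \<longleftrightarrow> (\<forall>k. k_times_cont_diff k f) \<and> compact (closure {x. f x \<noteq> 0})"

definition Lp_rad :: "real \<Rightarrow> ('a::euclidean_space \<Rightarrow> 'b::real_normed_vector) set" where
  "Lp_rad q = {u \<in> Lp_space q. \<forall>e>0. \<exists>\<phi>. test_function \<phi> \<and> spherically_symmetric \<phi> \<and>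
     Lp_norm q (\<lambda>x. u x - \<phi> x) < e}"

text \<open>
  The Fourier transform on \<open>L\<^sup>2\<close> as the limit in the mean of the truncated integrals. The kernel is
  \<open>exp (- \<i> x \<bullet> \<xi>)\<close> (so that \<open>\<bar>\<xi>\<bar>\<^sup>2\<close> is the symbol of the Laplacian \<open>- \<Delta>\<close>), and the factor
  \<open>(2 \<pi>) powr (- n / 2)\<close> makes the transform unitary. \<open>L2_fourier u v\<close> says that \<open>v\<close> is
  (a representative of) the transform of \<open>u\<close>; accordingly \<open>u\<close> is the inverse transform of \<open>v\<close>.
  The mean-square distance is a nonnegative integral, so it is infinite rather than a default value
  when the difference is not square integrable.
\<close>

definition truncated_fourier :: "real \<Rightarrow> ('a::euclidean_space \<Rightarrow> complex) \<Rightarrow> 'a \<Rightarrow> complex" where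
  "truncated_fourier R u \<xi> =
     complex_of_real ((2 * pi) powr (- real DIM('a) / 2)) *
     set_lebesgue_integral lebesgue (cball 0 R) (\<lambda>x. exp (- \<i> * complex_of_real (x \<bullet> \<xi>)) * u x)"

definition L2_fourier :: "('a::euclidean_space \<Rightarrow> complex) \<Rightarrow> ('a \<Rightarrow> complex) \<Rightarrow> bool" where
  "L2_fourier u v \<longleftrightarrow> u \<in> Lp_space 2 \<and> v \<in> Lp_space 2 \<and>
     ((\<lambda>R. \<integral>\<^sup>+\<xi>. ennreal ((norm (truncated_fourier R u \<xi> - v \<xi>))\<^sup>2) \<partial>lebesgue) \<longlongrightarrow> 0) at_top"

text \<open>
  \<open>fourier_multiplier m u w\<close>: the function \<open>w \<in> L\<^sup>2\<close> is the inverse Fourier transform of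
  \<open>m\<close> times the transform of \<open>u \<in> L\<^sup>2\<close>. As the transform is a bijection of \<open>L\<^sup>2\<close> (and of the
  tempered distributions), such a \<open>w\<close> exists precisely when this inverse transform lies in \<open>L\<^sup>2\<close>,
  and it is unique up to null sets.
\<close>

definition fourier_multiplier ::
  "('a::euclidean_space \<Rightarrow> real) \<Rightarrow> ('a \<Rightarrow> complex) \<Rightarrow> ('a \<Rightarrow> complex) \<Rightarrow> bool" where
  "fourier_multiplier m u w \<longleftrightarrow>
     (\<exists>v. L2_fourier u v \<and> L2_fourier w (\<lambda>\<xi>. complex_of_real (m \<xi>) * v \<xi>))"

definition H22 :: "(real \<Rightarrow> real) \<Rightarrow> ('a::euclidean_space \<Rightarrow> complex) set" where
  "H22 a = {u \<in> Lp_space 2. \<exists>w \<in> Lp_space 2. fourier_multiplier (\<lambda>\<xi>. 1 + a ((norm \<xi>)\<^sup>2)) u w}"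

definition H22_rad :: "(real \<Rightarrow> real) \<Rightarrow> ('a::euclidean_space \<Rightarrow> complex) set" where
  "H22_rad a = {u \<in> H22 a. spherically_symmetric u}"

text \<open>\<open>fractional_laplacian s u w\<close>: \<open>w = (- \<Delta>)\<^sup>s u\<close>, with symbol \<open>\<bar>\<xi>\<bar>\<close> to the power \<open>2 s\<close>.\<close>

definition fractional_laplacian ::
  "real \<Rightarrow> ('a::euclidean_space \<Rightarrow> complex) \<Rightarrow> ('a \<Rightarrow> complex) \<Rightarrow> bool" where
  "fractional_laplacian s u w \<longleftrightarrow> fourier_multiplier (\<lambda>\<xi>. norm \<xi> powr (2 * s)) u w"

text \<open>
  A real-valued \<open>u\<close> solves \<open>\<kappa>\<^sup>-\<^sup>1 (- \<Delta>)\<^bsup>\<gamma>/2\<^esup> u = - u + V(x, u)\<close> as an identity in \<open>L\<^sup>2\<close>, that is,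
  almost everywhere.
\<close>

definition solves_equation ::
  "real \<Rightarrow> real \<Rightarrow> ('a::euclidean_space \<Rightarrow> real \<Rightarrow> real) \<Rightarrow> ('a \<Rightarrow> real) \<Rightarrow> bool" where
  "solves_equation \<kappa> \<gamma> V u \<longleftrightarrow>
     (\<exists>w. fractional_laplacian (\<gamma> / 2) (\<lambda>x. complex_of_real (u x)) w \<and>
       (AE x in lebesgue. complex_of_real (1 / \<kappa>) * w x = complex_of_real (- u x + V x (u x))))"

end

theory Submission
  imports Defs "HOL-Probability.Characteristic_Functions" "HOL-Probability.Distributions"
    "HOL-Complex_Analysis.Complex_Analysis" "HOL-Real_Asymp.Real_Asymp"
begin

text \<open>
  Write \<open>\<alpha> = \<gamma> / 2\<close>. The equation says \<open>u = G (V(x, u))\<close>, where \<open>G = (1 + \<kappa>\<^sup>-\<^sup>1 (- \<Delta>)\<^sup>\<alpha>)\<^sup>-\<^sup>1\<close> has symbol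
  \<open>1 / (1 + \<kappa>\<^sup>-\<^sup>1 \<bar>\<xi>\<bar>\<close> to the power \<open>2 \<alpha>)\<close>. By Stieltjes' formula this symbol is a positive mixture of the
  Gaussians \<open>exp (- t \<bar>\<xi>\<bar>\<^sup>2)\<close>, so \<open>G\<close> is convolution with a positive radial integrable kernel; it preserves order and
  spherical symmetry, and the lower bound on \<open>\<gamma>\<close> makes it bounded from \<open>L\<^sup>2\<close> to \<open>L\<^sup>q\<close>, \<open>q = 2 (1 + \<delta>)\<close>.

  As \<open>g\<close> is not assumed to be small, the map \<open>u \<mapsto> G (V(x, u))\<close> need not be a contraction. Instead, for
  small data there is a barrier \<open>U = G (C (H + U\<close> to the power \<open>1 + \<delta>))\<close> with small \<open>L\<^sup>q\<close> norm, where \<open>H \<le> \<bar>h\<bar>\<close> is a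
  radial majorant, and a solution with \<open>\<bar>u\<bar> \<le> U\<close> is found by monotone iteration from \<open>- U\<close>: with the
  resolvent of \<open>1 + k + \<kappa>\<^sup>-\<^sup>1 (- \<Delta>)\<^sup>\<alpha>\<close> the iteration is increasing wherever \<open>V(x, \<cdot>)\<close> is \<open>k\<close>-Lipschitz on
  \<open>[- U, U]\<close>, and afterwards \<open>k\<close> tends to infinity.
\<close>

section \<open>The heat kernel\<close>

text \<open>The threshold on \<gamma> is an exponent count. The heat semigroup contracts L^2 and
  maps L^2 to bounded functions with norm at most t^(-n/4); interpolating at q costs t^(-n \<delta>
  / (4 (1 + \<delta>))). The mixing density of the Gaussians integrates this power when n \<delta> /
  (4 (1 + \<delta>)) < \<gamma> / 2, which is the hypothesis on \<gamma>. The bound \<gamma> < 1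
  keeps the denominator of the symbol free of zeros in the strip of width 2 \<pi> behind Stieltjes'
  formula. The exponent q is the one for which u in L^q puts |u|^(1+\<delta>) in L^2, so G returns
  the right-hand side to L^q with the superlinear gain \<epsilon>^(q \<delta>). That step sees only
  C, \<delta>, \<gamma>, \<kappa> and n, so \<epsilon> and \<rho> are fixed before V, h and g. The
  derivative bound enters one x at a time, as a Lipschitz bound of V(x, .) on bounded intervals.
  Elements of the spaces are functions, not classes, and symmetry is required at every point. Order
  and limit statements hold only almost everywhere, so iterates are clamped to [- U, U] and limits
  are formed with \<open>lim\<close>: both operations keep exact symmetry.\<close>

lemma lborel_prod_Basis:
  fixes f :: "'a::euclidean_space \<Rightarrow> real \<Rightarrow> complex"
  assumes "\<And>b. b \<in> Basis \<Longrightarrow> integrable lborel (f b)"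
  shows "integrable lborel (\<lambda>x::'a. \<Prod>b\<in>Basis. f b (x \<bullet> b))" (is ?i)
    and "(\<integral>x. (\<Prod>b\<in>Basis. f b (x \<bullet> b)) \<partial>lborel) = (\<Prod>b\<in>Basis. \<integral>x. f b x \<partial>lborel)" (is ?e)
proof -
  interpret product_sigma_finite "\<lambda>_::'a. lborel :: real measure" by standard
  have [measurable]: "f b \<in> borel_measurable borel" if "b \<in> Basis" for b
    using borel_measurable_integrable[OF assms[OF that]] by simp
  have m: "(\<lambda>x::'a. \<Prod>b\<in>Basis. f b (x \<bullet> b)) \<in> borel_measurable borel"
    by (intro borel_measurable_prod) measurable
  have T: "(\<lambda>g. \<Sum>b\<in>Basis. g b *\<^sub>R b) \<in> measurable (\<Pi>\<^sub>M b\<in>Basis. lborel) (borel :: 'a measure)"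
    by measurable
  have eq: "(\<Prod>b\<in>Basis. f b ((\<Sum>b'\<in>Basis. g b' *\<^sub>R b') \<bullet> b)) = (\<Prod>b\<in>Basis. f b (g b))" for g :: "'a \<Rightarrow> real"
    by (intro prod.cong refl) (simp add: inner_sum_left inner_Basis if_distrib cong: if_cong)
  show ?i
    by (subst lborel_eq, subst integrable_distr_eq[OF T m])
      (simp only: eq, intro product_integrable_prod assms finite_Basis)
  show ?e
    by (subst lborel_eq, subst integral_distr[OF T m])
      (simp only: eq, intro product_integral_prod assms finite_Basis)
qed

text \<open>This is the characteristic function of the standard normal law after the substitution x
  = c y with \<open>c = sqrt (2 * t)\<close>, which turns x^2 / (4 t) into y^2 / 2. The frequency is
  \<open>- c * \<xi>\<close> because the kernel carries the sign of exp(- i x \<xi>).\<close>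

lemma gauss_fourier_real:
  fixes t \<xi> :: real
  assumes "t > 0"
  shows "integrable lborel (\<lambda>x. complex_of_real (exp (- x\<^sup>2 / (4 * t))) * exp (- \<i> * complex_of_real (x * \<xi>)))" (is "integrable _ ?f")
    and "(\<integral>x. complex_of_real (exp (- x\<^sup>2 / (4 * t))) * exp (- \<i> * complex_of_real (x * \<xi>)) \<partial>lborel)
      = complex_of_real (sqrt (4 * pi * t) * exp (- t * \<xi>\<^sup>2))"
proof -
  define c where "c = sqrt (2 * t)"
  have c: "c > 0" "c\<^sup>2 = 2 * t" using assms by (auto simp: c_def)
  define g where "g x = std_normal_density x *\<^sub>R iexp ((- c * \<xi>) * x)" for x
  have gi: "integrable lborel g"
    unfolding g_def
    by (rule Bochner_Integration.integrable_bound[OF integrable_std_normal_moment[of 0]]) auto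
  have "(\<integral>x. g x \<partial>lborel) = char std_normal_distribution (- c * \<xi>)"
    unfolding char_def g_def
    by (subst integral_density) auto
  also have "\<dots> = complex_of_real (exp (- t * \<xi>\<^sup>2))"
    using c by (simp add: char_std_normal_distribution power_mult_distrib)
  finally have gI: "(\<integral>x. g x \<partial>lborel) = complex_of_real (exp (- t * \<xi>\<^sup>2))" .
  have f: "?f x = complex_of_real (sqrt (2 * pi)) * g (0 + (1 / c) * x)" for x
  proof -
    have "(x / c)\<^sup>2 = x\<^sup>2 / (2 * t)" using c by (simp add: power_divide)
    then have "std_normal_density (0 + (1 / c) * x) = exp (- x\<^sup>2 / (4 * t)) / sqrt (2 * pi)"
      unfolding std_normal_density_def by (simp add: algebra_simps)
    moreover have "- c * \<xi> * (0 + (1 / c) * x) = - (x * \<xi>)" using c by simp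
    ultimately show ?thesis
      unfolding g_def by (simp only: scaleR_conv_of_real) simp
  qed
  show "integrable lborel ?f"
    unfolding f using c by (intro integrable_mult_right lborel_integrable_real_affine gi) auto
  have "complex_of_real (exp (- t * \<xi>\<^sup>2)) = complex_of_real (1 / c) * (\<integral>x. g (0 + (1 / c) * x) \<partial>lborel)"
    using lborel_integral_real_affine[of "1 / c" g 0] c gI by (simp add: scaleR_conv_of_real)
  then have "(\<integral>x. g (0 + (1 / c) * x) \<partial>lborel) = complex_of_real (c * exp (- t * \<xi>\<^sup>2))"
    using c by (simp add: field_simps)
  then have "(\<integral>x. ?f x \<partial>lborel) = complex_of_real (sqrt (2 * pi) * (c * exp (- t * \<xi>\<^sup>2)))"
    unfolding f by simp
  moreover have "sqrt (2 * pi) * c = sqrt (4 * pi * t)"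
    unfolding c_def by (simp add: real_sqrt_mult[symmetric] mult_ac)
  ultimately show "(\<integral>x. ?f x \<partial>lborel) = complex_of_real (sqrt (4 * pi * t) * exp (- t * \<xi>\<^sup>2))"
    by (metis mult.assoc)
qed

definition heat_kernel :: "real \<Rightarrow> 'a::euclidean_space \<Rightarrow> real" where
  "heat_kernel t z = (4 * pi * t) powr (- real DIM('a) / 2) * exp (- (norm z)\<^sup>2 / (4 * t))"

lemma heat_kernel_nonneg [simp]: "heat_kernel t z \<ge> 0"
  by (simp add: heat_kernel_def)

lemma heat_kernel_minus [simp]: "heat_kernel t (- z) = heat_kernel t z"
  by (simp add: heat_kernel_def)

lemma heat_kernel_norm_cong: "norm (z::'a::euclidean_space) = norm (z'::'a) \<Longrightarrow> heat_kernel t z = heat_kernel t z'"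
  by (simp add: heat_kernel_def)

lemma borel_measurable_heat_kernel [measurable]:
  "(\<lambda>p. heat_kernel (fst p) (snd p :: 'a::euclidean_space)) \<in> borel_measurable (borel \<Otimes>\<^sub>M borel)"
  "heat_kernel t \<in> borel_measurable (borel :: 'a::euclidean_space measure)"
  unfolding heat_kernel_def [abs_def] by measurable

text \<open>Both the Gaussian and the character are products over the coordinates, so the integral
  is a product of one-dimensional ones. The factors \<open>sqrt (4 * pi * t)\<close> collected from
  the coordinates cancel the normalising power of the kernel.\<close>

lemma heat_kernel_fourier:
  fixes \<xi> :: "'a::euclidean_space"
  assumes "t > 0"
  shows "integrable lborel (\<lambda>x::'a. complex_of_real (heat_kernel t x) * exp (- \<i> * complex_of_real (x \<bullet> \<xi>)))" (is "integrable _ ?f")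
    and "(\<integral>x. complex_of_real (heat_kernel t (x::'a)) * exp (- \<i> * complex_of_real (x \<bullet> \<xi>)) \<partial>lborel)
      = complex_of_real (exp (- t * (norm \<xi>)\<^sup>2))"
proof -
  define f where "f b x = complex_of_real (exp (- x\<^sup>2 / (4 * t))) * exp (- \<i> * complex_of_real (x * (\<xi> \<bullet> b)))" for b x
  have n: "(norm (y::'a))\<^sup>2 = (\<Sum>b\<in>Basis. (y \<bullet> b)\<^sup>2)" for y
    unfolding power2_norm_eq_inner by (subst euclidean_inner) (simp add: power2_eq_square)
  have "?f x = complex_of_real ((4 * pi * t) powr (- real DIM('a) / 2)) * (\<Prod>b\<in>Basis. f b (x \<bullet> b))" for x
  proof -
    have "(\<Prod>b\<in>Basis. f b (x \<bullet> b)) = exp (\<Sum>b\<in>Basis. complex_of_real (- (x \<bullet> b)\<^sup>2 / (4 * t)) + - \<i> * complex_of_real ((x \<bullet> b) * (\<xi> \<bullet> b)))"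
      by (simp only: f_def exp_sum finite_Basis exp_add exp_of_real)
    also have "(\<Sum>b\<in>Basis. complex_of_real (- (x \<bullet> b)\<^sup>2 / (4 * t)) + - \<i> * complex_of_real ((x \<bullet> b) * (\<xi> \<bullet> b)))
       = complex_of_real (- (norm x)\<^sup>2 / (4 * t)) + - \<i> * complex_of_real (x \<bullet> \<xi>)"
      unfolding n euclidean_inner[of x \<xi>]
      by (simp add: sum.distrib sum_subtractf sum_negf sum_divide_distrib sum_distrib_left)
    finally show ?thesis
      by (simp only: heat_kernel_def of_real_mult exp_add exp_of_real mult.assoc)
  qed
  note eq = this
  have fi: "integrable lborel (f b)" for b unfolding f_def using gauss_fourier_real(1)[OF assms] by blast
  show "integrable lborel ?f"
    unfolding eq by (intro integrable_mult_right lborel_prod_Basis fi)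
  have "(\<integral>x. ?f x \<partial>lborel) = complex_of_real ((4 * pi * t) powr (- real DIM('a) / 2)) *
     (\<Prod>b\<in>Basis. complex_of_real (sqrt (4 * pi * t) * exp (- t * (\<xi> \<bullet> b)\<^sup>2)))"
    unfolding eq by (simp only: integral_mult_right_zero lborel_prod_Basis(2)[OF fi]) (simp only: f_def gauss_fourier_real(2)[OF assms])
  also have "(\<Prod>b\<in>Basis. complex_of_real (sqrt (4 * pi * t) * exp (- t * (\<xi> \<bullet> b)\<^sup>2))) =
     complex_of_real (sqrt (4 * pi * t) ^ DIM('a) * exp (- t * (norm \<xi>)\<^sup>2))"
    unfolding n by (simp add: prod.distrib exp_sum[symmetric] sum_distrib_left sum_negf flip: of_real_prod)
  also have "sqrt (4 * pi * t) ^ DIM('a) = (4 * pi * t) powr (real DIM('a) / 2)"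
    using assms by (simp add: powr_half_sqrt[symmetric] powr_realpow[symmetric] powr_powr)
  finally show "(\<integral>x. ?f x \<partial>lborel) = complex_of_real (exp (- t * (norm \<xi>)\<^sup>2))"
    using assms by (simp add: powr_minus)
qed

lemma heat_kernel_integral:
  assumes "t > 0"
  shows "integrable lborel (heat_kernel t :: 'a::euclidean_space \<Rightarrow> real)"
    and "(\<integral>x. heat_kernel t (x::'a) \<partial>lborel) = 1"
proof -
  show "integrable lborel (heat_kernel t :: 'a \<Rightarrow> real)"
    using heat_kernel_fourier(1)[OF assms, of 0] by (simp add: complex_of_real_integrable_eq)
  show "(\<integral>x. heat_kernel t (x::'a) \<partial>lborel) = 1"
    using heat_kernel_fourier(2)[OF assms, of 0] by (metis (no_types, lifting) Bochner_Integration.integral_cong exp_zero inner_zero_right integral_complex_of_real mult.right_neutral mult_zero_right norm_zero of_real_0 of_real_1 of_real_eq_iff power_zero_numeral)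
qed

lemma heat_kernel_nn_integral:
  "t > 0 \<Longrightarrow> (\<integral>\<^sup>+x. ennreal (heat_kernel t (x::'a::euclidean_space)) \<partial>lborel) = 1"
  by (subst nn_integral_eq_integral) (auto simp: heat_kernel_integral)

lemma heat_kernel_le: "t > 0 \<Longrightarrow> heat_kernel t (z::'a::euclidean_space) \<le> (4 * pi * t) powr (- real DIM('a) / 2)"
  unfolding heat_kernel_def by (simp add: mult_left_le)

section \<open>Affine substitutions and reflections of Lebesgue measure\<close>

lemma lborel_nn_integral_affine:
  fixes f :: "'a::euclidean_space \<Rightarrow> ennreal"
  assumes [measurable]: "f \<in> borel_measurable borel" and "c \<noteq> 0"
  shows "(\<integral>\<^sup>+x. f x \<partial>lborel) = ennreal (\<bar>c\<bar> ^ DIM('a)) * (\<integral>\<^sup>+x. f (t + c *\<^sub>R x) \<partial>lborel)"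
  by (subst lborel_affine[OF assms(2), of t])
    (simp add: nn_integral_density nn_integral_distr nn_integral_cmult ennreal_power)

lemma lborel_nn_integral_shift:
  fixes f :: "'a::euclidean_space \<Rightarrow> ennreal"
  assumes [measurable]: "f \<in> borel_measurable borel"
  shows "(\<integral>\<^sup>+x. f (x + t) \<partial>lborel) = (\<integral>\<^sup>+x. f x \<partial>lborel)"
    and "(\<integral>\<^sup>+x. f (x - t) \<partial>lborel) = (\<integral>\<^sup>+x. f x \<partial>lborel)"
    and "(\<integral>\<^sup>+x. f (t - x) \<partial>lborel) = (\<integral>\<^sup>+x. f x \<partial>lborel)"
  using lborel_nn_integral_affine[of f 1 t] lborel_nn_integral_affine[of f 1 "- t"]
    lborel_nn_integral_affine[of f "-1" t]
  by (simp_all add: add.commute)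

lemma lborel_integral_affine:
  fixes f :: "'a::euclidean_space \<Rightarrow> 'b::{banach, second_countable_topology}"
  assumes [measurable]: "f \<in> borel_measurable borel" and "c \<noteq> 0"
  shows "integrable lborel (\<lambda>x. f (t + c *\<^sub>R x)) \<longleftrightarrow> integrable lborel f"
    and "(\<integral>x. f x \<partial>lborel) = (\<bar>c\<bar> ^ DIM('a)) *\<^sub>R (\<integral>x. f (t + c *\<^sub>R x) \<partial>lborel)"
proof -
  have "(\<integral>\<^sup>+x. ennreal (norm (f x)) \<partial>lborel) = ennreal (\<bar>c\<bar> ^ DIM('a)) * (\<integral>\<^sup>+x. ennreal (norm (f (t + c *\<^sub>R x))) \<partial>lborel)"
    by (intro lborel_nn_integral_affine assms) measurable
  then show "integrable lborel (\<lambda>x. f (t + c *\<^sub>R x)) \<longleftrightarrow> integrable lborel f"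
    using assms unfolding integrable_iff_bounded
    by (auto simp: ennreal_mult_less_top ennreal_mult_eq_top_iff less_top[symmetric] power_le_zero_eq)
  show "(\<integral>x. f x \<partial>lborel) = (\<bar>c\<bar> ^ DIM('a)) *\<^sub>R (\<integral>x. f (t + c *\<^sub>R x) \<partial>lborel)"
    by (subst lborel_affine[OF assms(2), of t])
      (simp add: integral_density integral_distr)
qed

lemma lborel_integral_shift:
  fixes f :: "'a::euclidean_space \<Rightarrow> 'b::{banach, second_countable_topology}"
  assumes [measurable]: "f \<in> borel_measurable borel"
  shows "(\<integral>x. f (x + t) \<partial>lborel) = (\<integral>x. f x \<partial>lborel)"
    and "(\<integral>x. f (x - t) \<partial>lborel) = (\<integral>x. f x \<partial>lborel)"
    and "(\<integral>x. f (t - x) \<partial>lborel) = (\<integral>x. f x \<partial>lborel)"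
    and "integrable lborel (\<lambda>x. f (x + t)) \<longleftrightarrow> integrable lborel f"
    and "integrable lborel (\<lambda>x. f (x - t)) \<longleftrightarrow> integrable lborel f"
    and "integrable lborel (\<lambda>x. f (t - x)) \<longleftrightarrow> integrable lborel f"
  using lborel_integral_affine[of f 1 t] lborel_integral_affine[of f 1 "- t"]
    lborel_integral_affine[of f "-1" t]
  by (simp_all add: add.commute)

text \<open>A translation-invariant measure is determined by its value on one ball: Fubini applied to
  \<open>\<integral>\<integral> 1\<^sub>A(x) 1\<^sub>B(x + y)\<close> in both orders compares it with \<open>lborel\<close>.\<close>

lemma lborel_distr_isometry:
  fixes T :: "'a::euclidean_space \<Rightarrow> 'a"
  assumes lin: "linear T" and inv: "\<And>x. T (T x) = x" and iso: "\<And>x. norm (T x) = norm x"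
  shows "distr lborel borel T = lborel"
proof -
  have [measurable]: "T \<in> borel_measurable borel"
    by (intro borel_measurable_continuous_onI linear_continuous_on) (simp add: lin linear_conv_bounded_linear[symmetric])
  let ?B = "ball (0::'a) 1"
  have TB: "indicator ?B (- T x) = (indicator ?B x :: ennreal)" for x
    by (simp add: indicator_def iso)
  \<comment> \<open>The comparison ends with this measure as a common factor on both sides; it can
    be cancelled in \<open>ennreal\<close> because it is neither zero nor infinite.\<close>
  have fin: "emeasure lborel ?B \<noteq> \<infinity>" "emeasure lborel ?B \<noteq> 0"
    using emeasure_lborel_ball_finite[of "0::'a" 1] content_ball_pos[of 1 "0::'a"]
    by (auto simp: measure_def enn2real_positive_iff)
  define \<phi> where "\<phi> = (indicator ?B :: 'a \<Rightarrow> ennreal)"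
  have [measurable]: "\<phi> \<in> borel_measurable borel" unfolding \<phi>_def by (rule borel_measurable_indicator) simp
  have \<phi>I: "(\<integral>\<^sup>+x. \<phi> x * k \<partial>lborel) = emeasure lborel ?B * k" "(\<integral>\<^sup>+x. \<phi> x \<partial>lborel) = emeasure lborel ?B" for k
    unfolding \<phi>_def by (simp_all add: mult.commute[of _ k] nn_integral_cmult_indicator mult.commute)
  have \<phi>n: "\<phi> x = \<phi> y" if "norm x = norm y" for x y
    using that by (simp add: \<phi>_def indicator_def)
  show ?thesis
  proof (rule measure_eqI)
    fix B :: "'a set" assume "B \<in> sets (distr lborel borel T)"
    then have Bm: "B \<in> sets borel" by simp
    define \<psi> where "\<psi> = (indicator B :: 'a \<Rightarrow> ennreal)"
    have [measurable]: "\<psi> \<in> borel_measurable borel" unfolding \<psi>_def using Bm by (intro borel_measurable_indicator) simp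
    have "emeasure (distr lborel borel T) B = (\<integral>\<^sup>+y. \<psi> y \<partial>distr lborel borel T)"
      using Bm by (simp add: \<psi>_def)
    also have "\<dots> = (\<integral>\<^sup>+y. \<psi> (T y) \<partial>lborel)" by (rule nn_integral_distr) measurable
    finally have "emeasure lborel ?B * emeasure (distr lborel borel T) B = (\<integral>\<^sup>+x. \<phi> x * (\<integral>\<^sup>+y. \<psi> (T y) \<partial>lborel) \<partial>lborel)"
      by (simp only: \<phi>I)
    also have "\<dots> = (\<integral>\<^sup>+x. \<integral>\<^sup>+y. \<phi> x * \<psi> (x + T y) \<partial>lborel \<partial>lborel)"
    proof (rule nn_integral_cong)
      fix x :: 'a
      have "(\<integral>\<^sup>+y. \<psi> (x + T y) \<partial>lborel) = (\<integral>\<^sup>+y. \<psi> (T (y + T x)) \<partial>(lborel::'a measure))"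
        by (simp add: linear_add[OF lin] inv add.commute)
      also have "\<dots> = (\<integral>\<^sup>+y. \<psi> (T y) \<partial>lborel)"
        by (rule lborel_nn_integral_shift) measurable
      finally show "\<phi> x * (\<integral>\<^sup>+y. \<psi> (T y) \<partial>lborel) = (\<integral>\<^sup>+y. \<phi> x * \<psi> (x + T y) \<partial>lborel)"
        by (simp add: nn_integral_cmult)
    qed
    also have "\<dots> = (\<integral>\<^sup>+y. \<integral>\<^sup>+x. \<phi> x * \<psi> (x + T y) \<partial>lborel \<partial>lborel)"
      by (rule lborel_pair.Fubini'[symmetric]) simp
    also have "\<dots> = (\<integral>\<^sup>+y. \<integral>\<^sup>+x. \<phi> (x - T y) * \<psi> x \<partial>lborel \<partial>lborel)"
    proof (rule nn_integral_cong)
      fix y :: 'a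
      show "(\<integral>\<^sup>+x. \<phi> x * \<psi> (x + T y) \<partial>lborel) = (\<integral>\<^sup>+x. \<phi> (x - T y) * \<psi> x \<partial>lborel)"
        using lborel_nn_integral_shift(1)[of "\<lambda>x. \<phi> (x - T y) * \<psi> x" "T y"] by simp
    qed
    also have "\<dots> = (\<integral>\<^sup>+x. \<integral>\<^sup>+y. \<phi> (x - T y) * \<psi> x \<partial>lborel \<partial>lborel)"
      by (rule lborel_pair.Fubini') simp
    also have "\<dots> = (\<integral>\<^sup>+x. emeasure lborel ?B * \<psi> x \<partial>lborel)"
    proof (rule nn_integral_cong)
      fix x :: 'a
      \<comment> \<open>Applying the involutive isometry to x - T y gives T x - y, so as a function
        of y the integrand is the indicator of a translated ball and T has disappeared from the
        integration variable.\<close>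
      have "(\<integral>\<^sup>+y. \<phi> (x - T y) \<partial>lborel) = (\<integral>\<^sup>+y. \<phi> (y - T x) \<partial>(lborel :: 'a measure))"
      proof (intro nn_integral_cong \<phi>n)
        fix y :: 'a
        show "norm (x - T y) = norm (y - T x)"
          using iso[of "x - T y"] by (simp add: linear_diff[OF lin] inv norm_minus_commute)
      qed
      also have "\<dots> = emeasure lborel ?B"
        using lborel_nn_integral_shift(2)[of "\<phi>" "T x"] by (simp add: \<phi>I)
      finally show "(\<integral>\<^sup>+y. \<phi> (x - T y) * \<psi> x \<partial>lborel) = emeasure lborel ?B * \<psi> x"
        by (simp add: nn_integral_multc)
    qed
    also have "\<dots> = emeasure lborel ?B * emeasure lborel B"
      using Bm by (simp add: nn_integral_cmult \<psi>_def)
    finally show "emeasure (distr lborel borel T) B = emeasure lborel B"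
      using fin by (simp add: ennreal_mult_cancel_left)
  qed simp
qed

text \<open>The reflection in the hyperplane orthogonal to x - x' exchanges two points of equal
  norm. An involution is asked for because \<open>lborel_distr_isometry\<close> is proved for
  involutive isometries.\<close>

lemma reflection_exists:
  fixes x x' :: "'a::euclidean_space"
  assumes "norm x = norm x'"
  obtains T where "linear T" "\<And>z. T (T z) = z" "\<And>z. norm (T z) = norm z" "T x = x'"
proof (cases "x = x'")
  case True
  then show ?thesis using that[of "\<lambda>z. z"] by (simp add: linear_iff)
next
  case False
  define v where "v = x - x'"
  define T where "T z = z - (2 * (z \<bullet> v) / (v \<bullet> v)) *\<^sub>R v" for z
  have v: "v \<bullet> v \<noteq> 0" using False by (simp add: v_def)
  have lin: "linear T"
    by (rule linearI) (simp_all add: T_def algebra_simps inner_add_left add_divide_distrib)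
  have Tv: "T z \<bullet> v = - (z \<bullet> v)" for z
    using v by (simp add: T_def inner_diff_left)
  have 1: "T (T z) = z" for z
    unfolding T_def[of "T z"] Tv by (simp add: T_def)
  have 2: "norm (T z) = norm z" for z
  proof -
    have "T z \<bullet> T z = z \<bullet> z"
      unfolding T_def using v by (simp add: inner_diff_left inner_diff_right inner_commute field_simps power2_eq_square)
    then show ?thesis by (simp add: norm_eq_sqrt_inner)
  qed
  have "x \<bullet> x = x' \<bullet> x'" using assms by (simp add: norm_eq_sqrt_inner)
  then have "v \<bullet> v = 2 * (x \<bullet> v)"
    by (simp add: v_def inner_diff_left inner_diff_right inner_commute)
  then have "T x = x'" using v by (simp add: T_def v_def)
  with lin 1 2 show ?thesis using that[of T] by blast
qed

section \<open>Approximation in \<open>L\<^sup>p\<close>\<close>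

text \<open>A quasi-triangle inequality with a crude constant, valid for every p > 0. It serves the
  approximation arguments, where only smallness matters and the factor 2^p is absorbed into the
  choice of the tolerance.\<close>

lemma norm_add_powr_le:
  fixes a b :: "'b::real_normed_vector"
  assumes "p > 0"
  shows "norm (a + b) powr p \<le> 2 powr p * (norm a powr p + norm b powr p)"
proof -
  have "norm (a + b) powr p \<le> (2 * max (norm a) (norm b)) powr p"
    using norm_triangle_ineq[of a b] assms by (intro powr_mono2) auto
  also have "\<dots> = 2 powr p * max (norm a) (norm b) powr p" by (simp add: powr_mult)
  also have "max (norm a) (norm b) powr p \<le> norm a powr p + norm b powr p"
    by (simp add: max_def)
  finally show ?thesis by (simp add: mult_left_mono)
qed

lemma nn_integral_powr_add_le:
  fixes f g :: "'a \<Rightarrow> 'b::{real_normed_vector, second_countable_topology}"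
  assumes "p > 0" and [measurable]: "f \<in> borel_measurable M" "g \<in> borel_measurable M"
  shows "(\<integral>\<^sup>+x. ennreal (norm (f x + g x) powr p) \<partial>M)
    \<le> ennreal (2 powr p) * ((\<integral>\<^sup>+x. ennreal (norm (f x) powr p) \<partial>M) + (\<integral>\<^sup>+x. ennreal (norm (g x) powr p) \<partial>M))"
proof -
  have "(\<integral>\<^sup>+x. ennreal (norm (f x + g x) powr p) \<partial>M) \<le>
    (\<integral>\<^sup>+x. ennreal (2 powr p) * (ennreal (norm (f x) powr p) + ennreal (norm (g x) powr p)) \<partial>M)"
    using norm_add_powr_le[OF assms(1)]
    by (intro nn_integral_mono) (simp flip: ennreal_plus ennreal_mult)
  then show ?thesis by (simp add: nn_integral_cmult nn_integral_add)
qed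

lemma nn_integral_cball_finite:
  fixes R c :: real
  shows "(\<lambda>x::'a::euclidean_space. ennreal c * indicator (cball 0 R) x) \<in> borel_measurable lborel"
    and "(\<lambda>x::'a. ennreal c * indicator (cball 0 R) x) \<in> borel_measurable lebesgue"
    and "(\<integral>\<^sup>+x. ennreal c * indicator (cball (0::'a) R) x \<partial>lborel) < \<infinity>"
    and "(\<integral>\<^sup>+x. ennreal c * indicator (cball (0::'a) R) x \<partial>lebesgue) < \<infinity>"
proof -
  show m: "(\<lambda>x::'a::euclidean_space. ennreal c * indicator (cball 0 R) x) \<in> borel_measurable lborel"
  proof -
    have "(indicator (cball 0 R) :: 'a \<Rightarrow> ennreal) \<in> borel_measurable lborel"
      by (rule borel_measurable_indicator) simp
    then show ?thesis by measurable
  qed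
  then show "(\<lambda>x::'a. ennreal c * indicator (cball 0 R) x) \<in> borel_measurable lebesgue"
    by (rule measurable_completion)
  have "(\<integral>\<^sup>+x. ennreal c * indicator (cball (0::'a) R) x \<partial>lborel) = ennreal c * emeasure lborel (cball (0::'a) R)"
    by (rule nn_integral_cmult_indicator) simp
  also have "\<dots> < \<infinity>"
    using emeasure_lborel_cball_finite[of "0::'a" R] by (simp add: ennreal_mult_less_top)
  finally show "(\<integral>\<^sup>+x. ennreal c * indicator (cball (0::'a) R) x \<partial>lborel) < \<infinity>" .
  then show "(\<integral>\<^sup>+x. ennreal c * indicator (cball (0::'a) R) x \<partial>lebesgue) < \<infinity>"
    by (subst nn_integral_completion)
qed

text \<open>Domain and range are cut at the same level, which leaves a bounded function of bounded
  support. The cut depends on x only through its norm and the value there, so a radial function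
  stays radial; \<open>Lp_rad_spherically_symmetric\<close> relies on this.\<close>

lemma Lp_truncation:
  fixes f :: "'a::euclidean_space \<Rightarrow> 'b::euclidean_space"
  assumes fm [measurable]: "f \<in> borel_measurable lebesgue"
    and fi: "(\<integral>\<^sup>+x. ennreal (norm (f x) powr p) \<partial>lebesgue) < \<infinity>"
  shows "(\<lambda>n. \<integral>\<^sup>+x. ennreal (norm (f x - (if norm x \<le> real n \<and> norm (f x) \<le> real n then f x else 0)) powr p) \<partial>lebesgue) \<longlonglongrightarrow> 0"
proof -
  define F where "F n x = (if norm x \<le> real n \<and> norm (f x) \<le> real n then f x else 0)" for n :: nat and x
  have nm [measurable]: "(norm :: 'a \<Rightarrow> real) \<in> borel_measurable lebesgue"
    by (intro measurable_completion) measurable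
  have [measurable]: "F n \<in> borel_measurable lebesgue" for n
    unfolding F_def by measurable
  have "(\<lambda>n. \<integral>\<^sup>+x. ennreal (norm (f x - F n x) powr p) \<partial>lebesgue) \<longlonglongrightarrow> (\<integral>\<^sup>+x. 0 \<partial>(lebesgue :: 'a measure))"
  proof (rule nn_integral_dominated_convergence[OF _ _ _ _ fi])
    show "AE x in lebesgue. ennreal (norm (f x - F n x) powr p) \<le> ennreal (norm (f x) powr p)" for n
      by (rule AE_I2) (simp add: F_def)
    show "AE x in lebesgue. (\<lambda>n. ennreal (norm (f x - F n x) powr p)) \<longlonglongrightarrow> 0"
    proof (rule AE_I2)
      fix x :: 'a
      obtain N where N: "norm x \<le> real N" "norm (f x) \<le> real N"
        by (meson max.bounded_iff real_arch_simple)
      have "\<forall>\<^sub>F n in sequentially. ennreal (norm (f x - F n x) powr p) = 0"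
        using eventually_ge_at_top[of N] by eventually_elim (use N in \<open>simp add: F_def\<close>)
      then show "(\<lambda>n. ennreal (norm (f x - F n x) powr p)) \<longlonglongrightarrow> 0" by (rule tendsto_eventually)
    qed
  qed measurable
  then show ?thesis by (simp add: F_def)
qed

text \<open>A Lebesgue measurable function is almost everywhere a limit of continuous functions.
  Retracting these onto the ball of radius N in the range (\<open>cl\<close>) and multiplying by a
  cutoff in the domain (\<open>\<theta>\<close>) gives a common bound and a common bounded support,
  so dominated convergence turns pointwise into L^p convergence.\<close>

lemma Cc_dense_Lp:
  fixes f :: "'a::euclidean_space \<Rightarrow> 'b::euclidean_space"
  assumes p: "p > 0" and fm [measurable]: "f \<in> borel_measurable lebesgue"
    and fi: "(\<integral>\<^sup>+x. ennreal (norm (f x) powr p) \<partial>lebesgue) < \<infinity>" and e: "e > 0"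
  shows "\<exists>g R. continuous_on UNIV g \<and> (\<forall>x. norm x > R \<longrightarrow> g x = 0) \<and>
    (\<integral>\<^sup>+x. ennreal (norm (f x - g x) powr p) \<partial>lebesgue) < ennreal e"
proof -
  define F where "F n x = (if norm x \<le> real n \<and> norm (f x) \<le> real n then f x else 0)" for n :: nat and x
  have nm [measurable]: "(norm :: 'a \<Rightarrow> real) \<in> borel_measurable lebesgue"
    by (intro measurable_completion) measurable
  have [measurable]: "F n \<in> borel_measurable lebesgue" for n
    unfolding F_def by measurable
  \<comment> \<open>Two errors of size d enter a quasi-triangle inequality with factor 2^p, which
    totals e / 2.\<close>
  define d where "d = e / (4 * 2 powr p)"
  have d: "d > 0" using e by (simp add: d_def)
  have "(\<lambda>n. \<integral>\<^sup>+x. ennreal (norm (f x - F n x) powr p) \<partial>lebesgue) \<longlonglongrightarrow> 0"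
    unfolding F_def by (rule Lp_truncation[OF fm fi])
  then have "\<forall>\<^sub>F n in sequentially. (\<integral>\<^sup>+x. ennreal (norm (f x - F n x) powr p) \<partial>lebesgue) < ennreal d"
    using d by (intro order_tendstoD) auto
  \<comment> \<open>The condition N >= 1 keeps the denominator in \<open>cl\<close>
    positive.\<close>
  then obtain N where N: "N \<ge> 1" "(\<integral>\<^sup>+x. ennreal (norm (f x - F N x) powr p) \<partial>lebesgue) < ennreal d"
    by (metis (mono_tags, lifting) eventually_at_top_linorder nat_le_linear)
  have "F N measurable_on UNIV"
    by (rule lebesgue_measurable_imp_measurable_on) auto
  then obtain K g where K: "negligible K" and g: "\<And>n. continuous_on UNIV (g n)" "\<And>x. x \<notin> K \<Longrightarrow> (\<lambda>n. g n x) \<longlonglongrightarrow> F N x"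
    unfolding measurable_on_def by auto
  define cl where "cl y = (real N / max (real N) (norm y)) *\<^sub>R y" for y :: 'b
  define \<theta> where "\<theta> x = max 0 (min 1 (real N + 1 - norm x))" for x :: 'a
  define h where "h n x = \<theta> x *\<^sub>R cl (g n x)" for n x
  have cl_cont: "continuous_on UNIV cl" unfolding cl_def using N by (intro continuous_intros) auto
  have cl_le: "norm (cl y) \<le> real N" for y
    unfolding cl_def using N by (auto simp: max_def field_simps)
  have cl_id: "cl y = y" if "norm y \<le> real N" for y
    using that N by (simp add: cl_def max_def)
  have hc: "continuous_on UNIV (h n)" for n
    unfolding h_def \<theta>_def
    by (intro continuous_intros continuous_on_compose2[OF cl_cont] g) auto
  have h0: "h n x = 0" if "norm x > real N + 1" for n x
    using that by (simp add: h_def \<theta>_def)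
  have hle: "norm (h n x) \<le> real N * indicator (cball 0 (real N + 1)) x" for n x
  proof (cases "norm x > real N + 1")
    case False
    have "norm (h n x) \<le> 1 * norm (cl (g n x))"
      unfolding h_def by (simp add: \<theta>_def mult_left_le_one_le)
    with cl_le[of "g n x"] False show ?thesis by simp
  qed (simp add: h0)
  have FN: "\<theta> x *\<^sub>R cl (F N x) = F N x" for x
  proof -
    have "cl (F N x) = F N x" by (intro cl_id) (simp add: F_def)
    moreover have "\<theta> x = 1 \<or> F N x = 0" by (auto simp: \<theta>_def F_def)
    ultimately show ?thesis by auto
  qed
  have Fle: "norm (F N x) \<le> real N * indicator (cball 0 (real N + 1)) x" for x
    by (auto simp: F_def indicator_def)
  have hm [measurable]: "h n \<in> borel_measurable lebesgue" for n
    using hc[of n] by (intro measurable_completion) (simp add: borel_measurable_continuous_onI)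
  have "(\<lambda>n. \<integral>\<^sup>+x. ennreal (norm (F N x - h n x) powr p) \<partial>lebesgue) \<longlonglongrightarrow> (\<integral>\<^sup>+x. 0 \<partial>(lebesgue :: 'a measure))"
  proof (rule nn_integral_dominated_convergence)
    show "(\<lambda>x::'a. ennreal ((2 * real N) powr p) * indicator (cball 0 (real N + 1)) x) \<in> borel_measurable lebesgue"
      by (rule nn_integral_cball_finite)
    show "(\<integral>\<^sup>+x. ennreal ((2 * real N) powr p) * indicator (cball (0::'a) (real N + 1)) x \<partial>lebesgue) < \<infinity>"
      by (rule nn_integral_cball_finite)
    show "AE x in lebesgue. ennreal (norm (F N x - h n x) powr p) \<le> ennreal ((2 * real N) powr p) * indicator (cball 0 (real N + 1)) x" for n
    proof (rule AE_I2)
      fix x :: 'a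
      have le: "norm (F N x - h n x) \<le> 2 * real N * indicator (cball 0 (real N + 1)) x"
        using norm_triangle_ineq4[of "F N x" "h n x"] hle[of n x] Fle[of x] by linarith
      show "ennreal (norm (F N x - h n x) powr p) \<le> ennreal ((2 * real N) powr p) * indicator (cball 0 (real N + 1)) x"
      proof (cases "x \<in> cball 0 (real N + 1)")
        case True
        then have "norm (F N x - h n x) \<le> 2 * real N" using le by simp
        then have "norm (F N x - h n x) powr p \<le> (2 * real N) powr p" using p by (intro powr_mono2) auto
        then show ?thesis using True by (simp add: ennreal_leI)
      next
        case False
        then have "norm (F N x - h n x) \<le> 0" using le by (simp add: indicator_def)
        then show ?thesis using p by simp
      qed
    qed
    have "AE x in lebesgue. x \<notin> K"
      using K by (simp add: AE_not_in negligible_iff_null_sets)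
    then show "AE x in lebesgue. (\<lambda>n. ennreal (norm (F N x - h n x) powr p)) \<longlonglongrightarrow> 0"
    proof eventually_elim
      case (elim x)
      have "(\<lambda>n. cl (g n x)) \<longlonglongrightarrow> cl (F N x)"
        by (rule continuous_on_tendsto_compose[OF cl_cont g(2)[OF elim]]) auto
      then have "(\<lambda>n. h n x) \<longlonglongrightarrow> \<theta> x *\<^sub>R cl (F N x)"
        unfolding h_def by (intro tendsto_intros)
      then have "(\<lambda>n. h n x) \<longlonglongrightarrow> F N x" by (simp only: FN)
      then have "(\<lambda>n. norm (F N x - h n x)) \<longlonglongrightarrow> 0"
        by (subst norm_minus_commute) (simp add: LIM_zero_iff tendsto_norm_zero_iff)
      then have "(\<lambda>n. norm (F N x - h n x) powr p) \<longlonglongrightarrow> 0"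
        using tendsto_powr'[OF _ tendsto_const[of p], of "\<lambda>n. norm (F N x - h n x)" 0] p by simp
      then show ?case using tendsto_ennrealI by fastforce
    qed
  qed measurable
  then have "\<forall>\<^sub>F n in sequentially. (\<integral>\<^sup>+x. ennreal (norm (F N x - h n x) powr p) \<partial>lebesgue) < ennreal d"
    using d by (intro order_tendstoD) auto
  then obtain n where n: "(\<integral>\<^sup>+x. ennreal (norm (F N x - h n x) powr p) \<partial>lebesgue) < ennreal d"
    by (auto simp: eventually_at_top_linorder)
  have "(\<integral>\<^sup>+x. ennreal (norm (f x - h n x) powr p) \<partial>lebesgue) =
    (\<integral>\<^sup>+x. ennreal (norm ((f x - F N x) + (F N x - h n x)) powr p) \<partial>lebesgue)" by simp
  also have "\<dots> \<le> ennreal (2 powr p) * ((\<integral>\<^sup>+x. ennreal (norm (f x - F N x) powr p) \<partial>lebesgue) + (\<integral>\<^sup>+x. ennreal (norm (F N x - h n x) powr p) \<partial>lebesgue))"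
    by (rule nn_integral_powr_add_le[OF p]) measurable
  also have "\<dots> \<le> ennreal (2 powr p) * (ennreal d + ennreal d)"
    using N n by (intro mult_left_mono add_mono) auto
  also have "\<dots> = ennreal (e / 2)"
    using d by (simp add: d_def flip: ennreal_plus ennreal_mult)
  also have "\<dots> < ennreal e" using e by (simp add: ennreal_less_iff)
  finally show ?thesis using hc[of n] h0[of _ n] by blast
qed

lemma tendsto_0_ennrealI:
  fixes f :: "'i \<Rightarrow> ennreal"
  assumes "\<And>e::real. e > 0 \<Longrightarrow> \<forall>\<^sub>F n in F. f n < ennreal e"
  shows "(f \<longlongrightarrow> 0) F"
proof (rule order_tendstoI)
  fix a :: ennreal assume "0 < a"
  then obtain e where e: "e > 0" "ennreal e < a"
  proof (cases a)
    case (real r)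
    then have "r > 0" using \<open>0 < a\<close> by simp
    then have "ennreal (r / 2) < a" using real by (simp add: ennreal_lessI)
    with \<open>r > 0\<close> that[of "r / 2"] show thesis by simp
  next
    case top
    with that[of 1] show thesis by simp
  qed
  from assms[OF e(1)] show "\<forall>\<^sub>F n in F. f n < a"
    by (rule eventually_mono) (rule less_trans[OF _ e(2)])
qed simp

text \<open>For continuous functions of bounded support this is dominated convergence; in general f
  is replaced by such a g, and the error f - g has the same size before and after
  translation.\<close>

lemma Lp_translation_continuous:
  fixes f :: "'a::euclidean_space \<Rightarrow> 'b::euclidean_space"
  assumes p: "p > 0" and fm [measurable]: "f \<in> borel_measurable borel"
    and fi: "(\<integral>\<^sup>+x. ennreal (norm (f x) powr p) \<partial>lborel) < \<infinity>" and z: "z \<longlonglongrightarrow> 0"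
  shows "(\<lambda>n. \<integral>\<^sup>+x. ennreal (norm (f (x + z n) - f x) powr p) \<partial>lborel) \<longlonglongrightarrow> 0"
proof (rule tendsto_0_ennrealI)
  fix e :: real assume e: "e > 0"
  \<comment> \<open>The three-term splitting uses the quasi-triangle inequality twice, so the total
    error is at most 2^p d + 2 * 2^p * 2^p d, which is strictly below e for this d.\<close>
  define d where "d = e / (2 * 2 powr p + 2 * (2 powr p * 2 powr p))"
  have d: "d > 0" using e by (simp add: d_def add_pos_pos)
  have "(\<integral>\<^sup>+x. ennreal (norm (f x) powr p) \<partial>lebesgue) < \<infinity>"
    using fi by (subst nn_integral_completion) auto
  then obtain g R where gc: "continuous_on UNIV g" and g0: "\<And>x. norm x > R \<Longrightarrow> g x = 0"
    and gd: "(\<integral>\<^sup>+x. ennreal (norm (f x - g x) powr p) \<partial>lebesgue) < ennreal d"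
    using Cc_dense_Lp[OF p _ _ d, of f] measurable_completion[of f lborel borel] fm by auto
  have [measurable]: "g \<in> borel_measurable borel" using gc by (rule borel_measurable_continuous_onI)
  have gd': "(\<integral>\<^sup>+x. ennreal (norm (f x - g x) powr p) \<partial>lborel) < ennreal d"
    using gd by (subst (asm) nn_integral_completion) auto
  obtain B where B: "\<And>x. norm (g x) \<le> B" "B \<ge> 0"
  proof -
    have "compact (g ` cball 0 R)" by (intro compact_continuous_image continuous_on_subset[OF gc]) auto
    then have "\<exists>B. \<forall>x\<in>cball 0 R. norm (g x) \<le> B"
      by (auto dest!: compact_imp_bounded simp: bounded_iff)
    then obtain B where "\<And>x. norm x \<le> R \<Longrightarrow> norm (g x) \<le> B" by (metis mem_cball_0)
    then have "norm (g x) \<le> max 0 B" for x using g0[of x] by (cases "norm x \<le> R") (auto simp: le_max_iff_disj)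
    then show ?thesis using that[of "max 0 B"] by auto
  qed
  have "(\<lambda>n. \<integral>\<^sup>+x. ennreal (norm (g (x + z n) - g x) powr p) \<partial>lborel) \<longlonglongrightarrow> (\<integral>\<^sup>+x. 0 \<partial>(lborel :: 'a measure))"
  proof -
    \<comment> \<open>Dropping finitely many terms makes all shifts at most 1 in norm, so every
      translate of g vanishes outside one fixed ball, of radius
      \<open>\<bar>R\<bar> + 1\<close>.\<close>
    obtain m where m: "\<And>n. n \<ge> m \<Longrightarrow> norm (z n) \<le> 1"
      using LIMSEQ_D[OF z, of 1] by (auto intro: less_imp_le)
    have "(\<lambda>n. \<integral>\<^sup>+x. ennreal (norm (g (x + z (n + m)) - g x) powr p) \<partial>lborel) \<longlonglongrightarrow> (\<integral>\<^sup>+x. 0 \<partial>(lborel :: 'a measure))"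
    proof (rule nn_integral_dominated_convergence)
      show "(\<lambda>x::'a. ennreal ((2 * B) powr p) * indicator (cball 0 (\<bar>R\<bar> + 1)) x) \<in> borel_measurable lborel"
        by (rule nn_integral_cball_finite)
      show "(\<integral>\<^sup>+x. ennreal ((2 * B) powr p) * indicator (cball (0::'a) (\<bar>R\<bar> + 1)) x \<partial>lborel) < \<infinity>"
        by (rule nn_integral_cball_finite)
      show "AE x in lborel. ennreal (norm (g (x + z (n + m)) - g x) powr p) \<le> ennreal ((2 * B) powr p) * indicator (cball 0 (\<bar>R\<bar> + 1)) x" for n
      proof (rule AE_I2)
        fix x :: 'a
        have le: "norm (g (x + z (n + m)) - g x) \<le> 2 * B"
          using norm_triangle_ineq4[of "g (x + z (n + m))" "g x"] B(1)[of x] B(1)[of "x + z (n + m)"] by linarith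
        show "ennreal (norm (g (x + z (n + m)) - g x) powr p) \<le> ennreal ((2 * B) powr p) * indicator (cball 0 (\<bar>R\<bar> + 1)) x"
        proof (cases "x \<in> cball 0 (\<bar>R\<bar> + 1)")
          case True
          have "norm (g (x + z (n + m)) - g x) powr p \<le> (2 * B) powr p" using p le by (intro powr_mono2) auto
          then show ?thesis using True by (simp add: ennreal_leI)
        next
          case False
          have "norm x \<le> norm (x + z (n + m)) + norm (z (n + m))" using norm_triangle_ineq4[of "x + z (n + m)" "z (n + m)"] by simp
          then have "norm (x + z (n + m)) > R" "norm x > R" using False m[of "n + m"] by auto
          then show ?thesis using g0 p by simp
        qed
      qed
      show "AE x in lborel. (\<lambda>n. ennreal (norm (g (x + z (n + m)) - g x) powr p)) \<longlonglongrightarrow> 0"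
      proof (rule AE_I2)
        fix x :: 'a
        have "(\<lambda>n. x + z (n + m)) \<longlonglongrightarrow> x + 0" by (intro tendsto_intros LIMSEQ_ignore_initial_segment z)
        then have "(\<lambda>n. g (x + z (n + m))) \<longlonglongrightarrow> g x"
          using continuous_on_tendsto_compose[OF gc, of "\<lambda>n. x + z (n + m)" x] by simp
        then have "(\<lambda>n. norm (g (x + z (n + m)) - g x)) \<longlonglongrightarrow> 0"
          by (simp add: LIM_zero_iff tendsto_norm_zero_iff)
        then have "(\<lambda>n. norm (g (x + z (n + m)) - g x) powr p) \<longlonglongrightarrow> 0"
          using tendsto_powr'[OF _ tendsto_const[of p], of "\<lambda>n. norm (g (x + z (n + m)) - g x)" 0] p by simp
        then show "(\<lambda>n. ennreal (norm (g (x + z (n + m)) - g x) powr p)) \<longlonglongrightarrow> 0" using tendsto_ennrealI by fastforce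
      qed
    qed measurable
    then show ?thesis by (rule LIMSEQ_offset)
  qed
  then have "\<forall>\<^sub>F n in sequentially. (\<integral>\<^sup>+x. ennreal (norm (g (x + z n) - g x) powr p) \<partial>lborel) < ennreal d"
    using d by (intro order_tendstoD) auto
  then show "\<forall>\<^sub>F n in sequentially. (\<integral>\<^sup>+x. ennreal (norm (f (x + z n) - f x) powr p) \<partial>lborel) < ennreal e"
  proof eventually_elim
    case (elim n)
    let ?I = "\<lambda>h :: 'a \<Rightarrow> 'b. \<integral>\<^sup>+x. ennreal (norm (h x) powr p) \<partial>lborel"
    have "?I (\<lambda>x. f (x + z n) - f x) = ?I (\<lambda>x. (f (x + z n) - g (x + z n)) + ((g (x + z n) - g x) + (g x - f x)))" by simp
    also have "\<dots> \<le> ennreal (2 powr p) * (?I (\<lambda>x. f (x + z n) - g (x + z n)) + ?I (\<lambda>x. (g (x + z n) - g x) + (g x - f x)))"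
      by (rule nn_integral_powr_add_le[OF p]) measurable
    also have "?I (\<lambda>x. (g (x + z n) - g x) + (g x - f x)) \<le> ennreal (2 powr p) * (?I (\<lambda>x. g (x + z n) - g x) + ?I (\<lambda>x. g x - f x))"
      by (rule nn_integral_powr_add_le[OF p]) measurable
    also have "?I (\<lambda>x. g x - f x) = ?I (\<lambda>x. f x - g x)" by (simp add: norm_minus_commute)
    also have "?I (\<lambda>x. f (x + z n) - g (x + z n)) = ?I (\<lambda>x. f x - g x)"
      by (rule lborel_nn_integral_shift(1)[of "\<lambda>x. ennreal (norm (f x - g x) powr p)"]) measurable
    finally have "?I (\<lambda>x. f (x + z n) - f x) \<le> ennreal (2 powr p) * (?I (\<lambda>x. f x - g x) + ennreal (2 powr p) * (?I (\<lambda>x. g (x + z n) - g x) + ?I (\<lambda>x. f x - g x)))"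
      by (simp add: add_left_mono mult_left_mono order_trans)
    also have "\<dots> \<le> ennreal (2 powr p) * (ennreal d + ennreal (2 powr p) * (ennreal d + ennreal d))"
      using elim gd' by (intro mult_left_mono add_mono) auto
    also have "\<dots> = ennreal (2 powr p * d + 2 powr p * 2 powr p * (2 * d))"
      using d by (simp add: algebra_simps flip: ennreal_plus ennreal_mult)
    also have "\<dots> < ennreal e"
    proof -
      have D: "2 * 2 powr p + 2 * (2 powr p * 2 powr p) > 0" by (simp add: add_pos_pos)
      have "2 powr p * d + 2 powr p * 2 powr p * (2 * d) < (2 * 2 powr p + 2 * (2 powr p * 2 powr p)) * d"
        using d by (simp add: algebra_simps)
      also have "\<dots> = e" unfolding d_def using D by (simp add: field_simps)
      finally show ?thesis using e by (intro ennreal_lessI)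
    qed
    finally show ?case .
  qed
qed

lemma heat_kernel_scale:
  assumes "t > 0"
  shows "sqrt t ^ DIM('a) * heat_kernel t (sqrt t *\<^sub>R (z::'a::euclidean_space)) = heat_kernel 1 z"
proof -
  have "sqrt t ^ DIM('a) = t powr (real DIM('a) / 2)"
    using assms by (simp add: powr_half_sqrt[symmetric] powr_realpow[symmetric] powr_powr)
  moreover have "(4 * pi * t) powr (- real DIM('a) / 2) = (4 * pi) powr (- real DIM('a) / 2) * t powr (- real DIM('a) / 2)"
    by (rule powr_mult)
  moreover have "t powr (real DIM('a) / 2) * t powr (- real DIM('a) / 2) = 1"
    using assms by (simp flip: powr_add)
  ultimately show ?thesis
    using assms by (simp add: heat_kernel_def power_mult_distrib)
qed

text \<open>Parabolic scaling moves the dependence on t from the kernel into the argument of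
  \<open>\<Omega>\<close>. What remains is integration against the fixed time-one kernel, and B
  times that kernel is an integrable majorant.\<close>

lemma heat_kernel_approx_identity:
  fixes \<Omega> :: "'a::euclidean_space \<Rightarrow> ennreal"
  assumes [measurable]: "\<Omega> \<in> borel_measurable borel" and B: "\<And>z. \<Omega> z \<le> B" "B < \<infinity>"
    and lim: "\<And>z. z \<longlonglongrightarrow> 0 \<Longrightarrow> (\<lambda>n. \<Omega> (z n)) \<longlonglongrightarrow> 0"
    and t: "\<And>n. t n > 0" "t \<longlonglongrightarrow> 0"
  shows "(\<lambda>n. \<integral>\<^sup>+z. ennreal (heat_kernel (t n) z) * \<Omega> z \<partial>lborel) \<longlonglongrightarrow> 0"
proof -
  have eq: "(\<integral>\<^sup>+z. ennreal (heat_kernel (t n) z) * \<Omega> z \<partial>lborel) = (\<integral>\<^sup>+z. ennreal (heat_kernel 1 z) * \<Omega> (sqrt (t n) *\<^sub>R z) \<partial>lborel)" for n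
  proof -
    have "(\<integral>\<^sup>+z. ennreal (heat_kernel (t n) z) * \<Omega> z \<partial>lborel) =
      ennreal (sqrt (t n) ^ DIM('a)) * (\<integral>\<^sup>+z. ennreal (heat_kernel (t n) (sqrt (t n) *\<^sub>R z)) * \<Omega> (sqrt (t n) *\<^sub>R z) \<partial>lborel)"
      using lborel_nn_integral_affine[of "\<lambda>z. ennreal (heat_kernel (t n) z) * \<Omega> z" "sqrt (t n)" 0] t(1)[of n] by simp
    also have "\<dots> = (\<integral>\<^sup>+z. ennreal (sqrt (t n) ^ DIM('a)) * (ennreal (heat_kernel (t n) (sqrt (t n) *\<^sub>R z)) * \<Omega> (sqrt (t n) *\<^sub>R z)) \<partial>lborel)"
      by (rule nn_integral_cmult[symmetric]) measurable
    also have "\<dots> = (\<integral>\<^sup>+z. ennreal (heat_kernel 1 z) * \<Omega> (sqrt (t n) *\<^sub>R z) \<partial>lborel)"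
      using t(1)[of n] less_imp_le[OF t(1)[of n]]
      by (intro nn_integral_cong) (simp add: heat_kernel_scale flip: ennreal_mult mult.assoc)
    finally show ?thesis .
  qed
  have "(\<lambda>n. \<integral>\<^sup>+z. ennreal (heat_kernel 1 z) * \<Omega> (sqrt (t n) *\<^sub>R z) \<partial>lborel) \<longlonglongrightarrow> (\<integral>\<^sup>+z. 0 \<partial>(lborel :: 'a measure))"
  proof (rule nn_integral_dominated_convergence)
    show "(\<lambda>z::'a. ennreal (heat_kernel 1 z) * B) \<in> borel_measurable lborel" by measurable
    show "(\<integral>\<^sup>+z. ennreal (heat_kernel 1 (z::'a)) * B \<partial>lborel) < \<infinity>"
      using B(2) by (simp add: nn_integral_multc heat_kernel_nn_integral)
    show "AE z in lborel. ennreal (heat_kernel 1 z) * \<Omega> (sqrt (t n) *\<^sub>R z) \<le> ennreal (heat_kernel 1 z) * B" for n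
      by (intro AE_I2 mult_left_mono B) auto
    show "AE z in lborel. (\<lambda>n. ennreal (heat_kernel 1 z) * \<Omega> (sqrt (t n) *\<^sub>R z)) \<longlonglongrightarrow> 0"
    proof (rule AE_I2)
      fix z :: 'a
      have "(\<lambda>n. sqrt (t n) *\<^sub>R z) \<longlonglongrightarrow> sqrt 0 *\<^sub>R z" by (intro tendsto_intros t)
      then have "(\<lambda>n. \<Omega> (sqrt (t n) *\<^sub>R z)) \<longlonglongrightarrow> 0" by (intro lim) simp
      then show "(\<lambda>n. ennreal (heat_kernel 1 z) * \<Omega> (sqrt (t n) *\<^sub>R z)) \<longlonglongrightarrow> 0"
        using ennreal_tendsto_cmult[of "ennreal (heat_kernel 1 z)"] by fastforce
    qed
  qed measurable
  then show ?thesis unfolding eq by simp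
qed

lemma lborel_integrable_prod:
  fixes f g :: "'a::euclidean_space \<Rightarrow> complex"
  assumes "integrable lborel f" "integrable lborel g"
  shows "integrable (lborel \<Otimes>\<^sub>M lborel) (\<lambda>p. f (fst p) * g (snd p))"
proof -
  have "f \<in> borel_measurable lborel" "g \<in> borel_measurable lborel"
    using assms by auto
  note m = measurable_compose[OF measurable_fst this(1)] measurable_compose[OF measurable_snd this(2)]
  show ?thesis
  proof (rule lborel_pair.Fubini_integrable)
    show "integrable lborel (\<lambda>x. \<integral>y. norm (f (fst (x, y)) * g (snd (x, y))) \<partial>lborel)"
      using assms by (simp add: norm_mult)
    show "AE x in lborel. integrable lborel (\<lambda>y. f (fst (x, y)) * g (snd (x, y)))"
      using assms by simp
  qed (intro borel_measurable_times m)
qed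

section \<open>The Plancherel identity\<close>

text \<open>Left without a normalising factor, so that convolution corresponds to the plain product
  of transforms; the unitary version is \<open>unitary_fourier_int\<close>.\<close>

definition fourier_int :: "('a::euclidean_space \<Rightarrow> complex) \<Rightarrow> 'a \<Rightarrow> complex" where
  "fourier_int f \<xi> = (\<integral>x. exp (- \<i> * complex_of_real (x \<bullet> \<xi>)) * f x \<partial>lborel)"

lemma norm_exp_i_real [simp]: "norm (exp (- (\<i> * complex_of_real r))) = 1"
  using norm_exp_i_times[of "- r"] by simp

lemma fourier_int_measurable [measurable]:
  fixes f :: "'a::euclidean_space \<Rightarrow> complex"
  assumes [measurable]: "f \<in> borel_measurable borel"
  shows "fourier_int f \<in> borel_measurable borel"
proof -
  have "(\<lambda>\<xi>. \<integral>x. exp (- \<i> * complex_of_real (x \<bullet> \<xi>)) * f x \<partial>lborel) \<in> borel_measurable borel"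
    by (rule lborel.borel_measurable_lebesgue_integral) simp
  then show ?thesis by (simp add: fourier_int_def [abs_def])
qed

lemma integrable_exp_mult:
  fixes f :: "'a::euclidean_space \<Rightarrow> complex"
  assumes "integrable lborel f"
  shows "integrable lborel (\<lambda>x. exp (- \<i> * complex_of_real (x \<bullet> \<xi>)) * f x)"
  by (rule Bochner_Integration.integrable_bound[OF assms])
    (use borel_measurable_integrable[OF assms] in \<open>auto simp: norm_mult\<close>)

lemma fourier_int_bound:
  fixes f :: "'a::euclidean_space \<Rightarrow> complex"
  shows "norm (fourier_int f \<xi>) \<le> (\<integral>x. norm (f x) \<partial>lborel)"
proof -
  have "norm (fourier_int f \<xi>) \<le> (\<integral>x. norm (exp (- \<i> * complex_of_real (x \<bullet> \<xi>)) * f x) \<partial>lborel)"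
    unfolding fourier_int_def by (rule integral_norm_bound)
  then show ?thesis by (simp add: norm_mult)
qed

text \<open>The exponential is symmetric in x and \<xi>, so Fubini moves the transform from one
  factor to the other.\<close>

lemma fourier_int_multiplication:
  fixes f \<phi> :: "'a::euclidean_space \<Rightarrow> complex"
  assumes f: "integrable lborel f" and \<phi>: "integrable lborel \<phi>"
  shows "(\<integral>\<xi>. fourier_int f \<xi> * \<phi> \<xi> \<partial>lborel) = (\<integral>x. f x * fourier_int \<phi> x \<partial>lborel)"
proof -
  let ?k = "\<lambda>x \<xi> :: 'a. exp (- \<i> * complex_of_real (x \<bullet> \<xi>)) * f x * \<phi> \<xi>"
  have [measurable]: "f \<in> borel_measurable borel" "\<phi> \<in> borel_measurable borel"
    using f \<phi> by (auto dest: borel_measurable_integrable)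
  have "integrable (lborel \<Otimes>\<^sub>M lborel) (\<lambda>p. ?k (fst p) (snd p))"
    by (rule Bochner_Integration.integrable_bound[OF lborel_integrable_prod[OF f \<phi>]])
      (simp_all add: norm_mult)
  then have "integrable (lborel \<Otimes>\<^sub>M lborel) (\<lambda>(x, \<xi>). ?k x \<xi>)"
    by (simp add: case_prod_beta')
  from lborel_pair.Fubini_integral[OF this]
  have "(\<integral>\<xi>. \<integral>x. ?k x \<xi> \<partial>lborel \<partial>lborel) = (\<integral>x. \<integral>\<xi>. ?k x \<xi> \<partial>lborel \<partial>lborel)" by simp
  note eq = this
  have 1: "(\<integral>x. ?k x \<xi> \<partial>lborel) = fourier_int f \<xi> * \<phi> \<xi>" for \<xi>
    by (simp add: fourier_int_def)
  have 2: "(\<integral>\<xi>. ?k x \<xi> \<partial>lborel) = f x * fourier_int \<phi> x" for x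
  proof -
    have "(\<integral>\<xi>. ?k x \<xi> \<partial>lborel) = (\<integral>\<xi>. f x * (exp (- \<i> * complex_of_real (\<xi> \<bullet> x)) * \<phi> \<xi>) \<partial>lborel)"
      by (intro Bochner_Integration.integral_cong) (auto simp: inner_commute)
    then show ?thesis by (simp add: fourier_int_def)
  qed
  from eq show ?thesis by (simp only: 1 2)
qed

text \<open>A Gaussian in \<xi> is a multiple of the heat kernel at the reciprocal time s = 1 / (4
  t), whose transform is known. The outcome is Fourier inversion for the heat kernel, with the
  constant (2 \<pi>)^n of the unnormalised transform.\<close>

lemma fourier_int_gauss:
  fixes y :: "'a::euclidean_space"
  assumes "t > 0"
  shows "integrable lborel (\<lambda>\<xi>::'a. complex_of_real (exp (- t * (norm \<xi>)\<^sup>2)))"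
    and "fourier_int (\<lambda>\<xi>. complex_of_real (exp (- t * (norm \<xi>)\<^sup>2))) y
      = complex_of_real ((2 * pi) ^ DIM('a) * heat_kernel t y)"
proof -
  define s where "s = 1 / (4 * t)"
  have s: "s > 0" using assms by (simp add: s_def)
  define c where "c = (pi / t) powr (real DIM('a) / 2)"
  have eq: "exp (- t * (norm \<xi>)\<^sup>2) = c * heat_kernel s \<xi>" for \<xi> :: 'a
  proof -
    have "4 * pi * s = pi / t" "(norm \<xi>)\<^sup>2 / (4 * s) = t * (norm \<xi>)\<^sup>2" using assms by (auto simp: s_def)
    moreover have "c * (pi / t) powr (- real DIM('a) / 2) = 1"
      using assms unfolding c_def by (simp flip: powr_add)
    ultimately show ?thesis by (simp add: heat_kernel_def)
  qed
  show "integrable lborel (\<lambda>\<xi>::'a. complex_of_real (exp (- t * (norm \<xi>)\<^sup>2)))"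
    unfolding eq using heat_kernel_integral(1)[OF s, where 'a='a] by (simp add: complex_of_real_integrable_eq)
  have "fourier_int (\<lambda>\<xi>. complex_of_real (exp (- t * (norm \<xi>)\<^sup>2))) y
    = complex_of_real c * (\<integral>x. complex_of_real (heat_kernel s x) * exp (- \<i> * complex_of_real (x \<bullet> y)) \<partial>lborel)"
    unfolding fourier_int_def eq
    by (subst integral_mult_right_zero[symmetric]) (intro Bochner_Integration.integral_cong, auto)
  also have "\<dots> = complex_of_real (c * exp (- s * (norm y)\<^sup>2))"
    unfolding heat_kernel_fourier(2)[OF s] by simp
  also have "c * exp (- s * (norm y)\<^sup>2) = (2 * pi) ^ DIM('a) * heat_kernel t y"
  proof -
    have "(2 * pi) ^ DIM('a) = ((2 * pi)\<^sup>2) powr (real DIM('a) / 2)"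
    proof -
      have "(2 * pi) ^ DIM('a) = (2 * pi) powr (2 * (real DIM('a) / 2))" by (simp add: powr_realpow)
      also have "\<dots> = ((2 * pi) powr 2) powr (real DIM('a) / 2)" by (rule powr_powr[symmetric])
      also have "(2 * pi) powr 2 = (2 * pi)\<^sup>2" by (rule powr_numeral) simp
      finally show ?thesis .
    qed
    moreover have "((2 * pi)\<^sup>2) powr (real DIM('a) / 2) * (4 * pi * t) powr (- real DIM('a) / 2)
       = ((2 * pi)\<^sup>2 / (4 * pi * t)) powr (real DIM('a) / 2)"
    proof -
      have "x powr r * y powr (- r) = (x / y) powr r" if "x \<ge> 0" "y \<ge> 0" for x y r :: real
        using that by (simp add: powr_divide powr_minus_divide)
      from this[of "(2 * pi)\<^sup>2" "4 * pi * t" "real DIM('a) / 2"] show ?thesis using assms by simp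
    qed
    moreover have "(2 * pi)\<^sup>2 / (4 * pi * t) = pi / t"
      using assms by (simp add: power2_eq_square field_simps)
    ultimately have "(2 * pi) ^ DIM('a) * (4 * pi * t) powr (- real DIM('a) / 2) = c"
      unfolding c_def by simp
    then show ?thesis
      unfolding heat_kernel_def by (simp add: s_def mult.assoc[symmetric])
  qed
  finally show "fourier_int (\<lambda>\<xi>. complex_of_real (exp (- t * (norm \<xi>)\<^sup>2))) y
      = complex_of_real ((2 * pi) ^ DIM('a) * heat_kernel t y)" .
qed

text \<open>The damped integral of |f^|^2, where f^ is the transform of f, equals (2 \<pi>)^n times
  the double integral of f(x) cnj(f(y)) against the heat kernel at y - x. Polarising that product
  produces the squared norm of f minus half a heat average of the squared differences f(x + z) -
  f(x). The identity is written as a sum because subtraction in \<open>ennreal\<close> is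
  truncated.\<close>

lemma plancherel_gauss:
  fixes f :: "'a::euclidean_space \<Rightarrow> complex"
  assumes f: "integrable lborel f" and f2: "(\<integral>\<^sup>+x. ennreal ((norm (f x))\<^sup>2) \<partial>lborel) < \<infinity>" and t: "t > 0"
  shows "(\<integral>\<^sup>+\<xi>. ennreal ((norm (fourier_int f \<xi>))\<^sup>2 * exp (- t * (norm \<xi>)\<^sup>2)) \<partial>lborel)
     + ennreal ((2 * pi) ^ DIM('a) / 2) * (\<integral>\<^sup>+z. ennreal (heat_kernel t z) * (\<integral>\<^sup>+x. ennreal ((norm (f (x + z) - f x))\<^sup>2) \<partial>lborel) \<partial>lborel)
     = ennreal ((2 * pi) ^ DIM('a)) * (\<integral>\<^sup>+x. ennreal ((norm (f x))\<^sup>2) \<partial>lborel)"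
proof -
  have [measurable]: "f \<in> borel_measurable borel" using f by (auto dest: borel_measurable_integrable)
  define K where "K = (2 * pi) ^ DIM('a)"
  have K: "K > 0" by (simp add: K_def)
  let ?e = "\<lambda>\<xi>::'a. complex_of_real (exp (- t * (norm \<xi>)\<^sup>2))"
  let ?N = "\<lambda>p :: 'a \<times> 'a. heat_kernel t (snd p - fst p)"
  let ?Q = "lborel \<Otimes>\<^sub>M (lborel :: 'a measure)"
  define S where "S = (\<integral>\<^sup>+x. ennreal ((norm (f x))\<^sup>2) \<partial>lborel)"
  define W where "W = (\<integral>\<^sup>+z. ennreal (heat_kernel t z) * (\<integral>\<^sup>+x. ennreal ((norm (f (x + z) - f x))\<^sup>2) \<partial>lborel) \<partial>lborel)"
  define \<phi> where "\<phi> \<xi> = cnj (fourier_int f \<xi>) * ?e \<xi>" for \<xi>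
  define a where "a p = (norm (f (fst p)))\<^sup>2 * ?N p" for p
  define b where "b p = (norm (f (snd p)))\<^sup>2 * ?N p" for p
  define c where "c p = (norm (f (snd p) - f (fst p)))\<^sup>2 * ?N p" for p
  define q where "q p = f (fst p) * cnj (f (snd p)) * complex_of_real (?N p)" for p
  have [measurable]: "a \<in> borel_measurable ?Q" unfolding a_def by simp
  have [measurable]: "b \<in> borel_measurable ?Q" unfolding b_def by simp
  have [measurable]: "c \<in> borel_measurable ?Q" unfolding c_def by simp
  have [measurable]: "cnj \<in> borel_measurable borel"
    by (intro borel_measurable_continuous_onI continuous_intros)
  have [measurable]: "q \<in> borel_measurable ?Q" unfolding q_def by simp
  have nn: "a p \<ge> 0" "b p \<ge> 0" "c p \<ge> 0" for p by (auto simp: a_def b_def c_def)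
  have A: "(\<integral>\<^sup>+p. ennreal (a p) \<partial>?Q) = S"
  proof -
    have "(\<integral>\<^sup>+p. ennreal (a p) \<partial>?Q) = (\<integral>\<^sup>+x. \<integral>\<^sup>+y. ennreal (a (x, y)) \<partial>lborel \<partial>lborel)"
      by (rule lborel.nn_integral_fst[symmetric]) simp
    also have "\<dots> = S" unfolding S_def
    proof (rule nn_integral_cong)
      fix x :: 'a
      have "(\<integral>\<^sup>+y. ennreal (a (x, y)) \<partial>lborel) = (\<integral>\<^sup>+y. ennreal ((norm (f x))\<^sup>2) * ennreal (heat_kernel t (y - x)) \<partial>lborel)"
        by (simp add: a_def ennreal_mult)
      also have "\<dots> = ennreal ((norm (f x))\<^sup>2) * (\<integral>\<^sup>+y. ennreal (heat_kernel t (y - x)) \<partial>lborel)"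
        by (rule nn_integral_cmult) simp
      also have "(\<integral>\<^sup>+y. ennreal (heat_kernel t (y - x)) \<partial>lborel) = 1"
        using lborel_nn_integral_shift(2)[of "\<lambda>y. ennreal (heat_kernel t y)" x] heat_kernel_nn_integral[OF t, where 'a='a] by simp
      finally show "(\<integral>\<^sup>+y. ennreal (a (x, y)) \<partial>lborel) = ennreal ((norm (f x))\<^sup>2)" by simp
    qed
    finally show ?thesis .
  qed
  have B: "(\<integral>\<^sup>+p. ennreal (b p) \<partial>?Q) = S"
  proof -
    have "(\<integral>\<^sup>+p. ennreal (b p) \<partial>?Q) = (\<integral>\<^sup>+y. \<integral>\<^sup>+x. ennreal (b (x, y)) \<partial>lborel \<partial>lborel)"
      by (rule lborel_pair.nn_integral_snd[symmetric]) simp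
    also have "\<dots> = S" unfolding S_def
    proof (rule nn_integral_cong)
      fix y :: 'a
      have "(\<integral>\<^sup>+x. ennreal (b (x, y)) \<partial>lborel) = (\<integral>\<^sup>+x. ennreal ((norm (f y))\<^sup>2) * ennreal (heat_kernel t (y - x)) \<partial>lborel)"
        by (simp add: b_def ennreal_mult)
      also have "\<dots> = ennreal ((norm (f y))\<^sup>2) * (\<integral>\<^sup>+x. ennreal (heat_kernel t (y - x)) \<partial>lborel)"
        by (rule nn_integral_cmult) simp
      also have "(\<integral>\<^sup>+x. ennreal (heat_kernel t (y - x)) \<partial>lborel) = 1"
        using lborel_nn_integral_shift(3)[of "\<lambda>y. ennreal (heat_kernel t y)" y] heat_kernel_nn_integral[OF t, where 'a='a] by simp
      finally show "(\<integral>\<^sup>+x. ennreal (b (x, y)) \<partial>lborel) = ennreal ((norm (f y))\<^sup>2)" by simp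
    qed
    finally show ?thesis .
  qed
  have C: "(\<integral>\<^sup>+p. ennreal (c p) \<partial>?Q) = W"
  proof -
    have "(\<integral>\<^sup>+p. ennreal (c p) \<partial>?Q) = (\<integral>\<^sup>+x. \<integral>\<^sup>+y. ennreal (c (x, y)) \<partial>lborel \<partial>lborel)"
      by (rule lborel.nn_integral_fst[symmetric]) simp
    also have "\<dots> = (\<integral>\<^sup>+x. \<integral>\<^sup>+z. ennreal (heat_kernel t z) * ennreal ((norm (f (x + z) - f x))\<^sup>2) \<partial>lborel \<partial>lborel)"
    proof (rule nn_integral_cong)
      fix x :: 'a
      have "(\<integral>\<^sup>+y. ennreal (c (x, y)) \<partial>lborel) = (\<integral>\<^sup>+z. ennreal (c (x, z + x)) \<partial>lborel)"
        by (rule lborel_nn_integral_shift(1)[symmetric]) (simp add: c_def)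
      then show "(\<integral>\<^sup>+y. ennreal (c (x, y)) \<partial>lborel) = (\<integral>\<^sup>+z. ennreal (heat_kernel t z) * ennreal ((norm (f (x + z) - f x))\<^sup>2) \<partial>lborel)"
        by (simp add: c_def add.commute mult.commute ennreal_mult[symmetric])
    qed
    also have "\<dots> = (\<integral>\<^sup>+z. \<integral>\<^sup>+x. ennreal (heat_kernel t z) * ennreal ((norm (f (x + z) - f x))\<^sup>2) \<partial>lborel \<partial>lborel)"
      by (rule lborel_pair.Fubini'[symmetric]) simp
    also have "\<dots> = W" unfolding W_def
      by (intro nn_integral_cong nn_integral_cmult) simp
    finally show ?thesis .
  qed
  have Sf: "S < \<infinity>" using f2 by (simp add: S_def)
  have ai: "integrable ?Q a" using A nn Sf by (intro integrableI_bounded) auto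
  have bi: "integrable ?Q b" using B nn Sf by (intro integrableI_bounded) auto
  have cab: "c p \<le> 2 * a p + 2 * b p" for p
  proof -
    have "(norm (f (snd p) - f (fst p)))\<^sup>2 \<le> (norm (f (snd p)) + norm (f (fst p)))\<^sup>2"
      by (intro power_mono norm_triangle_ineq4) auto
    also have "\<dots> \<le> 2 * (norm (f (fst p)))\<^sup>2 + 2 * (norm (f (snd p)))\<^sup>2"
      using sum_squares_bound[of "norm (f (snd p))" "norm (f (fst p))"] by (simp add: power2_sum)
    finally show ?thesis unfolding a_def b_def c_def
      by (metis (no_types, lifting) distrib_right heat_kernel_nonneg mult.assoc mult_right_mono)
  qed
  have ci: "integrable ?Q c"
    by (rule Bochner_Integration.integrable_bound[of ?Q "\<lambda>p. 2 * a p + 2 * b p"])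
      (use ai bi nn cab in auto)
  have qab: "norm (q p) \<le> a p + b p" for p
  proof -
    have "norm (f (fst p)) * norm (f (snd p)) \<le> (norm (f (fst p)))\<^sup>2 + (norm (f (snd p)))\<^sup>2"
    proof -
      have "2 * norm (f (fst p)) * norm (f (snd p)) \<le> (norm (f (fst p)))\<^sup>2 + (norm (f (snd p)))\<^sup>2"
        by (rule sum_squares_bound)
      moreover have "0 \<le> norm (f (fst p)) * norm (f (snd p))" by simp
      ultimately show ?thesis by linarith
    qed
    then show ?thesis unfolding a_def b_def q_def
      by (simp add: norm_mult) (metis (no_types, lifting) distrib_right heat_kernel_nonneg mult_right_mono)
  qed
  have qi: "integrable ?Q q"
    by (rule Bochner_Integration.integrable_bound[of ?Q "\<lambda>p. a p + b p"])
      (use ai bi nn qab in auto)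
  \<comment> \<open>Polarisation: 2 Re (u cnj v) = |u|^2 + |v|^2 - |v - u|^2. The first two terms
    integrate to the squared norm of f, the third is the translation defect.\<close>
  have req: "2 * Re (q p) = a p + b p - c p" for p
  proof -
    have "2 * Re (u * cnj v) = (norm u)\<^sup>2 + (norm v)\<^sup>2 - (norm (v - u))\<^sup>2" for u v
      unfolding cmod_power2 by (simp add: algebra_simps power2_eq_square)
    note eq = this
    have "2 * Re (q p) = (2 * Re (f (fst p) * cnj (f (snd p)))) * ?N p"
      by (simp add: q_def algebra_simps)
    also have "\<dots> = a p + b p - c p"
      unfolding eq a_def b_def c_def by (simp only: left_diff_distrib distrib_right)
    finally show ?thesis .
  qed
  have I1: "(\<integral>p. Re (q p) \<partial>?Q) = enn2real S - enn2real W / 2"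
  proof -
    have "2 * (\<integral>p. Re (q p) \<partial>?Q) = (\<integral>p. a p + b p - c p \<partial>?Q)"
      unfolding req[symmetric] by simp
    also have "\<dots> = (\<integral>p. a p \<partial>?Q) + (\<integral>p. b p \<partial>?Q) - (\<integral>p. c p \<partial>?Q)"
      using ai bi ci by simp
    also have "\<dots> = enn2real S + enn2real S - enn2real W"
      using A B C nn by (simp add: integral_eq_nn_integral)
    finally show ?thesis by simp
  qed
  have ei: "integrable lborel ?e" by (rule fourier_int_gauss[OF t])
  have bd: "integrable lborel (\<lambda>\<xi>. g \<xi> * ?e \<xi>)" if "g \<in> borel_measurable borel" "\<And>\<xi>. norm (g \<xi>) \<le> M" for g :: "'a \<Rightarrow> complex" and M
  proof (rule Bochner_Integration.integrable_bound[of _ "\<lambda>\<xi>. M * ?e \<xi>"])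
    show "integrable lborel (\<lambda>\<xi>. M * ?e \<xi>)" using ei by simp
    have "M \<ge> 0" using that(2)[of 0] norm_ge_zero order_trans by blast
    then show "AE \<xi> in lborel. norm (g \<xi> * ?e \<xi>) \<le> norm (M * ?e \<xi>)"
      using that(2) by (auto simp: norm_mult intro!: mult_right_mono)
  qed (use that(1) in simp)
  have \<phi>i: "integrable lborel \<phi>"
    unfolding \<phi>_def by (rule bd[of _ "\<integral>x. norm (f x) \<partial>lborel"]) (use fourier_int_bound[of f] in auto)
  \<comment> \<open>\<open>\<phi>\<close> is the conjugate of the transform of f times a modulated
    Gaussian. Conjugating the multiplication formula reduces its transform to that of the Gaussian,
    and the modulation becomes a translation by x.\<close>
  have \<phi>hat: "fourier_int \<phi> x = complex_of_real K * (\<integral>y. cnj (f y) * heat_kernel t (y - x) \<partial>lborel)" for x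
  proof -
    define \<phi>2 where "\<phi>2 \<xi> = exp (\<i> * complex_of_real (\<xi> \<bullet> x)) * ?e \<xi>" for \<xi>
    have \<phi>2i: "integrable lborel \<phi>2"
      unfolding \<phi>2_def by (rule bd[of _ 1]) auto
    have 1: "fourier_int \<phi>2 y = complex_of_real (K * heat_kernel t (y - x))" for y
    proof -
      have "fourier_int \<phi>2 y = fourier_int ?e (y - x)"
        unfolding fourier_int_def \<phi>2_def
        by (intro Bochner_Integration.integral_cong) (auto simp: inner_diff_right algebra_simps exp_add[symmetric] mult_exp_exp)
      then show ?thesis unfolding K_def by (simp only: fourier_int_gauss[OF t])
    qed
    have "fourier_int \<phi> x = (\<integral>\<xi>. cnj (fourier_int f \<xi> * \<phi>2 \<xi>) \<partial>lborel)"
      unfolding fourier_int_def[of \<phi>] \<phi>_def \<phi>2_def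
      by (intro Bochner_Integration.integral_cong) (auto simp: exp_cnj algebra_simps)
    also have "\<dots> = cnj (\<integral>\<xi>. fourier_int f \<xi> * \<phi>2 \<xi> \<partial>lborel)" by (rule Bochner_Integration.integral_cnj)
    also have "\<dots> = cnj (\<integral>y. f y * fourier_int \<phi>2 y \<partial>lborel)"
      by (simp only: fourier_int_multiplication[OF f \<phi>2i])
    also have "\<dots> = (\<integral>y. cnj (f y * fourier_int \<phi>2 y) \<partial>lborel)" by (rule Bochner_Integration.integral_cnj[symmetric])
    also have "\<dots> = (\<integral>y. complex_of_real K * (cnj (f y) * heat_kernel t (y - x)) \<partial>lborel)"
      by (intro Bochner_Integration.integral_cong) (auto simp: 1)
    finally show ?thesis by simp
  qed
  have I: "(\<integral>\<xi>. fourier_int f \<xi> * \<phi> \<xi> \<partial>lborel) = complex_of_real K * (\<integral>p. q p \<partial>?Q)"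
  proof -
    have "(\<integral>\<xi>. fourier_int f \<xi> * \<phi> \<xi> \<partial>lborel) = (\<integral>x. f x * fourier_int \<phi> x \<partial>lborel)"
      by (rule fourier_int_multiplication[OF f \<phi>i])
    also have "\<dots> = (\<integral>x. complex_of_real K * (\<integral>y. q (x, y) \<partial>lborel) \<partial>lborel)"
      unfolding \<phi>hat q_def
      by (intro Bochner_Integration.integral_cong) (auto simp: mult.assoc)
    also have "\<dots> = complex_of_real K * (\<integral>x. \<integral>y. q (x, y) \<partial>lborel \<partial>lborel)" by simp
    also have "(\<integral>x. \<integral>y. q (x, y) \<partial>lborel \<partial>lborel) = (\<integral>p. q p \<partial>?Q)"
      by (rule lborel_pair.integral_fst'[OF qi])
    finally show ?thesis .
  qed
  let ?r = "\<lambda>\<xi>. (norm (fourier_int f \<xi>))\<^sup>2 * exp (- t * (norm \<xi>)\<^sup>2)"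
  have r: "fourier_int f \<xi> * \<phi> \<xi> = complex_of_real (?r \<xi>)" for \<xi>
  proof -
    have "z * cnj z = (complex_of_real (norm z))\<^sup>2" for z :: complex
      by (metis complex_norm_square of_real_power)
    then show ?thesis by (simp add: \<phi>_def mult.assoc[symmetric])
  qed
  have "integrable lborel (\<lambda>\<xi>. fourier_int f \<xi> * \<phi> \<xi>)"
  proof -
    have "integrable lborel (\<lambda>\<xi>. (fourier_int f \<xi> * cnj (fourier_int f \<xi>)) * ?e \<xi>)"
      by (rule bd[of _ "(\<integral>x. norm (f x) \<partial>lborel) * (\<integral>x. norm (f x) \<partial>lborel)"])
        (use fourier_int_bound[of f] in \<open>auto simp: norm_mult intro!: mult_mono\<close>)
    then show ?thesis by (simp add: \<phi>_def mult.assoc)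
  qed
  then have ri: "integrable lborel ?r" unfolding r complex_of_real_integrable_eq .
  have Ir: "complex_of_real (\<integral>\<xi>. ?r \<xi> \<partial>lborel) = complex_of_real K * (\<integral>p. q p \<partial>?Q)"
    using I unfolding r by (simp only: integral_complex_of_real)
  have "(\<integral>\<xi>. ?r \<xi> \<partial>lborel) = Re (complex_of_real (\<integral>\<xi>. ?r \<xi> \<partial>lborel))" by simp
  also have "\<dots> = K * Re (\<integral>p. q p \<partial>?Q)" unfolding Ir by simp
  also have "Re (\<integral>p. q p \<partial>?Q) = (\<integral>p. Re (q p) \<partial>?Q)" using qi by simp
  finally have rI: "(\<integral>\<xi>. ?r \<xi> \<partial>lborel) = K * (enn2real S - enn2real W / 2)" by (simp only: I1)
  have Wf: "W < \<infinity>" using ci C nn by (auto simp: integrable_iff_bounded)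
  obtain s where s: "S = ennreal s" "s \<ge> 0" using Sf by (cases S) auto
  obtain w where w: "W = ennreal w" "w \<ge> 0" using Wf by (cases W) auto
  have "(\<integral>\<^sup>+\<xi>. ennreal (?r \<xi>) \<partial>lborel) = ennreal (K * (s - w / 2))"
    using ri rI s w by (subst nn_integral_eq_integral) auto
  \<comment> \<open>Read off from the integral of a nonnegative function. It matters because
    \<open>ennreal\<close> sends negative numbers to 0, which would spoil the sum below.\<close>
  moreover have "K * (s - w / 2) \<ge> 0"
    using rI s w Bochner_Integration.integral_nonneg[of lborel ?r] by simp
  moreover have "ennreal (K * (s - w / 2)) + ennreal (K / 2) * ennreal w = ennreal K * ennreal s"
  proof -
    have "ennreal (K * (s - w / 2)) + ennreal (K / 2) * ennreal w = ennreal (K * (s - w / 2)) + ennreal (K / 2 * w)"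
      using ennreal_mult[of "K / 2" w] w K by simp
    also have "\<dots> = ennreal (K * (s - w / 2) + K / 2 * w)"
      using \<open>K * (s - w / 2) \<ge> 0\<close> w K by (intro ennreal_plus[symmetric]) auto
    also have "K * (s - w / 2) + K / 2 * w = K * s" by (simp add: algebra_simps)
    finally show ?thesis using s K by (simp add: ennreal_mult)
  qed
  ultimately show ?thesis
    using s w unfolding K_def[symmetric] S_def[symmetric] W_def[symmetric] by simp
qed

text \<open>Let t tend to 0 in \<open>plancherel_gauss\<close>. The damping disappears by monotone
  convergence, and the defect term vanishes because translation is continuous in L^2 and the heat
  kernels concentrate at the origin.\<close>

lemma plancherel:
  fixes f :: "'a::euclidean_space \<Rightarrow> complex"
  assumes f: "integrable lborel f" and f2: "(\<integral>\<^sup>+x. ennreal ((norm (f x))\<^sup>2) \<partial>lborel) < \<infinity>"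
  shows "(\<integral>\<^sup>+\<xi>. ennreal ((norm (fourier_int f \<xi>))\<^sup>2) \<partial>lborel)
     = ennreal ((2 * pi) ^ DIM('a)) * (\<integral>\<^sup>+x. ennreal ((norm (f x))\<^sup>2) \<partial>lborel)"
proof -
  have [measurable]: "f \<in> borel_measurable borel" using f by (auto dest: borel_measurable_integrable)
  define t where "t n = 1 / real (Suc n)" for n
  have t: "t n > 0" for n by (simp add: t_def)
  have t0: "t \<longlonglongrightarrow> 0" unfolding t_def inverse_eq_divide[symmetric] by (rule LIMSEQ_inverse_real_of_nat)
  define S where "S = (\<integral>\<^sup>+x. ennreal ((norm (f x))\<^sup>2) \<partial>lborel)"
  define \<Omega> where "\<Omega> z = (\<integral>\<^sup>+x. ennreal ((norm (f (x + z) - f x))\<^sup>2) \<partial>lborel)" for z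
  define W where "W n = (\<integral>\<^sup>+z. ennreal (heat_kernel (t n) z) * \<Omega> z \<partial>lborel)" for n
  have pw: "norm y powr 2 = (norm y)\<^sup>2" for y :: complex by (simp add: powr_numeral)
  have [measurable]: "\<Omega> \<in> borel_measurable borel"
    unfolding \<Omega>_def by (rule lborel.borel_measurable_nn_integral) simp
  have W0: "W \<longlonglongrightarrow> 0" unfolding W_def
  proof (rule heat_kernel_approx_identity[where B = "4 * (S + S)"])
    show "\<Omega> z \<le> 4 * (S + S)" for z
    proof -
      have "\<Omega> z \<le> ennreal (2 powr 2) * ((\<integral>\<^sup>+x. ennreal (norm (f (x + z)) powr 2) \<partial>lborel) + (\<integral>\<^sup>+x. ennreal (norm (- f x) powr 2) \<partial>lborel))"
        unfolding \<Omega>_def pw[symmetric] diff_conv_add_uminus by (rule nn_integral_powr_add_le) auto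
      also have "(\<integral>\<^sup>+x. ennreal (norm (f (x + z)) powr 2) \<partial>lborel) = S"
        unfolding S_def pw[symmetric] by (rule lborel_nn_integral_shift(1)[of "\<lambda>x. ennreal (norm (f x) powr 2)"]) simp
      finally show ?thesis by (simp add: S_def)
    qed
    show "4 * (S + S) < \<infinity>" using f2 by (simp add: S_def ennreal_mult_less_top)
    show "(\<lambda>n. \<Omega> (z n)) \<longlonglongrightarrow> 0" if "z \<longlonglongrightarrow> 0" for z
      unfolding \<Omega>_def pw[symmetric]
      by (rule Lp_translation_continuous) (use that f2 in \<open>simp_all\<close>)
  qed (use t t0 in auto)
  define L where "L n = (\<integral>\<^sup>+\<xi>. ennreal ((norm (fourier_int f \<xi>))\<^sup>2 * exp (- t n * (norm \<xi>)\<^sup>2)) \<partial>lborel)" for n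
  define K where "K = (2 * pi) ^ DIM('a)"
  have sum: "L n + ennreal (K / 2) * W n = ennreal K * S" for n
    unfolding L_def K_def W_def \<Omega>_def S_def by (rule plancherel_gauss[OF f f2 t])
  have KS: "ennreal K * S < \<infinity>" using f2 by (simp add: S_def ennreal_mult_less_top)
  \<comment> \<open>Both summands are at most the finite value \<open>ennreal K * S\<close>, so the
    truncated subtraction is exact here.\<close>
  have "L n = ennreal K * S - ennreal (K / 2) * W n" for n
  proof -
    have "ennreal (K / 2) * W n < \<infinity>" using sum[of n] KS
      by (metis add.commute ennreal_add_eq_top infinity_ennreal_def less_top)
    then show ?thesis using sum[of n] by (metis ennreal_add_diff_cancel_right infinity_ennreal_def less_top)
  qed
  then have "L = (\<lambda>n. ennreal K * S - ennreal (K / 2) * W n)" by auto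
  moreover have "(\<lambda>n. ennreal K * S - ennreal (K / 2) * W n) \<longlonglongrightarrow> ennreal K * S - ennreal (K / 2) * 0"
    using KS by (intro tendsto_diff_ennreal tendsto_const ennreal_tendsto_cmult W0) auto
  ultimately have "L \<longlonglongrightarrow> ennreal K * S" by simp
  moreover have "L \<longlonglongrightarrow> (\<integral>\<^sup>+\<xi>. ennreal ((norm (fourier_int f \<xi>))\<^sup>2) \<partial>lborel)"
    unfolding L_def
  proof (rule nn_integral_LIMSEQ)
    show "incseq (\<lambda>n \<xi>. ennreal ((norm (fourier_int f \<xi>))\<^sup>2 * exp (- t n * (norm \<xi>)\<^sup>2)))"
      by (auto simp: incseq_def le_fun_def t_def intro!: ennreal_leI mult_left_mono mult_right_mono divide_left_mono)
    show "(\<lambda>n. ennreal ((norm (fourier_int f \<xi>))\<^sup>2 * exp (- t n * (norm \<xi>)\<^sup>2))) \<longlonglongrightarrow> ennreal ((norm (fourier_int f \<xi>))\<^sup>2)" for \<xi>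
    proof -
      have "(\<lambda>n. (norm (fourier_int f \<xi>))\<^sup>2 * exp (- t n * (norm \<xi>)\<^sup>2)) \<longlonglongrightarrow> (norm (fourier_int f \<xi>))\<^sup>2 * exp (- 0 * (norm \<xi>)\<^sup>2)"
        by (intro tendsto_intros t0)
      then show ?thesis by (intro tendsto_ennrealI) simp
    qed
  qed simp
  ultimately show ?thesis using LIMSEQ_unique unfolding K_def S_def by blast
qed

section \<open>The Fourier transform on \<open>L\<^sup>2\<close>\<close>

text \<open>The squared L^2 norm with values in \<open>ennreal\<close>: it needs no integrability
  side condition and coincides with the mean-square distance in \<open>L2_fourier\<close>.\<close>

definition sq_norm :: "('a::euclidean_space \<Rightarrow> 'b::real_normed_vector) \<Rightarrow> ennreal" where
  "sq_norm u = (\<integral>\<^sup>+x. ennreal ((norm (u x))\<^sup>2) \<partial>lebesgue)"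

lemma norm_powr_2: "norm y powr 2 = (norm y)\<^sup>2"
  by (simp add: powr_numeral)

lemma Lp_space_2_iff:
  fixes u :: "'a::euclidean_space \<Rightarrow> 'b::{real_normed_vector, second_countable_topology}"
  shows "u \<in> Lp_space 2 \<longleftrightarrow> u \<in> borel_measurable lebesgue \<and> sq_norm u < \<infinity>"
  unfolding Lp_space_def sq_norm_def norm_powr_2 by (auto simp: integrable_iff_bounded)

lemma sq_norm_lborel:
  fixes u :: "'a::euclidean_space \<Rightarrow> 'b::{real_normed_vector, second_countable_topology}"
  assumes "u \<in> borel_measurable borel"
  shows "sq_norm u = (\<integral>\<^sup>+x. ennreal ((norm (u x))\<^sup>2) \<partial>lborel)"
  unfolding sq_norm_def by (rule nn_integral_completion)

lemma sq_norm_cong_AE: "AE x in lebesgue. norm (u x) = norm (v x) \<Longrightarrow> sq_norm u = sq_norm v"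
  unfolding sq_norm_def by (rule nn_integral_cong_AE) auto

lemma sq_norm_cong_AE': "AE x in lebesgue. u x = v x \<Longrightarrow> sq_norm u = sq_norm v"
  by (rule sq_norm_cong_AE) (auto elim!: eventually_mono)

lemma sq_norm_mono_AE: "AE x in lebesgue. norm (u x) \<le> norm (v x) \<Longrightarrow> sq_norm u \<le> sq_norm v"
  unfolding sq_norm_def by (rule nn_integral_mono_AE) (auto elim!: eventually_mono intro!: ennreal_leI power_mono)

lemma sq_norm_scale:
  fixes u :: "'a::euclidean_space \<Rightarrow> complex"
  assumes "u \<in> borel_measurable lebesgue"
  shows "sq_norm (\<lambda>x. c * u x) = ennreal ((norm c)\<^sup>2) * sq_norm u"
  unfolding sq_norm_def using assms
  by (subst nn_integral_cmult[symmetric]) (auto simp: norm_mult power_mult_distrib ennreal_mult)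

lemma sq_norm_add:
  fixes u v :: "'a::euclidean_space \<Rightarrow> 'b::{real_normed_vector, second_countable_topology}"
  assumes "u \<in> borel_measurable lebesgue" "v \<in> borel_measurable lebesgue"
  shows "sq_norm (\<lambda>x. u x + v x) \<le> 4 * (sq_norm u + sq_norm v)"
  using nn_integral_powr_add_le[of 2 u lebesgue v] assms unfolding sq_norm_def norm_powr_2 by simp

lemma sq_norm_minus: "sq_norm (\<lambda>x. u x - v x) = sq_norm (\<lambda>x. v x - u x)"
  unfolding sq_norm_def by (simp add: norm_minus_commute)

lemma sq_norm_diff:
  fixes u v :: "'a::euclidean_space \<Rightarrow> 'b::{real_normed_vector, second_countable_topology}"
  assumes "u \<in> borel_measurable lebesgue" "v \<in> borel_measurable lebesgue"
  shows "sq_norm (\<lambda>x. u x - v x) \<le> 4 * (sq_norm u + sq_norm v)"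
  using sq_norm_add[of u "\<lambda>x. - v x"] assms by (simp add: sq_norm_def)

lemma sq_norm_triangle:
  fixes u v w :: "'a::euclidean_space \<Rightarrow> 'b::{real_normed_vector, second_countable_topology}"
  assumes "u \<in> borel_measurable lebesgue" "v \<in> borel_measurable lebesgue" "w \<in> borel_measurable lebesgue"
  shows "sq_norm (\<lambda>x. u x - w x) \<le> 4 * (sq_norm (\<lambda>x. u x - v x) + sq_norm (\<lambda>x. v x - w x))"
  using sq_norm_add[of "\<lambda>x. u x - v x" "\<lambda>x. v x - w x"] assms by simp

lemma sq_norm_eq_0_iff:
  fixes u :: "'a::euclidean_space \<Rightarrow> 'b::{real_normed_vector, second_countable_topology}"
  assumes "u \<in> borel_measurable lebesgue"
  shows "sq_norm u = 0 \<longleftrightarrow> (AE x in lebesgue. u x = 0)"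
  unfolding sq_norm_def using assms by (subst nn_integral_0_iff_AE) auto

lemma Lp2_add: "u \<in> Lp_space 2 \<Longrightarrow> v \<in> Lp_space 2 \<Longrightarrow> (\<lambda>x. u x + v x) \<in> Lp_space 2"
  for u v :: "'a::euclidean_space \<Rightarrow> 'b::{real_normed_vector, second_countable_topology}"
  unfolding Lp_space_2_iff using sq_norm_add[of u v]
  by (auto simp: ennreal_mult_less_top intro: le_less_trans)

lemma Lp2_diff: "u \<in> Lp_space 2 \<Longrightarrow> v \<in> Lp_space 2 \<Longrightarrow> (\<lambda>x. u x - v x) \<in> Lp_space 2"
  for u v :: "'a::euclidean_space \<Rightarrow> 'b::{real_normed_vector, second_countable_topology}"
  unfolding Lp_space_2_iff using sq_norm_diff[of u v]
  by (auto simp: ennreal_mult_less_top intro: le_less_trans)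

lemma Lp2_scale: "u \<in> Lp_space 2 \<Longrightarrow> (\<lambda>x. c * u x) \<in> Lp_space 2"
  for u :: "'a::euclidean_space \<Rightarrow> complex"
  unfolding Lp_space_2_iff using sq_norm_scale[of u c] by (auto simp: ennreal_mult_less_top)

text \<open>The constant 4 of \<open>sq_norm_add\<close> is too lossy for the convergence of norms.
  Instead |p|^2 <= (1 + h) |q|^2 + (1 + 1/h) |p - q|^2 is used in both directions, with h > 0 small
  before the index moves.\<close>

lemma sq_norm_tendsto:
  fixes a :: "'i \<Rightarrow> 'a::euclidean_space \<Rightarrow> complex"
  assumes m [measurable]: "\<And>i. a i \<in> borel_measurable lebesgue" "b \<in> borel_measurable lebesgue"
    and fin: "sq_norm b < \<infinity>" and lim: "((\<lambda>i. sq_norm (\<lambda>x. a i x - b x)) \<longlongrightarrow> 0) F"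
  shows "((\<lambda>i. sq_norm (a i)) \<longlongrightarrow> sq_norm b) F"
proof -
  have ineq: "sq_norm u \<le> ennreal (1 + h) * sq_norm v + ennreal (1 + 1 / h) * sq_norm (\<lambda>x. u x - v x)"
    if "h > 0" and [measurable]: "u \<in> borel_measurable lebesgue" "v \<in> borel_measurable lebesgue" for h and u v :: "'a \<Rightarrow> complex"
  proof -
    have "(norm p)\<^sup>2 \<le> (1 + h) * (norm q)\<^sup>2 + (1 + 1 / h) * (norm (p - q))\<^sup>2" for p q :: complex
    proof -
      have "norm p \<le> norm q + norm (p - q)" using norm_triangle_ineq[of q "p - q"] by simp
      then have "(norm p)\<^sup>2 \<le> (norm q + norm (p - q))\<^sup>2" by (intro power_mono) auto
      also have "\<dots> \<le> (1 + h) * (norm q)\<^sup>2 + (1 + 1 / h) * (norm (p - q))\<^sup>2"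
      proof -
        have "0 \<le> (h * norm q - norm (p - q))\<^sup>2 / h" using that by simp
        also have "\<dots> = h * (norm q)\<^sup>2 + (1 / h) * (norm (p - q))\<^sup>2 - 2 * norm q * norm (p - q)"
          using that by (simp add: power2_eq_square field_simps)
        finally show ?thesis by (simp add: power2_sum algebra_simps)
      qed
      finally show ?thesis .
    qed
    then have "sq_norm u \<le> (\<integral>\<^sup>+x. ennreal (1 + h) * ennreal ((norm (v x))\<^sup>2) + ennreal (1 + 1 / h) * ennreal ((norm (u x - v x))\<^sup>2) \<partial>lebesgue)"
      unfolding sq_norm_def using that(1)
      by (intro nn_integral_mono) (simp flip: ennreal_mult ennreal_plus)
    also have "\<dots> = ennreal (1 + h) * sq_norm v + ennreal (1 + 1 / h) * sq_norm (\<lambda>x. u x - v x)"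
      unfolding sq_norm_def by (simp add: nn_integral_add nn_integral_cmult)
    finally show ?thesis .
  qed
  obtain s where s: "sq_norm b = ennreal s" "s \<ge> 0" using fin by (cases "sq_norm b") auto
  have small: "\<forall>\<^sub>F i in F. ennreal c + ennreal k * sq_norm (\<lambda>x. a i x - b x) < ennreal d" if "0 \<le> c" "c < d" for c k d
  proof -
    have "((\<lambda>i. ennreal c + ennreal k * sq_norm (\<lambda>x. a i x - b x)) \<longlongrightarrow> ennreal c + ennreal k * 0) F"
      by (intro tendsto_add tendsto_const ennreal_tendsto_cmult lim) auto
    then show ?thesis using that by (intro order_tendstoD) (auto simp: ennreal_less_iff)
  qed
  show ?thesis
  proof (rule order_tendstoI)
    fix y assume y: "y < sq_norm b"
    then obtain r where r: "y = ennreal r" "r \<ge> 0" by (cases y) (auto simp: s)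
    have rs: "r < s" using y r s by (simp add: ennreal_less_iff)
    \<comment> \<open>Chosen so that h r is at most (s - r) / 2 and hence (1 + h) r < s; the summand
      1 covers the case r = 0. The upper bound uses the same choice with r and s exchanged.\<close>
    define h where "h = (s - r) / (2 * (r + 1))"
    have h: "h > 0" using rs r by (simp add: h_def)
    have hs: "(1 + h) * r < s"
    proof -
      have "h * r \<le> h * (r + 1)" using h by simp
      also have "\<dots> = (s - r) / 2" using r by (simp add: h_def field_simps)
      also have "\<dots> < s - r" using rs by simp
      finally show ?thesis by (simp add: algebra_simps)
    qed
    have "\<forall>\<^sub>F i in F. ennreal ((1 + h) * r) + ennreal (1 + 1 / h) * sq_norm (\<lambda>x. a i x - b x) < ennreal s"
      using hs h r by (intro small) auto
    then show "\<forall>\<^sub>F i in F. y < sq_norm (a i)"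
    proof eventually_elim
      case (elim i)
      show ?case
      proof (rule ccontr)
        assume "\<not> y < sq_norm (a i)"
        then have "sq_norm (a i) \<le> ennreal r" using r by simp
        then have "ennreal (1 + h) * sq_norm (a i) \<le> ennreal ((1 + h) * r)"
          using h r by (simp add: ennreal_mult mult_left_mono)
        moreover have "ennreal s \<le> ennreal (1 + h) * sq_norm (a i) + ennreal (1 + 1 / h) * sq_norm (\<lambda>x. a i x - b x)"
          using ineq[OF h m(2) m(1), of i] by (simp add: s sq_norm_minus[of b])
        ultimately have "ennreal s \<le> ennreal ((1 + h) * r) + ennreal (1 + 1 / h) * sq_norm (\<lambda>x. a i x - b x)"
          by (meson add_right_mono order_trans)
        with elim show False by simp
      qed
    qed
  next
    fix y assume y: "sq_norm b < y"
    obtain r where r: "s < r" "ennreal r \<le> y"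
    proof (cases y)
      case (real r)
      then show ?thesis using y s that[of r] by (simp add: ennreal_less_iff)
    next
      case top
      then show ?thesis using that[of "s + 1"] by simp
    qed
    define h where "h = (r - s) / (2 * (s + 1))"
    have h: "h > 0" using r s by (simp add: h_def)
    have hs: "(1 + h) * s < r"
    proof -
      have "h * s \<le> h * (s + 1)" using h by simp
      also have "\<dots> = (r - s) / 2" using s by (simp add: h_def field_simps)
      also have "\<dots> < r - s" using r by simp
      finally show ?thesis by (simp add: algebra_simps)
    qed
    have "\<forall>\<^sub>F i in F. ennreal ((1 + h) * s) + ennreal (1 + 1 / h) * sq_norm (\<lambda>x. a i x - b x) < ennreal r"
      using hs h s by (intro small) auto
    then show "\<forall>\<^sub>F i in F. sq_norm (a i) < y"
    proof eventually_elim
      case (elim i)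
      have "sq_norm (a i) \<le> ennreal ((1 + h) * s) + ennreal (1 + 1 / h) * sq_norm (\<lambda>x. a i x - b x)"
        using ineq[OF h m(1) m(2), of i] h s by (simp add: ennreal_mult)
      also note elim
      also note r(2)
      finally show ?case .
    qed
  qed
qed

text \<open>Fubini is applied on products of \<open>lborel\<close>, where measurability is Borel.
  Passing to a Borel representative is the bridge from the Lebesgue measurable elements of L^p; it
  is found coordinate by coordinate.\<close>

lemma borel_rep_euclidean:
  fixes u :: "'a::euclidean_space \<Rightarrow> 'b::euclidean_space"
  assumes u: "u \<in> borel_measurable lebesgue"
  obtains u' where "u' \<in> borel_measurable borel" "AE x in lebesgue. u x = u' x"
proof -
  have "\<forall>b\<in>Basis. \<exists>p. p \<in> borel_measurable lborel \<and> (AE x in lborel. u x \<bullet> b = p x)"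
  proof
    fix b :: 'b
    have "(\<lambda>x. u x \<bullet> b) \<in> borel_measurable lebesgue" using u by simp
    then show "\<exists>p. p \<in> borel_measurable lborel \<and> (AE x in lborel. u x \<bullet> b = p x)"
      using completion_ex_borel_measurable_real by blast
  qed
  then obtain p where p: "\<And>b. b \<in> Basis \<Longrightarrow> p b \<in> borel_measurable lborel" "\<And>b. b \<in> Basis \<Longrightarrow> AE x in lborel. u x \<bullet> b = p b x"
    by metis
  have "AE x in lborel. \<forall>b\<in>Basis. u x \<bullet> b = p b x"
    using p(2) by (intro AE_finite_allI) auto
  then have "AE x in lborel. u x = (\<Sum>b\<in>Basis. p b x *\<^sub>R b)"
    by eventually_elim (metis (no_types, lifting) euclidean_representation sum.cong)
  moreover have "(\<lambda>x. \<Sum>b\<in>Basis. p b x *\<^sub>R b) \<in> borel_measurable borel"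
    using p(1) by (intro borel_measurable_sum borel_measurable_scaleR) auto
  ultimately show ?thesis using that AE_completion by blast
qed

section \<open>The unitary transform of truncated functions\<close>

definition unitary_fourier_int :: "('a::euclidean_space \<Rightarrow> complex) \<Rightarrow> 'a \<Rightarrow> complex" where
  "unitary_fourier_int f \<xi> = complex_of_real ((2 * pi) powr (- real DIM('a) / 2)) * fourier_int f \<xi>"

lemma unitary_fourier_int_measurable [measurable]:
  "f \<in> borel_measurable borel \<Longrightarrow> unitary_fourier_int f \<in> borel_measurable borel"
  unfolding unitary_fourier_int_def [abs_def] by measurable

lemma sq_norm_unitary_fourier_int:
  fixes f :: "'a::euclidean_space \<Rightarrow> complex"
  assumes f: "integrable lborel f" and f2: "sq_norm f < \<infinity>"
  shows "sq_norm (unitary_fourier_int f) = sq_norm f"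
proof -
  have [measurable]: "f \<in> borel_measurable borel" using f by (auto dest: borel_measurable_integrable)
  have "sq_norm (unitary_fourier_int f) = ennreal (((2 * pi) powr (- real DIM('a) / 2))\<^sup>2) * sq_norm (fourier_int f)"
    unfolding unitary_fourier_int_def using measurable_completion[of "fourier_int f" lborel borel]
    by (subst sq_norm_scale) auto
  also have "sq_norm (fourier_int f) = ennreal ((2 * pi) ^ DIM('a)) * sq_norm f"
    using f2 plancherel[OF f] by (simp add: sq_norm_lborel)
  also have "ennreal (((2 * pi) powr (- real DIM('a) / 2))\<^sup>2) * (ennreal ((2 * pi) ^ DIM('a)) * sq_norm f) = sq_norm f"
  proof -
    have "((2 * pi) powr (- real DIM('a) / 2))\<^sup>2 * (2 * pi) ^ DIM('a)
       = (2 * pi) powr (- real DIM('a) / 2 + - real DIM('a) / 2 + real DIM('a))"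
      unfolding powr_add power2_eq_square by (simp add: powr_realpow)
    then have "((2 * pi) powr (- real DIM('a) / 2))\<^sup>2 * (2 * pi) ^ DIM('a) = 1" by simp
    then show ?thesis by (simp add: mult.assoc[symmetric] flip: ennreal_mult)
  qed
  finally show ?thesis .
qed

lemma fourier_int_linear:
  assumes "integrable lborel f" "integrable lborel g"
  shows "fourier_int (\<lambda>x. a * f x + b * g x) \<xi> = a * fourier_int f \<xi> + b * fourier_int g \<xi>"
proof -
  have "fourier_int (\<lambda>x. a * f x + b * g x) \<xi> =
    (\<integral>x. a * (exp (- \<i> * complex_of_real (x \<bullet> \<xi>)) * f x) + b * (exp (- \<i> * complex_of_real (x \<bullet> \<xi>)) * g x) \<partial>lborel)"
    unfolding fourier_int_def by (intro Bochner_Integration.integral_cong) (auto simp: algebra_simps)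
  then show ?thesis
    unfolding fourier_int_def
    using integrable_exp_mult[OF assms(1), of \<xi>] integrable_exp_mult[OF assms(2), of \<xi>]
    by (subst (asm) Bochner_Integration.integral_add) auto
qed

lemma unitary_fourier_int_linear:
  assumes "integrable lborel f" "integrable lborel g"
  shows "unitary_fourier_int (\<lambda>x. a * f x + b * g x) \<xi> = a * unitary_fourier_int f \<xi> + b * unitary_fourier_int g \<xi>"
  unfolding unitary_fourier_int_def fourier_int_linear[OF assms] by (simp add: algebra_simps)

definition cut :: "real \<Rightarrow> ('a::euclidean_space \<Rightarrow> 'b::real_normed_vector) \<Rightarrow> 'a \<Rightarrow> 'b" where
  "cut R u x = indicator (cball 0 R) x *\<^sub>R u x"

lemma cut_measurable:
  fixes u :: "'a::euclidean_space \<Rightarrow> 'b::{real_normed_vector, second_countable_topology}"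
  shows "u \<in> borel_measurable borel \<Longrightarrow> cut R u \<in> borel_measurable borel"
    and "u \<in> borel_measurable lebesgue \<Longrightarrow> cut R u \<in> borel_measurable lebesgue"
proof -
  have i: "(indicator (cball 0 R) :: 'a \<Rightarrow> real) \<in> borel_measurable borel"
    by (rule borel_measurable_indicator) simp
  then have i': "(indicator (cball 0 R) :: 'a \<Rightarrow> real) \<in> borel_measurable lebesgue"
    by (intro measurable_completion) simp
  show "u \<in> borel_measurable borel \<Longrightarrow> cut R u \<in> borel_measurable borel"
    unfolding cut_def [abs_def] by (intro borel_measurable_scaleR i)
  show "u \<in> borel_measurable lebesgue \<Longrightarrow> cut R u \<in> borel_measurable lebesgue"
    unfolding cut_def [abs_def] by (intro borel_measurable_scaleR i')
qed

text \<open>On a ball, |u| <= 1 + |u|^2, and both terms have finite integrals there.\<close>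

lemma cut_integrable:
  fixes u :: "'a::euclidean_space \<Rightarrow> complex"
  assumes u [measurable]: "u \<in> borel_measurable borel" and u2: "sq_norm u < \<infinity>"
  shows "integrable lborel (cut R u)"
proof (rule integrableI_bounded)
  show "cut R u \<in> borel_measurable lborel" using cut_measurable(1)[OF u] by simp
  have i: "(indicator (cball 0 R) :: 'a \<Rightarrow> ennreal) \<in> borel_measurable borel"
    by (rule borel_measurable_indicator) simp
  have "(\<integral>\<^sup>+x. ennreal (norm (cut R u x)) \<partial>lborel) \<le> (\<integral>\<^sup>+x. ennreal 1 * indicator (cball 0 R) x + ennreal ((norm (u x))\<^sup>2) \<partial>lborel)"
  proof (rule nn_integral_mono)
    fix x :: 'a
    have "norm (u x) \<le> 1 + (norm (u x))\<^sup>2"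
    proof -
      have "2 * norm (u x) \<le> 1 + (norm (u x))\<^sup>2"
        using zero_le_power2[of "norm (u x) - 1"] unfolding power2_diff by simp
      then show ?thesis using norm_ge_zero[of "u x"] by linarith
    qed
    then have "ennreal (norm (u x)) \<le> ennreal (1 + (norm (u x))\<^sup>2)" by (rule ennreal_leI)
    also have "\<dots> = 1 + ennreal ((norm (u x))\<^sup>2)" by (subst ennreal_plus) auto
    finally show "ennreal (norm (cut R u x)) \<le> ennreal 1 * indicator (cball 0 R) x + ennreal ((norm (u x))\<^sup>2)"
      by (cases "x \<in> cball 0 R") (simp_all add: cut_def)
  qed
  also have "\<dots> = (\<integral>\<^sup>+x. ennreal 1 * indicator (cball (0::'a) R) x \<partial>lborel) + sq_norm u"
    unfolding sq_norm_lborel[OF u] using nn_integral_cball_finite(1)[of 1 R, where 'a='a] by (subst nn_integral_add) auto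
  also have "\<dots> < \<infinity>" using u2 nn_integral_cball_finite(3)[of 1 R, where 'a='a] by simp
  finally show "(\<integral>\<^sup>+x. ennreal (norm (cut R u x)) \<partial>lborel) < \<infinity>" .
qed

lemma norm_cut_le: "norm (cut R u x) \<le> norm (u x)"
  by (simp add: cut_def indicator_def)

text \<open>Equality holds at every frequency, since an integral does not see the null set on which
  u and u' differ. It makes truncated transforms Borel measurable and brings them under the L^1
  theory.\<close>

lemma truncated_fourier_eq:
  fixes u u' :: "'a::euclidean_space \<Rightarrow> complex"
  assumes u: "u \<in> borel_measurable lebesgue" and u': "u' \<in> borel_measurable borel" and eq: "AE x in lebesgue. u x = u' x"
  shows "truncated_fourier R u = unitary_fourier_int (cut R u')"
proof
  fix \<xi> :: 'a
  let ?e = "\<lambda>x::'a. exp (- \<i> * complex_of_real (x \<bullet> \<xi>))"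
  have e: "?e \<in> borel_measurable borel"
    by (intro borel_measurable_continuous_onI continuous_intros)
  then have e': "?e \<in> borel_measurable lebesgue" by (intro measurable_completion) simp
  have "set_lebesgue_integral lebesgue (cball 0 R) (\<lambda>x. ?e x * u x) = (\<integral>x. ?e x * cut R u x \<partial>lebesgue)"
    unfolding set_lebesgue_integral_def cut_def by (intro Bochner_Integration.integral_cong) auto
  also have "\<dots> = (\<integral>x. ?e x * cut R u' x \<partial>lebesgue)"
  proof (rule integral_cong_AE)
    show "(\<lambda>x. ?e x * cut R u x) \<in> borel_measurable lebesgue"
      using e' cut_measurable(2)[OF u, of R] by (intro borel_measurable_times)
    have "u' \<in> borel_measurable lebesgue" using u' by (intro measurable_completion) simp
    then show "(\<lambda>x. ?e x * cut R u' x) \<in> borel_measurable lebesgue"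
      using e' by (intro borel_measurable_times cut_measurable)
    show "AE x in lebesgue. ?e x * cut R u x = ?e x * cut R u' x"
      using eq by eventually_elim (simp add: cut_def)
  qed
  also have "\<dots> = (\<integral>x. ?e x * cut R u' x \<partial>lborel)"
    using e cut_measurable(1)[OF u', of R] by (intro integral_completion) simp
  finally show "truncated_fourier R u \<xi> = unitary_fourier_int (cut R u') \<xi>"
    unfolding truncated_fourier_def unitary_fourier_int_def fourier_int_def by simp
qed

lemma truncated_fourier_props:
  fixes u :: "'a::euclidean_space \<Rightarrow> complex"
  assumes u: "u \<in> Lp_space 2"
  shows "truncated_fourier R u \<in> borel_measurable borel"
    and "truncated_fourier R u \<in> borel_measurable lebesgue"
    and "sq_norm (truncated_fourier R u) = sq_norm (cut R u)"
    and "sq_norm (\<lambda>\<xi>. truncated_fourier R u \<xi> - truncated_fourier R' u \<xi>) = sq_norm (\<lambda>x. cut R u x - cut R' u x)"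
    and "v \<in> Lp_space 2 \<Longrightarrow> truncated_fourier R (\<lambda>x. a * u x + b * v x) \<xi> = a * truncated_fourier R u \<xi> + b * truncated_fourier R v \<xi>"
proof -
  have um: "u \<in> borel_measurable lebesgue" and u2: "sq_norm u < \<infinity>" using u by (auto simp: Lp_space_2_iff)
  obtain u' where u'm: "u' \<in> borel_measurable borel" and ae: "AE x in lebesgue. u x = u' x"
    using borel_rep_euclidean[OF um] .
  have u'2: "sq_norm u' < \<infinity>" using sq_norm_cong_AE'[OF ae] u2 by simp
  note eq = truncated_fourier_eq[OF um u'm ae]
  note ci = cut_integrable[OF u'm u'2]
  have c2: "sq_norm (cut R u') < \<infinity>" for R
    using sq_norm_mono_AE[of "cut R u'" u'] u'2 norm_cut_le[of R u'] by (auto intro: le_less_trans)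
  show 1: "truncated_fourier R u \<in> borel_measurable borel"
    unfolding eq using cut_measurable(1)[OF u'm] by measurable
  then show "truncated_fourier R u \<in> borel_measurable lebesgue" by (intro measurable_completion) simp
  show "sq_norm (truncated_fourier R u) = sq_norm (cut R u)"
    unfolding eq sq_norm_unitary_fourier_int[OF ci c2]
    using ae by (intro sq_norm_cong_AE) (auto simp: cut_def elim!: eventually_mono)
  have d: "(\<lambda>x. cut R u' x - cut R' u' x) = (\<lambda>x. 1 * cut R u' x + (- 1) * cut R' u' x)" by auto
  have "sq_norm (\<lambda>\<xi>. unitary_fourier_int (cut R u') \<xi> - unitary_fourier_int (cut R' u') \<xi>)
     = sq_norm (unitary_fourier_int (\<lambda>x. cut R u' x - cut R' u' x))"
    unfolding d by (subst unitary_fourier_int_linear[OF ci ci, abs_def]) simp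
  also have "\<dots> = sq_norm (\<lambda>x. cut R u' x - cut R' u' x)"
  proof (rule sq_norm_unitary_fourier_int)
    show "integrable lborel (\<lambda>x. cut R u' x - cut R' u' x)" using ci by simp
    have "sq_norm (\<lambda>x. cut R u' x - cut R' u' x) \<le> sq_norm u'"
      by (intro sq_norm_mono_AE AE_I2) (simp add: cut_def indicator_def)
    then show "sq_norm (\<lambda>x. cut R u' x - cut R' u' x) < \<infinity>" using u'2 by (rule le_less_trans)
  qed
  also have "\<dots> = sq_norm (\<lambda>x. cut R u x - cut R' u x)"
    using ae by (intro sq_norm_cong_AE) (auto simp: cut_def elim!: eventually_mono)
  finally show "sq_norm (\<lambda>\<xi>. truncated_fourier R u \<xi> - truncated_fourier R' u \<xi>) = sq_norm (\<lambda>x. cut R u x - cut R' u x)"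
    unfolding eq .
  show "truncated_fourier R (\<lambda>x. a * u x + b * v x) \<xi> = a * truncated_fourier R u \<xi> + b * truncated_fourier R v \<xi>"
    if v: "v \<in> Lp_space 2"
  proof -
    have vm: "v \<in> borel_measurable lebesgue" and v2: "sq_norm v < \<infinity>" using v by (auto simp: Lp_space_2_iff)
    obtain v' where v'm: "v' \<in> borel_measurable borel" and aev: "AE x in lebesgue. v x = v' x"
      using borel_rep_euclidean[OF vm] .
    have v'2: "sq_norm v' < \<infinity>" using sq_norm_cong_AE'[OF aev] v2 by simp
    have "truncated_fourier R (\<lambda>x. a * u x + b * v x) = unitary_fourier_int (cut R (\<lambda>x. a * u' x + b * v' x))"
    proof (rule truncated_fourier_eq)
      show "AE x in lebesgue. a * u x + b * v x = a * u' x + b * v' x"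
        using ae aev by eventually_elim simp
    qed (use um vm u'm v'm in auto)
    also have "cut R (\<lambda>x. a * u' x + b * v' x) = (\<lambda>x. a * cut R u' x + b * cut R v' x)"
      by (auto simp: cut_def algebra_simps indicator_def)
    finally show ?thesis
      unfolding eq truncated_fourier_eq[OF vm v'm aev]
      using unitary_fourier_int_linear[OF ci cut_integrable[OF v'm v'2]] by simp
  qed
qed

lemma cut_tendsto:
  fixes u :: "'a::euclidean_space \<Rightarrow> complex"
  assumes u: "u \<in> Lp_space 2"
  shows "((\<lambda>R. sq_norm (\<lambda>x. cut R u x - u x)) \<longlongrightarrow> 0) at_top"
proof -
  have um: "u \<in> borel_measurable lebesgue" and u2: "sq_norm u < \<infinity>" using u by (auto simp: Lp_space_2_iff)
  have "(\<lambda>n. sq_norm (\<lambda>x. cut (real n) u x - u x)) \<longlonglongrightarrow> (\<integral>\<^sup>+x. 0 \<partial>(lebesgue :: 'a measure))"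
    unfolding sq_norm_def
  proof (rule nn_integral_dominated_convergence)
    show "(\<lambda>x. ennreal ((norm (cut (real n) u x - u x))\<^sup>2)) \<in> borel_measurable lebesgue" for n
      using cut_measurable(2)[OF um] um by simp
    show "(\<lambda>x. ennreal ((norm (u x))\<^sup>2)) \<in> borel_measurable lebesgue" using um by simp
    show "(\<integral>\<^sup>+x. ennreal ((norm (u x))\<^sup>2) \<partial>lebesgue) < \<infinity>" using u2 by (simp add: sq_norm_def)
    show "AE x in lebesgue. ennreal ((norm (cut (real n) u x - u x))\<^sup>2) \<le> ennreal ((norm (u x))\<^sup>2)" for n
      by (rule AE_I2) (simp add: cut_def indicator_def)
    show "AE x in lebesgue. (\<lambda>n. ennreal ((norm (cut (real n) u x - u x))\<^sup>2)) \<longlonglongrightarrow> 0"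
    proof (rule AE_I2)
      fix x :: 'a
      obtain N :: nat where N: "norm x \<le> real N" using real_arch_simple by blast
      have "\<forall>\<^sub>F n in sequentially. ennreal ((norm (cut (real n) u x - u x))\<^sup>2) = 0"
        using eventually_ge_at_top[of N] by eventually_elim (use N in \<open>simp add: cut_def\<close>)
      then show "(\<lambda>n. ennreal ((norm (cut (real n) u x - u x))\<^sup>2)) \<longlonglongrightarrow> 0" by (rule tendsto_eventually)
    qed
  qed auto
  then have lim: "(\<lambda>n. sq_norm (\<lambda>x. cut (real n) u x - u x)) \<longlonglongrightarrow> 0" by simp
  \<comment> \<open>The tails decrease in the radius, which carries the limit along the integers
    over to all real radii, as \<open>L2_fourier\<close> demands.\<close>
  have mono: "sq_norm (\<lambda>x. cut R u x - u x) \<le> sq_norm (\<lambda>x. cut r u x - u x)" if "r \<le> R" for r R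
    by (intro sq_norm_mono_AE AE_I2) (use that in \<open>auto simp: cut_def indicator_def\<close>)
  show ?thesis
  proof (rule tendsto_0_ennrealI)
    fix e :: real assume "e > 0"
    then have "\<forall>\<^sub>F n in sequentially. sq_norm (\<lambda>x. cut (real n) u x - u x) < ennreal e"
      by (intro order_tendstoD(2)[OF lim]) simp
    then obtain n where n: "sq_norm (\<lambda>x. cut (real n) u x - u x) < ennreal e"
      by (auto simp: eventually_at_top_linorder)
    show "\<forall>\<^sub>F R in at_top. sq_norm (\<lambda>x. cut R u x - u x) < ennreal e"
      using eventually_ge_at_top[of "real n"] by eventually_elim (rule le_less_trans[OF mono n])
  qed
qed

section \<open>Isometry, existence and closedness of the transform\<close>

lemma L2_fourier_iff:
  "L2_fourier u v \<longleftrightarrow> u \<in> Lp_space 2 \<and> v \<in> Lp_space 2 \<and>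
     ((\<lambda>R. sq_norm (\<lambda>\<xi>. truncated_fourier R u \<xi> - v \<xi>)) \<longlongrightarrow> 0) at_top"
  unfolding L2_fourier_def sq_norm_def ..

lemma L2_fourierD:
  assumes "L2_fourier u v"
  shows "u \<in> Lp_space 2" "v \<in> Lp_space 2" "u \<in> borel_measurable lebesgue" "v \<in> borel_measurable lebesgue"
    "sq_norm u < \<infinity>" "sq_norm v < \<infinity>"
  using assms by (auto simp: L2_fourier_iff Lp_space_2_iff)

text \<open>Plancherel gives equality for each truncation, and the norms on both sides converge by
  \<open>sq_norm_tendsto\<close>.\<close>

lemma L2_fourier_isometry:
  assumes "L2_fourier u v"
  shows "sq_norm v = sq_norm u"
proof -
  note uv = L2_fourierD[OF assms]
  have "((\<lambda>R. sq_norm (truncated_fourier R u)) \<longlongrightarrow> sq_norm v) at_top"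
    using assms uv by (intro sq_norm_tendsto truncated_fourier_props) (auto simp: L2_fourier_iff)
  moreover have "((\<lambda>R. sq_norm (cut R u)) \<longlongrightarrow> sq_norm u) at_top"
    using uv by (intro sq_norm_tendsto cut_measurable cut_tendsto)
  ultimately show ?thesis
    using tendsto_unique[OF trivial_limit_at_top_linorder] by (simp add: truncated_fourier_props(3)[OF uv(1)])
qed

lemma tendsto_0_ennreal_le:
  fixes f g :: "'i \<Rightarrow> ennreal"
  assumes "(g \<longlongrightarrow> 0) F" "\<And>i. f i \<le> c * g i" "c < \<infinity>"
  shows "(f \<longlongrightarrow> 0) F"
proof (rule tendsto_sandwich[OF _ _ tendsto_const])
  show "((\<lambda>i. c * g i) \<longlongrightarrow> 0) F"
    using ennreal_tendsto_cmult[OF _ assms(1), of c] assms(3) by simp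
qed (use assms(2) in auto)

lemma L2_fourier_linear:
  assumes 1: "L2_fourier u v" and 2: "L2_fourier u' v'"
  shows "L2_fourier (\<lambda>x. a * u x + b * u' x) (\<lambda>\<xi>. a * v \<xi> + b * v' \<xi>)"
  unfolding L2_fourier_iff
proof (intro conjI)
  note d1 = L2_fourierD[OF 1] and d2 = L2_fourierD[OF 2]
  show "(\<lambda>x. a * u x + b * u' x) \<in> Lp_space 2" using d1 d2 by (intro Lp2_add Lp2_scale)
  show "(\<lambda>x. a * v x + b * v' x) \<in> Lp_space 2" using d1 d2 by (intro Lp2_add Lp2_scale)
  note m1 [measurable] = truncated_fourier_props(2)[OF d1(1)]
  note m2 [measurable] = truncated_fourier_props(2)[OF d2(1)]
  note [measurable] = d1(4) d2(4)
  have "((\<lambda>R. 4 * (ennreal ((norm a)\<^sup>2) * sq_norm (\<lambda>\<xi>. truncated_fourier R u \<xi> - v \<xi>)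
      + ennreal ((norm b)\<^sup>2) * sq_norm (\<lambda>\<xi>. truncated_fourier R u' \<xi> - v' \<xi>))) \<longlongrightarrow>
      4 * (ennreal ((norm a)\<^sup>2) * 0 + ennreal ((norm b)\<^sup>2) * 0)) at_top"
    using 1 2 unfolding L2_fourier_iff by (intro ennreal_tendsto_cmult tendsto_add) (auto simp: less_top)
  then have lim: "((\<lambda>R. 4 * (ennreal ((norm a)\<^sup>2) * sq_norm (\<lambda>\<xi>. truncated_fourier R u \<xi> - v \<xi>)
      + ennreal ((norm b)\<^sup>2) * sq_norm (\<lambda>\<xi>. truncated_fourier R u' \<xi> - v' \<xi>))) \<longlongrightarrow> 0) at_top" by simp
  have le: "sq_norm (\<lambda>\<xi>. truncated_fourier R (\<lambda>x. a * u x + b * u' x) \<xi> - (a * v \<xi> + b * v' \<xi>)) \<le>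
    4 * (ennreal ((norm a)\<^sup>2) * sq_norm (\<lambda>\<xi>. truncated_fourier R u \<xi> - v \<xi>)
      + ennreal ((norm b)\<^sup>2) * sq_norm (\<lambda>\<xi>. truncated_fourier R u' \<xi> - v' \<xi>))" for R
  proof -
    have "(\<lambda>\<xi>. truncated_fourier R (\<lambda>x. a * u x + b * u' x) \<xi> - (a * v \<xi> + b * v' \<xi>))
      = (\<lambda>\<xi>. a * (truncated_fourier R u \<xi> - v \<xi>) + b * (truncated_fourier R u' \<xi> - v' \<xi>))"
      by (auto simp: truncated_fourier_props(5)[OF d1(1) d2(1)] algebra_simps)
    then show ?thesis
      using sq_norm_add[of "\<lambda>\<xi>. a * (truncated_fourier R u \<xi> - v \<xi>)" "\<lambda>\<xi>. b * (truncated_fourier R u' \<xi> - v' \<xi>)"]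
      by (simp add: sq_norm_scale)
  qed
  show "((\<lambda>R. sq_norm (\<lambda>\<xi>. truncated_fourier R (\<lambda>x. a * u x + b * u' x) \<xi> - (a * v \<xi> + b * v' \<xi>))) \<longlongrightarrow> 0) at_top"
    by (rule tendsto_sandwich[OF _ _ tendsto_const lim]) (use le in auto)
qed

lemma L2_fourier_diff:
  "L2_fourier u v \<Longrightarrow> L2_fourier u' v' \<Longrightarrow> L2_fourier (\<lambda>x. u x - u' x) (\<lambda>\<xi>. v \<xi> - v' \<xi>)"
  using L2_fourier_linear[of u v u' v' 1 "-1"] by simp

lemma L2_fourier_cong_AE:
  assumes uv: "L2_fourier u v" and u: "AE x in lebesgue. u x = u' x" and v: "AE \<xi> in lebesgue. v \<xi> = v' \<xi>"
  shows "L2_fourier u' v'"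
proof -
  note d = L2_fourierD[OF uv]
  have um: "u' \<in> borel_measurable lebesgue" and vm: "v' \<in> borel_measurable lebesgue"
    using borel_measurable_AE[OF d(3) u] borel_measurable_AE[OF d(4) v] by auto
  have "truncated_fourier R u' = truncated_fourier R u" for R
  proof -
    obtain w where w: "w \<in> borel_measurable borel" "AE x in lebesgue. u x = w x"
      using borel_rep_euclidean[OF d(3)] .
    have "AE x in lebesgue. u' x = w x" using w(2) u by eventually_elim simp
    then show ?thesis using truncated_fourier_eq[OF um w(1)] truncated_fourier_eq[OF d(3) w] by simp
  qed
  moreover have "sq_norm (\<lambda>\<xi>. truncated_fourier R u \<xi> - v' \<xi>) = sq_norm (\<lambda>\<xi>. truncated_fourier R u \<xi> - v \<xi>)" for R
    by (rule sq_norm_cong_AE') (use v in \<open>auto elim!: eventually_mono\<close>)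
  ultimately show ?thesis
    using uv um vm sq_norm_cong_AE'[OF u] sq_norm_cong_AE'[OF v] unfolding L2_fourier_iff Lp_space_2_iff by simp
qed

lemma L2_fourier_inj:
  assumes "L2_fourier u v" "L2_fourier u' v'" "AE \<xi> in lebesgue. v \<xi> = v' \<xi>"
  shows "AE x in lebesgue. u x = u' x"
proof -
  note d = L2_fourier_diff[OF assms(1,2)]
  have "sq_norm (\<lambda>x. u x - u' x) = sq_norm (\<lambda>\<xi>. v \<xi> - v' \<xi>)" using L2_fourier_isometry[OF d] by simp
  also have "\<dots> = 0"
    using assms(3) L2_fourierD(4)[OF d] by (subst sq_norm_eq_0_iff) (auto elim!: eventually_mono)
  finally show ?thesis using L2_fourierD(3)[OF d] by (subst (asm) sq_norm_eq_0_iff) auto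
qed

lemma L2_fourier_fun:
  assumes "L2_fourier u v" "L2_fourier u' v'" "AE x in lebesgue. u x = u' x"
  shows "AE \<xi> in lebesgue. v \<xi> = v' \<xi>"
proof -
  note d = L2_fourier_diff[OF assms(1,2)]
  have "sq_norm (\<lambda>\<xi>. v \<xi> - v' \<xi>) = sq_norm (\<lambda>x. u x - u' x)" using L2_fourier_isometry[OF d] by simp
  also have "\<dots> = 0"
    using assms(3) L2_fourierD(3)[OF d] by (subst sq_norm_eq_0_iff) (auto elim!: eventually_mono)
  finally show ?thesis using L2_fourierD(4)[OF d] by (subst (asm) sq_norm_eq_0_iff) auto
qed

lemma sq_norm_fatou:
  fixes F :: "nat \<Rightarrow> 'a::euclidean_space \<Rightarrow> complex"
  assumes [measurable]: "\<And>n. F n \<in> borel_measurable lebesgue" "w \<in> borel_measurable lebesgue"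
    and ae: "AE x in lebesgue. (\<lambda>n. F n x) \<longlonglongrightarrow> v x" and le: "\<forall>\<^sub>F n in sequentially. sq_norm (\<lambda>x. w x - F n x) \<le> c"
  shows "sq_norm (\<lambda>x. w x - v x) \<le> c"
proof -
  have "sq_norm (\<lambda>x. w x - v x) = (\<integral>\<^sup>+x. liminf (\<lambda>n. ennreal ((norm (w x - F n x))\<^sup>2)) \<partial>lebesgue)"
    unfolding sq_norm_def
  proof (rule nn_integral_cong_AE)
    show "AE x in lebesgue. ennreal ((norm (w x - v x))\<^sup>2) = liminf (\<lambda>n. ennreal ((norm (w x - F n x))\<^sup>2))"
      using ae
    proof eventually_elim
      case (elim x)
      then have "(\<lambda>n. ennreal ((norm (w x - F n x))\<^sup>2)) \<longlonglongrightarrow> ennreal ((norm (w x - v x))\<^sup>2)"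
        by (intro tendsto_intros)
      then show ?case by (intro lim_imp_Liminf[symmetric]) auto
    qed
  qed
  also have "\<dots> \<le> liminf (\<lambda>n. \<integral>\<^sup>+x. ennreal ((norm (w x - F n x))\<^sup>2) \<partial>lebesgue)"
    by (rule nn_integral_liminf) measurable
  also have "\<dots> \<le> c"
    using le unfolding sq_norm_def by (intro Liminf_le) auto
  finally show ?thesis .
qed

text \<open>Riesz--Fischer along a fast Cauchy sequence: \<open>\<Sum> 2\<^sup>n \<bar>F\<^sub>n\<^sub>+\<^sub>1 - F\<^sub>n\<bar>\<^sup>2\<close> has a finite integral, so
  the increments are a.e. dominated by a geometric series.\<close>

lemma sq_norm_Cauchy_AE:
  fixes F :: "nat \<Rightarrow> 'a::euclidean_space \<Rightarrow> complex"
  assumes m [measurable]: "\<And>n. F n \<in> borel_measurable lebesgue"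
    and le: "\<And>n. sq_norm (\<lambda>x. F (Suc n) x - F n x) \<le> ennreal ((1/4) ^ n)"
  shows "\<exists>v. v \<in> borel_measurable lebesgue \<and> (AE x in lebesgue. (\<lambda>n. F n x) \<longlonglongrightarrow> v x)"
proof -
  define d where "d n x = (norm (F (Suc n) x - F n x))\<^sup>2" for n x
  have [measurable]: "d n \<in> borel_measurable lebesgue" for n unfolding d_def by measurable
  have "(\<integral>\<^sup>+x. (\<Sum>n. ennreal (2 ^ n * d n x)) \<partial>lebesgue) = (\<Sum>n. \<integral>\<^sup>+x. ennreal (2 ^ n * d n x) \<partial>lebesgue)"
    by (rule nn_integral_suminf) measurable
  also have "\<dots> = (\<Sum>n. ennreal (2 ^ n) * sq_norm (\<lambda>x. F (Suc n) x - F n x))"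
    unfolding sq_norm_def d_def by (intro suminf_cong) (simp add: ennreal_mult nn_integral_cmult)
  also have "\<dots> \<le> (\<Sum>n. ennreal ((1/2) ^ n))"
  proof (intro suminf_le summableI)
    fix n
    have "ennreal (2 ^ n) * sq_norm (\<lambda>x. F (Suc n) x - F n x) \<le> ennreal (2 ^ n) * ennreal ((1/4) ^ n)"
      by (intro mult_left_mono le) auto
    also have "\<dots> = ennreal ((2 * (1/4)) ^ n)" by (simp only: power_mult_distrib) (simp add: ennreal_mult)
    finally show "ennreal (2 ^ n) * sq_norm (\<lambda>x. F (Suc n) x - F n x) \<le> ennreal ((1/2) ^ n)" by simp
  qed
  also have "\<dots> = ennreal 2"
  proof -
    have "(\<lambda>n. (1/2::real) ^ n) sums 2" using geometric_sums[of "1/2::real"] by simp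
    then have "(\<lambda>n. ennreal ((1/2) ^ n)) sums ennreal 2" by (subst sums_ennreal) auto
    then show ?thesis by (rule sums_unique[symmetric])
  qed
  finally have "(\<integral>\<^sup>+x. (\<Sum>n. ennreal (2 ^ n * d n x)) \<partial>lebesgue) \<noteq> \<infinity>" by (auto simp: top_unique)
  then have "AE x in lebesgue. (\<Sum>n. ennreal (2 ^ n * d n x)) \<noteq> \<infinity>"
    by (intro nn_integral_PInf_AE) measurable
  then have conv: "AE x in lebesgue. convergent (\<lambda>n. F n x)"
  proof eventually_elim
    case (elim x)
    obtain M where M: "(\<Sum>n. ennreal (2 ^ n * d n x)) = ennreal M" "M \<ge> 0"
      using elim by (cases "(\<Sum>n. ennreal (2 ^ n * d n x))") auto
    have b: "norm (F (Suc n) x - F n x) \<le> sqrt M * (sqrt (1/2)) ^ n" for n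
    proof -
      have "(\<Sum>i\<in>{n}. ennreal (2 ^ i * d i x)) \<le> (\<Sum>n. ennreal (2 ^ n * d n x))"
        by (rule sum_le_suminf) auto
      then have "2 ^ n * d n x \<le> M" using M by simp
      then have "d n x \<le> M * (1/2) ^ n" by (simp add: field_simps)
      then have "sqrt (d n x) \<le> sqrt (M * (1/2) ^ n)" by simp
      then show ?thesis by (simp add: d_def real_sqrt_mult real_sqrt_power)
    qed
    have "summable (\<lambda>n. sqrt M * (sqrt (1/2)) ^ n)"
      by (intro summable_mult summable_geometric) (simp add: real_sqrt_divide)
    then have "summable (\<lambda>n. F (Suc n) x - F n x)"
      by (rule summable_comparison_test'[of _ 0]) (rule b)
    then have "(\<lambda>n. \<Sum>i<n. F (Suc i) x - F i x) \<longlonglongrightarrow> (\<Sum>n. F (Suc n) x - F n x)"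
      by (rule summable_LIMSEQ)
    then have "(\<lambda>n. F n x - F 0 x) \<longlonglongrightarrow> (\<Sum>n. F (Suc n) x - F n x)"
      using sum_lessThan_telescope[of "\<lambda>n. F n x"] by simp
    then have "(\<lambda>n. (F n x - F 0 x) + F 0 x) \<longlonglongrightarrow> (\<Sum>n. F (Suc n) x - F n x) + F 0 x"
      by (intro tendsto_intros)
    then show ?case by (auto simp: convergent_def)
  qed
  have "(\<lambda>x. lim (\<lambda>n. F n x)) \<in> borel_measurable lebesgue" by measurable
  moreover have "AE x in lebesgue. (\<lambda>n. F n x) \<longlonglongrightarrow> lim (\<lambda>n. F n x)"
    using conv by eventually_elim (simp add: convergent_LIMSEQ_iff)
  ultimately show ?thesis by (intro exI[of _ "\<lambda>x. lim (\<lambda>n. F n x)"]) simp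
qed

text \<open>By Plancherel the truncated transforms inherit the Cauchy property of the truncations u
  restricted to balls. A fast subsequence converges almost everywhere, and Fatou's lemma recovers
  mean-square convergence along all radii.\<close>

lemma L2_fourier_exists:
  assumes u: "u \<in> Lp_space 2"
  shows "\<exists>v. L2_fourier u v"
proof -
  have um: "u \<in> borel_measurable lebesgue" and u2: "sq_norm u < \<infinity>" using u by (auto simp: Lp_space_2_iff)
  define \<tau> where "\<tau> R = sq_norm (\<lambda>x. cut R u x - u x)" for R
  have \<tau>lim: "(\<tau> \<longlongrightarrow> 0) at_top" unfolding \<tau>_def [abs_def] by (rule cut_tendsto[OF u])
  have le: "sq_norm (\<lambda>\<xi>. truncated_fourier R' u \<xi> - truncated_fourier R u \<xi>) \<le> \<tau> R" if "R \<le> R'" for R R'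
  proof -
    have "sq_norm (\<lambda>\<xi>. truncated_fourier R' u \<xi> - truncated_fourier R u \<xi>) = sq_norm (\<lambda>x. cut R' u x - cut R u x)"
      by (rule truncated_fourier_props(4)[OF u])
    also have "\<dots> \<le> \<tau> R" unfolding \<tau>_def
      by (intro sq_norm_mono_AE AE_I2) (use that in \<open>auto simp: cut_def indicator_def\<close>)
    finally show ?thesis .
  qed
  have "\<forall>n. \<exists>k. \<forall>R\<ge>k. \<tau> R < ennreal ((1/4) ^ n)"
  proof
    fix n
    have "\<forall>\<^sub>F R in at_top. \<tau> R < ennreal ((1/4) ^ n)" by (intro order_tendstoD(2)[OF \<tau>lim]) simp
    then show "\<exists>k. \<forall>R\<ge>k. \<tau> R < ennreal ((1/4) ^ n)" by (simp add: eventually_at_top_linorder)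
  qed
  then obtain k where k: "\<And>n R. R \<ge> k n \<Longrightarrow> \<tau> R < ennreal ((1/4) ^ n)" by metis
  \<comment> \<open>Adding up all earlier thresholds makes the radii increasing while each still
    exceeds its own threshold; the summand n makes them unbounded.\<close>
  define r where "r n = real n + (\<Sum>i\<le>n. \<bar>k i\<bar>)" for n
  have r: "r n \<ge> k n" "r n \<le> r (Suc n)" "r n \<ge> real n" for n
  proof -
    have "\<bar>k n\<bar> \<le> (\<Sum>i\<le>n. \<bar>k i\<bar>)" by (rule member_le_sum) auto
    then show "r n \<ge> k n" unfolding r_def by linarith
    show "r n \<le> r (Suc n)" by (simp add: r_def)
    show "r n \<ge> real n" by (simp add: r_def sum_nonneg)
  qed
  note tm [measurable] = truncated_fourier_props(2)[OF u]
  obtain v where v [measurable]: "v \<in> borel_measurable lebesgue"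
    and ae: "AE x in lebesgue. (\<lambda>n. truncated_fourier (r n) u x) \<longlonglongrightarrow> v x"
    using sq_norm_Cauchy_AE[of "\<lambda>n. truncated_fourier (r n) u"] le[OF r(2)] k[OF r(1)] tm
    by (meson less_imp_le order_trans)
  \<comment> \<open>Fatou's lemma compares a fixed radius R with the subsequence only, so the bound
    holds for every real R and the limit is not confined to the subsequence.\<close>
  have lev: "sq_norm (\<lambda>\<xi>. truncated_fourier R u \<xi> - v \<xi>) \<le> \<tau> R" for R
  proof (rule sq_norm_fatou[OF _ _ ae])
    show "\<forall>\<^sub>F n in sequentially. sq_norm (\<lambda>x. truncated_fourier R u x - truncated_fourier (r n) u x) \<le> \<tau> R"
      using eventually_ge_at_top[of "nat \<lceil>R\<rceil>"]
    proof eventually_elim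
      case (elim n)
      have "R \<le> real n" using elim by linarith
      then have "R \<le> r n" using r(3)[of n] by linarith
      then show ?case by (subst sq_norm_minus) (rule le)
    qed
  qed measurable
  have "sq_norm v < \<infinity>"
  proof -
    have "sq_norm v = sq_norm (\<lambda>x. truncated_fourier (r 0) u x - (truncated_fourier (r 0) u x - v x))" by simp
    also have "\<dots> \<le> 4 * (sq_norm (truncated_fourier (r 0) u) + sq_norm (\<lambda>x. truncated_fourier (r 0) u x - v x))"
      by (rule sq_norm_diff) measurable
    also have "\<dots> < \<infinity>"
    proof -
      have "sq_norm (truncated_fourier (r 0) u) \<le> sq_norm u"
        unfolding truncated_fourier_props(3)[OF u] by (intro sq_norm_mono_AE AE_I2 norm_cut_le)
      moreover have "sq_norm (\<lambda>x. truncated_fourier (r 0) u x - v x) < ennreal ((1/4)^0)"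
        by (rule le_less_trans[OF lev k[OF r(1)]])
      ultimately show ?thesis using u2 by (auto simp: ennreal_mult_less_top intro: le_less_trans less_le_trans)
    qed
    finally show ?thesis .
  qed
  moreover have "((\<lambda>R. sq_norm (\<lambda>\<xi>. truncated_fourier R u \<xi> - v \<xi>)) \<longlongrightarrow> 0) at_top"
    by (rule tendsto_0_ennreal_le[OF \<tau>lim, of _ 1]) (use lev in auto)
  ultimately show ?thesis using u v unfolding L2_fourier_iff Lp_space_2_iff by blast
qed

text \<open>The function u has some transform w, and the isometry forces W n to converge to w as
  well as to v. The two limits agree almost everywhere, so the graph of the transform is closed;
  this extends the convolution theorem from integrable functions to L^2.\<close>

lemma L2_fourier_closed:
  fixes u v :: "'a::euclidean_space \<Rightarrow> complex"
  assumes uv: "\<And>n. L2_fourier (U n) (W n)" and u: "u \<in> Lp_space 2" and v: "v \<in> borel_measurable lebesgue"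
    and lu: "(\<lambda>n. sq_norm (\<lambda>x. U n x - u x)) \<longlonglongrightarrow> 0" and lv: "(\<lambda>n. sq_norm (\<lambda>x. W n x - v x)) \<longlonglongrightarrow> 0"
  shows "L2_fourier u v"
proof -
  obtain w where w: "L2_fourier u w" using L2_fourier_exists[OF u] by blast
  note dw = L2_fourierD[OF w]
  have [measurable]: "W n \<in> borel_measurable lebesgue" "v \<in> borel_measurable lebesgue" "w \<in> borel_measurable lebesgue" for n
    using L2_fourierD(4)[OF uv] v dw by auto
  have lw: "(\<lambda>n. sq_norm (\<lambda>x. W n x - w x)) \<longlonglongrightarrow> 0"
    using lu L2_fourier_isometry[OF L2_fourier_diff[OF uv w]] by simp
  have "(\<lambda>n. 4 * (sq_norm (\<lambda>x. W n x - w x) + sq_norm (\<lambda>x. W n x - v x))) \<longlonglongrightarrow> 4 * (0 + 0)"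
    by (intro ennreal_tendsto_cmult tendsto_add lw lv) auto
  moreover have "sq_norm (\<lambda>x. w x - v x) \<le> 4 * (sq_norm (\<lambda>x. W n x - w x) + sq_norm (\<lambda>x. W n x - v x))" for n
    using sq_norm_triangle[of w "W n" v] by (simp add: sq_norm_minus[of w])
  ultimately have "sq_norm (\<lambda>x. w x - v x) \<le> 0"
    by (intro LIMSEQ_le_const) auto
  then have "AE x in lebesgue. w x - v x = 0" by (subst (asm) le_zero_eq, subst (asm) sq_norm_eq_0_iff) measurable
  then show ?thesis by (intro L2_fourier_cong_AE[OF w]) auto
qed

lemma L2_fourier_L1:
  fixes f :: "'a::euclidean_space \<Rightarrow> complex"
  assumes f: "integrable lborel f" and f2: "sq_norm f < \<infinity>"
  shows "L2_fourier f (unitary_fourier_int f)"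
  unfolding L2_fourier_iff
proof (intro conjI)
  have m: "f \<in> borel_measurable borel" using f by (auto dest: borel_measurable_integrable)
  have ml: "f \<in> borel_measurable lebesgue" using m by (intro measurable_completion) simp
  show f': "f \<in> Lp_space 2" using f2 ml by (simp add: Lp_space_2_iff)
  show "unitary_fourier_int f \<in> Lp_space 2"
    unfolding Lp_space_2_iff sq_norm_unitary_fourier_int[OF f f2]
    using f2 unitary_fourier_int_measurable[OF m] by (auto intro!: measurable_completion)
  have ci: "integrable lborel (cut R f)" for R by (rule cut_integrable[OF m f2])
  have "sq_norm (\<lambda>\<xi>. truncated_fourier R f \<xi> - unitary_fourier_int f \<xi>) = sq_norm (\<lambda>x. cut R f x - f x)" for R
  proof -
    have eq: "(\<lambda>\<xi>. truncated_fourier R f \<xi> - unitary_fourier_int f \<xi>) = unitary_fourier_int (\<lambda>x. cut R f x - f x)"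
      unfolding truncated_fourier_eq[OF ml m AE_I2[OF refl]]
      using unitary_fourier_int_linear[OF ci f, of 1 R "-1"] by auto
    show ?thesis unfolding eq
    proof (rule sq_norm_unitary_fourier_int)
      show "integrable lborel (\<lambda>x. cut R f x - f x)" using ci f by simp
      have "sq_norm (\<lambda>x. cut R f x - f x) \<le> sq_norm f"
        by (intro sq_norm_mono_AE AE_I2) (simp add: cut_def indicator_def)
      then show "sq_norm (\<lambda>x. cut R f x - f x) < \<infinity>" using f2 by (rule le_less_trans)
    qed
  qed
  then show "((\<lambda>R. sq_norm (\<lambda>\<xi>. truncated_fourier R f \<xi> - unitary_fourier_int f \<xi>)) \<longlongrightarrow> 0) at_top"
    using cut_tendsto[OF f'] by simp
qed

section \<open>Convolution with an integrable positive kernel\<close>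

text \<open>Scalar multiplication lets one operator act on real and on complex functions. Where the
  integral diverges the Bochner integral is 0; for f in L^2 and the kernels of
  \<open>conv_kernel\<close> this happens on a null set of points only.\<close>

definition convolve :: "('a::euclidean_space \<Rightarrow> real) \<Rightarrow> ('a \<Rightarrow> 'b::euclidean_space) \<Rightarrow> 'a \<Rightarrow> 'b" where
  "convolve g f x = (\<integral>y. g (x - y) *\<^sub>R f y \<partial>lebesgue)"

locale conv_kernel =
  fixes g :: "'a::euclidean_space \<Rightarrow> real"
  assumes kernel_measurable [measurable]: "g \<in> borel_measurable borel"
    and kernel_nonneg: "\<And>x. g x \<ge> 0"
    and kernel_integrable: "integrable lborel g"
begin

definition "mass = (\<integral>x. g x \<partial>lborel)"

lemma mass_nonneg: "mass \<ge> 0"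
  unfolding mass_def by (intro Bochner_Integration.integral_nonneg kernel_nonneg)

lemma mass_nn: "(\<integral>\<^sup>+x. ennreal (g x) \<partial>lborel) = ennreal mass"
  unfolding mass_def using kernel_integrable kernel_nonneg by (intro nn_integral_eq_integral) auto

lemma kernel_shift_measurable: "(\<lambda>y. g (x - y)) \<in> borel_measurable lebesgue"
  by (intro measurable_completion) measurable

lemma convolve_integrand_measurable:
  "f \<in> borel_measurable lebesgue \<Longrightarrow> (\<lambda>y. g (x - y) *\<^sub>R f y) \<in> borel_measurable lebesgue"
  for f :: "'a \<Rightarrow> 'b::euclidean_space"
  by (intro borel_measurable_scaleR kernel_shift_measurable)

lemma convolve_cong_AE:
  fixes f f' :: "'a \<Rightarrow> 'b::euclidean_space"
  assumes f: "f \<in> borel_measurable lebesgue" and eq: "AE x in lebesgue. f x = f' x"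
  shows "convolve g f = convolve g f'"
  unfolding convolve_def using borel_measurable_AE[OF f eq] f eq
  by (intro ext integral_cong_AE convolve_integrand_measurable) (auto elim!: eventually_mono)

lemma convolve_borel:
  fixes f :: "'a \<Rightarrow> 'b::euclidean_space"
  assumes [measurable]: "f \<in> borel_measurable borel"
  shows "convolve g f x = (\<integral>y. g (x - y) *\<^sub>R f y \<partial>lborel)"
  unfolding convolve_def by (rule integral_completion) measurable

lemma convolve_measurable:
  fixes f :: "'a \<Rightarrow> 'b::euclidean_space"
  assumes f: "f \<in> borel_measurable lebesgue"
  shows "convolve g f \<in> borel_measurable borel"
proof -
  obtain f' where f' [measurable]: "f' \<in> borel_measurable borel" and ae: "AE x in lebesgue. f x = f' x"
    using borel_rep_euclidean[OF f] .
  have "(\<lambda>x. \<integral>y. g (x - y) *\<^sub>R f' y \<partial>lborel) \<in> borel_measurable borel"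
    by (rule lborel.borel_measurable_lebesgue_integral) simp
  moreover have "convolve g f' = (\<lambda>x. \<integral>y. g (x - y) *\<^sub>R f' y \<partial>lborel)"
    using convolve_borel[OF f'] by auto
  ultimately show ?thesis unfolding convolve_cong_AE[OF f ae] by simp
qed

lemma convolve_measurable_lebesgue:
  "f \<in> borel_measurable lebesgue \<Longrightarrow> convolve g f \<in> borel_measurable lebesgue"
  for f :: "'a \<Rightarrow> 'b::euclidean_space"
  using convolve_measurable by (intro measurable_completion) simp

text \<open>Split the kernel as a product of two square roots and apply Cauchy-Schwarz in y: one
  factor integrates to the mass, the other is the convolution of the kernel with F^2, whose integral
  over x gives the second power of the mass by Fubini.\<close>

lemma young_L2_nn:
  fixes F :: "'a \<Rightarrow> real"
  assumes [measurable]: "F \<in> borel_measurable borel" and F0: "\<And>y. F y \<ge> 0"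
  shows "(\<integral>\<^sup>+x. (\<integral>\<^sup>+y. ennreal (g (x - y) * F y) \<partial>lborel)\<^sup>2 \<partial>lborel)
    \<le> ennreal (mass\<^sup>2) * (\<integral>\<^sup>+y. ennreal ((F y)\<^sup>2) \<partial>lborel)"
proof -
  have 1: "(\<integral>\<^sup>+y. ennreal (g (x - y) * F y) \<partial>lborel)\<^sup>2 \<le> ennreal mass * (\<integral>\<^sup>+y. ennreal (g (x - y) * (F y)\<^sup>2) \<partial>lborel)" for x
  proof -
    have "(\<integral>\<^sup>+y. ennreal (g (x - y) * F y) \<partial>lborel) = (\<integral>\<^sup>+y. ennreal (sqrt (g (x - y))) * ennreal (sqrt (g (x - y)) * F y) \<partial>lborel)"
      using kernel_nonneg F0 by (intro nn_integral_cong) (simp add: mult.assoc[symmetric] flip: ennreal_mult)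
    then have "(\<integral>\<^sup>+y. ennreal (g (x - y) * F y) \<partial>lborel)\<^sup>2
      \<le> (\<integral>\<^sup>+y. (ennreal (sqrt (g (x - y))))\<^sup>2 \<partial>lborel) * (\<integral>\<^sup>+y. (ennreal (sqrt (g (x - y)) * F y))\<^sup>2 \<partial>lborel)"
      using Cauchy_Schwarz_nn_integral[of "\<lambda>y. ennreal (sqrt (g (x - y)))" lborel "\<lambda>y. ennreal (sqrt (g (x - y)) * F y)"]
      by simp
    also have "(\<integral>\<^sup>+y. (ennreal (sqrt (g (x - y))))\<^sup>2 \<partial>lborel) = (\<integral>\<^sup>+y. ennreal (g (x - y)) \<partial>lborel)"
      using kernel_nonneg by (intro nn_integral_cong) (simp add: ennreal_power)
    also have "\<dots> = ennreal mass"
      unfolding mass_nn[symmetric] by (rule lborel_nn_integral_shift(3)[of "\<lambda>y. ennreal (g y)"]) simp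
    also have "(\<integral>\<^sup>+y. (ennreal (sqrt (g (x - y)) * F y))\<^sup>2 \<partial>lborel) = (\<integral>\<^sup>+y. ennreal (g (x - y) * (F y)\<^sup>2) \<partial>lborel)"
      using kernel_nonneg F0 by (intro nn_integral_cong) (simp add: ennreal_power power_mult_distrib)
    finally show ?thesis .
  qed
  have "(\<integral>\<^sup>+x. (\<integral>\<^sup>+y. ennreal (g (x - y) * F y) \<partial>lborel)\<^sup>2 \<partial>lborel) \<le>
    (\<integral>\<^sup>+x. ennreal mass * (\<integral>\<^sup>+y. ennreal (g (x - y) * (F y)\<^sup>2) \<partial>lborel) \<partial>lborel)"
    by (intro nn_integral_mono 1)
  also have "\<dots> = ennreal mass * (\<integral>\<^sup>+x. \<integral>\<^sup>+y. ennreal (g (x - y) * (F y)\<^sup>2) \<partial>lborel \<partial>lborel)"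
    by (rule nn_integral_cmult) simp
  also have "(\<integral>\<^sup>+x. \<integral>\<^sup>+y. ennreal (g (x - y) * (F y)\<^sup>2) \<partial>lborel \<partial>lborel)
    = (\<integral>\<^sup>+y. \<integral>\<^sup>+x. ennreal (g (x - y) * (F y)\<^sup>2) \<partial>lborel \<partial>lborel)"
    by (rule lborel_pair.Fubini'[symmetric]) simp
  also have "\<dots> = (\<integral>\<^sup>+y. ennreal mass * ennreal ((F y)\<^sup>2) \<partial>lborel)"
  proof (rule nn_integral_cong)
    fix y :: 'a
    have "(\<integral>\<^sup>+x. ennreal (g (x - y) * (F y)\<^sup>2) \<partial>lborel) = (\<integral>\<^sup>+x. ennreal (g (x - y)) \<partial>lborel) * ennreal ((F y)\<^sup>2)"
      using kernel_nonneg by (subst nn_integral_multc[symmetric]) (auto simp: ennreal_mult)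
    also have "(\<integral>\<^sup>+x. ennreal (g (x - y)) \<partial>lborel) = ennreal mass"
      unfolding mass_nn[symmetric] by (rule lborel_nn_integral_shift(2)[of "\<lambda>y. ennreal (g y)"]) simp
    finally show "(\<integral>\<^sup>+x. ennreal (g (x - y) * (F y)\<^sup>2) \<partial>lborel) = ennreal mass * ennreal ((F y)\<^sup>2)" .
  qed
  also have "\<dots> = ennreal mass * (\<integral>\<^sup>+y. ennreal ((F y)\<^sup>2) \<partial>lborel)"
    by (rule nn_integral_cmult) simp
  finally show ?thesis
    using mass_nonneg by (simp add: power2_eq_square ennreal_mult mult.assoc)
qed

lemma convolve_AE_integrable:
  fixes f :: "'a \<Rightarrow> 'b::euclidean_space"
  assumes f: "f \<in> Lp_space 2"
  shows "AE x in lebesgue. integrable lebesgue (\<lambda>y. g (x - y) *\<^sub>R f y)"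
    and "sq_norm (convolve g f) \<le> ennreal (mass\<^sup>2) * sq_norm f"
proof -
  have fm: "f \<in> borel_measurable lebesgue" and f2: "sq_norm f < \<infinity>" using f by (auto simp: Lp_space_2_iff)
  obtain f' where f' [measurable]: "f' \<in> borel_measurable borel" and ae: "AE x in lebesgue. f x = f' x"
    using borel_rep_euclidean[OF fm] .
  have ffm: "f' \<in> borel_measurable lebesgue" using f' by (intro measurable_completion) simp
  have f'2: "sq_norm f' = sq_norm f" using sq_norm_cong_AE'[OF ae] by simp
  let ?I = "\<lambda>x. \<integral>\<^sup>+y. ennreal (g (x - y) * norm (f' y)) \<partial>lborel"
  have Im [measurable]: "?I \<in> borel_measurable borel"
    by (rule lborel.borel_measurable_nn_integral) simp
  have I: "(\<integral>\<^sup>+x. (?I x)\<^sup>2 \<partial>lborel) \<le> ennreal (mass\<^sup>2) * sq_norm f"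
    using young_L2_nn[of "\<lambda>y. norm (f' y)"] unfolding f'2[symmetric] sq_norm_lborel[OF f'] by simp
  also have "\<dots> < \<infinity>" using f2 by (simp add: ennreal_mult_less_top)
  finally have "AE x in lborel. (?I x)\<^sup>2 \<noteq> \<infinity>" by (intro nn_integral_PInf_AE) auto
  then have "AE x in lebesgue. ?I x < \<infinity>"
    by (intro AE_completion) (auto elim!: eventually_mono simp: less_top power2_eq_square ennreal_mult_eq_top_iff)
  then show "AE x in lebesgue. integrable lebesgue (\<lambda>y. g (x - y) *\<^sub>R f y)"
  proof eventually_elim
    case (elim x)
    have "integrable lborel (\<lambda>y. g (x - y) *\<^sub>R f' y)"
      using elim kernel_nonneg by (intro integrableI_bounded) simp_all
    then have "integrable lebesgue (\<lambda>y. g (x - y) *\<^sub>R f' y)"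
      by (subst integrable_completion) simp_all
    moreover have "integrable lebesgue (\<lambda>y. g (x - y) *\<^sub>R f y) = integrable lebesgue (\<lambda>y. g (x - y) *\<^sub>R f' y)"
      using ae fm ffm by (intro integrable_cong_AE convolve_integrand_measurable) (auto elim!: eventually_mono)
    ultimately show ?case by simp
  qed
  have le: "ennreal (norm (convolve g f x)) \<le> ?I x" for x
  proof -
    have "ennreal (norm (convolve g f x)) \<le> (\<integral>\<^sup>+y. ennreal (norm (g (x - y) *\<^sub>R f' y)) \<partial>lborel)"
      unfolding convolve_cong_AE[OF fm ae] convolve_borel[OF f'] 
    proof (cases "integrable lborel (\<lambda>y. g (x - y) *\<^sub>R f' y)")
      case True
      then show "ennreal (norm (\<integral>y. g (x - y) *\<^sub>R f' y \<partial>lborel)) \<le> (\<integral>\<^sup>+y. ennreal (norm (g (x - y) *\<^sub>R f' y)) \<partial>lborel)"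
        by (rule integral_norm_bound_ennreal)
    qed (simp add: not_integrable_integral_eq)
    then show ?thesis using kernel_nonneg by simp
  qed
  have "sq_norm (convolve g f) = (\<integral>\<^sup>+x. ennreal ((norm (convolve g f x))\<^sup>2) \<partial>lborel)"
    by (rule sq_norm_lborel[OF convolve_measurable[OF fm]])
  also have "\<dots> \<le> (\<integral>\<^sup>+x. (?I x)\<^sup>2 \<partial>lborel)"
    using le by (intro nn_integral_mono) (simp add: power_mono flip: ennreal_power)
  also note I
  finally show "sq_norm (convolve g f) \<le> ennreal (mass\<^sup>2) * sq_norm f" .
qed

lemma convolve_Lp2: "f \<in> Lp_space 2 \<Longrightarrow> convolve g f \<in> Lp_space 2"
  for f :: "'a \<Rightarrow> 'b::euclidean_space"
  using convolve_AE_integrable(2)[of f] convolve_measurable_lebesgue[of f]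
  by (auto simp: Lp_space_2_iff ennreal_mult_less_top intro: le_less_trans)

lemma convolve_diff_AE:
  fixes f f' :: "'a \<Rightarrow> 'b::euclidean_space"
  assumes "f \<in> Lp_space 2" "f' \<in> Lp_space 2"
  shows "AE x in lebesgue. convolve g (\<lambda>y. f y - f' y) x = convolve g f x - convolve g f' x"
  using convolve_AE_integrable(1)[OF assms(1)] convolve_AE_integrable(1)[OF assms(2)]
  by eventually_elim (simp add: convolve_def scaleR_diff_right)

lemma convolve_minus: "convolve g (\<lambda>y. - f y) x = - convolve g f x"
  by (simp add: convolve_def)

lemma convolve_mono_AE:
  fixes f f' :: "'a \<Rightarrow> real"
  assumes "f \<in> Lp_space 2" "f' \<in> Lp_space 2" and le: "AE x in lebesgue. f x \<le> f' x"
  shows "AE x in lebesgue. convolve g f x \<le> convolve g f' x"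
  using convolve_AE_integrable(1)[OF assms(1)] convolve_AE_integrable(1)[OF assms(2)]
proof eventually_elim
  case (elim x)
  show ?case unfolding convolve_def
    using elim le kernel_nonneg
    by (intro integral_mono_AE) (auto elim!: eventually_mono intro!: mult_left_mono)
qed

lemma convolve_dominated:
  fixes f :: "'a \<Rightarrow> real"
  assumes fm: "\<And>n. F n \<in> borel_measurable lebesgue" "f \<in> borel_measurable lebesgue" and W: "W \<in> Lp_space 2"
    and le: "\<And>n. AE x in lebesgue. \<bar>F n x\<bar> \<le> W x" and lim: "AE x in lebesgue. (\<lambda>n. F n x) \<longlonglongrightarrow> f x"
  shows "AE x in lebesgue. (\<lambda>n. convolve g (F n) x) \<longlonglongrightarrow> convolve g f x"
  using convolve_AE_integrable(1)[OF W]
proof eventually_elim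
  case (elim x)
  show ?case unfolding convolve_def
  proof (rule integral_dominated_convergence[OF _ _ elim])
    show "AE y in lebesgue. (\<lambda>n. g (x - y) *\<^sub>R F n y) \<longlonglongrightarrow> g (x - y) *\<^sub>R f y"
      using lim by eventually_elim (intro tendsto_intros)
    show "AE y in lebesgue. norm (g (x - y) *\<^sub>R F n y) \<le> g (x - y) *\<^sub>R W y" for n
      using le[of n] by eventually_elim (simp add: abs_mult kernel_nonneg mult_left_mono)
  qed (intro convolve_integrand_measurable fm)+
qed

lemma convolve_of_real: "convolve g (\<lambda>x. complex_of_real (f x)) x = complex_of_real (convolve g f x)"
  unfolding convolve_def by (simp add: scaleR_conv_of_real flip: of_real_mult)

text \<open>Points of equal norm are exchanged by a reflection T. Substituting T in the integral
  leaves the measure, the radial kernel and f invariant, so symmetry holds at every point and not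
  merely almost everywhere.\<close>

lemma convolve_spherically_symmetric:
  fixes f :: "'a \<Rightarrow> 'b::euclidean_space"
  assumes g: "\<And>x y. norm x = norm y \<Longrightarrow> g x = g y" and fm: "f \<in> borel_measurable lebesgue"
    and f: "spherically_symmetric f"
  shows "spherically_symmetric (convolve g f)"
  unfolding spherically_symmetric_def
proof (intro allI impI)
  fix x x' :: 'a assume "norm x = norm x'"
  then obtain T where T: "linear T" "\<And>z. T (T z) = z" "\<And>z. norm (T z) = norm z" "T x = x'"
    using reflection_exists by blast
  have [measurable]: "T \<in> borel_measurable borel"
    by (intro borel_measurable_continuous_onI linear_continuous_on) (simp add: T linear_conv_bounded_linear[symmetric])
  note D = lborel_distr_isometry[OF T(1-3)]
  obtain f' where f' [measurable]: "f' \<in> borel_measurable borel" and ae: "AE x in lebesgue. f x = f' x"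
    using borel_rep_euclidean[OF fm] .
  \<comment> \<open>The Borel representative f' need not be radial. It agrees with f off a null set,
    T preserves null sets, and so f' is invariant under T almost everywhere, which is enough under
    the integral.\<close>
  have "AE x in distr lborel borel T. f x = f' x" unfolding D using ae by (simp add: AE_completion_iff)
  then have a1: "AE y in lborel. f (T y) = f' (T y)" by (rule AE_distrD[rotated]) simp
  have a2: "AE y in lborel. f y = f' y" using ae by (simp add: AE_completion_iff)
  have fT: "f (T y) = f y" for y using f T(3)[of y] unfolding spherically_symmetric_def by blast
  have ae': "AE y in lborel. f' (T y) = f' y"
    using a1 a2 by eventually_elim (simp add: fT)
  have "convolve g f x' = (\<integral>y. g (x' - y) *\<^sub>R f' y \<partial>distr lborel borel T)"
    unfolding D convolve_cong_AE[OF fm ae] convolve_borel[OF f'] ..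
  also have "\<dots> = (\<integral>y. g (x' - T y) *\<^sub>R f' (T y) \<partial>lborel)"
    by (rule integral_distr) simp_all
  also have "\<dots> = (\<integral>y. g (x - y) *\<^sub>R f' y \<partial>lborel)"
  proof (rule integral_cong_AE)
    have gT: "g (x' - T y) = g (x - y)" for y
      using T(3)[of "x - y"] by (intro g) (simp add: linear_diff[OF T(1)] T(4))
    show "AE y in lborel. g (x' - T y) *\<^sub>R f' (T y) = g (x - y) *\<^sub>R f' y"
      using ae' by eventually_elim (simp add: gT)
  qed simp_all
  also have "\<dots> = convolve g f x"
    unfolding convolve_cong_AE[OF fm ae] convolve_borel[OF f'] ..
  finally show "convolve g f x = convolve g f x'" ..
qed

section \<open>Convolution as multiplication by the symbol\<close>

abbreviation symbol :: "'a \<Rightarrow> complex" where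
  "symbol \<equiv> fourier_int (\<lambda>x. complex_of_real (g x))"

lemma symbol_bound: "norm (symbol \<xi>) \<le> mass"
  using fourier_int_bound[of "\<lambda>x. complex_of_real (g x)" \<xi>] kernel_nonneg by (simp add: mass_def)

lemma convolve_L1:
  fixes f :: "'a \<Rightarrow> complex"
  assumes f: "integrable lborel f"
  shows "integrable lborel (convolve g f)" "fourier_int (convolve g f) \<xi> = symbol \<xi> * fourier_int f \<xi>"
proof -
  have fm [measurable]: "f \<in> borel_measurable borel" using f by (auto dest: borel_measurable_integrable)
  let ?Q = "lborel \<Otimes>\<^sub>M (lborel :: 'a measure)"
  define k where "k p = g (fst p - snd p) *\<^sub>R f (snd p)" for p
  have km [measurable]: "k \<in> borel_measurable ?Q" unfolding k_def by simp
  have ki: "integrable ?Q k"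
  proof (rule integrableI_bounded[OF km])
    have "(\<integral>\<^sup>+p. ennreal (norm (k p)) \<partial>?Q) = (\<integral>\<^sup>+y. \<integral>\<^sup>+x. ennreal (norm (k (x, y))) \<partial>lborel \<partial>lborel)"
      by (rule lborel_pair.nn_integral_snd[symmetric]) simp
    also have "\<dots> = (\<integral>\<^sup>+y. ennreal mass * ennreal (norm (f y)) \<partial>lborel)"
    proof (rule nn_integral_cong)
      fix y :: 'a
      have "(\<integral>\<^sup>+x. ennreal (norm (k (x, y))) \<partial>lborel) = (\<integral>\<^sup>+x. ennreal (g (x - y)) * ennreal (norm (f y)) \<partial>lborel)"
        using kernel_nonneg by (simp add: k_def ennreal_mult)
      also have "\<dots> = (\<integral>\<^sup>+x. ennreal (g (x - y)) \<partial>lborel) * ennreal (norm (f y))"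
        by (rule nn_integral_multc) simp
      also have "(\<integral>\<^sup>+x. ennreal (g (x - y)) \<partial>lborel) = ennreal mass"
        unfolding mass_nn[symmetric] by (rule lborel_nn_integral_shift(2)[of "\<lambda>y. ennreal (g y)"]) simp
      finally show "(\<integral>\<^sup>+x. ennreal (norm (k (x, y))) \<partial>lborel) = ennreal mass * ennreal (norm (f y))" .
    qed
    also have "\<dots> = ennreal mass * (\<integral>\<^sup>+y. ennreal (norm (f y)) \<partial>lborel)"
      by (rule nn_integral_cmult) simp
    also have "\<dots> < \<infinity>" using f by (auto simp: integrable_iff_bounded ennreal_mult_less_top)
    finally show "(\<integral>\<^sup>+p. ennreal (norm (k p)) \<partial>?Q) < \<infinity>" .
  qed
  have h: "convolve g f x = (\<integral>y. k (x, y) \<partial>lborel)" for x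
    unfolding convolve_borel[OF fm] by (simp add: k_def)
  show "integrable lborel (convolve g f)"
    using lborel_pair.integrable_fst'[OF ki] by (simp add: h [abs_def])
  let ?e = "\<lambda>x. exp (- \<i> * complex_of_real (x \<bullet> \<xi>))"
  define l where "l p = ?e (fst p) * k p" for p
  have li: "integrable ?Q (\<lambda>(x, y). l (x, y))"
    by (rule Bochner_Integration.integrable_bound[OF ki]) (auto simp: l_def norm_mult)
  have "fourier_int (convolve g f) \<xi> = (\<integral>x. \<integral>y. l (x, y) \<partial>lborel \<partial>lborel)"
    unfolding fourier_int_def h by (simp add: l_def)
  also have "\<dots> = (\<integral>y. \<integral>x. l (x, y) \<partial>lborel \<partial>lborel)"
    by (rule lborel_pair.Fubini_integral[OF li, symmetric])
  also have "\<dots> = (\<integral>y. symbol \<xi> * (?e y * f y) \<partial>lborel)"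
  proof (rule Bochner_Integration.integral_cong)
    fix y :: 'a
    have "(\<integral>x. l (x, y) \<partial>lborel) = (\<integral>x. (?e (x - y) * complex_of_real (g (x - y))) * (?e y * f y) \<partial>lborel)"
      by (intro Bochner_Integration.integral_cong)
        (auto simp: l_def k_def scaleR_conv_of_real inner_diff_left algebra_simps simp flip: exp_add)
    also have "\<dots> = (\<integral>x. ?e (x - y) * complex_of_real (g (x - y)) \<partial>lborel) * (?e y * f y)"
      by (rule integral_mult_left_zero)
    also have "(\<integral>x. ?e (x - y) * complex_of_real (g (x - y)) \<partial>lborel) = symbol \<xi>"
      unfolding fourier_int_def by (rule lborel_integral_shift(2)[of "\<lambda>x. ?e x * complex_of_real (g x)"]) simp
    finally show "(\<integral>x. l (x, y) \<partial>lborel) = symbol \<xi> * (?e y * f y)" .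
  qed simp
  also have "\<dots> = symbol \<xi> * fourier_int f \<xi>"
    unfolding fourier_int_def[of f] by (rule integral_mult_right_zero)
  finally show "fourier_int (convolve g f) \<xi> = symbol \<xi> * fourier_int f \<xi>" .
qed

text \<open>For truncations of f, which lie in L^1 and L^2, the formula is Fubini. Both sides are
  bounded in f on L^2 with constant \<open>mass\<close>, the left by Young's inequality and the
  right by the sup bound on the symbol, so closedness of the graph carries the formula to the
  limit.\<close>

lemma L2_fourier_convolve:
  fixes f :: "'a \<Rightarrow> complex"
  assumes fv: "L2_fourier f v"
  shows "L2_fourier (convolve g f) (\<lambda>\<xi>. symbol \<xi> * v \<xi>)"
proof -
  note d = L2_fourierD[OF fv]
  obtain f' where f': "f' \<in> borel_measurable borel" and ae: "AE x in lebesgue. f x = f' x"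
    using borel_rep_euclidean[OF d(3)] .
  have f'2: "sq_norm f' < \<infinity>" using d(5) sq_norm_cong_AE'[OF ae] by simp
  have f'v: "L2_fourier f' v" using L2_fourier_cong_AE[OF fv ae] by simp
  note d' = L2_fourierD[OF f'v]
  let ?f = "\<lambda>n. cut (real n) f'"
  have ci: "integrable lborel (?f n)" for n by (rule cut_integrable[OF f' f'2])
  have c2: "sq_norm (?f n) < \<infinity>" for n
    using sq_norm_mono_AE[of "?f n" f'] f'2 norm_cut_le[of n f'] by (auto intro: le_less_trans)
  have cv: "L2_fourier (?f n) (unitary_fourier_int (?f n))" for n by (rule L2_fourier_L1[OF ci c2])
  note dc = L2_fourierD[OF cv]
  have lim: "(\<lambda>n. sq_norm (\<lambda>x. ?f n x - f' x)) \<longlonglongrightarrow> 0"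
    using filterlim_compose[OF cut_tendsto[OF d'(1)] filterlim_real_sequentially] .
  have sm: "symbol \<in> borel_measurable lebesgue"
    by (intro measurable_completion) simp
  have "L2_fourier (convolve g f') (\<lambda>\<xi>. symbol \<xi> * v \<xi>)"
  proof (rule L2_fourier_closed)
    show "L2_fourier (convolve g (?f n)) (\<lambda>\<xi>. symbol \<xi> * unitary_fourier_int (?f n) \<xi>)" for n
    proof -
      have "L2_fourier (convolve g (?f n)) (unitary_fourier_int (convolve g (?f n)))"
        using convolve_L1(1)[OF ci] L2_fourierD(1)[OF cv] convolve_Lp2[of "?f n"]
        by (intro L2_fourier_L1) (auto simp: Lp_space_2_iff)
      moreover have "unitary_fourier_int (convolve g (?f n)) = (\<lambda>\<xi>. symbol \<xi> * unitary_fourier_int (?f n) \<xi>)"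
        unfolding unitary_fourier_int_def convolve_L1(2)[OF ci] by (auto simp: algebra_simps)
      ultimately show ?thesis by simp
    qed
    show "convolve g f' \<in> Lp_space 2" by (rule convolve_Lp2[OF d'(1)])
    show "(\<lambda>\<xi>. symbol \<xi> * v \<xi>) \<in> borel_measurable lebesgue"
      using sm d(4) by (intro borel_measurable_times)
    show "(\<lambda>n. sq_norm (\<lambda>x. convolve g (?f n) x - convolve g f' x)) \<longlonglongrightarrow> 0"
    proof (rule tendsto_0_ennreal_le[OF lim, of _ "ennreal (mass\<^sup>2)"])
      fix n
      have "sq_norm (\<lambda>x. convolve g (?f n) x - convolve g f' x) = sq_norm (convolve g (\<lambda>x. ?f n x - f' x))"
        by (rule sq_norm_cong_AE'[OF convolve_diff_AE[OF dc(1) d'(1)], symmetric])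
      also have "\<dots> \<le> ennreal (mass\<^sup>2) * sq_norm (\<lambda>x. ?f n x - f' x)"
        by (intro convolve_AE_integrable Lp2_diff dc d')
      finally show "sq_norm (\<lambda>x. convolve g (?f n) x - convolve g f' x) \<le> ennreal (mass\<^sup>2) * sq_norm (\<lambda>x. ?f n x - f' x)" .
    qed simp
    show "(\<lambda>n. sq_norm (\<lambda>\<xi>. symbol \<xi> * unitary_fourier_int (?f n) \<xi> - symbol \<xi> * v \<xi>)) \<longlonglongrightarrow> 0"
    proof (rule tendsto_0_ennreal_le[OF lim, of _ "ennreal (mass\<^sup>2)"])
      fix n
      have m: "(\<lambda>\<xi>. unitary_fourier_int (?f n) \<xi> - v \<xi>) \<in> borel_measurable lebesgue"
        using dc d' by (intro borel_measurable_diff)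
      have "sq_norm (\<lambda>\<xi>. symbol \<xi> * unitary_fourier_int (?f n) \<xi> - symbol \<xi> * v \<xi>)
        \<le> sq_norm (\<lambda>\<xi>. complex_of_real mass * (unitary_fourier_int (?f n) \<xi> - v \<xi>))"
        by (intro sq_norm_mono_AE AE_I2)
          (auto simp: norm_mult mass_nonneg symbol_bound mult_right_mono simp flip: right_diff_distrib)
      also have "\<dots> = ennreal (mass\<^sup>2) * sq_norm (\<lambda>\<xi>. unitary_fourier_int (?f n) \<xi> - v \<xi>)"
        by (subst sq_norm_scale[OF m]) (simp add: mass_nonneg)
      also have "sq_norm (\<lambda>\<xi>. unitary_fourier_int (?f n) \<xi> - v \<xi>) = sq_norm (\<lambda>x. ?f n x - f' x)"
        by (rule L2_fourier_isometry[OF L2_fourier_diff[OF cv f'v]])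
      finally show "sq_norm (\<lambda>\<xi>. symbol \<xi> * unitary_fourier_int (?f n) \<xi> - symbol \<xi> * v \<xi>)
         \<le> ennreal (mass\<^sup>2) * sq_norm (\<lambda>x. ?f n x - f' x)" .
    qed simp
  qed
  then show ?thesis unfolding convolve_cong_AE[OF d(3) ae] .
qed

end

section \<open>A Stieltjes representation\<close>

text \<open>The density is the jump of \<open>1 / (c + b s\<^sup>\<alpha>)\<close> across the negative half-line at \<open>s = - exp y\<close>,
  divided by \<open>2 \<pi> \<i>\<close>.\<close>

definition stieltjes_density :: "real \<Rightarrow> real \<Rightarrow> real \<Rightarrow> real \<Rightarrow> real" where
  "stieltjes_density \<alpha> b c y = b * exp (\<alpha> * y) * sin (\<alpha> * pi) /
     (pi * ((c + b * exp (\<alpha> * y) * cos (\<alpha> * pi))\<^sup>2 + (b * exp (\<alpha> * y) * sin (\<alpha> * pi))\<^sup>2))"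

lemma stieltjes_density_measurable [measurable]: "stieltjes_density \<alpha> b c \<in> borel_measurable borel"
  unfolding stieltjes_density_def [abs_def] by measurable

context
  fixes \<alpha> b c :: real
  assumes \<alpha>: "0 < \<alpha>" "\<alpha> < 1 / 2" and b: "b > 0" and c: "c > 0"
begin

text \<open>As \<alpha> < 1/2, the angle lies in the open first quadrant. The sine makes the density
  nonnegative; the cosine keeps the real part of the denominator away from zero on the boundary of
  the strip.\<close>

lemma stieltjes_trig: "sin (\<alpha> * pi) > 0" "cos (\<alpha> * pi) > 0"
proof -
  have "0 < \<alpha> * pi" "\<alpha> * pi < pi / 2" using \<alpha> by auto
  then show "sin (\<alpha> * pi) > 0" "cos (\<alpha> * pi) > 0"
    by (auto intro!: sin_gt_zero cos_gt_zero)
qed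

lemma stieltjes_den: "(c + b * exp (\<alpha> * y) * cos (\<alpha> * pi))\<^sup>2 + (b * exp (\<alpha> * y) * sin (\<alpha> * pi))\<^sup>2 > 0"
  using b c stieltjes_trig by (intro add_nonneg_pos) (auto intro!: zero_less_power mult_pos_pos)

lemma stieltjes_density_nonneg: "stieltjes_density \<alpha> b c y \<ge> 0"
  unfolding stieltjes_density_def using b stieltjes_trig stieltjes_den[of y]
  by (intro divide_nonneg_pos mult_pos_pos) (auto intro!: mult_nonneg_nonneg less_imp_le)

lemma stieltjes_density_continuous: "continuous_on A (stieltjes_density \<alpha> b c)"
  unfolding stieltjes_density_def [abs_def] using stieltjes_den pi_gt_zero
  by (intro continuous_intros) (metis less_irrefl mult_pos_pos)

text \<open>Cauchy's theorem for \<open>exp w / ((exp w - s) (c + b exp (\<alpha> w)))\<close> on rectangles of height \<open>2 \<pi>\<close>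
  around the real axis, rotated by a right angle (\<open>w = - \<i> z\<close>). As \<open>\<alpha> < 1 / 2\<close>, the second
  factor of the denominator has no zero there.\<close>

lemma stieltjes_interval_limit:
  assumes s: "s > 0"
  shows "(\<lambda>n. integral {- real (Suc n)..real (Suc n)} (\<lambda>y. exp y / (exp y + s) * stieltjes_density \<alpha> b c y))
    \<longlonglongrightarrow> 1 / (c + b * s powr \<alpha>)"
proof -
  \<comment> \<open>With z = x + i y one has w = y - i x, so the horizontal edges of the rectangle
    in w become the vertical lines Re z = \<pi> and Re z = - \<pi>, parametrised directly by
    y.\<close>
  define E where "E z = exp (- \<i> * z)" for z
  define D where "D z = complex_of_real c + complex_of_real b * exp (- \<i> * complex_of_real \<alpha> * z)" for z
  define K where "K z = (E z / D z) / (E z - complex_of_real s)" for z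
  \<comment> \<open>The first bound keeps |\<alpha> Re z| below \<pi> / 2, so \<open>D\<close> has
    no zero; the second is below 2 \<pi>, so the periodic function \<open>E\<close> attains s at one
    point of the strip. Both exceed \<pi>, which leaves room for the closed rectangles.\<close>
  define L where "L = min (pi / (2 * \<alpha>)) (3 * pi / 2)"
  have L: "L > pi" using \<alpha> pi_gt_zero unfolding L_def by (simp add: field_simps)
  define S where "S = {z. - L < Re z} \<inter> {z. Re z < L}"
  have S: "open S" "connected S"
  proof -
    show "open S" unfolding S_def by (intro open_Int open_halfspace_Re_gt open_halfspace_Re_lt)
    have "convex S" unfolding S_def by (intro convex_Int convex_halfspace_Re_gt convex_halfspace_Re_lt)
    then show "connected S" by (rule convex_connected)
  qed
  have Dre: "Re (D z) = c + b * exp (\<alpha> * Im z) * cos (\<alpha> * Re z)" for z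
    by (simp add: D_def Re_exp mult.assoc)
  have Eabs: "norm (E z) = exp (Im z)" for z by (simp add: E_def norm_exp_eq_Re)
  have D0: "D z \<noteq> 0" if "z \<in> S" for z
  proof -
    have "\<bar>Re z\<bar> < pi / (2 * \<alpha>)" using that by (auto simp: S_def L_def)
    then have "\<bar>\<alpha> * Re z\<bar> < pi / 2" using \<alpha> by (simp add: abs_mult field_simps)
    then have "cos (\<alpha> * Re z) > 0" by (intro cos_gt_zero_pi) auto
    then have "Re (D z) > 0" unfolding Dre using b c by (intro add_pos_pos mult_pos_pos) auto
    then show ?thesis by auto
  qed
  define z0 where "z0 = \<i> * complex_of_real (ln s)"
  have Ez0: "E z0 = complex_of_real s" using s by (simp add: E_def z0_def exp_of_real)
  have pole: "E z = complex_of_real s \<longleftrightarrow> z = z0" if "z \<in> S" for z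
  proof
    assume "E z = complex_of_real s"
    then have "exp (- \<i> * z) = exp (- \<i> * z0)" using Ez0 by (simp add: E_def)
    then obtain n :: int where n: "- \<i> * z = - \<i> * z0 + (of_int (2 * n) * pi) * \<i>"
      by (auto simp: exp_eq)
    have "Re z = - 2 * of_int n * pi"
      using arg_cong[OF n, of Im] by (simp add: z0_def)
    moreover have "\<bar>Re z\<bar> < 2 * pi" using that pi_gt_zero by (auto simp: S_def L_def)
    ultimately have "n = 0" by (simp add: abs_mult)
    then show "z = z0" using n by simp
  qed (simp add: Ez0)
  have hol: "(\<lambda>z. E z / D z) holomorphic_on S" "(\<lambda>z. E z - complex_of_real s) holomorphic_on S"
    unfolding E_def D_def using D0[unfolded D_def] by (auto intro!: holomorphic_intros)
  have L0: "L > 0" using L pi_gt_zero by (rule less_trans[rotated])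
  have Lb: "- L < pi" "- pi < L" "- L < - pi" using L L0 pi_gt_zero by linarith+
  have z0S: "z0 \<in> S" using L0 by (simp add: z0_def S_def)
  have Khol: "K holomorphic_on S - {z0}"
    unfolding K_def using pole by (intro holomorphic_on_divide holomorphic_on_subset[OF hol(1)] holomorphic_on_subset[OF hol(2)]) auto
  have Dz0: "D z0 = complex_of_real (c + b * s powr \<alpha>)"
  proof -
    have "exp (- \<i> * complex_of_real \<alpha> * z0) = complex_of_real (exp (\<alpha> * ln s))"
    proof -
      have "- \<i> * complex_of_real \<alpha> * z0 = complex_of_real (\<alpha> * ln s)"
        by (simp add: z0_def complex_eq_iff)
      then show ?thesis by (simp only: exp_of_real)
    qed
    then show ?thesis using s by (simp add: D_def powr_def)
  qed
  \<comment> \<open>At the simple zero the derivative of \<open>E z - s\<close> is - i E(z0), so the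
    factor E(z0) cancels and only i / D(z0) is left. That cancellation is why exp w stands in the
    numerator.\<close>
  have res: "residue K z0 = \<i> / complex_of_real (c + b * s powr \<alpha>)"
  proof -
    have der: "((\<lambda>z. E z - complex_of_real s) has_field_derivative (- \<i> * E z0)) (at z0)"
      unfolding E_def by (auto intro!: derivative_eq_intros)
    have "residue K z0 = (E z0 / D z0) / (- \<i> * E z0)"
      unfolding K_def using s
      by (intro residue_simple_pole_deriv[OF hol S z0S der]) (auto simp: Ez0 D0[OF z0S])
    moreover have "w / d / (- \<i> * w) = \<i> / d" if "w \<noteq> 0" for w d :: complex
    proof -
      have "w / d / (- \<i> * w) = (w / (- \<i> * w)) / d" by (simp only: divide_divide_eq_left mult.commute)
      also have "w / (- \<i> * w) = \<i>" using that by (simp add: field_simps)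
      finally show ?thesis .
    qed
    moreover have "E z0 \<noteq> 0" using s by (simp add: Ez0)
    ultimately show ?thesis unfolding Dz0 by metis
  qed
  define k where "k y = exp y / (exp y + s) * stieltjes_density \<alpha> b c y" for y
  have kc: "continuous_on A k" for A
    unfolding k_def using s by (intro continuous_intros stieltjes_density_continuous) (auto simp: add_pos_pos less_imp_neq[symmetric])
  \<comment> \<open>On the two lines \<open>E\<close> has the same value - exp y, while
    \<open>D\<close> takes conjugate values A - i B and A + i B. Only the imaginary part of 1 / D
    survives, and 2 B / (A^2 + B^2) is 2 \<pi> times the density.\<close>
  have jump: "K (Complex pi y) - K (Complex (- pi) y) = 2 * pi * \<i> * complex_of_real (k y)" for y
  proof -
    define A where "A = c + b * exp (\<alpha> * y) * cos (\<alpha> * pi)"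
    define B where "B = b * exp (\<alpha> * y) * sin (\<alpha> * pi)"
    have E1: "E (Complex pi y) = - complex_of_real (exp y)" "E (Complex (- pi) y) = - complex_of_real (exp y)"
      by (auto simp: E_def complex_eq_iff Re_exp Im_exp)
    have D1: "D (Complex pi y) = Complex A (- B)" "D (Complex (- pi) y) = Complex A B"
      by (auto simp: D_def A_def B_def complex_eq_iff Re_exp Im_exp mult.assoc)
    have AB: "A\<^sup>2 + B\<^sup>2 > 0" unfolding A_def B_def by (rule stieltjes_den)
    have e: "- complex_of_real (exp y) / w / (- complex_of_real (exp y) - complex_of_real s) = complex_of_real (exp y / (exp y + s)) * (1 / w)" for w
    proof -
      have "- complex_of_real (exp y) - complex_of_real s = - complex_of_real (exp y + s)" by simp
      moreover have "- a / w / (- p) = (a / p) * (1 / w)" for a p :: complex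
        by (simp add: mult.commute)
      ultimately show ?thesis by (simp only: of_real_divide)
    qed
    have d: "1 / Complex A (- B) - 1 / Complex A B = complex_of_real (2 * B / (A\<^sup>2 + B\<^sup>2)) * \<i>"
    proof -
      have "2 * B * (A\<^sup>2 + B\<^sup>2) / (A\<^sup>2 + B\<^sup>2)\<^sup>2 = 2 * B / (A\<^sup>2 + B\<^sup>2)"
        using AB unfolding power2_eq_square[of "A\<^sup>2 + B\<^sup>2"] by simp
      then show ?thesis by (simp add: complex_eq_iff Re_divide Im_divide)
    qed
    have "K (Complex pi y) - K (Complex (- pi) y) = complex_of_real (exp y / (exp y + s)) * (1 / Complex A (- B) - 1 / Complex A B)"
      unfolding K_def E1 D1 e by (simp only: right_diff_distrib)
    also have "\<dots> = complex_of_real (exp y / (exp y + s) * (2 * B / (A\<^sup>2 + B\<^sup>2))) * \<i>"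
      unfolding d by simp
    also have "exp y / (exp y + s) * (2 * B / (A\<^sup>2 + B\<^sup>2)) = 2 * pi * k y"
      unfolding k_def stieltjes_density_def A_def B_def by simp
    finally show ?thesis by simp
  qed
  define N where "N n = real (Suc n)" for n
  define top where "top n = contour_integral (linepath (Complex pi (N n)) (Complex (- pi) (N n))) K" for n
  define bot where "bot n = contour_integral (linepath (Complex (- pi) (- N n)) (Complex pi (- N n))) K" for n
  obtain n0 where n0: "\<And>n. n \<ge> n0 \<Longrightarrow> N n > \<bar>ln s\<bar>"
  proof -
    obtain m where "real m > \<bar>ln s\<bar>" using reals_Archimedean2 by blast
    then show ?thesis using that[of m] by (auto simp: N_def)
  qed
  \<comment> \<open>The vertical edges contribute i times 2 \<pi> i times the integral of k, and the
    residue contributes 2 \<pi> i times i / D(z0): both pick up the factor - 2 \<pi>. The condition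
    on n places the pole inside the rectangle.\<close>
  have contour: "2 * pi * (- integral {- N n..N n} k) + top n + bot n = - 2 * pi / (c + b * s powr \<alpha>)" if n: "n \<ge> n0" for n
  proof -
    have Nn: "N n > \<bar>ln s\<bar>" "N n > 0" using n0[OF n] by auto
    let ?a = "Complex (- pi) (- N n)" and ?b = "Complex pi (N n)"
    let ?a2 = "Complex pi (- N n)" and ?a4 = "Complex (- pi) (N n)"
    have box: "z0 \<in> box ?a ?b" using Nn pi_gt_zero by (auto simp: in_box_complex_iff z0_def)
    have sub: "path_image (rectpath ?a ?b) \<subseteq> S - {z0}"
    proof -
      have "path_image (rectpath ?a ?b) = cbox ?a ?b - box ?a ?b"
        using Nn by (intro path_image_rectpath_cbox_minus_box) auto
      moreover have "cbox ?a ?b \<subseteq> S" using L by (auto simp: S_def in_cbox_complex_iff)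
      ultimately show ?thesis using box by auto
    qed
    have cont: "continuous_on (path_image (rectpath ?a ?b)) K"
      using holomorphic_on_imp_continuous_on[OF Khol] sub by (rule continuous_on_subset)
    have pi: "path_image (rectpath ?a ?b) = closed_segment ?a ?a2 \<union> closed_segment ?a2 ?b \<union> closed_segment ?b ?a4 \<union> closed_segment ?a4 ?a"
      by (auto simp: rectpath_def Let_def path_image_join)
    have ci: "K contour_integrable_on linepath ?a ?a2" "K contour_integrable_on linepath ?a2 ?b"
      "K contour_integrable_on linepath ?b ?a4" "K contour_integrable_on linepath ?a4 ?a"
      by (intro contour_integrable_continuous_linepath continuous_on_subset[OF cont]; force simp: pi)+
    have "contour_integral (rectpath ?a ?b) K = complex_of_real (2 * pi) * \<i> * (\<Sum>p\<in>{z0}. winding_number (rectpath ?a ?b) p * residue K p)"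
    proof (rule Residue_theorem[OF S _ Khol])
      show "\<forall>z. z \<notin> S \<longrightarrow> winding_number (rectpath ?a ?b) z = 0"
        using Nn L by (auto intro!: winding_number_rectpath_outside simp: S_def in_cbox_complex_iff)
    qed (use sub in auto)
    also have "\<dots> = complex_of_real (2 * pi) * \<i> * (\<i> / complex_of_real (c + b * s powr \<alpha>))"
      using winding_number_rectpath[OF box] by (simp add: res)
    finally have R: "contour_integral (rectpath ?a ?b) K = - complex_of_real (2 * pi / (c + b * s powr \<alpha>))"
      by (simp add: field_simps)
    have J: "contour_integral (rectpath ?a ?b) K = bot n + contour_integral (linepath ?a2 ?b) K + top n + contour_integral (linepath ?a4 ?a) K"
      unfolding rectpath_def Let_def top_def bot_def using ci
      by (simp add: contour_integral_join contour_integrable_joinI valid_path_join add.assoc)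
    have V1: "contour_integral (linepath ?a2 ?b) K = \<i> * integral {- N n..N n} (\<lambda>y. K (Complex pi y))"
      by (rule contour_integral_linepath_same_Re) (use Nn in auto)
    have V2: "contour_integral (linepath ?a4 ?a) K = - (\<i> * integral {- N n..N n} (\<lambda>y. K (Complex (- pi) y)))"
    proof -
      have "contour_integral (linepath ?a4 ?a) K = - contour_integral (linepath ?a ?a4) K"
        by (intro contour_integral_reverse_linepath continuous_on_subset[OF cont]) (force simp: pi)
      also have "contour_integral (linepath ?a ?a4) K = \<i> * integral {- N n..N n} (\<lambda>y. K (Complex (- pi) y))"
        by (rule contour_integral_linepath_same_Re) (use Nn in auto)
      finally show ?thesis .
    qed
    have KC: "continuous_on {- N n..N n} (\<lambda>y. K (Complex x y))" if "x = pi \<or> x = - pi" for x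
    proof (rule continuous_on_compose2[OF holomorphic_on_imp_continuous_on[OF Khol]])
      show "continuous_on {- N n..N n} (\<lambda>y. Complex x y)"
        unfolding Complex_eq by (intro continuous_intros)
      show "Complex x ` {- N n..N n} \<subseteq> S - {z0}" using that L Lb by (auto simp: S_def z0_def complex_eq_iff)
    qed
    have "integral {- N n..N n} (\<lambda>y. K (Complex pi y)) - integral {- N n..N n} (\<lambda>y. K (Complex (- pi) y))
       = integral {- N n..N n} (\<lambda>y. K (Complex pi y) - K (Complex (- pi) y))"
      by (intro Henstock_Kurzweil_Integration.integral_diff[symmetric] integrable_continuous_interval KC) auto
    also have "\<dots> = 2 * pi * \<i> * integral {- N n..N n} (\<lambda>y. complex_of_real (k y))"
      unfolding jump by (simp add: Henstock_Kurzweil_Integration.integral_mult_right)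
    also have "integral {- N n..N n} (\<lambda>y. complex_of_real (k y)) = complex_of_real (integral {- N n..N n} k)"
      by (rule integral_unique, rule has_integral_of_real, rule integrable_integral, rule integrable_continuous_interval, rule kc)
    finally have V: "integral {- N n..N n} (\<lambda>y. K (Complex pi y)) - integral {- N n..N n} (\<lambda>y. K (Complex (- pi) y))
       = 2 * pi * \<i> * complex_of_real (integral {- N n..N n} k)" .
    have "contour_integral (rectpath ?a ?b) K = bot n + top n + \<i> * (integral {- N n..N n} (\<lambda>y. K (Complex pi y)) - integral {- N n..N n} (\<lambda>y. K (Complex (- pi) y)))"
      unfolding J V1 V2 by (simp add: algebra_simps)
    then show ?thesis unfolding V R by (simp add: algebra_simps)
  qed
  have seg: "Re z \<in> {- pi..pi}" "Im z = y" if "z \<in> closed_segment (Complex x y) (Complex x' y)" "x \<in> {- pi..pi}" "x' \<in> {- pi..pi}" for z x x' y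
  proof -
    have "z \<in> cbox (Complex (- pi) y) (Complex pi y)"
      using that closed_segment_subset[of "Complex x y" "cbox (Complex (- pi) y) (Complex pi y)" "Complex x' y"]
      by (auto simp: in_cbox_complex_iff)
    then show "Re z \<in> {- pi..pi}" "Im z = y" by (auto simp: in_cbox_complex_iff)
  qed
  have cosle: "cos (\<alpha> * x) \<ge> cos (\<alpha> * pi)" if "x \<in> {- pi..pi}" for x
  proof -
    have "cos (\<alpha> * pi) \<le> cos \<bar>\<alpha> * x\<bar>"
      using that \<alpha> pi_gt_zero by (intro cos_monotone_0_pi_le) (auto simp: abs_mult)
    then show ?thesis by simp
  qed
  have inS: "z \<in> S - {z0}" if "Re z \<in> {- pi..pi}" "Im z = y" "\<bar>y\<bar> > \<bar>ln s\<bar>" for z y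
    using that L Lb by (auto simp: S_def z0_def)
  have contK: "continuous_on T K" if "T \<subseteq> S - {z0}" for T
    using holomorphic_on_imp_continuous_on[OF Khol] that by (rule continuous_on_subset)
  \<comment> \<open>On the upper edge |E| = exp N compensates the first denominator, and the
    positive cosine bounds \<open>D\<close> below by a multiple of exp(\<alpha> N), so the bound
    decays like exp(- \<alpha> N).\<close>
  have topb: "norm (top n) \<le> exp (N n) / (exp (N n) - s) / (b * exp (\<alpha> * N n) * cos (\<alpha> * pi)) * (2 * pi)" if n: "n \<ge> n0" for n
  proof -
    have Nn: "N n > \<bar>ln s\<bar>" "N n > 0" using n0[OF n] by auto
    then have "exp (ln s) < exp (N n)" by (subst exp_less_cancel_iff) auto
    then have es: "exp (N n) > s" using s by simp
    have bc: "b * exp (\<alpha> * N n) * cos (\<alpha> * pi) > 0" using b stieltjes_trig by simp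
    have "norm (top n) \<le> exp (N n) / (exp (N n) - s) / (b * exp (\<alpha> * N n) * cos (\<alpha> * pi)) * norm (Complex (- pi) (N n) - Complex pi (N n))"
      unfolding top_def
    proof (rule contour_integral_bound_linepath)
      show "K contour_integrable_on linepath (Complex pi (N n)) (Complex (- pi) (N n))"
        using seg inS Nn by (intro contour_integrable_continuous_linepath contK subsetI) fastforce
      show "0 \<le> exp (N n) / (exp (N n) - s) / (b * exp (\<alpha> * N n) * cos (\<alpha> * pi))"
        using es bc by simp
      fix z assume "z \<in> closed_segment (Complex pi (N n)) (Complex (- pi) (N n))"
      then have z: "Re z \<in> {- pi..pi}" "Im z = N n" using seg pi_gt_zero by fastforce+
      have "b * exp (\<alpha> * N n) * cos (\<alpha> * pi) \<le> Re (D z)"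
        unfolding Dre z using cosle[OF z(1)] b c by (intro add_increasing mult_left_mono) auto
      also have "\<dots> \<le> norm (D z)" by (rule complex_Re_le_cmod)
      finally have 1: "b * exp (\<alpha> * N n) * cos (\<alpha> * pi) \<le> norm (D z)" .
      have 2: "exp (N n) - s \<le> norm (E z - complex_of_real s)"
        using norm_triangle_ineq2[of "E z" "complex_of_real s"] s by (simp add: Eabs z)
      have "norm (K z) = exp (N n) / norm (E z - complex_of_real s) / norm (D z)"
        by (simp add: K_def norm_divide norm_mult Eabs z mult.commute)
      also have "\<dots> \<le> exp (N n) / (exp (N n) - s) / (b * exp (\<alpha> * N n) * cos (\<alpha> * pi))"
        using 1 2 es bc by (intro frac_le divide_nonneg_pos) auto
      finally show "norm (K z) \<le> exp (N n) / (exp (N n) - s) / (b * exp (\<alpha> * N n) * cos (\<alpha> * pi))" .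
    qed
    also have "norm (Complex (- pi) (N n) - Complex pi (N n)) = 2 * pi" by (simp add: cmod_def real_sqrt_mult)
    finally show ?thesis .
  qed
  \<comment> \<open>On the lower edge the numerator itself decays, |E| = exp(- N), and
    \<open>D\<close> has real part at least c.\<close>
  have botb: "norm (bot n) \<le> exp (- N n) / (s - exp (- N n)) / c * (2 * pi)" if n: "n \<ge> n0" for n
  proof -
    have Nn: "N n > \<bar>ln s\<bar>" "N n > 0" using n0[OF n] by auto
    then have "exp (- N n) < exp (ln s)" by (subst exp_less_cancel_iff) auto
    then have es: "exp (- N n) < s" using s by simp
    have "norm (bot n) \<le> exp (- N n) / (s - exp (- N n)) / c * norm (Complex pi (- N n) - Complex (- pi) (- N n))"
      unfolding bot_def
    proof (rule contour_integral_bound_linepath)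
      show "K contour_integrable_on linepath (Complex (- pi) (- N n)) (Complex pi (- N n))"
        using seg inS Nn by (intro contour_integrable_continuous_linepath contK subsetI) fastforce
      show "0 \<le> exp (- N n) / (s - exp (- N n)) / c" using es c by simp
      fix z assume "z \<in> closed_segment (Complex (- pi) (- N n)) (Complex pi (- N n))"
      then have z: "Re z \<in> {- pi..pi}" "Im z = - N n" using seg pi_gt_zero by fastforce+
      have "0 \<le> b * exp (\<alpha> * Im z) * cos (\<alpha> * Re z)"
        using cosle[OF z(1)] b stieltjes_trig by (intro mult_nonneg_nonneg) auto
      then have "c \<le> Re (D z)" unfolding Dre by simp
      also have "\<dots> \<le> norm (D z)" by (rule complex_Re_le_cmod)
      finally have 1: "c \<le> norm (D z)" .
      have 2: "s - exp (- N n) \<le> norm (E z - complex_of_real s)"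
        using norm_triangle_ineq2[of "complex_of_real s" "E z"] s by (simp add: Eabs z norm_minus_commute)
      have "norm (K z) = exp (- N n) / norm (E z - complex_of_real s) / norm (D z)"
        by (simp add: K_def norm_divide norm_mult Eabs z mult.commute)
      also have "\<dots> \<le> exp (- N n) / (s - exp (- N n)) / c"
        using 1 2 es c by (intro frac_le divide_nonneg_pos) auto
      finally show "norm (K z) \<le> exp (- N n) / (s - exp (- N n)) / c" .
    qed
    also have "norm (Complex pi (- N n) - Complex (- pi) (- N n)) = 2 * pi" by (simp add: cmod_def real_sqrt_mult)
    finally show ?thesis .
  qed
  have Ninf: "filterlim N at_top sequentially"
    unfolding N_def by (intro filterlim_compose[OF filterlim_real_sequentially] filterlim_Suc)
  have top0: "top \<longlonglongrightarrow> 0"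
  proof (rule Lim_null_comparison)
    show "\<forall>\<^sub>F n in sequentially. norm (top n) \<le> exp (N n) / (exp (N n) - s) / (b * exp (\<alpha> * N n) * cos (\<alpha> * pi)) * (2 * pi)"
      using eventually_ge_at_top[of n0] by eventually_elim (rule topb)
    have "((\<lambda>x. exp x / (exp x - s) / (b * exp (\<alpha> * x) * cos (\<alpha> * pi)) * (2 * pi)) \<longlongrightarrow> 0) at_top"
      using \<alpha>(1) b stieltjes_trig(2) by real_asymp
    then show "(\<lambda>n. exp (N n) / (exp (N n) - s) / (b * exp (\<alpha> * N n) * cos (\<alpha> * pi)) * (2 * pi)) \<longlonglongrightarrow> 0"
      by (rule filterlim_compose[OF _ Ninf])
  qed
  have bot0: "bot \<longlonglongrightarrow> 0"
  proof (rule Lim_null_comparison)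
    show "\<forall>\<^sub>F n in sequentially. norm (bot n) \<le> exp (- N n) / (s - exp (- N n)) / c * (2 * pi)"
      using eventually_ge_at_top[of n0] by eventually_elim (rule botb)
    have "((\<lambda>x. exp (- x) / (s - exp (- x)) / c * (2 * pi)) \<longlongrightarrow> 0) at_top"
      using s c by real_asymp
    then show "(\<lambda>n. exp (- N n) / (s - exp (- N n)) / c * (2 * pi)) \<longlonglongrightarrow> 0"
      by (rule filterlim_compose[OF _ Ninf])
  qed
  have "(\<lambda>n. top n + bot n) \<longlonglongrightarrow> 0" using tendsto_add[OF top0 bot0] by simp
  then have "(\<lambda>n. complex_of_real (1 / (c + b * s powr \<alpha>)) + (top n + bot n) / complex_of_real (2 * pi))
     \<longlonglongrightarrow> complex_of_real (1 / (c + b * s powr \<alpha>)) + 0 / complex_of_real (2 * pi)"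
    by (intro tendsto_add tendsto_divide tendsto_const) auto
  moreover have "\<forall>\<^sub>F n in sequentially. complex_of_real (1 / (c + b * s powr \<alpha>)) + (top n + bot n) / complex_of_real (2 * pi) = complex_of_real (integral {- N n..N n} k)"
    using eventually_ge_at_top[of n0]
  proof eventually_elim
    case (elim n)
    have "complex_of_real (2 * pi) * complex_of_real (integral {- N n..N n} k) = complex_of_real (2 * pi) * complex_of_real (1 / (c + b * s powr \<alpha>)) + (top n + bot n)"
      using contour[OF elim] by (simp add: algebra_simps)
    then show ?case by (simp add: field_simps)
  qed
  ultimately have "(\<lambda>n. complex_of_real (integral {- N n..N n} k)) \<longlonglongrightarrow> complex_of_real (1 / (c + b * s powr \<alpha>))"
    using Lim_transform_eventually by fastforce
  then show ?thesis unfolding N_def k_def by (simp only: tendsto_of_real_iff)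
qed

text \<open>The contour argument gives only the limit over symmetric intervals. The integrand is
  nonnegative, so monotone convergence identifies that limit with the full integral.\<close>

lemma stieltjes_representation:
  assumes s: "s > 0"
  shows "(\<integral>\<^sup>+y. ennreal (exp y / (exp y + s) * stieltjes_density \<alpha> b c y) \<partial>lborel) = ennreal (1 / (c + b * s powr \<alpha>))"
proof -
  define k where "k y = exp y / (exp y + s) * stieltjes_density \<alpha> b c y" for y
  have k0: "k y \<ge> 0" for y
    unfolding k_def using s stieltjes_density_nonneg by (intro mult_nonneg_nonneg divide_nonneg_pos) (auto intro: add_pos_pos)
  have [measurable]: "k \<in> borel_measurable borel" unfolding k_def by measurable
  have kc: "continuous_on A k" for A
    unfolding k_def using s by (intro continuous_intros stieltjes_density_continuous) (auto simp: add_pos_pos less_imp_neq[symmetric])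
  let ?I = "\<lambda>n. {- real (Suc n)..real (Suc n)}"
  have "(\<lambda>n. \<integral>\<^sup>+y. ennreal (k y) * indicator (?I n) y \<partial>lborel) \<longlonglongrightarrow> (\<integral>\<^sup>+y. ennreal (k y) \<partial>lborel)"
  proof (rule nn_integral_LIMSEQ)
    show "incseq (\<lambda>n y. ennreal (k y) * indicator (?I n) y)"
      by (auto simp: incseq_def le_fun_def indicator_def)
    show "(\<lambda>n. ennreal (k y) * indicator (?I n) y) \<longlonglongrightarrow> ennreal (k y)" for y
    proof (rule tendsto_eventually)
      obtain m where m: "real m > \<bar>y\<bar>" using reals_Archimedean2 by blast
      show "\<forall>\<^sub>F n in sequentially. ennreal (k y) * indicator (?I n) y = ennreal (k y)"
        using eventually_ge_at_top[of m] by eventually_elim (use m in \<open>auto simp: indicator_def\<close>)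
    qed
  qed simp
  moreover have "(\<integral>\<^sup>+y. ennreal (k y) * indicator (?I n) y \<partial>lborel) = ennreal (integral (?I n) k)" for n
    by (rule nn_integral_has_integral_lebesgue'[OF k0 integrable_integral]) (intro integrable_continuous_interval kc)
  moreover have "(\<lambda>n. ennreal (integral (?I n) k)) \<longlonglongrightarrow> ennreal (1 / (c + b * s powr \<alpha>))"
    using stieltjes_interval_limit[OF s] unfolding k_def by (rule tendsto_ennrealI)
  ultimately show ?thesis using LIMSEQ_unique unfolding k_def by fastforce
qed

end

section \<open>The resolvent kernel\<close>

text \<open>Writing \<open>exp y / (exp y + s)\<close> as the Laplace transform of an exponential density turns the
  Stieltjes representation into a mixture of the symbols \<open>exp (- t \<bar>\<xi>\<bar>\<^sup>2)\<close> of heat kernels.\<close>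

definition subord_density_nn :: "real \<Rightarrow> real \<Rightarrow> real \<Rightarrow> real \<Rightarrow> ennreal" where
  "subord_density_nn \<alpha> b c t = (\<integral>\<^sup>+y. ennreal (stieltjes_density \<alpha> b c y * exponential_density (exp y) t) \<partial>lborel)"

text \<open>A real-valued version of the mixing density: a value \<infinity> becomes 0. As the total
  mass is finite, this alters the density on a null set only.\<close>

definition subord_density :: "real \<Rightarrow> real \<Rightarrow> real \<Rightarrow> real \<Rightarrow> real" where
  "subord_density \<alpha> b c t = enn2real (subord_density_nn \<alpha> b c t)"

text \<open>The convolution kernel of the resolvent of b (- \<Delta>)^\<alpha> at c, that is, of the
  inverse of c + b (- \<Delta>)^\<alpha>, obtained by subordinating the heat semigroup. Positivity
  and radial symmetry are inherited from the heat kernel.\<close>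

definition resolvent_kernel :: "real \<Rightarrow> real \<Rightarrow> real \<Rightarrow> 'a::euclidean_space \<Rightarrow> real" where
  "resolvent_kernel \<alpha> b c z = (\<integral>t. subord_density \<alpha> b c t * heat_kernel t z \<partial>lborel)"

lemma exponential_density_measurable2 [measurable]:
  "(\<lambda>p. exponential_density (exp (snd p)) (fst p)) \<in> borel_measurable (borel \<Otimes>\<^sub>M borel)"
  unfolding exponential_density_def by measurable

lemma exponential_density_measurable1 [measurable]:
  "(\<lambda>y. exponential_density (exp y) t) \<in> borel_measurable borel"
  "(\<lambda>t. exponential_density a t) \<in> borel_measurable borel"
  unfolding exponential_density_def by measurable

lemma exponential_density_nn_integral: "l > 0 \<Longrightarrow> (\<integral>\<^sup>+x. ennreal (exponential_density l x) \<partial>lborel) = 1"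
  using nn_integral_erlang_ith_moment[of l 0 0] by simp

lemma resolvent_kernel_norm_cong: "norm (z::'a::euclidean_space) = norm (z'::'a) \<Longrightarrow> resolvent_kernel \<alpha> b c z = resolvent_kernel \<alpha> b c z'"
  unfolding resolvent_kernel_def by (metis heat_kernel_norm_cong)

context
  fixes \<alpha> b c :: real
  assumes \<alpha>: "0 < \<alpha>" "\<alpha> < 1 / 2" and b: "b > 0" and c: "c > 0"
begin

lemma subord_density_nn_measurable [measurable]: "subord_density_nn \<alpha> b c \<in> borel_measurable borel"
proof -
  have "(\<lambda>t. \<integral>\<^sup>+y. ennreal (stieltjes_density \<alpha> b c y * exponential_density (exp y) t) \<partial>lborel) \<in> borel_measurable borel"
    by (rule lborel.borel_measurable_nn_integral) (simp add: case_prod_beta')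
  then show ?thesis unfolding subord_density_nn_def [abs_def] .
qed

lemma subord_density_measurable [measurable]: "subord_density \<alpha> b c \<in> borel_measurable borel"
  unfolding subord_density_def [abs_def] by measurable

lemma subord_density_nonneg: "subord_density \<alpha> b c t \<ge> 0"
  by (simp add: subord_density_def)

lemma subord_density_nn_weight:
  assumes [measurable]: "w \<in> borel_measurable borel"
  shows "(\<integral>\<^sup>+t. subord_density_nn \<alpha> b c t * w t \<partial>lborel)
    = (\<integral>\<^sup>+y. ennreal (stieltjes_density \<alpha> b c y) * (\<integral>\<^sup>+t. ennreal (exponential_density (exp y) t) * w t \<partial>lborel) \<partial>lborel)"
proof -
  have "(\<integral>\<^sup>+t. subord_density_nn \<alpha> b c t * w t \<partial>lborel)
    = (\<integral>\<^sup>+t. \<integral>\<^sup>+y. ennreal (stieltjes_density \<alpha> b c y * exponential_density (exp y) t) * w t \<partial>lborel \<partial>lborel)"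
    unfolding subord_density_nn_def by (intro nn_integral_cong nn_integral_multc[symmetric]) measurable
  also have "\<dots> = (\<integral>\<^sup>+y. \<integral>\<^sup>+t. ennreal (stieltjes_density \<alpha> b c y * exponential_density (exp y) t) * w t \<partial>lborel \<partial>lborel)"
    by (rule lborel_pair.Fubini'[symmetric]) (simp add: case_prod_beta')
  also have "\<dots> = (\<integral>\<^sup>+y. ennreal (stieltjes_density \<alpha> b c y) * (\<integral>\<^sup>+t. ennreal (exponential_density (exp y) t) * w t \<partial>lborel) \<partial>lborel)"
  proof (rule nn_integral_cong)
    fix y :: real
    have "(\<integral>\<^sup>+t. ennreal (stieltjes_density \<alpha> b c y * exponential_density (exp y) t) * w t \<partial>lborel)
      = (\<integral>\<^sup>+t. ennreal (stieltjes_density \<alpha> b c y) * (ennreal (exponential_density (exp y) t) * w t) \<partial>lborel)"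
      using stieltjes_density_nonneg[OF \<alpha> b c] exponential_density_nonneg[of "exp y"]
      by (intro nn_integral_cong) (simp add: ennreal_mult mult.assoc)
    also have "\<dots> = ennreal (stieltjes_density \<alpha> b c y) * (\<integral>\<^sup>+t. ennreal (exponential_density (exp y) t) * w t \<partial>lborel)"
      by (rule nn_integral_cmult) measurable
    finally show "(\<integral>\<^sup>+t. ennreal (stieltjes_density \<alpha> b c y * exponential_density (exp y) t) * w t \<partial>lborel)
      = ennreal (stieltjes_density \<alpha> b c y) * (\<integral>\<^sup>+t. ennreal (exponential_density (exp y) t) * w t \<partial>lborel)" .
  qed
  finally show ?thesis .
qed

lemma subord_density_nn_laplace:
  assumes s: "s > 0"
  shows "(\<integral>\<^sup>+t. subord_density_nn \<alpha> b c t * ennreal (exp (- t * s)) \<partial>lborel) = ennreal (1 / (c + b * s powr \<alpha>))"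
proof -
  have "(\<integral>\<^sup>+t. subord_density_nn \<alpha> b c t * ennreal (exp (- t * s)) \<partial>lborel)
    = (\<integral>\<^sup>+y. ennreal (stieltjes_density \<alpha> b c y) * (\<integral>\<^sup>+t. ennreal (exponential_density (exp y) t) * ennreal (exp (- t * s)) \<partial>lborel) \<partial>lborel)"
    by (rule subord_density_nn_weight) measurable
  also have "\<dots> = (\<integral>\<^sup>+y. ennreal (exp y / (exp y + s) * stieltjes_density \<alpha> b c y) \<partial>lborel)"
  proof (rule nn_integral_cong)
    fix y :: real
    have p: "exp y + s > 0" using s by (simp add: add_pos_pos)
    have "ennreal (exponential_density (exp y) t) * ennreal (exp (- t * s)) = ennreal (exp y / (exp y + s)) * ennreal (exponential_density (exp y + s) t)" for t
    proof -
      have "exponential_density (exp y) t * exp (- t * s) = exp y / (exp y + s) * exponential_density (exp y + s) t"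
      proof -
        have "exp (- t * (exp y + s)) = exp (- t * exp y) * exp (- t * s)"
          by (simp add: exp_add[symmetric] distrib_left)
        then show ?thesis using p by (simp add: exponential_density_def)
      qed
      then show ?thesis
        using p exponential_density_nonneg[of "exp y" t] exponential_density_nonneg[of "exp y + s" t]
        by (simp flip: ennreal_mult)
    qed
    then have "(\<integral>\<^sup>+t. ennreal (exponential_density (exp y) t) * ennreal (exp (- t * s)) \<partial>lborel) = ennreal (exp y / (exp y + s)) * (\<integral>\<^sup>+t. ennreal (exponential_density (exp y + s) t) \<partial>lborel)"
      by (simp add: nn_integral_cmult)
    also have "\<dots> = ennreal (exp y / (exp y + s))" using exponential_density_nn_integral[OF p] by simp
    finally have I: "(\<integral>\<^sup>+t. ennreal (exponential_density (exp y) t) * ennreal (exp (- t * s)) \<partial>lborel) = ennreal (exp y / (exp y + s))" .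
    show "ennreal (stieltjes_density \<alpha> b c y) * (\<integral>\<^sup>+t. ennreal (exponential_density (exp y) t) * ennreal (exp (- t * s)) \<partial>lborel)
      = ennreal (exp y / (exp y + s) * stieltjes_density \<alpha> b c y)"
      unfolding I using p stieltjes_density_nonneg[OF \<alpha> b c, of y]
      by (subst ennreal_mult[symmetric]) (auto simp: mult.commute)
  qed
  also have "\<dots> = ennreal (1 / (c + b * s powr \<alpha>))"
    by (rule stieltjes_representation[OF \<alpha> b c s])
  finally show ?thesis .
qed

text \<open>The Laplace transform is evaluated at s tending to 0 from above. The density vanishes
  for negative t, so the weights exp(- t s) increase to 1 wherever they count and monotone
  convergence applies.\<close>

lemma subord_density_nn_mass: "(\<integral>\<^sup>+t. subord_density_nn \<alpha> b c t \<partial>lborel) = ennreal (1 / c)"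
proof -
  define s where "s n = 1 / real (Suc n)" for n
  have s: "s n > 0" for n by (simp add: s_def)
  have s0: "s \<longlonglongrightarrow> 0" unfolding s_def inverse_eq_divide[symmetric] by (rule LIMSEQ_inverse_real_of_nat)
  have neg: "subord_density_nn \<alpha> b c t = 0" if "t < 0" for t
    using that by (simp add: subord_density_nn_def exponential_density_def)
  have "(\<lambda>n. \<integral>\<^sup>+t. subord_density_nn \<alpha> b c t * ennreal (exp (- t * s n)) \<partial>lborel) \<longlonglongrightarrow> (\<integral>\<^sup>+t. subord_density_nn \<alpha> b c t \<partial>lborel)"
  proof (rule nn_integral_LIMSEQ)
    show "incseq (\<lambda>n t. subord_density_nn \<alpha> b c t * ennreal (exp (- t * s n)))"
    proof (unfold incseq_def le_fun_def, intro allI impI)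
      fix m n :: nat and t :: real assume "m \<le> n"
      then have "s n \<le> s m" by (simp add: s_def divide_left_mono)
      then show "subord_density_nn \<alpha> b c t * ennreal (exp (- t * s m)) \<le> subord_density_nn \<alpha> b c t * ennreal (exp (- t * s n))"
        by (cases "t < 0") (auto simp: neg intro!: mult_left_mono ennreal_leI)
    qed
    show "(\<lambda>n. subord_density_nn \<alpha> b c t * ennreal (exp (- t * s n))) \<longlonglongrightarrow> subord_density_nn \<alpha> b c t" for t
    proof -
      have "(\<lambda>n. ennreal (exp (- t * s n))) \<longlonglongrightarrow> ennreal (exp (- t * 0))"
        by (intro tendsto_intros s0)
      then have "(\<lambda>n. subord_density_nn \<alpha> b c t * ennreal (exp (- t * s n))) \<longlonglongrightarrow> subord_density_nn \<alpha> b c t * ennreal (exp (- t * 0))"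
        by (intro tendsto_mult_ennreal tendsto_const) auto
      then show ?thesis by simp
    qed
  qed measurable
  moreover have "(\<lambda>n. \<integral>\<^sup>+t. subord_density_nn \<alpha> b c t * ennreal (exp (- t * s n)) \<partial>lborel) \<longlonglongrightarrow> ennreal (1 / c)"
  proof -
    have "(\<lambda>n. s n powr \<alpha>) \<longlonglongrightarrow> 0"
      using tendsto_powr'[OF s0 tendsto_const[of \<alpha>]] \<alpha> s by (simp add: less_imp_le)
    then have "(\<lambda>n. 1 / (c + b * s n powr \<alpha>)) \<longlonglongrightarrow> 1 / (c + b * 0)"
      using c by (intro tendsto_divide tendsto_add tendsto_mult tendsto_const) auto
    then have "(\<lambda>n. ennreal (1 / (c + b * s n powr \<alpha>))) \<longlonglongrightarrow> ennreal (1 / c)"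
      using tendsto_ennrealI by fastforce
    then show ?thesis by (simp only: subord_density_nn_laplace[OF s])
  qed
  ultimately show ?thesis by (rule LIMSEQ_unique)
qed

lemma subord_density_AE: "AE t in lborel. subord_density_nn \<alpha> b c t = ennreal (subord_density \<alpha> b c t)"
proof -
  have "AE t in lborel. subord_density_nn \<alpha> b c t \<noteq> \<infinity>"
    by (rule nn_integral_PInf_AE) (simp_all add: subord_density_nn_mass)
  then show ?thesis by eventually_elim (simp add: subord_density_def less_top)
qed

lemma subord_density_weight:
  "(\<integral>\<^sup>+t. ennreal (subord_density \<alpha> b c t) * w t \<partial>lborel) = (\<integral>\<^sup>+t. subord_density_nn \<alpha> b c t * w t \<partial>lborel)"
  by (rule nn_integral_cong_AE) (use subord_density_AE in \<open>auto elim!: eventually_mono\<close>)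

lemma subord_density_neg: "t < 0 \<Longrightarrow> subord_density \<alpha> b c t = 0"
  by (simp add: subord_density_def subord_density_nn_def exponential_density_def)

lemma subord_density_AE_pos: "AE t in lborel. t > 0 \<or> subord_density \<alpha> b c t = 0"
  using AE_lborel_singleton[of 0] by eventually_elim (use subord_density_neg in force)

lemma subord_heat_integrable:
  "integrable (lborel \<Otimes>\<^sub>M lborel) (\<lambda>p. subord_density \<alpha> b c (fst p) * heat_kernel (fst p) (snd p :: 'a::euclidean_space))"
proof (rule integrableI_bounded)
  show m: "(\<lambda>p. subord_density \<alpha> b c (fst p) * heat_kernel (fst p) (snd p :: 'a)) \<in> borel_measurable (lborel \<Otimes>\<^sub>M lborel)"
    by simp
  have "(\<integral>\<^sup>+p. ennreal (norm (subord_density \<alpha> b c (fst p) * heat_kernel (fst p) (snd p :: 'a))) \<partial>(lborel \<Otimes>\<^sub>M lborel))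
    = (\<integral>\<^sup>+t. \<integral>\<^sup>+z. ennreal (norm (subord_density \<alpha> b c t * heat_kernel t (z::'a))) \<partial>lborel \<partial>lborel)"
    by (subst lborel.nn_integral_fst[symmetric]) simp_all
  also have "\<dots> = (\<integral>\<^sup>+t. ennreal (subord_density \<alpha> b c t) * 1 \<partial>lborel)"
  proof (rule nn_integral_cong_AE)
    show "AE t in lborel. (\<integral>\<^sup>+z. ennreal (norm (subord_density \<alpha> b c t * heat_kernel t (z::'a))) \<partial>lborel) = ennreal (subord_density \<alpha> b c t) * 1"
      using subord_density_AE_pos
    proof eventually_elim
      case (elim t)
      have "(\<integral>\<^sup>+z. ennreal (norm (subord_density \<alpha> b c t * heat_kernel t (z::'a))) \<partial>lborel)
         = (\<integral>\<^sup>+z. ennreal (subord_density \<alpha> b c t) * ennreal (heat_kernel t (z::'a)) \<partial>lborel)"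
        by (intro nn_integral_cong) (simp add: subord_density_nonneg ennreal_mult)
      also have "\<dots> = ennreal (subord_density \<alpha> b c t) * (\<integral>\<^sup>+z. ennreal (heat_kernel t (z::'a)) \<partial>lborel)"
        by (rule nn_integral_cmult) measurable
      finally show ?case using elim heat_kernel_nn_integral[of t, where 'a='a] by auto
    qed
  qed
  also have "\<dots> = ennreal (1 / c)" using subord_density_weight[of "\<lambda>_. 1"] subord_density_nn_mass by simp
  finally show "(\<integral>\<^sup>+p. ennreal (norm (subord_density \<alpha> b c (fst p) * heat_kernel (fst p) (snd p :: 'a))) \<partial>(lborel \<Otimes>\<^sub>M lborel)) < \<infinity>"
    by simp
qed

lemma resolvent_kernel_conv: "conv_kernel (resolvent_kernel \<alpha> b c :: 'a::euclidean_space \<Rightarrow> real)"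
proof
  let ?g = "resolvent_kernel \<alpha> b c :: 'a \<Rightarrow> real"
  have "(\<lambda>z::'a. \<integral>t. subord_density \<alpha> b c t * heat_kernel t z \<partial>lborel) \<in> borel_measurable borel"
  proof (rule lborel.borel_measurable_lebesgue_integral)
    have "(\<lambda>p. heat_kernel (snd p) (fst p :: 'a)) \<in> borel_measurable (borel \<Otimes>\<^sub>M borel)"
      unfolding heat_kernel_def by measurable
    then show "(\<lambda>(x::'a, y). subord_density \<alpha> b c y * heat_kernel y x) \<in> borel_measurable (borel \<Otimes>\<^sub>M lborel)"
      by (simp add: case_prod_beta')
  qed
  then show "?g \<in> borel_measurable borel" unfolding resolvent_kernel_def [abs_def] .
  show "?g z \<ge> 0" for z unfolding resolvent_kernel_def
    by (intro Bochner_Integration.integral_nonneg mult_nonneg_nonneg subord_density_nonneg) auto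
  have "integrable lborel (\<lambda>z::'a. \<integral>t. subord_density \<alpha> b c (fst (t, z)) * heat_kernel (fst (t, z)) (snd (t, z)) \<partial>lborel)"
    using lborel_pair.integrable_snd[of "\<lambda>t z. subord_density \<alpha> b c t * heat_kernel t (z::'a)"] subord_heat_integrable[where 'a='a]
    by (simp add: case_prod_beta')
  then show "integrable lborel ?g" by (simp add: resolvent_kernel_def [abs_def])
qed

text \<open>Fubini reduces the transform of the mixture to the Laplace transform of the density at s
  = |\<xi>|^2. The latter is available for s > 0, which leaves out the single frequency 0, a null
  set for every later use.\<close>

lemma resolvent_kernel_symbol:
  fixes \<xi> :: "'a::euclidean_space"
  assumes \<xi>: "\<xi> \<noteq> 0"
  shows "fourier_int (\<lambda>x. complex_of_real (resolvent_kernel \<alpha> b c x)) \<xi> = complex_of_real (1 / (c + b * norm \<xi> powr (2 * \<alpha>)))"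
proof -
  let ?e = "\<lambda>x::'a. exp (- \<i> * complex_of_real (x \<bullet> \<xi>))"
  define l where "l t z = complex_of_real (subord_density \<alpha> b c t) * (complex_of_real (heat_kernel t z) * ?e z)" for t and z :: 'a
  have li: "integrable (lborel \<Otimes>\<^sub>M lborel) (\<lambda>(t, z). l t z)"
  proof (rule Bochner_Integration.integrable_bound[OF subord_heat_integrable])
    show "(\<lambda>(t, z). l t z) \<in> borel_measurable (lborel \<Otimes>\<^sub>M lborel)"
      unfolding l_def by (simp add: case_prod_beta')
  qed (auto simp: l_def norm_mult subord_density_nonneg)
  have "fourier_int (\<lambda>x. complex_of_real (resolvent_kernel \<alpha> b c x)) \<xi> = (\<integral>z. \<integral>t. l t z \<partial>lborel \<partial>lborel)"
    unfolding fourier_int_def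
  proof (rule Bochner_Integration.integral_cong)
    fix z :: 'a
    have "complex_of_real (resolvent_kernel \<alpha> b c z) = (\<integral>t. complex_of_real (subord_density \<alpha> b c t * heat_kernel t z) \<partial>lborel)"
      unfolding resolvent_kernel_def by (rule integral_complex_of_real[symmetric])
    then have "?e z * complex_of_real (resolvent_kernel \<alpha> b c z) = (\<integral>t. ?e z * complex_of_real (subord_density \<alpha> b c t * heat_kernel t z) \<partial>lborel)"
      by simp
    also have "\<dots> = (\<integral>t. l t z \<partial>lborel)"
      by (intro Bochner_Integration.integral_cong) (auto simp: l_def)
    finally show "?e z * complex_of_real (resolvent_kernel \<alpha> b c z) = (\<integral>t. l t z \<partial>lborel)" .
  qed simp
  also have "\<dots> = (\<integral>t. \<integral>z. l t z \<partial>lborel \<partial>lborel)"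
    by (rule lborel_pair.Fubini_integral[OF li])
  also have "\<dots> = (\<integral>t. complex_of_real (subord_density \<alpha> b c t * exp (- t * (norm \<xi>)\<^sup>2)) \<partial>lborel)"
  proof (rule integral_cong_AE)
    have lm: "(\<lambda>(t, z). l t z) \<in> borel_measurable (lborel \<Otimes>\<^sub>M lborel)" using li by auto
    show "(\<lambda>t. \<integral>z. l t z \<partial>lborel) \<in> borel_measurable lborel"
      using lborel.borel_measurable_lebesgue_integral[OF lm] by simp
    show "AE t in lborel. (\<integral>z. l t z \<partial>lborel) = complex_of_real (subord_density \<alpha> b c t * exp (- t * (norm \<xi>)\<^sup>2))"
      using subord_density_AE_pos
    proof eventually_elim
      case (elim t)
      show ?case
      proof (cases "t > 0")
        case True
        have "(\<integral>z. l t z \<partial>lborel) = complex_of_real (subord_density \<alpha> b c t) * (\<integral>z. complex_of_real (heat_kernel t z) * ?e z \<partial>lborel)"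
          unfolding l_def by (rule integral_mult_right_zero)
        then show ?thesis unfolding heat_kernel_fourier(2)[OF True] by simp
      qed (use elim in \<open>simp add: l_def\<close>)
    qed
  qed measurable
  also have "\<dots> = complex_of_real (\<integral>t. subord_density \<alpha> b c t * exp (- t * (norm \<xi>)\<^sup>2) \<partial>lborel)"
    by (rule integral_complex_of_real)
  also have "(\<integral>t. subord_density \<alpha> b c t * exp (- t * (norm \<xi>)\<^sup>2) \<partial>lborel) = 1 / (c + b * norm \<xi> powr (2 * \<alpha>))"
  proof -
    have s: "(norm \<xi>)\<^sup>2 > 0" using \<xi> by simp
    have pw: "((norm \<xi>)\<^sup>2) powr \<alpha> = norm \<xi> powr (2 * \<alpha>)"
      using \<xi> by (simp add: powr_powr flip: powr_numeral)
    have "(\<integral>\<^sup>+t. ennreal (subord_density \<alpha> b c t * exp (- t * (norm \<xi>)\<^sup>2)) \<partial>lborel)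
      = (\<integral>\<^sup>+t. ennreal (subord_density \<alpha> b c t) * ennreal (exp (- t * (norm \<xi>)\<^sup>2)) \<partial>lborel)"
      by (intro nn_integral_cong) (simp add: ennreal_mult subord_density_nonneg)
    also have "\<dots> = ennreal (1 / (c + b * norm \<xi> powr (2 * \<alpha>)))"
      unfolding subord_density_weight subord_density_nn_laplace[OF s] pw ..
    finally show ?thesis
      using b c by (subst integral_eq_nn_integral) (auto simp: subord_density_nonneg intro!: divide_nonneg_nonneg add_nonneg_nonneg mult_nonneg_nonneg)
  qed
  finally show ?thesis .
qed

end

section \<open>Smoothing from \<open>L\<^sup>2\<close> to \<open>L\<^sup>q\<close>\<close>

text \<open>After the scaling t to a t this is Euler's integral for the Gamma function; convergence
  at t = 0 is the condition \<beta> < 1.\<close>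

lemma exponential_density_neg_moment:
  assumes a: "a > 0" and \<beta>: "\<beta> < 1"
  shows "(\<integral>\<^sup>+t. ennreal (exponential_density a t) * ennreal (t powr - \<beta>) \<partial>lborel) = ennreal (a powr \<beta>) * ennreal (Gamma (1 - \<beta>))"
proof -
  let ?I = "\<integral>\<^sup>+t. ennreal (exponential_density a t) * ennreal (t powr - \<beta>) \<partial>lborel"
  have "ennreal (Gamma (1 - \<beta>)) = (\<integral>\<^sup>+t. ennreal (indicator {0..} t * t powr - \<beta> / exp t) \<partial>lborel)"
    using Gamma_conv_nn_integral_real[of "1 - \<beta>"] \<beta> by simp
  also have "\<dots> = ennreal a * (\<integral>\<^sup>+t. ennreal (indicator {0..} (0 + a * t) * (0 + a * t) powr - \<beta> / exp (0 + a * t)) \<partial>lborel)"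
    using a by (subst nn_integral_real_affine[where c = a and t = 0]) auto
  also have "\<dots> = (\<integral>\<^sup>+t. ennreal a * ennreal (indicator {0..} (0 + a * t) * (0 + a * t) powr - \<beta> / exp (0 + a * t)) \<partial>lborel)"
    by (rule nn_integral_cmult[symmetric]) measurable
  also have "\<dots> = (\<integral>\<^sup>+t. ennreal (a powr - \<beta>) * (ennreal (exponential_density a t) * ennreal (t powr - \<beta>)) \<partial>lborel)"
  proof (rule nn_integral_cong)
    fix t :: real
    have "a * (indicator {0..} (0 + a * t) * (0 + a * t) powr - \<beta> / exp (0 + a * t)) = a powr - \<beta> * (exponential_density a t * t powr - \<beta>)"
      using a by (cases "t < 0")
        (auto simp: exponential_density_def indicator_def powr_mult exp_minus divide_inverse mult_less_0_iff zero_le_mult_iff mult_ac)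
    then show "ennreal a * ennreal (indicator {0..} (0 + a * t) * (0 + a * t) powr - \<beta> / exp (0 + a * t)) = ennreal (a powr - \<beta>) * (ennreal (exponential_density a t) * ennreal (t powr - \<beta>))"
      using a exponential_density_nonneg[OF a, of t] by (simp flip: ennreal_mult)
  qed
  also have "\<dots> = ennreal (a powr - \<beta>) * ?I"
    by (rule nn_integral_cmult) measurable
  finally have "ennreal (a powr \<beta>) * ennreal (Gamma (1 - \<beta>)) = ennreal (a powr \<beta>) * (ennreal (a powr - \<beta>) * ?I)" by simp
  also have "\<dots> = ennreal (a powr \<beta> * a powr - \<beta>) * ?I" by (simp add: ennreal_mult mult.assoc)
  also have "a powr \<beta> * a powr - \<beta> = 1" using a by (simp flip: powr_add)
  finally show ?thesis by simp
qed

text \<open>Integrating out t turns t^(- \<beta>) into a multiple of exp(\<beta> y). The Stieltjes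
  density decays like exp(- \<alpha> y) as y tends to \<infinity> and like exp(\<alpha> y) as y
  tends to - \<infinity>, so the product is dominated by exponential densities of rates \<alpha> -
  \<beta> and \<alpha> + \<beta>. The first rate is where \<beta> < \<alpha> enters.\<close>

lemma subord_density_neg_moment_finite:
  assumes \<alpha>: "0 < \<alpha>" "\<alpha> < 1 / 2" and b: "b > 0" and c: "c > 0" and \<beta>: "0 < \<beta>" "\<beta> < \<alpha>"
  shows "(\<integral>\<^sup>+t. ennreal (subord_density \<alpha> b c t) * ennreal (t powr - \<beta>) \<partial>lborel) < \<infinity>"
proof -
  note tr = stieltjes_trig[OF \<alpha> b c]
  \<comment> \<open>The sum of the constants for y >= 0 (drop A^2, keep B^2) and for y < 0 (use A >=
    c, drop B^2), each divided by the rate that normalises the exponential density on its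
    side.\<close>
  define M where "M = 1 / ((\<alpha> - \<beta>) * pi * b * sin (\<alpha> * pi)) + b / (pi * c\<^sup>2 * (\<alpha> + \<beta>))"
  have M1: "1 / ((\<alpha> - \<beta>) * pi * b * sin (\<alpha> * pi)) \<le> M" and M2: "b / (pi * c\<^sup>2 * (\<alpha> + \<beta>)) \<le> M" and M0: "M \<ge> 0"
  proof -
    have "0 < (\<alpha> - \<beta>) * pi * b * sin (\<alpha> * pi)" "0 < pi * c\<^sup>2 * (\<alpha> + \<beta>)"
      using \<alpha> \<beta> b c tr by (auto intro!: mult_pos_pos)
    then have "0 \<le> 1 / ((\<alpha> - \<beta>) * pi * b * sin (\<alpha> * pi))" "0 \<le> b / (pi * c\<^sup>2 * (\<alpha> + \<beta>))"
      using b by (auto intro!: divide_nonneg_pos)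
    then show "1 / ((\<alpha> - \<beta>) * pi * b * sin (\<alpha> * pi)) \<le> M" "b / (pi * c\<^sup>2 * (\<alpha> + \<beta>)) \<le> M" "M \<ge> 0"
      unfolding M_def by linarith+
  qed
  have bound: "stieltjes_density \<alpha> b c y * exp y powr \<beta> \<le> M * exponential_density (\<alpha> - \<beta>) y + M * exponential_density (\<alpha> + \<beta>) (0 - y)" for y
  proof -
    define A where "A = c + b * exp (\<alpha> * y) * cos (\<alpha> * pi)"
    define B where "B = b * exp (\<alpha> * y) * sin (\<alpha> * pi)"
    have B0: "B > 0" unfolding B_def using b tr by simp
    have Ac: "A \<ge> c" unfolding A_def using b tr by simp
    have r: "stieltjes_density \<alpha> b c y = B / (pi * (A\<^sup>2 + B\<^sup>2))" by (simp add: stieltjes_density_def A_def B_def)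
    have ep: "exp y powr \<beta> = exp (\<beta> * y)" by (simp add: powr_def)
    show ?thesis
    proof (cases "y \<ge> 0")
      case True
      have "B / (pi * (A\<^sup>2 + B\<^sup>2)) \<le> B / (pi * B\<^sup>2)"
        using B0 by (intro divide_left_mono mult_pos_pos add_nonneg_pos) (auto intro: mult_left_mono)
      also have "\<dots> = 1 / (pi * B)" using B0 by (simp add: power2_eq_square)
      finally have "stieltjes_density \<alpha> b c y * exp y powr \<beta> \<le> 1 / (pi * B) * exp (\<beta> * y)"
        unfolding r ep by (intro mult_right_mono) auto
      also have "\<dots> = 1 / ((\<alpha> - \<beta>) * pi * b * sin (\<alpha> * pi)) * ((\<alpha> - \<beta>) * exp (- y * (\<alpha> - \<beta>)))"
      proof -
        have "exp (\<beta> * y) = exp (\<alpha> * y) * exp (- y * (\<alpha> - \<beta>))" by (simp add: exp_add[symmetric] algebra_simps)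
        then show ?thesis unfolding B_def using \<beta> b tr by (simp add: field_simps)
      qed
      also have "\<dots> \<le> M * exponential_density (\<alpha> - \<beta>) y"
      proof -
        have e: "exponential_density (\<alpha> - \<beta>) y = (\<alpha> - \<beta>) * exp (- y * (\<alpha> - \<beta>))"
          using True by (simp add: exponential_density_def)
        show ?thesis unfolding e using \<beta> by (intro mult_right_mono M1) auto
      qed
      also have "\<dots> \<le> M * exponential_density (\<alpha> - \<beta>) y + M * exponential_density (\<alpha> + \<beta>) (0 - y)"
        using M0 exponential_density_nonneg[of "\<alpha> + \<beta>" "0 - y"] \<alpha> \<beta> by simp
      finally show ?thesis .
    next
      case False
      have "B / (pi * (A\<^sup>2 + B\<^sup>2)) \<le> B / (pi * c\<^sup>2)"
      proof (intro divide_left_mono mult_pos_pos)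
        have "c\<^sup>2 \<le> A\<^sup>2" using Ac c by (intro power_mono) auto
        then show "pi * c\<^sup>2 \<le> pi * (A\<^sup>2 + B\<^sup>2)" by (intro mult_left_mono) (auto intro: add_increasing2)
      qed (use B0 c in \<open>auto intro: add_nonneg_pos\<close>)
      also have "\<dots> \<le> b * exp (\<alpha> * y) / (pi * c\<^sup>2)"
        unfolding B_def using b c by (intro divide_right_mono) (auto simp: mult_left_le)
      finally have "stieltjes_density \<alpha> b c y * exp y powr \<beta> \<le> b * exp (\<alpha> * y) / (pi * c\<^sup>2) * exp (\<beta> * y)"
        unfolding r ep by (intro mult_right_mono) auto
      also have "\<dots> = b / (pi * c\<^sup>2 * (\<alpha> + \<beta>)) * ((\<alpha> + \<beta>) * exp (- (0 - y) * (\<alpha> + \<beta>)))"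
      proof -
        have "exp (- (0 - y) * (\<alpha> + \<beta>)) = exp (\<alpha> * y) * exp (\<beta> * y)" by (simp add: exp_add[symmetric] algebra_simps)
        then show ?thesis using \<alpha> \<beta> by simp
      qed
      also have "\<dots> \<le> M * exponential_density (\<alpha> + \<beta>) (0 - y)"
      proof -
        have e: "exponential_density (\<alpha> + \<beta>) (0 - y) = (\<alpha> + \<beta>) * exp (- (0 - y) * (\<alpha> + \<beta>))"
          using False by (simp add: exponential_density_def)
        show ?thesis unfolding e using \<alpha> \<beta> by (intro mult_right_mono M2) auto
      qed
      also have "\<dots> \<le> M * exponential_density (\<alpha> - \<beta>) y + M * exponential_density (\<alpha> + \<beta>) (0 - y)"
        using M0 exponential_density_nonneg[of "\<alpha> - \<beta>" y] \<beta> by simp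
      finally show ?thesis .
    qed
  qed
  have "(\<integral>\<^sup>+t. ennreal (subord_density \<alpha> b c t) * ennreal (t powr - \<beta>) \<partial>lborel)
    = (\<integral>\<^sup>+y. ennreal (stieltjes_density \<alpha> b c y) * (\<integral>\<^sup>+t. ennreal (exponential_density (exp y) t) * ennreal (t powr - \<beta>) \<partial>lborel) \<partial>lborel)"
    unfolding subord_density_weight[OF \<alpha> b c] by (rule subord_density_nn_weight[OF \<alpha> b c]) measurable
  also have "\<dots> = (\<integral>\<^sup>+y. ennreal (stieltjes_density \<alpha> b c y * exp y powr \<beta>) * ennreal (Gamma (1 - \<beta>)) \<partial>lborel)"
    using \<alpha> \<beta> stieltjes_density_nonneg[OF \<alpha> b c]
    by (intro nn_integral_cong) (simp add: exponential_density_neg_moment ennreal_mult mult.assoc)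
  also have "\<dots> \<le> (\<integral>\<^sup>+y. (ennreal M * ennreal (exponential_density (\<alpha> - \<beta>) y) + ennreal M * ennreal (exponential_density (\<alpha> + \<beta>) (0 - y))) * ennreal (Gamma (1 - \<beta>)) \<partial>lborel)"
  proof (intro nn_integral_mono mult_right_mono)
    fix y :: real
    have "ennreal (stieltjes_density \<alpha> b c y * exp y powr \<beta>) \<le> ennreal (M * exponential_density (\<alpha> - \<beta>) y + M * exponential_density (\<alpha> + \<beta>) (0 - y))"
      by (intro ennreal_leI bound)
    also have "\<dots> = ennreal (M * exponential_density (\<alpha> - \<beta>) y) + ennreal (M * exponential_density (\<alpha> + \<beta>) (0 - y))"
      using M0 exponential_density_nonneg[of "\<alpha> + \<beta>" "0 - y"] exponential_density_nonneg[of "\<alpha> - \<beta>" y] \<alpha> \<beta>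
      by (intro ennreal_plus) auto
    finally show "ennreal (stieltjes_density \<alpha> b c y * exp y powr \<beta>) \<le> ennreal M * ennreal (exponential_density (\<alpha> - \<beta>) y) + ennreal M * ennreal (exponential_density (\<alpha> + \<beta>) (0 - y))"
      using M0 by (simp add: ennreal_mult')
  qed simp
  also have "\<dots> = (ennreal M * 1 + ennreal M * 1) * ennreal (Gamma (1 - \<beta>))"
  proof -
    have "(\<integral>\<^sup>+y. ennreal (exponential_density (\<alpha> + \<beta>) (0 - y)) \<partial>lborel) = 1"
      using lborel_nn_integral_shift(3)[of "\<lambda>y. ennreal (exponential_density (\<alpha> + \<beta>) y)" "0::real"] exponential_density_nn_integral[of "\<alpha> + \<beta>"] \<alpha> \<beta> by simp
    moreover have "(\<integral>\<^sup>+y. ennreal (exponential_density (\<alpha> - \<beta>) y) \<partial>lborel) = 1"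
      using exponential_density_nn_integral[of "\<alpha> - \<beta>"] \<beta> by simp
    ultimately show ?thesis
      by (subst nn_integral_multc, measurable) (subst nn_integral_add, measurable, simp add: nn_integral_cmult)
  qed
  also have "\<dots> < \<infinity>" by (simp add: ennreal_mult_less_top flip: ennreal_plus)
  finally show ?thesis .
qed

lemma heat_conv_kernel:
  assumes t: "t > 0"
  shows "conv_kernel (heat_kernel t :: 'a::euclidean_space \<Rightarrow> real)" "conv_kernel.mass (heat_kernel t :: 'a \<Rightarrow> real) = 1"
proof -
  show *: "conv_kernel (heat_kernel t :: 'a \<Rightarrow> real)"
    using heat_kernel_integral[OF t, where 'a='a] by unfold_locales auto
  show "conv_kernel.mass (heat_kernel t :: 'a \<Rightarrow> real) = 1"
    using heat_kernel_integral[OF t, where 'a='a] by (simp add: conv_kernel.mass_def[OF *])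
qed

text \<open>Together with \<open>optimize_bound\<close> this replaces the \<open>L\<^sup>2\<close>--\<open>L\<^sup>q\<close> heat estimate: integrating against the
  subordination density leaves only its moment of order \<open>- n \<delta> / (4 (1 + \<delta>))\<close>, and the free
  parameter \<open>m\<close> is optimised pointwise afterwards.\<close>

lemma interpolation_pointwise:
  fixes v m n \<delta> t :: real
  assumes v: "v \<ge> 0" and m: "m > 0" and \<delta>: "\<delta> > 0" and t: "t > 0" and vt: "v\<^sup>2 \<le> t powr (- n / 2)"
  shows "v \<le> t powr - (n * \<delta> / (4 * (1 + \<delta>))) * (m + m powr (1 - 2 * (1 + \<delta>)) * v\<^sup>2)"
proof (cases "v = 0")
  case False
  then have v0: "v > 0" using v by simp
  \<comment> \<open>Write v as v^(1-p) times v^p. The first factor is controlled by the decay in t;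
    the second, called w, satisfies w^q = v^2, and v^2 is what integrates over x.\<close>
  define p where "p = 1 / (1 + \<delta>)"
  define q where "q = 2 * (1 + \<delta>)"
  have pq: "p * q = 2" "1 - p = \<delta> / (1 + \<delta>)" "q > 1" using \<delta> by (auto simp: p_def q_def field_simps)
  have "v powr (1 - p) = (v\<^sup>2) powr ((1 - p) / 2)" using v0 by (simp add: powr_powr diff_divide_distrib flip: powr_numeral)
  also have "\<dots> \<le> (t powr (- n / 2)) powr ((1 - p) / 2)"
    using vt pq \<delta> by (intro powr_mono2) auto
  also have "\<dots> = t powr - (n * \<delta> / (4 * (1 + \<delta>)))"
    unfolding powr_powr pq(2) using \<delta> by (simp add: field_simps)
  finally have 1: "v powr (1 - p) \<le> t powr - (n * \<delta> / (4 * (1 + \<delta>)))" .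
  define w where "w = v powr p"
  have w: "w > 0" unfolding w_def using v0 by simp
  have wq: "w powr q = v\<^sup>2" unfolding w_def powr_powr pq using v0 by (simp add: powr_numeral)
  \<comment> \<open>Either w is at most m, or w > m and then w = m^(1-q) m^(q-1) w is at most
    m^(1-q) w^q. This splits a power below the square into a constant and a square.\<close>
  have 2: "w \<le> m + m powr (1 - q) * v\<^sup>2"
  proof (cases "w \<le> m")
    case True
    then show ?thesis by (simp add: add_increasing2)
  next
    case False
    have "m powr (q - 1) \<le> w powr (q - 1)" using False m pq by (intro powr_mono2) auto
    then have le: "w * (m powr (1 - q) * m powr (q - 1)) \<le> w * (m powr (1 - q) * w powr (q - 1))"
      using w by (intro mult_left_mono) auto
    have "m powr (1 - q) * m powr (q - 1) = 1" using m by (simp flip: powr_add)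
    then have "w = w * (m powr (1 - q) * m powr (q - 1))" by simp
    also note le
    also have "w * (m powr (1 - q) * w powr (q - 1)) = m powr (1 - q) * (w * w powr (q - 1))"
      by (rule mult.left_commute)
    also have "w * w powr (q - 1) = v\<^sup>2" using w wq by (simp add: powr_mult_base)
    finally have "w \<le> m powr (1 - q) * v\<^sup>2" .
    then show ?thesis using m by simp
  qed
  have "v = v powr (1 - p) * w" unfolding w_def using v0 by (simp flip: powr_add)
  also have "\<dots> \<le> t powr - (n * \<delta> / (4 * (1 + \<delta>))) * (m + m powr (1 - q) * v\<^sup>2)"
    using 1 2 w by (intro mult_mono) auto
  finally show ?thesis unfolding q_def .
qed (use m in simp)

text \<open>With m = x / (2 Z) the term m Z equals x / 2 and is absorbed on the left; what remains
  is solved for x^q.\<close>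

lemma optimize_bound:
  fixes x Z i q :: real
  assumes x: "x \<ge> 0" and Z: "Z > 0" and i: "i \<ge> 0" and le: "\<And>m. m > 0 \<Longrightarrow> x \<le> m * Z + m powr (1 - q) * i"
  shows "x powr q \<le> 2 * (2 * Z) powr (q - 1) * i"
proof (cases "x = 0")
  case False
  then have x0: "x > 0" using x by simp
  have "x \<le> x / (2 * Z) * Z + (x / (2 * Z)) powr (1 - q) * i" using x0 Z by (intro le) auto
  then have "x / 2 \<le> (x / (2 * Z)) powr (1 - q) * i" using Z by simp
  also have "(x / (2 * Z)) powr (1 - q) = x powr (1 - q) * (2 * Z) powr (q - 1)"
  proof -
    have "(2 * Z) powr (q - 1) = inverse ((2 * Z) powr (1 - q))"
      using powr_minus[of "2 * Z" "1 - q"] by simp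
    moreover have "(x / (2 * Z)) powr (1 - q) = x powr (1 - q) / (2 * Z) powr (1 - q)"
      by (rule powr_divide)
    ultimately show ?thesis by (simp only: divide_inverse)
  qed
  finally have le2: "x powr (q - 1) * (x / 2) \<le> x powr (q - 1) * (x powr (1 - q) * (2 * Z) powr (q - 1) * i)"
    by (intro mult_left_mono) auto
  have "x powr (q - 1) * x powr (1 - q) = 1" using x0 by (simp flip: powr_add)
  then have e1: "x powr (q - 1) * (x powr (1 - q) * (2 * Z) powr (q - 1) * i) = (2 * Z) powr (q - 1) * i"
    by (simp only: mult.assoc[symmetric] mult_1)
  have e2: "x powr (q - 1) * (x / 2) = x powr q / 2" using x0 by (simp add: powr_mult_base mult.commute)
  show ?thesis using le2 unfolding e1 e2 by simp
qed (use assms in simp)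

text \<open>Cauchy-Schwarz, with the square of the kernel bounded by its maximum times itself, whose
  integral is 1. The factor 4 \<pi> is dropped because it is at least 1 and the exponent is
  negative.\<close>

lemma heat_sup_bound:
  fixes F :: "'a::euclidean_space \<Rightarrow> real"
  assumes t: "t > 0" and [measurable]: "F \<in> borel_measurable borel" and F0: "\<And>y. F y \<ge> 0"
    and F2: "(\<integral>\<^sup>+y. ennreal ((F y)\<^sup>2) \<partial>lborel) \<le> 1"
  shows "(\<integral>\<^sup>+y. ennreal (heat_kernel t (x - y) * F y) \<partial>lborel)\<^sup>2 \<le> ennreal (t powr (- real DIM('a) / 2))"
proof -
  let ?h = "\<lambda>y. heat_kernel t (x - y)"
  let ?K = "(4 * pi * t) powr (- real DIM('a) / 2)"
  have "(\<integral>\<^sup>+y. ennreal (?h y * F y) \<partial>lborel)\<^sup>2 = (\<integral>\<^sup>+y. ennreal (?h y) * ennreal (F y) \<partial>lborel)\<^sup>2"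
    using F0 by (simp add: ennreal_mult)
  also have "\<dots> \<le> (\<integral>\<^sup>+y. (ennreal (?h y))\<^sup>2 \<partial>lborel) * (\<integral>\<^sup>+y. (ennreal (F y))\<^sup>2 \<partial>lborel)"
    by (rule Cauchy_Schwarz_nn_integral) measurable
  also have "(\<integral>\<^sup>+y. (ennreal (F y))\<^sup>2 \<partial>lborel) = (\<integral>\<^sup>+y. ennreal ((F y)\<^sup>2) \<partial>lborel)"
    using F0 by (simp add: ennreal_power)
  also have "(\<integral>\<^sup>+y. (ennreal (?h y))\<^sup>2 \<partial>lborel) \<le> (\<integral>\<^sup>+y. ennreal ?K * ennreal (?h y) \<partial>lborel)"
    unfolding power2_eq_square by (intro nn_integral_mono mult_right_mono ennreal_leI heat_kernel_le[OF t]) auto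
  also have "\<dots> = ennreal ?K * (\<integral>\<^sup>+y. ennreal (?h y) \<partial>lborel)"
    by (rule nn_integral_cmult) measurable
  also have "(\<integral>\<^sup>+y. ennreal (?h y) \<partial>lborel) = 1"
    using lborel_nn_integral_shift(3)[of "\<lambda>y. ennreal (heat_kernel t y)" x] heat_kernel_nn_integral[OF t, where 'a='a] by simp
  finally have "(\<integral>\<^sup>+y. ennreal (?h y * F y) \<partial>lborel)\<^sup>2 \<le> ennreal ?K * 1 * 1"
    using F2 by (meson mult_left_mono order_trans zero_le mult_right_mono)
  also have "\<dots> \<le> ennreal (t powr (- real DIM('a) / 2))"
  proof -
    have "4 * pi * t \<ge> t" using t pi_ge_two by (simp add: mult_le_cancel_right1) 
    then have "?K \<le> t powr (- real DIM('a) / 2)" using t by (intro powr_mono2') auto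
    then show ?thesis by (simp add: ennreal_leI)
  qed
  finally show ?thesis .
qed

text \<open>The convolution is dominated by the average over t of the heat evolutions
  \<open>Q t x\<close> of |f|. The pointwise interpolation bounds this average by m Z + m^(1-q)
  I(x), where \<open>I\<close> is a weighted average of \<open>(Q t x)\<^sup>2\<close> whose
  integral is at most Z, as the heat semigroup contracts L^2. Optimising m separately at each x
  leaves a multiple of I(x), which is integrated.\<close>

lemma resolvent_smoothing:
  assumes \<alpha>: "0 < \<alpha>" "\<alpha> < 1 / 2" and b: "b > 0" and c: "c > 0" and \<delta>: "\<delta> > 0"
    and \<beta>: "real DIM('a::euclidean_space) * \<delta> / (4 * (1 + \<delta>)) < \<alpha>"
  shows "\<exists>C0>0. \<forall>f::'a \<Rightarrow> real. f \<in> Lp_space 2 \<longrightarrow> sq_norm f \<le> 1 \<longrightarrow>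
    (\<integral>\<^sup>+x. ennreal (\<bar>convolve (resolvent_kernel \<alpha> b c) f x\<bar> powr (2 * (1 + \<delta>))) \<partial>lebesgue) \<le> ennreal C0"
proof -
  define \<beta>0 where "\<beta>0 = real DIM('a) * \<delta> / (4 * (1 + \<delta>))"
  have \<beta>0: "0 < \<beta>0" "\<beta>0 < \<alpha>" using \<beta> \<delta> by (auto simp: \<beta>0_def)
  define q where "q = 2 * (1 + \<delta>)"
  let ?\<phi> = "subord_density \<alpha> b c"
  let ?K = "resolvent_kernel \<alpha> b c :: 'a \<Rightarrow> real"
  note \<phi>m [measurable] = subord_density_measurable[OF \<alpha> b c]
  have \<phi>0: "?\<phi> t \<ge> 0" for t by (rule subord_density_nonneg[OF \<alpha> b c])
  interpret conv_kernel ?K by (rule resolvent_kernel_conv[OF \<alpha> b c])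
  obtain Z0 where Z0: "(\<integral>\<^sup>+t. ennreal (?\<phi> t) * ennreal (t powr - \<beta>0) \<partial>lborel) = ennreal Z0" "Z0 \<ge> 0"
    using subord_density_neg_moment_finite[OF \<alpha> b c \<beta>0]
    by (cases "\<integral>\<^sup>+t. ennreal (?\<phi> t) * ennreal (t powr - \<beta>0) \<partial>lborel") auto
  \<comment> \<open>The moment is only known to be nonnegative; adding 1 makes it positive, as the
    optimisation divides by it.\<close>
  define Z where "Z = Z0 + 1"
  have Z: "Z > 0" "Z0 \<le> Z" using Z0 by (auto simp: Z_def)
  define C1 where "C1 = 2 * (2 * Z) powr (q - 1)"
  have C1: "C1 > 0" using Z by (simp add: C1_def)
  have "(\<integral>\<^sup>+x. ennreal (\<bar>convolve ?K f x\<bar> powr q) \<partial>lebesgue) \<le> ennreal (C1 * Z)"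
    if f: "f \<in> Lp_space 2" "sq_norm f \<le> 1" for f :: "'a \<Rightarrow> real"
  proof -
    have fm: "f \<in> borel_measurable lebesgue" using f by (simp add: Lp_space_2_iff)
    obtain f' where f' [measurable]: "f' \<in> borel_measurable borel" and ae: "AE x in lebesgue. f x = f' x"
      using borel_rep_euclidean[OF fm] .
    have f'2: "(\<integral>\<^sup>+y. ennreal (\<bar>f' y\<bar>\<^sup>2) \<partial>lborel) \<le> 1"
      using f(2) sq_norm_cong_AE'[OF ae] sq_norm_lborel[OF f'] by simp
    define Q where "Q t x = (\<integral>\<^sup>+y. ennreal (heat_kernel t (x - y) * \<bar>f' y\<bar>) \<partial>lborel)" for t x
    have hm3: "(\<lambda>p. heat_kernel (fst (fst p)) (snd (fst p) - snd p :: 'a)) \<in> borel_measurable ((borel \<Otimes>\<^sub>M borel) \<Otimes>\<^sub>M borel)"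
      unfolding heat_kernel_def by measurable
    have Qm: "(\<lambda>p. Q (fst p) (snd p)) \<in> borel_measurable (borel \<Otimes>\<^sub>M borel)"
    proof -
      have "(\<lambda>p. \<integral>\<^sup>+y. ennreal (heat_kernel (fst p) (snd p - y) * \<bar>f' y\<bar>) \<partial>lborel) \<in> borel_measurable (borel \<Otimes>\<^sub>M borel)"
        by (rule lborel.borel_measurable_nn_integral) (use hm3 in \<open>simp add: case_prod_beta'\<close>)
      then show ?thesis by (simp add: Q_def)
    qed
    have Qm1 [measurable]: "(\<lambda>t. Q t x) \<in> borel_measurable borel" for x
      using measurable_compose[OF _ Qm, of "\<lambda>t. (t, x)" borel] by simp
    have Qm2 [measurable]: "(\<lambda>x. Q t x) \<in> borel_measurable borel" for t
      using measurable_compose[OF _ Qm, of "\<lambda>x. (t, x)" borel] by simp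
    define I where "I x = (\<integral>\<^sup>+t. ennreal (?\<phi> t) * ennreal (t powr - \<beta>0) * (Q t x)\<^sup>2 \<partial>lborel)" for x
    define G where "G x = (\<integral>\<^sup>+t. ennreal (?\<phi> t) * Q t x \<partial>lborel)" for x
    have Im [measurable]: "I \<in> borel_measurable borel"
      unfolding I_def by (rule lborel.borel_measurable_nn_integral)
        (use measurable_compose[OF measurable_pair_swap' Qm] in \<open>simp add: case_prod_beta'\<close>)
    have Q2: "(Q t x)\<^sup>2 \<le> ennreal (t powr (- real DIM('a) / 2))" if "t > 0" for t x
      unfolding Q_def by (rule heat_sup_bound[OF that]) (use f'2 in auto)
    have QI: "(\<integral>\<^sup>+x. (Q t x)\<^sup>2 \<partial>lborel) \<le> 1" if "t > 0" for t
    proof -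
      have "(\<integral>\<^sup>+x. (Q t x)\<^sup>2 \<partial>lborel) \<le> ennreal (1\<^sup>2) * (\<integral>\<^sup>+y. ennreal (\<bar>f' y\<bar>\<^sup>2) \<partial>lborel)"
        using conv_kernel.young_L2_nn[OF heat_conv_kernel(1)[OF that], of "\<lambda>y. \<bar>f' y\<bar>"] heat_conv_kernel(2)[OF that, where 'a='a]
        unfolding Q_def by simp
      then show ?thesis using f'2 by simp
    qed
    have GI: "G x \<le> ennreal m * ennreal Z + ennreal (m powr (1 - q)) * I x" if m: "m > 0" for m x
    proof -
      have "G x \<le> (\<integral>\<^sup>+t. ennreal m * (ennreal (?\<phi> t) * ennreal (t powr - \<beta>0)) + ennreal (m powr (1 - q)) * (ennreal (?\<phi> t) * ennreal (t powr - \<beta>0) * (Q t x)\<^sup>2) \<partial>lborel)"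
        unfolding G_def
      proof (rule nn_integral_mono_AE)
        show "AE t in lborel. ennreal (?\<phi> t) * Q t x \<le> ennreal m * (ennreal (?\<phi> t) * ennreal (t powr - \<beta>0)) + ennreal (m powr (1 - q)) * (ennreal (?\<phi> t) * ennreal (t powr - \<beta>0) * (Q t x)\<^sup>2)"
          using subord_density_AE_pos[OF \<alpha> b c]
        proof eventually_elim
          case (elim t)
          show ?case
          proof (cases "t > 0")
            case True
            have "(Q t x)\<^sup>2 < \<infinity>" using Q2[OF True, of x] by (rule le_less_trans) simp
            then obtain v where v: "Q t x = ennreal v" "v \<ge> 0" by (cases "Q t x") (auto simp: power2_eq_square)
            have v2: "v\<^sup>2 \<le> t powr (- real DIM('a) / 2)" using Q2[OF True, of x] v by (simp add: ennreal_power)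
            have "v \<le> t powr - \<beta>0 * (m + m powr (1 - q) * v\<^sup>2)"
              unfolding \<beta>0_def q_def using v m \<delta> True v2 by (intro interpolation_pointwise) auto
            then have "?\<phi> t * v \<le> ?\<phi> t * (t powr - \<beta>0 * (m + m powr (1 - q) * v\<^sup>2))"
              using \<phi>0 by (intro mult_left_mono)
            also have "\<dots> = m * (?\<phi> t * t powr - \<beta>0) + m powr (1 - q) * (?\<phi> t * t powr - \<beta>0 * v\<^sup>2)"
              by (simp add: algebra_simps)
            finally have "ennreal (?\<phi> t * v) \<le> ennreal (m * (?\<phi> t * t powr - \<beta>0) + m powr (1 - q) * (?\<phi> t * t powr - \<beta>0 * v\<^sup>2))"
              by (rule ennreal_leI)
            also have "\<dots> = ennreal m * (ennreal (?\<phi> t) * ennreal (t powr - \<beta>0)) + ennreal (m powr (1 - q)) * (ennreal (?\<phi> t) * ennreal (t powr - \<beta>0) * ennreal (v\<^sup>2))"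
              using m \<phi>0 v by (simp add: ennreal_mult)
            finally show ?thesis using v \<phi>0 by (simp add: ennreal_mult ennreal_power)
          qed (use elim in simp)
        qed
      qed
      also have "\<dots> = ennreal m * ennreal Z0 + ennreal (m powr (1 - q)) * I x"
      proof -
        define u where "u t = ennreal (?\<phi> t) * ennreal (t powr - \<beta>0)" for t
        define w where "w t = u t * (Q t x)\<^sup>2" for t
        have um: "u \<in> borel_measurable lborel" unfolding u_def by simp
        have wm: "w \<in> borel_measurable lborel" unfolding w_def using um Qm1[of x] by simp
        have "(\<integral>\<^sup>+t. ennreal m * u t + ennreal (m powr (1 - q)) * w t \<partial>lborel)
          = (\<integral>\<^sup>+t. ennreal m * u t \<partial>lborel) + (\<integral>\<^sup>+t. ennreal (m powr (1 - q)) * w t \<partial>lborel)"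
          using um wm by (intro nn_integral_add) simp_all
        also have "\<dots> = ennreal m * (\<integral>\<^sup>+t. u t \<partial>lborel) + ennreal (m powr (1 - q)) * (\<integral>\<^sup>+t. w t \<partial>lborel)"
          using nn_integral_cmult[OF um] nn_integral_cmult[OF wm] by simp
        finally show ?thesis unfolding I_def Z0(1)[symmetric] u_def w_def .
      qed
      also have "\<dots> \<le> ennreal m * ennreal Z + ennreal (m powr (1 - q)) * I x"
        using Z by (intro add_right_mono mult_left_mono ennreal_leI) auto
      finally show ?thesis .
    qed
    have II: "(\<integral>\<^sup>+x. I x \<partial>lborel) \<le> ennreal Z"
    proof -
      have "(\<integral>\<^sup>+x. I x \<partial>lborel) = (\<integral>\<^sup>+t. \<integral>\<^sup>+x. ennreal (?\<phi> t) * ennreal (t powr - \<beta>0) * (Q t x)\<^sup>2 \<partial>lborel \<partial>lborel)"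
        unfolding I_def by (rule lborel_pair.Fubini') (use Qm in \<open>simp add: case_prod_beta'\<close>)
      also have "\<dots> \<le> (\<integral>\<^sup>+t. ennreal (?\<phi> t) * ennreal (t powr - \<beta>0) \<partial>lborel)"
      proof (rule nn_integral_mono_AE)
        show "AE t in lborel. (\<integral>\<^sup>+x. ennreal (?\<phi> t) * ennreal (t powr - \<beta>0) * (Q t x)\<^sup>2 \<partial>lborel) \<le> ennreal (?\<phi> t) * ennreal (t powr - \<beta>0)"
          using subord_density_AE_pos[OF \<alpha> b c]
        proof eventually_elim
          case (elim t)
          have "(\<integral>\<^sup>+x. ennreal (?\<phi> t) * ennreal (t powr - \<beta>0) * (Q t x)\<^sup>2 \<partial>lborel) = ennreal (?\<phi> t) * ennreal (t powr - \<beta>0) * (\<integral>\<^sup>+x. (Q t x)\<^sup>2 \<partial>lborel)"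
            by (rule nn_integral_cmult) measurable
          also have "\<dots> \<le> ennreal (?\<phi> t) * ennreal (t powr - \<beta>0) * 1"
          proof (cases "t > 0")
            case True
            then show ?thesis by (intro mult_left_mono QI) auto
          qed (use elim in simp)
          finally show ?case by simp
        qed
      qed
      also have "\<dots> \<le> ennreal Z" unfolding Z0(1) using Z by (intro ennreal_leI)
      finally show ?thesis .
    qed
    have cG: "ennreal \<bar>convolve ?K f x\<bar> \<le> G x" for x
    proof -
      have K: "ennreal (?K z) \<le> (\<integral>\<^sup>+t. ennreal (?\<phi> t * heat_kernel t z) \<partial>lborel)" for z
      proof (cases "integrable lborel (\<lambda>t. ?\<phi> t * heat_kernel t z)")
        case True
        then show ?thesis unfolding resolvent_kernel_def
          using \<phi>0 by (subst nn_integral_eq_integral) auto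
      qed (simp add: resolvent_kernel_def not_integrable_integral_eq)
      have "ennreal \<bar>convolve ?K f x\<bar> \<le> (\<integral>\<^sup>+y. ennreal (norm (?K (x - y) *\<^sub>R f' y)) \<partial>lborel)"
        unfolding convolve_cong_AE[OF fm ae] convolve_borel[OF f'] real_norm_def[symmetric]
      proof (cases "integrable lborel (\<lambda>y. ?K (x - y) *\<^sub>R f' y)")
        case True
        then show "ennreal (norm (\<integral>y. ?K (x - y) *\<^sub>R f' y \<partial>lborel)) \<le> (\<integral>\<^sup>+y. ennreal (norm (?K (x - y) *\<^sub>R f' y)) \<partial>lborel)"
          by (rule integral_norm_bound_ennreal)
      qed (simp add: not_integrable_integral_eq)
      also have "\<dots> \<le> (\<integral>\<^sup>+y. (\<integral>\<^sup>+t. ennreal (?\<phi> t * heat_kernel t (x - y)) \<partial>lborel) * ennreal \<bar>f' y\<bar> \<partial>lborel)"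
        using K kernel_nonneg by (intro nn_integral_mono) (simp add: abs_mult ennreal_mult mult_right_mono)
      also have "\<dots> = (\<integral>\<^sup>+y. \<integral>\<^sup>+t. ennreal (?\<phi> t * heat_kernel t (x - y)) * ennreal \<bar>f' y\<bar> \<partial>lborel \<partial>lborel)"
      proof (intro nn_integral_cong nn_integral_multc[symmetric])
        fix y :: 'a
        show "(\<lambda>t. ennreal (?\<phi> t * heat_kernel t (x - y))) \<in> borel_measurable lborel"
          unfolding heat_kernel_def by measurable
      qed
      also have "\<dots> = (\<integral>\<^sup>+t. \<integral>\<^sup>+y. ennreal (?\<phi> t * heat_kernel t (x - y)) * ennreal \<bar>f' y\<bar> \<partial>lborel \<partial>lborel)"
      proof (rule lborel_pair.Fubini')
        have "(\<lambda>p. heat_kernel (fst p) (x - snd p)) \<in> borel_measurable (borel \<Otimes>\<^sub>M borel)"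
          unfolding heat_kernel_def by measurable
        then show "(\<lambda>(t, y). ennreal (?\<phi> t * heat_kernel t (x - y)) * ennreal \<bar>f' y\<bar>) \<in> borel_measurable (lborel \<Otimes>\<^sub>M lborel)"
          by (simp add: case_prod_beta')
      qed
      also have "\<dots> = G x" unfolding G_def Q_def
      proof (rule nn_integral_cong)
        fix t :: real
        have "(\<integral>\<^sup>+y. ennreal (?\<phi> t * heat_kernel t (x - y)) * ennreal \<bar>f' y\<bar> \<partial>lborel) = (\<integral>\<^sup>+y. ennreal (?\<phi> t) * ennreal (heat_kernel t (x - y) * \<bar>f' y\<bar>) \<partial>lborel)"
          using \<phi>0 by (intro nn_integral_cong) (simp add: ennreal_mult mult.assoc)
        also have "\<dots> = ennreal (?\<phi> t) * (\<integral>\<^sup>+y. ennreal (heat_kernel t (x - y) * \<bar>f' y\<bar>) \<partial>lborel)"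
          by (rule nn_integral_cmult) measurable
        finally show "(\<integral>\<^sup>+y. ennreal (?\<phi> t * heat_kernel t (x - y)) * ennreal \<bar>f' y\<bar> \<partial>lborel) = ennreal (?\<phi> t) * (\<integral>\<^sup>+y. ennreal (heat_kernel t (x - y) * \<bar>f' y\<bar>) \<partial>lborel)" .
      qed
      finally show ?thesis .
    qed
    \<comment> \<open>The optimisation is a statement about real numbers, so points with I(x)
      infinite have to be discarded before it.\<close>
    have "AE x in lborel. I x \<noteq> \<infinity>"
      using II by (intro nn_integral_PInf_AE) (auto simp: top_unique)
    then have le: "AE x in lborel. ennreal (\<bar>convolve ?K f x\<bar> powr q) \<le> ennreal C1 * I x"
    proof eventually_elim
      case (elim x)
      then obtain i where i: "I x = ennreal i" "i \<ge> 0" by (cases "I x") auto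
      have "\<bar>convolve ?K f x\<bar> \<le> m * Z + m powr (1 - q) * i" if m: "m > 0" for m
      proof -
        have "ennreal \<bar>convolve ?K f x\<bar> \<le> ennreal m * ennreal Z + ennreal (m powr (1 - q)) * ennreal i"
          using order_trans[OF cG[of x] GI[OF m, of x]] by (simp only: i(1))
        also have "\<dots> = ennreal (m * Z + m powr (1 - q) * i)" using m Z i by (simp add: ennreal_mult)
        finally show ?thesis using m Z i by (subst (asm) ennreal_le_iff) auto
      qed
      then have "\<bar>convolve ?K f x\<bar> powr q \<le> C1 * i"
        unfolding C1_def using Z i by (intro optimize_bound) auto
      then show ?case using i C1 by (simp add: ennreal_leI flip: ennreal_mult)
    qed
    have cm: "convolve ?K f \<in> borel_measurable borel" by (rule convolve_measurable[OF fm])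
    have "(\<integral>\<^sup>+x. ennreal (\<bar>convolve ?K f x\<bar> powr q) \<partial>lebesgue) = (\<integral>\<^sup>+x. ennreal (\<bar>convolve ?K f x\<bar> powr q) \<partial>lborel)"
      by (rule nn_integral_completion)
    also have "\<dots> \<le> (\<integral>\<^sup>+x. ennreal C1 * I x \<partial>lborel)" by (rule nn_integral_mono_AE[OF le])
    also have "\<dots> = ennreal C1 * (\<integral>\<^sup>+x. I x \<partial>lborel)" by (rule nn_integral_cmult) measurable
    also have "\<dots> \<le> ennreal C1 * ennreal Z" by (intro mult_left_mono II) auto
    also have "\<dots> = ennreal (C1 * Z)" using C1 Z by (simp add: ennreal_mult)
    finally show ?thesis .
  qed
  moreover have "C1 * Z > 0" using C1 Z by simp
  ultimately show ?thesis unfolding q_def by blast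
qed

section \<open>Monotone iteration\<close>

lemma Lp2_dominated:
  fixes f :: "'a::euclidean_space \<Rightarrow> 'b::{real_normed_vector, second_countable_topology}" and F :: "'a \<Rightarrow> real"
  assumes "f \<in> borel_measurable lebesgue" "F \<in> Lp_space 2" "AE x in lebesgue. norm (f x) \<le> F x"
  shows "f \<in> Lp_space 2"
proof -
  have "sq_norm f \<le> sq_norm F" using assms(3) by (intro sq_norm_mono_AE) (auto elim!: eventually_mono)
  then show ?thesis using assms(1,2) by (auto simp: Lp_space_2_iff intro: le_less_trans)
qed

lemma sq_norm_real_scale:
  fixes u :: "'a::euclidean_space \<Rightarrow> real"
  assumes "u \<in> borel_measurable lebesgue"
  shows "sq_norm (\<lambda>x. c * u x) = ennreal (c\<^sup>2) * sq_norm u"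
proof -
  have "(\<lambda>x. ennreal ((norm (u x))\<^sup>2)) \<in> borel_measurable lebesgue" using assms by simp
  from nn_integral_cmult[OF this, of "ennreal (c\<^sup>2)"] show ?thesis
    unfolding sq_norm_def by (simp add: power_mult_distrib ennreal_mult)
qed

lemma Lp2_real_scale:
  "u \<in> Lp_space 2 \<Longrightarrow> (\<lambda>x. c * u x) \<in> Lp_space 2" for u :: "'a::euclidean_space \<Rightarrow> real"
  using sq_norm_real_scale[of u c] by (auto simp: Lp_space_2_iff ennreal_mult_less_top)

lemma Lp2_of_real:
  "u \<in> Lp_space 2 \<Longrightarrow> (\<lambda>x. complex_of_real (u x)) \<in> Lp_space 2" for u :: "'a::euclidean_space \<Rightarrow> real"
  by (auto simp: Lp_space_2_iff sq_norm_def)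

text \<open>\<open>lim\<close> is a function of the sequence alone, so equal sequences have equal
  values even where they diverge; symmetry of the limit is therefore exact.\<close>

lemma spherically_symmetric_lim:
  assumes "\<And>n. spherically_symmetric (u n)"
  shows "spherically_symmetric (\<lambda>x. lim (\<lambda>n. u n x :: real))"
  unfolding spherically_symmetric_def
proof (intro allI impI)
  fix x x' :: 'a assume "norm x = norm x'"
  then have "u n x = u n x'" for n using assms[of n] unfolding spherically_symmetric_def by blast
  then show "lim (\<lambda>n. u n x) = lim (\<lambda>n. u n x')" by simp
qed

text \<open>Rounding u down to multiples of 1 / (n + 1) gives countably many values, so the
  composition is pasted from countably many measurable functions; continuity in the second argument
  passes to the limit.\<close>

lemma caratheodory_measurable:
  fixes V :: "'a::euclidean_space \<Rightarrow> real \<Rightarrow> real"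
  assumes V: "\<And>y. (\<lambda>x. V x y) \<in> borel_measurable lebesgue" and cont: "\<And>x. continuous_on UNIV (V x)"
    and u: "u \<in> borel_measurable lebesgue"
  shows "(\<lambda>x. V x (u x)) \<in> borel_measurable lebesgue"
proof (rule borel_measurable_LIMSEQ_real)
  let ?v = "\<lambda>n x. real_of_int \<lfloor>real (Suc n) * u x\<rfloor> / real (Suc n)"
  show "(\<lambda>n. V x (?v n x)) \<longlonglongrightarrow> V x (u x)" for x
  proof -
    have "(\<lambda>n. ?v n x) \<longlonglongrightarrow> u x"
    proof (rule LIMSEQ_I)
      fix r :: real assume r: "r > 0"
      obtain m :: nat where m: "inverse (real (Suc m)) < r" using reals_Archimedean[OF r] by auto
      show "\<exists>no. \<forall>n\<ge>no. norm (?v n x - u x) < r"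
      proof (intro exI[of _ m] allI impI)
        fix n assume n: "m \<le> n"
        have "\<bar>real_of_int \<lfloor>real (Suc n) * u x\<rfloor> - real (Suc n) * u x\<bar> \<le> 1" by linarith
        then have "\<bar>real_of_int \<lfloor>real (Suc n) * u x\<rfloor> - real (Suc n) * u x\<bar> / real (Suc n) \<le> 1 / real (Suc n)"
          by (intro divide_right_mono) auto
        moreover have "?v n x - u x = (real_of_int \<lfloor>real (Suc n) * u x\<rfloor> - real (Suc n) * u x) / real (Suc n)"
          by (simp add: diff_divide_distrib del: of_nat_Suc)
        ultimately have "\<bar>?v n x - u x\<bar> \<le> inverse (real (Suc n))"
          by (simp only: abs_divide abs_of_nat inverse_eq_divide)
        also have "\<dots> \<le> inverse (real (Suc m))" using n by simp
        finally show "norm (?v n x - u x) < r" using m by simp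
      qed
    qed
    then show ?thesis by (rule continuous_on_tendsto_compose[OF cont]) auto
  qed
  show "(\<lambda>x. V x (?v n x)) \<in> borel_measurable lebesgue" for n
  proof -
    have "(\<lambda>x. real (Suc n) * u x) \<in> borel_measurable lebesgue" using u by simp
    then have "(\<lambda>x. \<lfloor>real (Suc n) * u x\<rfloor>) \<in> measurable lebesgue (count_space UNIV)"
      by (rule measurable_compose) (rule measurable_real_floor)
    from measurable_compose_countable[OF V this] show ?thesis .
  qed
qed

lemma convolve_real_cmult: "convolve g (\<lambda>x. c * h x) x = c * convolve g h x" for h :: "'a::euclidean_space \<Rightarrow> real"
  unfolding convolve_def real_scaleR_def mult.left_commute[of _ c] by (rule integral_mult_right_zero)

lemma continuous_le_on_Rats:
  fixes f g :: "real \<Rightarrow> real"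
  assumes "continuous_on UNIV f" "continuous_on UNIV g" "\<And>r. r \<in> \<rat> \<Longrightarrow> f r \<le> g r"
  shows "f y \<le> g y"
proof -
  have "closed {y. f y \<le> g y}" using assms(1,2) by (rule closed_Collect_le)
  then have "closure \<rat> \<subseteq> {y. f y \<le> g y}" using assms(3) by (intro closure_minimal) auto
  then show ?thesis by (auto simp: Rats_closure_real)
qed

section \<open>Fixed points of the resolvent: solutions below a barrier\<close>

context
  fixes \<alpha> b :: real
  assumes \<alpha>: "0 < \<alpha>" "\<alpha> < 1 / 2" and b: "b > 0"
begin

text \<open>The resolvent with zeroth-order coefficient 1 + k. For k = 0 it unfolds to the literal
  parameter \<open>1 + 0\<close>, the form in which it is quoted outside this context.\<close>

abbreviation res_op :: "real \<Rightarrow> ('a::euclidean_space \<Rightarrow> real) \<Rightarrow> 'a \<Rightarrow> real" where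
  "res_op k \<equiv> convolve (resolvent_kernel \<alpha> b (1 + k))"

lemma res_op_conv: "k \<ge> 0 \<Longrightarrow> conv_kernel (resolvent_kernel \<alpha> b (1 + k) :: 'a::euclidean_space \<Rightarrow> real)"
  by (rule resolvent_kernel_conv[OF \<alpha> b]) simp

lemma res_op_measurable: "k \<ge> 0 \<Longrightarrow> f \<in> borel_measurable lebesgue \<Longrightarrow> res_op k f \<in> borel_measurable lebesgue"
  by (rule conv_kernel.convolve_measurable_lebesgue[OF res_op_conv])

lemma res_op_Lp2: "k \<ge> 0 \<Longrightarrow> f \<in> Lp_space 2 \<Longrightarrow> res_op k f \<in> Lp_space 2"
  by (rule conv_kernel.convolve_Lp2[OF res_op_conv])

lemma res_op_mono:
  "k \<ge> 0 \<Longrightarrow> f \<in> Lp_space 2 \<Longrightarrow> f' \<in> Lp_space 2 \<Longrightarrow> AE x in lebesgue. f x \<le> f' x \<Longrightarrow>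
    AE x in lebesgue. res_op k f x \<le> res_op k f' x"
  by (rule conv_kernel.convolve_mono_AE[OF res_op_conv])

lemma res_op_radial:
  "k \<ge> 0 \<Longrightarrow> f \<in> borel_measurable lebesgue \<Longrightarrow> spherically_symmetric f \<Longrightarrow> spherically_symmetric (res_op k f)"
  by (rule conv_kernel.convolve_spherically_symmetric[OF res_op_conv]) (auto intro: resolvent_kernel_norm_cong)

lemma res_op_dominated:
  assumes "k \<ge> 0" "\<And>n. F n \<in> borel_measurable lebesgue" "f \<in> borel_measurable lebesgue" "W \<in> Lp_space 2"
    "\<And>n. AE x in lebesgue. \<bar>F n x\<bar> \<le> W x" "AE x in lebesgue. (\<lambda>n. F n x) \<longlonglongrightarrow> f x"
  shows "AE x in lebesgue. (\<lambda>n. res_op k (F n) x) \<longlonglongrightarrow> res_op k f x"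
  by (rule conv_kernel.convolve_dominated[OF res_op_conv[OF assms(1)] assms(2-6)])

lemma res_op_fourier:
  fixes f :: "'a::euclidean_space \<Rightarrow> real"
  assumes k: "k \<ge> 0" and fv: "L2_fourier (\<lambda>x. complex_of_real (f x)) v"
  shows "L2_fourier (\<lambda>x. complex_of_real (res_op k f x)) (\<lambda>\<xi>. complex_of_real (1 / (1 + k + b * norm \<xi> powr (2 * \<alpha>))) * v \<xi>)"
proof -
  have 1: "L2_fourier (convolve (resolvent_kernel \<alpha> b (1 + k)) (\<lambda>x. complex_of_real (f x)))
    (\<lambda>\<xi>. fourier_int (\<lambda>x. complex_of_real (resolvent_kernel \<alpha> b (1 + k) x)) \<xi> * v \<xi>)"
    by (rule conv_kernel.L2_fourier_convolve[OF res_op_conv[OF k] fv])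
  have "AE \<xi>::'a in lebesgue. \<xi> \<noteq> 0" using AE_lborel_singleton[of "0::'a"] by (rule AE_completion)
  then have 2: "AE \<xi>::'a in lebesgue. fourier_int (\<lambda>x. complex_of_real (resolvent_kernel \<alpha> b (1 + k) x)) \<xi> * v \<xi>
     = complex_of_real (1 / (1 + k + b * norm \<xi> powr (2 * \<alpha>))) * v \<xi>"
  proof eventually_elim
    case (elim \<xi>)
    have "fourier_int (\<lambda>x. complex_of_real (resolvent_kernel \<alpha> b (1 + k) x)) \<xi> = complex_of_real (1 / (1 + k + b * norm \<xi> powr (2 * \<alpha>)))"
      by (rule resolvent_kernel_symbol[OF \<alpha> b _ elim]) (use k in simp)
    then show ?case by (simp only:)
  qed
  show ?thesis
    by (rule L2_fourier_cong_AE[OF 1 _ 2]) (simp add: conv_kernel.convolve_of_real[OF res_op_conv[OF k]])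
qed

text \<open>Shifting the resolvent parameter by \<open>k\<close> adds \<open>k w\<close> to the right-hand side, which makes a
  nonlinearity with one-sided Lipschitz constant \<open>k\<close> increasing.\<close>

lemma resolvent_identity:
  fixes f w :: "'a::euclidean_space \<Rightarrow> real"
  assumes k: "k \<ge> 0" and f: "f \<in> Lp_space 2" and w: "w \<in> Lp_space 2"
  shows "(AE x in lebesgue. w x = res_op 0 f x) \<longleftrightarrow> (AE x in lebesgue. w x = res_op k (\<lambda>y. f y + k * w y) x)"
proof -
  obtain v z where v: "L2_fourier (\<lambda>x. complex_of_real (f x)) v" and z: "L2_fourier (\<lambda>x. complex_of_real (w x)) z"
    using L2_fourier_exists[OF Lp2_of_real[OF f]] L2_fourier_exists[OF Lp2_of_real[OF w]] by blast
  let ?s = "\<lambda>\<xi>::'a. b * norm \<xi> powr (2 * \<alpha>)"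
  have s: "?s \<xi> \<ge> 0" for \<xi> using b by simp
  have F0: "L2_fourier (\<lambda>x. complex_of_real (res_op 0 f x)) (\<lambda>\<xi>. complex_of_real (1 / (1 + 0 + ?s \<xi>)) * v \<xi>)"
    by (rule res_op_fourier[OF order_refl v])
  have "L2_fourier (\<lambda>x. complex_of_real (f x + k * w x)) (\<lambda>\<xi>. v \<xi> + complex_of_real k * z \<xi>)"
    using L2_fourier_linear[OF v z, of 1 "complex_of_real k"] by simp
  from res_op_fourier[OF k this]
  have Fk: "L2_fourier (\<lambda>x. complex_of_real (res_op k (\<lambda>y. f y + k * w y) x))
     (\<lambda>\<xi>. complex_of_real (1 / (1 + k + ?s \<xi>)) * (v \<xi> + complex_of_real k * z \<xi>))" .
  \<comment> \<open>Pointwise in the frequency both equations say that z times 1 + b |\<xi>|^(2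
    \<alpha>) equals v; the second one has k z added on either side.\<close>
  have alg: "z \<xi> = complex_of_real (1 / (1 + 0 + ?s \<xi>)) * v \<xi> \<longleftrightarrow>
     z \<xi> = complex_of_real (1 / (1 + k + ?s \<xi>)) * (v \<xi> + complex_of_real k * z \<xi>)" for \<xi>
  proof -
    define p where "p = complex_of_real (1 + ?s \<xi>)"
    define r where "r = complex_of_real (1 + k + ?s \<xi>)"
    have p: "p \<noteq> 0" "r \<noteq> 0" "r = p + complex_of_real k"
      using s[of \<xi>] k unfolding p_def r_def of_real_eq_0_iff by (auto simp: add_nonneg_eq_0_iff)
    have "z \<xi> = v \<xi> / p \<longleftrightarrow> z \<xi> * p = v \<xi>" using p by (simp add: eq_divide_eq)
    also have "\<dots> \<longleftrightarrow> z \<xi> * r = v \<xi> + complex_of_real k * z \<xi>" unfolding p(3) by (simp add: algebra_simps)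
    also have "\<dots> \<longleftrightarrow> z \<xi> = (v \<xi> + complex_of_real k * z \<xi>) / r" using p by (simp add: eq_divide_eq)
    finally show ?thesis unfolding p_def r_def by simp
  qed
  have "(AE x in lebesgue. w x = res_op 0 f x) \<longleftrightarrow> (AE \<xi> in lebesgue. z \<xi> = complex_of_real (1 / (1 + 0 + ?s \<xi>)) * v \<xi>)"
    using L2_fourier_fun[OF z F0] L2_fourier_inj[OF z F0] unfolding of_real_eq_iff by (rule iffI)
  also have "\<dots> \<longleftrightarrow> (AE \<xi> in lebesgue. z \<xi> = complex_of_real (1 / (1 + k + ?s \<xi>)) * (v \<xi> + complex_of_real k * z \<xi>))"
    unfolding alg ..
  also have "\<dots> \<longleftrightarrow> (AE x in lebesgue. w x = res_op k (\<lambda>y. f y + k * w y) x)"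
    using L2_fourier_inj[OF z Fk] L2_fourier_fun[OF z Fk] unfolding of_real_eq_iff by (rule iffI)
  finally show ?thesis .
qed

text \<open>U solves the equation with the largest right-hand side W, so positivity of the resolvent
  maps functions between - U and U back into that range, while the shift k makes the map monotone.
  Iteration from - U increases to a solution lying below every supersolution in the range. Clamping
  by \<open>cl\<close> supplies the bound and the symmetry at every point, as the operator
  inequalities hold only almost everywhere. Minimality is what allows solutions for different k to
  be compared later.\<close>

lemma minimal_solution:
  fixes U W :: "'a::euclidean_space \<Rightarrow> real" and N :: "'a \<Rightarrow> real \<Rightarrow> real"
  assumes k: "k \<ge> 0"
    and U: "U \<in> Lp_space 2" "spherically_symmetric U" "\<And>x. U x \<ge> 0" and W: "W \<in> Lp_space 2"
    and UW: "AE x in lebesgue. U x = res_op 0 W x"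
    and Nrad: "spherically_symmetric N"
    and Nm: "\<And>u. u \<in> borel_measurable lebesgue \<Longrightarrow> (\<lambda>x. N x (u x)) \<in> borel_measurable lebesgue"
    and Nb: "\<And>x y. \<bar>y\<bar> \<le> U x \<Longrightarrow> \<bar>N x y\<bar> \<le> W x"
    and Nmono: "\<And>x y y'. \<bar>y\<bar> \<le> U x \<Longrightarrow> \<bar>y'\<bar> \<le> U x \<Longrightarrow> y \<le> y' \<Longrightarrow> N x y + k * y \<le> N x y' + k * y'"
    and Nc: "\<And>x. continuous_on UNIV (N x)"
  shows "\<exists>u. u \<in> borel_measurable lebesgue \<and> spherically_symmetric u \<and> (\<forall>x. \<bar>u x\<bar> \<le> U x) \<and>
    (AE x in lebesgue. u x = res_op 0 (\<lambda>y. N y (u y)) x) \<and>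
    (\<forall>w. w \<in> borel_measurable lebesgue \<longrightarrow> (\<forall>x. \<bar>w x\<bar> \<le> U x) \<longrightarrow>
      (AE x in lebesgue. res_op k (\<lambda>y. N y (w y) + k * w y) x \<le> w x) \<longrightarrow> (AE x in lebesgue. u x \<le> w x))"
proof -
  define cl where "cl f x = max (- U x) (min (U x) (f x))" for f x
  define T where "T v = cl (res_op k (\<lambda>y. N y (v y) + k * v y))" for v
  define adm where "adm v \<longleftrightarrow> v \<in> borel_measurable lebesgue \<and> (\<forall>x. \<bar>v x\<bar> \<le> U x)" for v
  have Um: "U \<in> borel_measurable lebesgue" and Wm: "W \<in> borel_measurable lebesgue"
    using U W by (auto simp: Lp_space_2_iff)
  have clm: "cl f \<in> borel_measurable lebesgue" if "f \<in> borel_measurable lebesgue" for f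
    unfolding cl_def using that Um by (intro borel_measurable_max borel_measurable_min borel_measurable_uminus)
  have clb: "\<bar>cl f x\<bar> \<le> U x" for f x unfolding cl_def using U(3)[of x] by auto
  have clid: "cl f x = f x" if "\<bar>f x\<bar> \<le> U x" for f x unfolding cl_def using that by auto
  have clr: "spherically_symmetric (cl f)" if "spherically_symmetric f" for f
    using that U(2) unfolding spherically_symmetric_def cl_def by metis
  have WkU: "(\<lambda>x. W x + k * U x) \<in> Lp_space 2" using U W by (intro Lp2_add Lp2_real_scale)
  have W0: "W x \<ge> 0" for x using Nb[of 0 x] U(3)[of x] by (simp add: order_trans[OF abs_ge_zero])
  have Nfm: "(\<lambda>y. N y (v y) + k * v y) \<in> borel_measurable lebesgue" if "adm v" for v
    using that Nm[of v] unfolding adm_def by (intro borel_measurable_add borel_measurable_times borel_measurable_const) auto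
  have Nfb: "\<bar>N x (v x) + k * v x\<bar> \<le> W x + k * U x" if "adm v" for v x
  proof -
    have "\<bar>N x (v x)\<bar> \<le> W x" "\<bar>v x\<bar> \<le> U x" using that Nb unfolding adm_def by auto
    moreover have "\<bar>k * v x\<bar> \<le> k * U x" using k \<open>\<bar>v x\<bar> \<le> U x\<close> by (simp add: abs_mult mult_left_mono)
    ultimately show ?thesis by linarith
  qed
  have Nf: "(\<lambda>y. N y (v y) + k * v y) \<in> Lp_space 2" if "adm v" for v
    using Nfb[OF that] by (intro Lp2_dominated[OF Nfm[OF that] WkU]) auto
  have NL: "(\<lambda>y. N y (v y)) \<in> Lp_space 2" if "adm v" for v
    using that Nm[of v] Nb unfolding adm_def by (intro Lp2_dominated[OF _ W]) auto
  have vL: "v \<in> Lp_space 2" if "adm v" for v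
    using that unfolding adm_def by (intro Lp2_dominated[OF _ U(1)]) auto
  have Uk: "AE x in lebesgue. U x = res_op k (\<lambda>y. W y + k * U y) x"
    using resolvent_identity[OF k W U(1)] UW by simp
  \<comment> \<open>The shifted right-hand side lies between plus and minus W + k U, and the
    resolvent maps W + k U to U; so the clamp is inactive almost everywhere.\<close>
  have Teq: "AE x in lebesgue. T v x = res_op k (\<lambda>y. N y (v y) + k * v y) x" if v: "adm v" for v
  proof -
    have lo: "(- 1) * (W x + k * U x) \<le> N x (v x) + k * v x" and hi: "N x (v x) + k * v x \<le> W x + k * U x" for x
      using Nfb[OF v, of x] unfolding mult_minus1 abs_le_iff by linarith+
    have 1: "AE x in lebesgue. res_op k (\<lambda>y. N y (v y) + k * v y) x \<le> res_op k (\<lambda>y. W y + k * U y) x"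
      using hi by (intro res_op_mono[OF k Nf[OF v] WkU] AE_I2)
    have 2: "AE x in lebesgue. res_op k (\<lambda>y. (- 1) * (W y + k * U y)) x \<le> res_op k (\<lambda>y. N y (v y) + k * v y) x"
      using lo by (intro res_op_mono[OF k _ Nf[OF v]] Lp2_real_scale WkU AE_I2)
    have 3: "res_op k (\<lambda>y. (- 1) * (W y + k * U y)) x = - res_op k (\<lambda>y. W y + k * U y) x" for x
      using conv_kernel.convolve_minus[OF res_op_conv[OF k], of "\<lambda>y. W y + k * U y" x] by simp
    show ?thesis using 1 2 Uk
    proof eventually_elim
      case (elim x)
      have "\<bar>res_op k (\<lambda>y. N y (v y) + k * v y) x\<bar> \<le> U x"
        using elim(1,3) elim(2)[unfolded 3] by linarith
      then show ?case unfolding T_def by (rule clid)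
    qed
  qed
  have Tadm: "adm (T v)" if "adm v" for v
    unfolding adm_def T_def using clm[OF res_op_measurable[OF k Nfm[OF that]]] clb by auto
  have Nle: "AE x in lebesgue. N x (v x) + k * v x \<le> N x (v' x) + k * v' x" if "adm v" "adm v'" "AE x in lebesgue. v x \<le> v' x" for v v'
    using that(3) by eventually_elim (use that(1,2) Nmono in \<open>auto simp: adm_def\<close>)
  have Tmono: "AE x in lebesgue. T v x \<le> T v' x" if v: "adm v" "adm v'" "AE x in lebesgue. v x \<le> v' x" for v v'
    using res_op_mono[OF k Nf[OF v(1)] Nf[OF v(2)] Nle[OF v]] Teq[OF v(1)] Teq[OF v(2)]
    by eventually_elim simp
  define s where "s n = (T ^^ n) (\<lambda>x. - U x)" for n
  have s0: "s 0 = (\<lambda>x. - U x)" and sS: "s (Suc n) = T (s n)" for n by (auto simp: s_def)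
  have sadm: "adm (s n)" for n
  proof (induction n)
    case 0
    show ?case unfolding s0 adm_def using Um U(3) by auto
  next
    case (Suc n)
    then show ?case unfolding sS by (rule Tadm)
  qed
  have srad: "spherically_symmetric (s n)" for n
  proof (induction n)
    case 0
    show ?case unfolding s0 using U(2) unfolding spherically_symmetric_def by metis
  next
    case (Suc n)
    have "spherically_symmetric (\<lambda>y. N y (s n y) + k * s n y)"
      using Suc Nrad unfolding spherically_symmetric_def by metis
    then show ?case unfolding sS T_def by (intro clr res_op_radial[OF k Nfm[OF sadm]])
  qed
  have smono: "AE x in lebesgue. s n x \<le> s (Suc n) x" for n
  proof (induction n)
    case 0
    have "- U x \<le> s (Suc 0) x" for x using sadm[of "Suc 0"] unfolding adm_def by (auto simp: abs_le_iff dest!: spec[of _ x])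
    then show ?case unfolding s0 by simp
  next
    case (Suc n)
    show ?case unfolding sS[of n] sS[of "Suc n"] using Tmono[OF sadm sadm Suc] by (simp add: sS)
  qed
  have smono': "AE x in lebesgue. incseq (\<lambda>n. s n x)"
    using smono unfolding incseq_Suc_iff by (simp add: AE_all_countable)
  define u where "u = cl (\<lambda>x. lim (\<lambda>n. s n x))"
  have um: "u \<in> borel_measurable lebesgue" unfolding u_def
    using sadm unfolding adm_def by (intro clm borel_measurable_lim_metric) auto
  have uadm: "adm u" unfolding adm_def using um clb by (auto simp: u_def)
  have urad: "spherically_symmetric u" unfolding u_def by (intro clr spherically_symmetric_lim srad)
  have sb: "\<bar>s n x\<bar> \<le> U x" for n x using sadm[of n] unfolding adm_def by auto
  have slim: "AE x in lebesgue. (\<lambda>n. s n x) \<longlonglongrightarrow> u x"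
    using smono'
  proof eventually_elim
    case (elim x)
    have "\<forall>n. s n x \<le> U x" using sb[of _ x] by (auto simp: abs_le_iff)
    then obtain L where L: "(\<lambda>n. s n x) \<longlonglongrightarrow> L"
      using incseq_convergent[OF elim] by metis
    have "\<bar>L\<bar> \<le> U x" using tendsto_rabs[OF L] sb[of _ x] by (intro LIMSEQ_le_const2) auto
    moreover have "lim (\<lambda>n. s n x) = L" using L by (rule limI)
    ultimately show ?case using L by (simp add: u_def clid)
  qed
  have ueq: "AE x in lebesgue. u x = res_op k (\<lambda>y. N y (u y) + k * u y) x"
  proof -
    have "AE x in lebesgue. (\<lambda>n. res_op k (\<lambda>y. N y (s n y) + k * s n y) x) \<longlonglongrightarrow> res_op k (\<lambda>y. N y (u y) + k * u y) x"
    proof (rule res_op_dominated[OF k Nfm[OF sadm] Nfm[OF uadm] WkU])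
      show "AE x in lebesgue. \<bar>N x (s n x) + k * s n x\<bar> \<le> W x + k * U x" for n by (intro AE_I2 Nfb sadm)
      show "AE x in lebesgue. (\<lambda>n. N x (s n x) + k * s n x) \<longlonglongrightarrow> N x (u x) + k * u x"
        using slim
        by eventually_elim (intro tendsto_intros continuous_on_tendsto_compose[OF Nc], auto)
    qed
    moreover have "AE x in lebesgue. \<forall>n. s (Suc n) x = res_op k (\<lambda>y. N y (s n y) + k * s n y) x"
      unfolding AE_all_countable sS using Teq[OF sadm] by simp
    ultimately show ?thesis using slim
    proof eventually_elim
      case (elim x)
      have "(\<lambda>n. s (Suc n) x) \<longlonglongrightarrow> res_op k (\<lambda>y. N y (u y) + k * u y) x" using elim(1,2) by simp
      moreover have "(\<lambda>n. s (Suc n) x) \<longlonglongrightarrow> u x" using elim(3) by (rule LIMSEQ_Suc)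
      ultimately show ?case using LIMSEQ_unique by blast
    qed
  qed
  then have ueq0: "AE x in lebesgue. u x = res_op 0 (\<lambda>y. N y (u y)) x"
    using resolvent_identity[OF k NL[OF uadm] vL[OF uadm]] by simp
  have min: "AE x in lebesgue. u x \<le> w x" if w: "w \<in> borel_measurable lebesgue" "\<forall>x. \<bar>w x\<bar> \<le> U x"
      and super: "AE x in lebesgue. res_op k (\<lambda>y. N y (w y) + k * w y) x \<le> w x" for w
  proof -
    have wadm: "adm w" unfolding adm_def using w by auto
    have "AE x in lebesgue. s n x \<le> w x" for n
    proof (induction n)
      case 0
      have "- U x \<le> w x" for x using w(2) by (auto simp: abs_le_iff dest!: spec[of _ x])
      then show ?case unfolding s0 by simp
    next
      case (Suc n)
      show ?case unfolding sS
        using Tmono[OF sadm wadm Suc] Teq[OF wadm] super by eventually_elim simp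
    qed
    then have "AE x in lebesgue. \<forall>n. s n x \<le> w x" by (simp add: AE_all_countable)
    then show ?thesis using slim
      by eventually_elim (rule LIMSEQ_le_const2, auto)
  qed
  show ?thesis
    using um urad uadm ueq0 min unfolding adm_def by blast
qed

text \<open>The Lipschitz constant of \<open>V x\<close> on \<open>[- U x, U x]\<close> is not bounded in \<open>x\<close>. Off the set where it
  is at most \<open>k\<close>, the nonlinearity is replaced by its lower bound \<open>- W\<close>; the minimal solutions of the
  modified problems increase with \<open>k\<close>.\<close>

lemma radial_solution:
  fixes U H :: "'a::euclidean_space \<Rightarrow> real" and V :: "'a \<Rightarrow> real \<Rightarrow> real" and C \<delta> :: real
  defines "W \<equiv> \<lambda>x. C * (H x + U x powr (1 + \<delta>))"
  assumes C: "C > 0" and \<delta>: "\<delta> > 0"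
    and U: "U \<in> Lp_space 2" "spherically_symmetric U" "\<And>x. U x \<ge> 0" and W: "W \<in> Lp_space 2"
    and UW: "AE x in lebesgue. U x = res_op 0 W x"
    and H: "spherically_symmetric H"
    and Vrad: "spherically_symmetric V" and Vm: "\<And>y. (\<lambda>x. V x y) \<in> borel_measurable lebesgue"
    and Vc: "\<And>x. continuous_on UNIV (V x)"
    and Vb: "\<And>x y. \<bar>V x y\<bar> \<le> C * (H x + \<bar>y\<bar> powr (1 + \<delta>))"
    and Vlip: "\<And>x M. \<exists>L. \<forall>y y'. \<bar>y\<bar> \<le> M \<longrightarrow> \<bar>y'\<bar> \<le> M \<longrightarrow> \<bar>V x y - V x y'\<bar> \<le> L * \<bar>y - y'\<bar>"
  shows "\<exists>u. u \<in> borel_measurable lebesgue \<and> spherically_symmetric u \<and> (\<forall>x. \<bar>u x\<bar> \<le> U x) \<and>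
    (AE x in lebesgue. u x = res_op 0 (\<lambda>y. V y (u y)) x) \<and> (\<lambda>y. V y (u y)) \<in> Lp_space 2"
proof -
  have Um: "U \<in> borel_measurable lebesgue" and Wm: "W \<in> borel_measurable lebesgue"
    using U W by (auto simp: Lp_space_2_iff)
  define A where "A k = {x. \<forall>y y'. \<bar>y\<bar> \<le> U x \<longrightarrow> \<bar>y'\<bar> \<le> U x \<longrightarrow> \<bar>V x y - V x y'\<bar> \<le> real k * \<bar>y - y'\<bar>}" for k :: nat
  define cl where "cl r = max (- 1) (min 1 r)" for r :: real
  have clc: "continuous_on UNIV cl" unfolding cl_def by (intro continuous_intros)
  have clb: "\<bar>cl r * U x\<bar> \<le> U x" for r x
  proof -
    have "\<bar>cl r\<bar> \<le> 1" by (auto simp: cl_def)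
    then show ?thesis using U(3)[of x] by (simp add: abs_mult mult_left_le_one_le)
  qed
  \<comment> \<open>Measurability calls for countably many conditions, but y and y' range over an
    interval that depends on x. Writing y as \<open>cl r * U x\<close> moves the dependence into the
    function, and continuity of V(x, .) reduces r to the rationals.\<close>
  have Aalt: "A k = {x. \<forall>r\<in>\<rat>. \<forall>s\<in>\<rat>. \<bar>V x (cl r * U x) - V x (cl s * U x)\<bar> \<le> real k * \<bar>cl r * U x - cl s * U x\<bar>}" for k
  proof (intro set_eqI iffI)
    fix x assume "x \<in> A k"
    then show "x \<in> {x. \<forall>r\<in>\<rat>. \<forall>s\<in>\<rat>. \<bar>V x (cl r * U x) - V x (cl s * U x)\<bar> \<le> real k * \<bar>cl r * U x - cl s * U x\<bar>}"
      unfolding A_def using clb by blast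
  next
    fix x assume x: "x \<in> {x. \<forall>r\<in>\<rat>. \<forall>s\<in>\<rat>. \<bar>V x (cl r * U x) - V x (cl s * U x)\<bar> \<le> real k * \<bar>cl r * U x - cl s * U x\<bar>}"
    have c: "continuous_on UNIV (\<lambda>r. cl r * U x)" by (intro continuous_on_mult clc continuous_on_const)
    have Vcl: "continuous_on UNIV (\<lambda>r. V x (cl r * U x))" by (rule continuous_on_compose2[OF Vc c]) simp
    have Vr: "continuous_on UNIV (\<lambda>r. \<bar>V x (cl r * U x) - a\<bar>)" "continuous_on UNIV (\<lambda>r. \<bar>a - V x (cl r * U x)\<bar>)" for a
      using Vcl by (intro continuous_on_rabs continuous_on_diff continuous_on_const; assumption)+
    have Ur: "continuous_on UNIV (\<lambda>r. real k * \<bar>cl r * U x - a\<bar>)" "continuous_on UNIV (\<lambda>r. real k * \<bar>a - cl r * U x\<bar>)" for a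
      by (intro continuous_on_mult continuous_on_rabs continuous_on_diff continuous_on_const clc)+
    have half: "\<bar>V x (cl r * U x) - V x (cl s * U x)\<bar> \<le> real k * \<bar>cl r * U x - cl s * U x\<bar>" if "s \<in> \<rat>" for r s
      by (rule continuous_le_on_Rats[OF Vr(1) Ur(1)]) (use x that in simp)
    have all: "\<bar>V x (cl r * U x) - V x (cl s * U x)\<bar> \<le> real k * \<bar>cl r * U x - cl s * U x\<bar>" for r s
      by (rule continuous_le_on_Rats[OF Vr(2) Ur(2)]) (rule half)
    have rep: "\<exists>r. y = cl r * U x" if "\<bar>y\<bar> \<le> U x" for y
    proof (cases "U x = 0")
      case False
      then have pos: "U x > 0" using U(3)[of x] by simp
      then have "\<bar>y / U x\<bar> \<le> 1" using that by simp
      moreover have "cl z = z" if "\<bar>z\<bar> \<le> 1" for z using that by (auto simp: cl_def)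
      ultimately have "cl (y / U x) = y / U x" by blast
      then show ?thesis using pos by (intro exI[of _ "y / U x"]) simp
    qed (use that in simp)
    show "x \<in> A k" unfolding A_def using all rep by blast
  qed
  have Am: "A k \<in> sets lebesgue" for k
  proof -
    have V1: "(\<lambda>x. V x (cl r * U x)) \<in> borel_measurable lebesgue" for r
      by (rule caratheodory_measurable[OF Vm Vc]) (use Um in simp)
    have "{x \<in> space lebesgue. \<forall>r\<in>\<rat>. \<forall>s\<in>\<rat>. \<bar>V x (cl r * U x) - V x (cl s * U x)\<bar> \<le> real k * \<bar>cl r * U x - cl s * U x\<bar>} \<in> sets lebesgue"
    proof (intro sets.sets_Collect_countable_All' countable_rat borel_measurable_le)
      fix r s :: real
      show "(\<lambda>x. \<bar>V x (cl r * U x) - V x (cl s * U x)\<bar>) \<in> borel_measurable lebesgue"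
        by (intro borel_measurable_abs borel_measurable_diff V1)
      show "(\<lambda>x. real k * \<bar>cl r * U x - cl s * U x\<bar>) \<in> borel_measurable lebesgue"
        using Um by (intro borel_measurable_times borel_measurable_const borel_measurable_abs borel_measurable_diff)
    qed
    then show ?thesis unfolding Aalt by simp
  qed
  have Arad: "x \<in> A k \<longleftrightarrow> x' \<in> A k" if "norm x = norm x'" for x x' k
  proof -
    have "V x = V x'" "U x = U x'" using that Vrad U(2) unfolding spherically_symmetric_def by blast+
    then show ?thesis by (simp add: A_def)
  qed
  have Amono: "A k \<subseteq> A (Suc k)" for k
  proof
    fix x assume x: "x \<in> A k"
    show "x \<in> A (Suc k)" unfolding A_def
    proof (intro CollectI allI impI)
      fix y y' assume "\<bar>y\<bar> \<le> U x" "\<bar>y'\<bar> \<le> U x"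
      then have "\<bar>V x y - V x y'\<bar> \<le> real k * \<bar>y - y'\<bar>" using x unfolding A_def by blast
      also have "\<dots> \<le> real (Suc k) * \<bar>y - y'\<bar>" by (intro mult_right_mono) auto
      finally show "\<bar>V x y - V x y'\<bar> \<le> real (Suc k) * \<bar>y - y'\<bar>" .
    qed
  qed
  have Aev: "\<forall>\<^sub>F k in sequentially. x \<in> A k" for x
  proof -
    obtain L where L: "\<And>y y'. \<bar>y\<bar> \<le> U x \<Longrightarrow> \<bar>y'\<bar> \<le> U x \<Longrightarrow> \<bar>V x y - V x y'\<bar> \<le> L * \<bar>y - y'\<bar>"
      using Vlip[of "U x" x] by blast
    obtain m :: nat where m: "L \<le> real m" using real_arch_simple by blast
    show ?thesis using eventually_ge_at_top[of m]
    proof eventually_elim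
      case (elim k)
      have "L \<le> real k" using m elim by (meson of_nat_mono order_trans)
      show ?case unfolding A_def
      proof (safe)
        fix y y' assume y: "\<bar>y\<bar> \<le> U x" "\<bar>y'\<bar> \<le> U x"
        have "L * \<bar>y - y'\<bar> \<le> real k * \<bar>y - y'\<bar>" using \<open>L \<le> real k\<close> by (intro mult_right_mono) auto
        then show "\<bar>V x y - V x y'\<bar> \<le> real k * \<bar>y - y'\<bar>" using L[OF y] by linarith
      qed
    qed
  qed
  \<comment> \<open>On A(k) the function is k-Lipschitz on the relevant range; elsewhere it is
    constant in y. Since V(x, y) >= - W(x) in that range and the sets grow with k, N increases with
    k. Every x lies in A(k) for all large k, so V is recovered in the limit.\<close>
  define N where "N k x y = (if x \<in> A k then V x y else - W x)" for k x y
  have VW: "\<bar>V x y\<bar> \<le> W x" if "\<bar>y\<bar> \<le> U x" for x y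
  proof -
    have "\<bar>y\<bar> powr (1 + \<delta>) \<le> U x powr (1 + \<delta>)" using that \<delta> by (intro powr_mono2) auto
    then have "C * (H x + \<bar>y\<bar> powr (1 + \<delta>)) \<le> W x" unfolding W_def using C by (intro mult_left_mono) auto
    then show ?thesis using Vb[of x y] by linarith
  qed
  have W0: "W x \<ge> 0" for x using VW[of 0 x] U(3)[of x] by (simp add: order_trans[OF abs_ge_zero])
  have Nb: "\<bar>N k x y\<bar> \<le> W x" if "\<bar>y\<bar> \<le> U x" for k x y
    using VW[OF that] W0[of x] by (simp add: N_def)
  have Nm: "(\<lambda>x. N k x (u x)) \<in> borel_measurable lebesgue" if "u \<in> borel_measurable lebesgue" for k u
    unfolding N_def
    by (intro measurable_If_set caratheodory_measurable[OF Vm Vc that] borel_measurable_uminus Wm) (simp add: Am)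
  have Wrad: "W x = W x'" if "norm x = norm x'" for x x'
  proof -
    have "H x = H x'" "U x = U x'" using that H U(2) unfolding spherically_symmetric_def by blast+
    then show ?thesis by (simp add: W_def)
  qed
  have Nrad: "spherically_symmetric (N k)" for k
    unfolding spherically_symmetric_def
  proof (intro allI impI ext)
    fix x x' :: 'a and y assume n: "norm x = norm x'"
    have "V x = V x'" using n Vrad unfolding spherically_symmetric_def by blast
    then show "N k x y = N k x' y" unfolding N_def using Arad[OF n, of k] Wrad[OF n] by simp
  qed
  have Nmono: "N k x y + real k * y \<le> N k x y' + real k * y'" if "\<bar>y\<bar> \<le> U x" "\<bar>y'\<bar> \<le> U x" "y \<le> y'" for k x y y'
  proof (cases "x \<in> A k")
    case True
    then have "\<bar>V x y - V x y'\<bar> \<le> real k * \<bar>y - y'\<bar>" using that unfolding A_def by blast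
    also have "\<bar>y - y'\<bar> = y' - y" using that by simp
    finally have "V x y - V x y' \<le> real k * y' - real k * y" by (simp add: right_diff_distrib abs_le_iff)
    then show ?thesis using True by (simp add: N_def)
  next
    case False
    then show ?thesis using that by (simp add: N_def mult_left_mono)
  qed
  have Nc: "continuous_on UNIV (N k x)" for k x
    unfolding N_def using Vc[of x] by (cases "x \<in> A k") auto
  define Q where "Q k u \<longleftrightarrow> u \<in> borel_measurable lebesgue \<and> spherically_symmetric u \<and> (\<forall>x. \<bar>u x\<bar> \<le> U x) \<and>
    (AE x in lebesgue. u x = res_op 0 (\<lambda>y. N k y (u y)) x) \<and>
    (\<forall>w. w \<in> borel_measurable lebesgue \<longrightarrow> (\<forall>x. \<bar>w x\<bar> \<le> U x) \<longrightarrow>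
      (AE x in lebesgue. res_op (real k) (\<lambda>y. N k y (w y) + real k * w y) x \<le> w x) \<longrightarrow> (AE x in lebesgue. u x \<le> w x))" for k u
  have "\<forall>k. \<exists>u. Q k u" unfolding Q_def
    by (intro allI minimal_solution[OF _ U W UW Nrad Nm Nb Nmono Nc]) auto
  from choice[OF this] obtain u where Q: "\<And>k. Q k (u k)" by blast
  have um: "u k \<in> borel_measurable lebesgue" and ur: "spherically_symmetric (u k)"
    and ub: "\<And>x. \<bar>u k x\<bar> \<le> U x" and ueq: "AE x in lebesgue. u k x = res_op 0 (\<lambda>y. N k y (u k y)) x"
    and umin: "\<And>w. w \<in> borel_measurable lebesgue \<Longrightarrow> (\<forall>x. \<bar>w x\<bar> \<le> U x) \<Longrightarrow>
      (AE x in lebesgue. res_op (real k) (\<lambda>y. N k y (w y) + real k * w y) x \<le> w x) \<Longrightarrow> (AE x in lebesgue. u k x \<le> w x)" for k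
    using Q[of k] unfolding Q_def by blast+
  have NL: "(\<lambda>y. N k y (v y)) \<in> Lp_space 2" if "v \<in> borel_measurable lebesgue" "\<And>x. \<bar>v x\<bar> \<le> U x" for v k
    using Nm[OF that(1)] Nb[OF that(2)] by (intro Lp2_dominated[OF _ W]) auto
  have uL: "u k \<in> Lp_space 2" for k
    using ub by (intro Lp2_dominated[OF um U(1)]) auto
  have shiftL: "(\<lambda>y. N j y (u l y) + real k * u l y) \<in> Lp_space 2" for j k l
    by (rule Lp2_add[OF NL[OF um ub] Lp2_real_scale[OF uL]])
  have umono: "AE x in lebesgue. u k x \<le> u (Suc k) x" for k
  proof (rule umin[OF um])
    show "\<forall>x. \<bar>u (Suc k) x\<bar> \<le> U x" using ub by blast
    \<comment> \<open>The equation of \<open>u (Suc k)\<close> is rewritten with the shift k of the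
      preceding problem, which \<open>resolvent_identity\<close> permits. As N increases with k,
      \<open>u (Suc k)\<close> is then a supersolution of the k-th problem, and minimality of
      \<open>u k\<close> gives the order.\<close>
    have "AE x in lebesgue. u (Suc k) x = res_op (real k) (\<lambda>y. N (Suc k) y (u (Suc k) y) + real k * u (Suc k) y) x"
      using resolvent_identity[OF _ NL[OF um ub] uL, of "real k" "Suc k" "Suc k" "Suc k"] ueq[of "Suc k"] by simp
    moreover have "AE x in lebesgue. res_op (real k) (\<lambda>y. N k y (u (Suc k) y) + real k * u (Suc k) y) x
       \<le> res_op (real k) (\<lambda>y. N (Suc k) y (u (Suc k) y) + real k * u (Suc k) y) x"
    proof (rule res_op_mono[OF of_nat_0_le_iff shiftL shiftL])
      show "AE x in lebesgue. N k x (u (Suc k) x) + real k * u (Suc k) x \<le> N (Suc k) x (u (Suc k) x) + real k * u (Suc k) x"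
      proof (rule AE_I2)
        fix x
        show "N k x (u (Suc k) x) + real k * u (Suc k) x \<le> N (Suc k) x (u (Suc k) x) + real k * u (Suc k) x"
          using Amono[of k] VW[OF ub[of "Suc k" x]] by (auto simp: N_def abs_le_iff)
      qed
    qed
    ultimately show "AE x in lebesgue. res_op (real k) (\<lambda>y. N k y (u (Suc k) y) + real k * u (Suc k) y) x \<le> u (Suc k) x"
      by eventually_elim simp
  qed
  have uinc: "AE x in lebesgue. incseq (\<lambda>k. u k x)"
    using umono unfolding incseq_Suc_iff by (simp add: AE_all_countable)
  define v where "v x = max (- U x) (min (U x) (lim (\<lambda>k. u k x)))" for x
  have vm: "v \<in> borel_measurable lebesgue"
    unfolding v_def using um Um
    by (intro borel_measurable_max borel_measurable_min borel_measurable_uminus borel_measurable_lim_metric)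
  have vb: "\<bar>v x\<bar> \<le> U x" for x unfolding v_def using U(3)[of x] by auto
  have vr: "spherically_symmetric v"
    unfolding spherically_symmetric_def
  proof (intro allI impI)
    fix x x' :: 'a assume n: "norm x = norm x'"
    have Ux: "U x = U x'" using U(2) n unfolding spherically_symmetric_def by blast
    have ux: "u k x = u k x'" for k using ur[of k] n unfolding spherically_symmetric_def by blast
    show "v x = v x'" unfolding v_def Ux ux ..
  qed
  have ulim: "AE x in lebesgue. (\<lambda>k. u k x) \<longlonglongrightarrow> v x"
    using uinc
  proof eventually_elim
    case (elim x)
    have "\<forall>k. u k x \<le> U x" using ub[of _ x] by (auto simp: abs_le_iff)
    then obtain L where L: "(\<lambda>k. u k x) \<longlonglongrightarrow> L" using incseq_convergent[OF elim] by metis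
    have "\<bar>L\<bar> \<le> U x" using tendsto_rabs[OF L] ub[of _ x] by (intro LIMSEQ_le_const2) auto
    moreover have "lim (\<lambda>k. u k x) = L" using L by (rule limI)
    ultimately have "v x = L" unfolding v_def by (auto simp: abs_le_iff)
    then show ?case using L by simp
  qed
  have Vvm: "(\<lambda>y. V y (v y)) \<in> borel_measurable lebesgue" by (rule caratheodory_measurable[OF Vm Vc vm])
  have VvL: "(\<lambda>y. V y (v y)) \<in> Lp_space 2"
    using VW[OF vb] by (intro Lp2_dominated[OF Vvm W]) auto
  have "AE x in lebesgue. (\<lambda>k. res_op 0 (\<lambda>y. N k y (u k y)) x) \<longlonglongrightarrow> res_op 0 (\<lambda>y. V y (v y)) x"
  proof (rule res_op_dominated[OF order_refl Nm[OF um] Vvm W])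
    show "AE x in lebesgue. \<bar>N k x (u k x)\<bar> \<le> W x" for k by (intro AE_I2 Nb ub)
    show "AE x in lebesgue. (\<lambda>k. N k x (u k x)) \<longlonglongrightarrow> V x (v x)"
      using ulim
    proof eventually_elim
      case (elim x)
      have "(\<lambda>k. V x (u k x)) \<longlonglongrightarrow> V x (v x)"
        by (rule continuous_on_tendsto_compose[OF Vc elim]) auto
      moreover have "\<forall>\<^sub>F k in sequentially. V x (u k x) = N k x (u k x)"
        using Aev[of x] by eventually_elim (simp add: N_def)
      ultimately show ?case by (rule Lim_transform_eventually)
    qed
  qed
  moreover have "AE x in lebesgue. \<forall>k. u k x = res_op 0 (\<lambda>y. N k y (u k y)) x"
    using ueq by (simp add: AE_all_countable)
  ultimately have "AE x in lebesgue. v x = res_op 0 (\<lambda>y. V y (v y)) x"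
    using ulim
  proof eventually_elim
    case (elim x)
    have "(\<lambda>k. u k x) \<longlonglongrightarrow> res_op 0 (\<lambda>y. V y (v y)) x" using elim(1) by (simp only: elim(2)[rule_format, symmetric])
    then show ?case using elim(3) LIMSEQ_unique by blast
  qed
  then show ?thesis using vm vr vb VvL by blast
qed

text \<open>The map u to G(C (H + u^(1+\<delta>))) is monotone on nonnegative functions and keeps
  the L^q ball of radius \<epsilon> invariant when H is small. Iterating from 0 gives an increasing
  sequence bounded in L^q, and its limit is a fixed point.\<close>

lemma barrier_exists:
  fixes C \<delta> :: real
  assumes C: "C > 0" and \<delta>: "\<delta> > 0" and \<beta>: "real DIM('a::euclidean_space) * \<delta> / (4 * (1 + \<delta>)) < \<alpha>"
  shows "\<exists>\<epsilon> \<rho>. 0 < \<epsilon> \<and> \<epsilon> < 1 \<and> 0 < \<rho> \<and> \<rho> < 1 \<and>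
    (\<forall>H::'a \<Rightarrow> real. H \<in> Lp_space 2 \<longrightarrow> spherically_symmetric H \<longrightarrow> (\<forall>x. H x \<ge> 0) \<longrightarrow> sq_norm H \<le> ennreal (\<rho>\<^sup>2) \<longrightarrow>
      (\<exists>U. U \<in> Lp_space 2 \<and> spherically_symmetric U \<and> (\<forall>x. U x \<ge> 0) \<and>
        (\<lambda>x. C * (H x + U x powr (1 + \<delta>))) \<in> Lp_space 2 \<and>
        (AE x in lebesgue. U x = res_op 0 (\<lambda>x. C * (H x + U x powr (1 + \<delta>))) x) \<and>
        (\<integral>\<^sup>+x. ennreal (U x powr (2 * (1 + \<delta>))) \<partial>lebesgue) \<le> ennreal (\<epsilon> powr (2 * (1 + \<delta>)))))"
proof -
  define q where "q = 2 * (1 + \<delta>)"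
  have q: "q > 2" using \<delta> by (simp add: q_def)
  obtain C0 where C0: "C0 > 0" and smooth: "\<And>f::'a \<Rightarrow> real. f \<in> Lp_space 2 \<Longrightarrow> sq_norm f \<le> 1 \<Longrightarrow>
    (\<integral>\<^sup>+x. ennreal (\<bar>res_op 0 f x\<bar> powr q) \<partial>lebesgue) \<le> ennreal C0"
    using resolvent_smoothing[OF \<alpha> b _ \<delta> \<beta>, of "1 + 0"] unfolding q_def by auto
  have smooth_scaled: "(\<integral>\<^sup>+x. ennreal (\<bar>res_op 0 f x\<bar> powr q) \<partial>lebesgue) \<le> ennreal (C0 * R powr q)"
    if f: "f \<in> Lp_space 2" "sq_norm f \<le> ennreal (R\<^sup>2)" and R: "R > 0" for f :: "'a \<Rightarrow> real" and R
  proof -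
    let ?f = "\<lambda>x. (1 / R) * f x"
    have fm: "f \<in> borel_measurable lebesgue" using f by (simp add: Lp_space_2_iff)
    have "sq_norm ?f = ennreal ((1 / R)\<^sup>2) * sq_norm f" by (rule sq_norm_real_scale[OF fm])
    also have "\<dots> \<le> ennreal ((1 / R)\<^sup>2) * ennreal (R\<^sup>2)" using f by (intro mult_left_mono) auto
    also have "\<dots> = 1" using R by (simp add: power_divide flip: ennreal_mult)
    finally have s: "sq_norm ?f \<le> 1" .
    have "res_op 0 f x = R * res_op 0 ?f x" for x
    proof -
      have "res_op 0 (\<lambda>x. R * ?f x) x = R * res_op 0 ?f x"
        by (rule convolve_real_cmult)
      then show ?thesis using R by simp
    qed
    then have "(\<integral>\<^sup>+x. ennreal (\<bar>res_op 0 f x\<bar> powr q) \<partial>lebesgue) = (\<integral>\<^sup>+x. ennreal (R powr q) * ennreal (\<bar>res_op 0 ?f x\<bar> powr q) \<partial>lebesgue)"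
      using R by (simp add: abs_mult powr_mult flip: ennreal_mult)
    also have "\<dots> = ennreal (R powr q) * (\<integral>\<^sup>+x. ennreal (\<bar>res_op 0 ?f x\<bar> powr q) \<partial>lebesgue)"
    proof (rule nn_integral_cmult)
      have "res_op 0 ?f \<in> borel_measurable lebesgue" using fm by (intro res_op_measurable) auto
      then show "(\<lambda>x. ennreal (\<bar>res_op 0 ?f x\<bar> powr q)) \<in> borel_measurable lebesgue" by simp
    qed
    also have "\<dots> \<le> ennreal (R powr q) * ennreal C0"
      using f s by (intro mult_left_mono smooth Lp2_real_scale) auto
    also have "\<dots> = ennreal (C0 * R powr q)" using C0 by (simp add: mult.commute flip: ennreal_mult)
    finally show ?thesis .
  qed
  \<comment> \<open>The right-hand side has L^2 norm at most 2 C \<rho> and the smoothing constant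
    is C0, so one step has q-th power integral at most C0 (2 C \<rho>)^q = A \<epsilon>^(q \<delta>)
    \<epsilon>^q. The ball is invariant once A \<epsilon>^(q \<delta>) <= 1, and \<epsilon> is
    defined accordingly.\<close>
  define A where "A = C0 * (2 * C) powr q"
  have A: "A > 0" using C0 C by (simp add: A_def)
  define \<epsilon> where "\<epsilon> = min (1 / 2) (A powr (- 1 / (q * \<delta>)))"
  have \<epsilon>: "0 < \<epsilon>" "\<epsilon> < 1" using A by (auto simp: \<epsilon>_def)
  have \<epsilon>A: "A * \<epsilon> powr (q * \<delta>) \<le> 1"
  proof -
    have "\<epsilon> powr (q * \<delta>) \<le> (A powr (- 1 / (q * \<delta>))) powr (q * \<delta>)"
      using \<epsilon> q \<delta> by (intro powr_mono2) (auto simp: \<epsilon>_def)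
    also have "\<dots> = A powr (- 1)" using q \<delta> by (simp add: powr_powr)
    also have "\<dots> = 1 / A" using A by (simp add: powr_minus_divide)
    finally show ?thesis using A by (simp add: field_simps)
  qed
  \<comment> \<open>Balances the two terms: \<rho>^2 = \<epsilon>^q is also the bound for the
    squared L^2 norm of |u|^(1+\<delta>) when u lies in the L^q ball.\<close>
  define \<rho> where "\<rho> = \<epsilon> powr (1 + \<delta>)"
  have \<rho>: "0 < \<rho>" "\<rho> < 1" "\<rho>\<^sup>2 = \<epsilon> powr q"
  proof -
    show "0 < \<rho>" using \<epsilon> by (simp add: \<rho>_def)
    show "\<rho> < 1" using \<epsilon> \<delta> powr_less_mono2[of "1 + \<delta>" \<epsilon> 1] by (simp add: \<rho>_def)
    have "\<rho>\<^sup>2 = \<rho> powr 2" using \<open>0 < \<rho>\<close> by (simp add: powr_numeral)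
    then show "\<rho>\<^sup>2 = \<epsilon> powr q" by (simp add: \<rho>_def powr_powr q_def mult.commute)
  qed
  have "\<exists>U. U \<in> Lp_space 2 \<and> spherically_symmetric U \<and> (\<forall>x. U x \<ge> 0) \<and>
        (\<lambda>x. C * (H x + U x powr (1 + \<delta>))) \<in> Lp_space 2 \<and>
        (AE x in lebesgue. U x = res_op 0 (\<lambda>x. C * (H x + U x powr (1 + \<delta>))) x) \<and>
        (\<integral>\<^sup>+x. ennreal (U x powr q) \<partial>lebesgue) \<le> ennreal (\<epsilon> powr q)"
    if H: "H \<in> Lp_space 2" "spherically_symmetric H" "\<forall>x. H x \<ge> 0" "sq_norm H \<le> ennreal (\<rho>\<^sup>2)" for H :: "'a \<Rightarrow> real"
  proof -
    have Hm: "H \<in> borel_measurable lebesgue" using H by (simp add: Lp_space_2_iff)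
    define Wf where "Wf u x = C * (H x + \<bar>u x\<bar> powr (1 + \<delta>))" for u and x :: 'a
    define I where "I u = (\<integral>\<^sup>+x. ennreal (\<bar>u x\<bar> powr q) \<partial>lebesgue)" for u :: "'a \<Rightarrow> real"
    have Wm: "Wf u \<in> borel_measurable lebesgue" if "u \<in> borel_measurable lebesgue" for u
      unfolding Wf_def using Hm that by simp
    have W0: "Wf u x \<ge> 0" for u x unfolding Wf_def using C H(3) by simp
    have WL: "Wf u \<in> Lp_space 2" "sq_norm (Wf u) \<le> ennreal ((2 * C * \<rho>)\<^sup>2)"
      if um: "u \<in> borel_measurable lebesgue" and uI: "I u \<le> ennreal (\<epsilon> powr q)" for u
    proof -
      have pt: "(norm (Wf u x))\<^sup>2 \<le> 2 * C\<^sup>2 * (norm (H x))\<^sup>2 + 2 * C\<^sup>2 * (\<bar>u x\<bar> powr q)" for x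
      proof -
        have "(\<bar>u x\<bar> powr (1 + \<delta>))\<^sup>2 = \<bar>u x\<bar> powr q"
        proof (cases "u x = 0")
          case False
          then have "(\<bar>u x\<bar> powr (1 + \<delta>))\<^sup>2 = (\<bar>u x\<bar> powr (1 + \<delta>)) powr 2" by (simp add: powr_numeral)
          then show ?thesis by (simp add: powr_powr q_def mult.commute)
        qed simp
        moreover have "(H x + \<bar>u x\<bar> powr (1 + \<delta>))\<^sup>2 \<le> 2 * (H x)\<^sup>2 + 2 * (\<bar>u x\<bar> powr (1 + \<delta>))\<^sup>2"
          using sum_squares_bound[of "H x" "\<bar>u x\<bar> powr (1 + \<delta>)"] by (simp add: power2_sum)
        ultimately have "C\<^sup>2 * (H x + \<bar>u x\<bar> powr (1 + \<delta>))\<^sup>2 \<le> C\<^sup>2 * (2 * (H x)\<^sup>2 + 2 * (\<bar>u x\<bar> powr q))"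
          by (intro mult_left_mono) auto
        moreover have "(norm (Wf u x))\<^sup>2 = C\<^sup>2 * (H x + \<bar>u x\<bar> powr (1 + \<delta>))\<^sup>2"
          by (simp add: Wf_def power_mult_distrib)
        ultimately show ?thesis by (simp add: algebra_simps)
      qed
      have "sq_norm (Wf u) \<le> (\<integral>\<^sup>+x. ennreal (2 * C\<^sup>2) * ennreal ((norm (H x))\<^sup>2) + ennreal (2 * C\<^sup>2) * ennreal (\<bar>u x\<bar> powr q) \<partial>lebesgue)"
        unfolding sq_norm_def
      proof (rule nn_integral_mono)
        fix x :: 'a
        have "ennreal ((norm (Wf u x))\<^sup>2) \<le> ennreal (2 * C\<^sup>2 * (norm (H x))\<^sup>2 + 2 * C\<^sup>2 * (\<bar>u x\<bar> powr q))"
          by (intro ennreal_leI pt)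
        also have "\<dots> = ennreal (2 * C\<^sup>2 * (norm (H x))\<^sup>2) + ennreal (2 * C\<^sup>2 * (\<bar>u x\<bar> powr q))"
          by (intro ennreal_plus) auto
        finally show "ennreal ((norm (Wf u x))\<^sup>2) \<le> ennreal (2 * C\<^sup>2) * ennreal ((norm (H x))\<^sup>2) + ennreal (2 * C\<^sup>2) * ennreal (\<bar>u x\<bar> powr q)"
          by (simp add: ennreal_mult')
      qed
      also have "\<dots> = ennreal (2 * C\<^sup>2) * sq_norm H + ennreal (2 * C\<^sup>2) * I u"
      proof -
        have hm: "(\<lambda>x. ennreal ((norm (H x))\<^sup>2)) \<in> borel_measurable lebesgue" and umm: "(\<lambda>x. ennreal (\<bar>u x\<bar> powr q)) \<in> borel_measurable lebesgue"
          using Hm um by simp_all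
        show ?thesis unfolding sq_norm_def I_def
          using hm umm nn_integral_cmult[OF hm] nn_integral_cmult[OF umm] by (subst nn_integral_add) auto
      qed
      also have "\<dots> \<le> ennreal (2 * C\<^sup>2) * ennreal (\<rho>\<^sup>2) + ennreal (2 * C\<^sup>2) * ennreal (\<rho>\<^sup>2)"
        using H(4) uI unfolding \<rho>(3) by (intro add_mono mult_left_mono) auto
      also have "\<dots> = ennreal (2 * C\<^sup>2 * \<rho>\<^sup>2) + ennreal (2 * C\<^sup>2 * \<rho>\<^sup>2)"
        by (simp add: ennreal_mult')
      also have "\<dots> = ennreal (2 * C\<^sup>2 * \<rho>\<^sup>2 + 2 * C\<^sup>2 * \<rho>\<^sup>2)" by (intro ennreal_plus[symmetric]) auto
      also have "2 * C\<^sup>2 * \<rho>\<^sup>2 + 2 * C\<^sup>2 * \<rho>\<^sup>2 = (2 * C * \<rho>)\<^sup>2" by (simp add: power_mult_distrib)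
      finally show s: "sq_norm (Wf u) \<le> ennreal ((2 * C * \<rho>)\<^sup>2)" .
      then show "Wf u \<in> Lp_space 2" using Wm[OF um] by (auto simp: Lp_space_2_iff intro: le_less_trans)
    qed
    have step: "I (res_op 0 (Wf u)) \<le> ennreal (\<epsilon> powr q)"
      if um: "u \<in> borel_measurable lebesgue" and uI: "I u \<le> ennreal (\<epsilon> powr q)" for u
    proof -
      have "I (res_op 0 (Wf u)) \<le> ennreal (C0 * (2 * C * \<rho>) powr q)"
        unfolding I_def using WL[OF um uI] C \<rho> by (intro smooth_scaled) auto
      also have "C0 * (2 * C * \<rho>) powr q = A * \<epsilon> powr (q * \<delta>) * \<epsilon> powr q"
      proof -
        have "\<rho> powr q = \<epsilon> powr (q * \<delta>) * \<epsilon> powr q"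
          unfolding \<rho>_def powr_powr by (simp add: powr_add[symmetric] algebra_simps)
        moreover have "(2 * C * \<rho>) powr q = (2 * C) powr q * \<rho> powr q" by (rule powr_mult)
        ultimately show ?thesis by (simp add: A_def)
      qed
      also have "ennreal (A * \<epsilon> powr (q * \<delta>) * \<epsilon> powr q) \<le> ennreal (1 * \<epsilon> powr q)"
        using \<epsilon>A by (intro ennreal_leI mult_right_mono) auto
      finally show ?thesis by simp
    qed
    define s where "s n = ((\<lambda>u. res_op 0 (Wf u)) ^^ n) (\<lambda>_. 0)" for n
    have s0: "s 0 = (\<lambda>_. 0)" and sS: "s (Suc n) = res_op 0 (Wf (s n))" for n by (auto simp: s_def)
    have sm: "s n \<in> borel_measurable lebesgue" for n
    proof (induction n)
      case (Suc n)
      then show ?case unfolding sS by (intro res_op_measurable order_refl Wm)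
    qed (simp add: s0)
    have sI: "I (s n) \<le> ennreal (\<epsilon> powr q)" for n
    proof (induction n)
      case 0
      then show ?case by (simp add: s0 I_def)
    next
      case (Suc n)
      then show ?case unfolding sS by (intro step sm)
    qed
    note sW = WL[OF sm sI]
    have sr: "spherically_symmetric (s n)" for n
    proof (induction n)
      case 0
      then show ?case by (simp add: s0 spherically_symmetric_def)
    next
      case (Suc n)
      have "spherically_symmetric (Wf (s n))"
        using Suc H(2) unfolding spherically_symmetric_def Wf_def by metis
      then show ?case unfolding sS by (intro res_op_radial Wm sm) simp_all
    qed
    have spos: "AE x in lebesgue. 0 \<le> s n x" for n
    proof (cases n)
      case (Suc m)
      have z: "(\<lambda>_::'a. 0::real) \<in> Lp_space 2" by (simp add: Lp_space_2_iff sq_norm_def)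
      have "AE x in lebesgue. res_op 0 (\<lambda>_. 0) x \<le> res_op 0 (Wf (s m)) x"
        by (intro res_op_mono z sW AE_I2 W0) simp
      then show ?thesis unfolding Suc sS by (simp add: convolve_def)
    qed (simp add: s0)
    have smono: "AE x in lebesgue. s n x \<le> s (Suc n) x" for n
    proof (induction n)
      case 0
      show ?case using spos[of 1] by (simp add: s0)
    next
      case (Suc n)
      have "AE x in lebesgue. Wf (s n) x \<le> Wf (s (Suc n)) x"
        using Suc spos[of n]
      proof eventually_elim
        case (elim x)
        then have "\<bar>s n x\<bar> powr (1 + \<delta>) \<le> \<bar>s (Suc n) x\<bar> powr (1 + \<delta>)" using \<delta> by (intro powr_mono2) auto
        then show ?case unfolding Wf_def using C by (intro mult_left_mono) auto
      qed
      from res_op_mono[OF order_refl sW(1) sW(1) this] show ?case by (simp only: sS)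
    qed
    have sinc: "AE x in lebesgue. incseq (\<lambda>n. s n x)"
      using smono unfolding incseq_Suc_iff by (simp add: AE_all_countable)
    have spos': "AE x in lebesgue. \<forall>n. 0 \<le> s n x" using spos by (simp add: AE_all_countable)
    \<comment> \<open>By monotone convergence the supremum has a finite integral, hence is finite
      almost everywhere. This bounds the increasing sequence at almost every point and makes it
      converge.\<close>
    define S where "S x = (SUP n. ennreal (\<bar>s n x\<bar> powr q))" for x
    have SI: "(\<integral>\<^sup>+x. S x \<partial>lebesgue) \<le> ennreal (\<epsilon> powr q)"
    proof -
      have "(\<integral>\<^sup>+x. S x \<partial>lebesgue) = (SUP n. \<integral>\<^sup>+x. ennreal (\<bar>s n x\<bar> powr q) \<partial>lebesgue)"
        unfolding S_def
      proof (rule nn_integral_monotone_convergence_SUP_AE)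
        show "AE x in lebesgue. ennreal (\<bar>s n x\<bar> powr q) \<le> ennreal (\<bar>s (Suc n) x\<bar> powr q)" for n
          using smono[of n] spos[of n]
          by eventually_elim (use q in \<open>auto intro!: ennreal_leI powr_mono2\<close>)
        show "(\<lambda>x. ennreal (\<bar>s n x\<bar> powr q)) \<in> borel_measurable lebesgue" for n using sm[of n] by simp
      qed
      also have "\<dots> \<le> ennreal (\<epsilon> powr q)" using sI unfolding I_def by (intro SUP_least) auto
      finally show ?thesis .
    qed
    have Sm: "S \<in> borel_measurable lebesgue"
    proof -
      have "(\<lambda>x. ennreal (\<bar>s n x\<bar> powr q)) \<in> borel_measurable lebesgue" for n using sm[of n] by simp
      then show ?thesis unfolding S_def [abs_def] by (intro borel_measurable_SUP) auto
    qed
    have Sfin: "AE x in lebesgue. S x \<noteq> \<infinity>"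
      using SI by (intro nn_integral_PInf_AE Sm) (auto simp: top_unique)
    \<comment> \<open>The iterates are nonnegative only almost everywhere; the absolute value makes
      U nonnegative at every point and changes it on a null set only.\<close>
    define U where "U x = \<bar>lim (\<lambda>n. s n x)\<bar>" for x
    have Um: "U \<in> borel_measurable lebesgue"
      unfolding U_def using sm by (intro borel_measurable_abs borel_measurable_lim_metric)
    have Ur: "spherically_symmetric U"
      unfolding spherically_symmetric_def
    proof (intro allI impI)
      fix x x' :: 'a assume n: "norm x = norm x'"
      have sx: "s n x = s n x'" for n using sr[of n] n unfolding spherically_symmetric_def by blast
      show "U x = U x'" unfolding U_def sx ..
    qed
    have U0: "U x \<ge> 0" for x by (simp add: U_def)
    have slim: "AE x in lebesgue. (\<lambda>n. s n x) \<longlonglongrightarrow> U x"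
      using sinc spos' Sfin
    proof eventually_elim
      case (elim x)
      obtain K where K: "S x = ennreal K" "K \<ge> 0" using elim(3) by (cases "S x") auto
      have "s n x \<le> K powr (1 / q)" for n
      proof -
        have "ennreal (\<bar>s n x\<bar> powr q) \<le> S x" unfolding S_def by (rule SUP_upper) simp
        then have "\<bar>s n x\<bar> powr q \<le> K" using K by simp
        then have "(\<bar>s n x\<bar> powr q) powr (1 / q) \<le> K powr (1 / q)" using q by (intro powr_mono2) auto
        moreover have "(\<bar>s n x\<bar> powr q) powr (1 / q) = \<bar>s n x\<bar>" using q by (simp add: powr_powr)
        ultimately show ?thesis by linarith
      qed
      then obtain L where L: "(\<lambda>n. s n x) \<longlonglongrightarrow> L" using incseq_convergent[OF elim(1)] by metis
      have "L \<ge> 0" using L elim(2) by (intro LIMSEQ_le_const) auto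
      then show ?case using L by (simp add: U_def limI[OF L])
    qed
    have sU: "AE x in lebesgue. s n x \<le> U x" for n
      using sinc slim by eventually_elim (rule incseq_le)
    have UI: "I U \<le> ennreal (\<epsilon> powr q)"
    proof -
      have "I U \<le> (\<integral>\<^sup>+x. S x \<partial>lebesgue)"
        unfolding I_def
      proof (rule nn_integral_mono_AE)
        show "AE x in lebesgue. ennreal (\<bar>U x\<bar> powr q) \<le> S x"
          using slim
        proof eventually_elim
          case (elim x)
          have "(\<lambda>n. \<bar>s n x\<bar> powr q) \<longlonglongrightarrow> \<bar>U x\<bar> powr q"
            using q by (intro tendsto_powr' tendsto_rabs elim tendsto_const) auto
          then have "(\<lambda>n. ennreal (\<bar>s n x\<bar> powr q)) \<longlonglongrightarrow> ennreal (\<bar>U x\<bar> powr q)" by (rule tendsto_ennrealI)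
          then show ?case
            by (rule LIMSEQ_le_const2) (auto simp: S_def intro!: exI[of _ 0] SUP_upper)
        qed
      qed
      then show ?thesis using SI by (rule order_trans)
    qed
    note UW = WL[OF Um UI]
    have WU: "Wf U = (\<lambda>x. C * (H x + U x powr (1 + \<delta>)))" using U0 by (simp add: Wf_def fun_eq_iff)
    have Ueq: "AE x in lebesgue. U x = res_op 0 (Wf U) x"
    proof -
      have "AE x in lebesgue. (\<lambda>n. res_op 0 (Wf (s n)) x) \<longlonglongrightarrow> res_op 0 (Wf U) x"
      proof (rule res_op_dominated[OF order_refl Wm[OF sm] Wm[OF Um] UW(1)])
        show "AE x in lebesgue. \<bar>Wf (s n) x\<bar> \<le> Wf U x" for n
          using sU[of n] spos[of n]
        proof eventually_elim
          case (elim x)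
          then have "\<bar>s n x\<bar> powr (1 + \<delta>) \<le> \<bar>U x\<bar> powr (1 + \<delta>)" using \<delta> by (intro powr_mono2) auto
          then have "Wf (s n) x \<le> Wf U x" unfolding Wf_def using C by (intro mult_left_mono) auto
          then show ?case using W0[of "s n" x] by simp
        qed
        show "AE x in lebesgue. (\<lambda>n. Wf (s n) x) \<longlonglongrightarrow> Wf U x"
          using slim
        proof eventually_elim
          case (elim x)
          have "(\<lambda>n. \<bar>s n x\<bar> powr (1 + \<delta>)) \<longlonglongrightarrow> \<bar>U x\<bar> powr (1 + \<delta>)"
            using \<delta> by (intro tendsto_powr' tendsto_rabs elim tendsto_const) auto
          then show ?case unfolding Wf_def by (intro tendsto_mult tendsto_add tendsto_const)
        qed
      qed
      then show ?thesis using slim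
      proof eventually_elim
        case (elim x)
        have "(\<lambda>n. s (Suc n) x) \<longlonglongrightarrow> res_op 0 (Wf U) x" using elim(1) by (simp only: sS)
        moreover have "(\<lambda>n. s (Suc n) x) \<longlonglongrightarrow> U x" using elim(2) by (rule LIMSEQ_Suc)
        ultimately show ?case using LIMSEQ_unique by blast
      qed
    qed
    have UL: "U \<in> Lp_space 2"
    proof -
      have "sq_norm U = sq_norm (res_op 0 (Wf U))" by (rule sq_norm_cong_AE'[OF Ueq])
      then show ?thesis using res_op_Lp2[OF order_refl UW(1)] Um by (simp add: Lp_space_2_iff)
    qed
    show ?thesis
      using UL Ur U0 UW(1) Ueq UI unfolding WU I_def by (intro exI[of _ U]) (simp add: U0)
  qed
  then show ?thesis using \<epsilon> \<rho>(1,2) unfolding q_def by blast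
qed

end

section \<open>Radial test functions\<close>

lemma Lp_norm_less:
  fixes f :: "'a::euclidean_space \<Rightarrow> 'b::{real_normed_vector, second_countable_topology}"
  assumes p: "p > 0" and fm: "f \<in> borel_measurable lebesgue" and e: "e > 0"
    and "(\<integral>\<^sup>+x. ennreal (norm (f x) powr p) \<partial>lebesgue) < ennreal (e powr p)"
  shows "Lp_norm p f < e"
proof -
  let ?I = "\<integral>\<^sup>+x. ennreal (norm (f x) powr p) \<partial>lebesgue"
  have "(\<integral>x. norm (f x) powr p \<partial>lebesgue) = enn2real ?I"
    using fm by (intro integral_eq_nn_integral AE_I2) auto
  also have "enn2real ?I < e powr p"
    using assms(4) by (cases ?I) (auto simp: ennreal_less_iff)
  finally have "(\<integral>x. norm (f x) powr p \<partial>lebesgue) powr (1 / p) < (e powr p) powr (1 / p)"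
    using p by (intro powr_less_mono2) auto
  then show ?thesis using p e by (simp add: Lp_norm_def powr_powr)
qed

section \<open>Calculus of k times continuously differentiable functions\<close>

lemma has_derivative_frechet:
  "\<forall>x. f differentiable (at x) \<Longrightarrow> (f has_derivative frechet_derivative f (at x)) (at x)"
  by (simp flip: frechet_derivative_works)

lemma k_times_cont_diffI:
  assumes "\<And>x. (f has_derivative f' x) (at x)" and "\<And>v. k_times_cont_diff k (\<lambda>x. f' x v)"
  shows "k_times_cont_diff (Suc k) f"
proof -
  have "frechet_derivative f (at x) = f' x" for x using frechet_derivative_at[OF assms(1)] by simp
  then show ?thesis using assms by (auto simp: differentiable_def)
qed

lemma k_times_cont_diff_Suc: "k_times_cont_diff (Suc k) f \<Longrightarrow> k_times_cont_diff k f"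
proof (induction k arbitrary: f)
  case 0
  then show ?case
    by (auto simp: continuous_on_eq_continuous_at differentiable_imp_continuous_within)
next
  case (Suc k)
  from Suc.prems have d: "\<forall>x. f differentiable (at x)"
    and "k_times_cont_diff (Suc k) (\<lambda>x. frechet_derivative f (at x) v)" for v
    by (auto simp only: k_times_cont_diff.simps(2)[of "Suc k"])
  then have "k_times_cont_diff k (\<lambda>x. frechet_derivative f (at x) v)" for v by (intro Suc.IH)
  with d show ?case by simp
qed

lemma k_times_cont_diff_const: "k_times_cont_diff k (\<lambda>x. c)"
proof (induction k arbitrary: c)
  case (Suc k)
  show ?case by (rule k_times_cont_diffI[OF has_derivative_const Suc])
qed simp

lemma k_times_cont_diff_linear:
  assumes "bounded_linear f"
  shows "k_times_cont_diff k f"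
proof (cases k)
  case 0
  then show ?thesis using linear_continuous_on[OF assms] by simp
next
  case (Suc j)
  show ?thesis unfolding Suc
    by (rule k_times_cont_diffI[OF bounded_linear_imp_has_derivative[OF assms] k_times_cont_diff_const])
qed

lemma k_times_cont_diff_add:
  "k_times_cont_diff k f \<Longrightarrow> k_times_cont_diff k g \<Longrightarrow> k_times_cont_diff k (\<lambda>x. f x + g x)"
proof (induction k arbitrary: f g)
  case 0
  then show ?case by (auto intro: continuous_on_add)
next
  case (Suc k)
  show ?case
  proof (rule k_times_cont_diffI)
    show "((\<lambda>x. f x + g x) has_derivative (\<lambda>v. frechet_derivative f (at x) v + frechet_derivative g (at x) v)) (at x)" for x
      using Suc.prems by (intro has_derivative_add has_derivative_frechet) auto
    show "k_times_cont_diff k (\<lambda>x. frechet_derivative f (at x) v + frechet_derivative g (at x) v)" for v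
      using Suc.prems by (intro Suc.IH) simp_all
  qed
qed

lemma k_times_cont_diff_mult:
  fixes f g :: "'a::euclidean_space \<Rightarrow> real"
  shows "k_times_cont_diff k f \<Longrightarrow> k_times_cont_diff k g \<Longrightarrow> k_times_cont_diff k (\<lambda>x. f x * g x)"
proof (induction k arbitrary: f g)
  case 0
  then show ?case by (auto intro: continuous_on_mult)
next
  case (Suc k)
  note prev = Suc.prems[THEN k_times_cont_diff_Suc]
  show ?case
  proof (rule k_times_cont_diffI)
    show "((\<lambda>x. f x * g x) has_derivative (\<lambda>v. f x * frechet_derivative g (at x) v + frechet_derivative f (at x) v * g x)) (at x)" for x
      using Suc.prems by (intro has_derivative_mult has_derivative_frechet) auto
    show "k_times_cont_diff k (\<lambda>x. f x * frechet_derivative g (at x) v + frechet_derivative f (at x) v * g x)" for v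
      using Suc.prems prev by (intro k_times_cont_diff_add Suc.IH) auto
  qed
qed

lemma k_times_cont_diff_real_polynomial:
  "real_polynomial_function f \<Longrightarrow> k_times_cont_diff k f"
  by (induction rule: real_polynomial_function.induct)
    (auto intro: k_times_cont_diff_linear k_times_cont_diff_const k_times_cont_diff_add k_times_cont_diff_mult)

text \<open>A derivative of P(G(x)) involves P', so the induction on k runs over a whole family
  closed under differentiation. The family used is the range of \<open>bump\<close>.\<close>

lemma k_times_cont_diff_compose:
  fixes G :: "'a::euclidean_space \<Rightarrow> real" and S :: "(real \<Rightarrow> real) set"
  assumes S: "\<And>P. P \<in> S \<Longrightarrow> \<exists>Q\<in>S. \<forall>s. (P has_real_derivative Q s) (at s)"
    and G: "\<And>k. k_times_cont_diff k G"
  shows "P \<in> S \<Longrightarrow> k_times_cont_diff k (\<lambda>x. P (G x))"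
proof (induction k arbitrary: P)
  case 0
  obtain Q where "\<And>s. (P has_real_derivative Q s) (at s)" using S[OF 0] by blast
  then have "continuous_on UNIV P" by (auto intro: DERIV_continuous_on has_field_derivative_at_within)
  then show ?case using G[of 0] by (auto intro: continuous_on_compose2)
next
  case (Suc k)
  obtain Q where Q: "Q \<in> S" "\<And>s. (P has_real_derivative Q s) (at s)" using S[OF Suc.prems] by blast
  have dG: "(G has_derivative frechet_derivative G (at x)) (at x)" for x
    using G[of 1] by (intro has_derivative_frechet) simp
  show ?case
  proof (rule k_times_cont_diffI)
    show "((\<lambda>x. P (G x)) has_derivative (\<lambda>v. Q (G x) * frechet_derivative G (at x) v)) (at x)" for x
      using has_derivative_compose[OF dG, of P "(*) (Q (G x))"] Q(2)[of "G x"] by (simp add: has_field_derivative_def)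
    show "k_times_cont_diff k (\<lambda>x. Q (G x) * frechet_derivative G (at x) v)" for v
      using Suc.IH[OF Q(1)] G[of "Suc k"] by (intro k_times_cont_diff_mult) auto
  qed
qed

text \<open>\<open>bump 1\<close> is the classical smooth function exp(- 1 / t) for t > 0, extended
  by 0. The polynomial factor in 1 / t makes the family closed under differentiation.\<close>

definition bump :: "real poly \<Rightarrow> real \<Rightarrow> real" where
  "bump p t = (if t > 0 then poly p (1 / t) * exp (- (1 / t)) else 0)"

lemma bump_tendsto: "((\<lambda>t. bump p t) \<longlongrightarrow> 0) (at_right 0)"
proof -
  have "((\<lambda>x. \<Sum>i\<le>degree p. coeff p i * (x ^ i / exp x)) \<longlongrightarrow> (\<Sum>i\<le>degree p. coeff p i * 0)) at_top"
    by (intro tendsto_intros tendsto_power_div_exp_0)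
  then have "((\<lambda>x. poly p x * exp (- x)) \<longlongrightarrow> 0) at_top"
    by (simp add: poly_altdef sum_distrib_right exp_minus divide_inverse mult.assoc)
  from filterlim_compose[OF this filterlim_inverse_at_top_right]
  have "((\<lambda>t. poly p (inverse t) * exp (- inverse t)) \<longlongrightarrow> 0) (at_right 0)" .
  then show ?thesis
    by (rule Lim_transform_eventually)
      (auto simp: eventually_at_right_field bump_def inverse_eq_divide intro!: exI[of _ 1])
qed

text \<open>With x = 1 / t the derivative of p(x) exp(- x) in t is x^2 (p - p')(x) exp(- x), again a
  function of the family; this is the polynomial \<open>?r\<close>.\<close>

lemma bump_derivative:
  "\<exists>p'. \<forall>t. (bump p has_real_derivative bump p' t) (at t)"
proof (intro exI allI)
  let ?r = "[:0, 0, 1:] * (p - pderiv p)"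
  fix t :: real
  consider "t > 0" | "t < 0" | "t = 0" by linarith
  then show "(bump p has_real_derivative bump ?r t) (at t)"
  proof cases
    case 1
    have "((\<lambda>t. poly p (1 / t) * exp (- (1 / t))) has_real_derivative
       poly (pderiv p) (1 / t) * (- (1 / t\<^sup>2)) * exp (- (1 / t)) + exp (- (1 / t)) * (1 / t\<^sup>2) * poly p (1 / t)) (at t)"
      using 1 by (auto intro!: derivative_eq_intros simp: power2_eq_square)
    also have "poly (pderiv p) (1 / t) * (- (1 / t\<^sup>2)) * exp (- (1 / t)) + exp (- (1 / t)) * (1 / t\<^sup>2) * poly p (1 / t) = bump ?r t"
      using 1 by (simp add: bump_def algebra_simps power2_eq_square)
    finally show ?thesis
      by (rule has_field_derivative_transform_within_open[of _ _ _ "{0<..}"]) (use 1 in \<open>auto simp: bump_def\<close>)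
  next
    case 2
    have "((\<lambda>_. 0) has_real_derivative bump ?r t) (at t)" using 2 by (simp add: bump_def)
    then show ?thesis
      by (rule has_field_derivative_transform_within_open[of _ _ _ "{..<0}"]) (use 2 in \<open>auto simp: bump_def\<close>)
  next
    case 3
    \<comment> \<open>Dividing by h multiplies the polynomial by x = 1 / h, so the right difference
      quotient at 0 is itself a \<open>bump\<close> and tends to 0.\<close>
    have R: "((\<lambda>h. bump p h / h) \<longlongrightarrow> 0) (at_right 0)"
      by (rule Lim_transform_eventually[OF bump_tendsto[of "[:0, 1:] * p"]])
        (auto simp: eventually_at_right_field bump_def intro!: exI[of _ 1])
    have L: "((\<lambda>h. bump p h / h) \<longlongrightarrow> 0) (at_left 0)"
      by (rule tendsto_eventually) (auto simp: eventually_at_left_field bump_def intro!: exI[of _ "-1"])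
    have "((\<lambda>h. bump p h / h) \<longlongrightarrow> 0) (at 0)" using L R by (rule filterlim_split_at)
    then show ?thesis unfolding 3 by (simp add: has_field_derivative_iff bump_def)
  qed
qed

lemma bump_bounds: "0 \<le> bump 1 t" "bump 1 t \<le> 1" "t > 0 \<Longrightarrow> bump 1 t > 0" "s \<le> t \<Longrightarrow> bump 1 s \<le> bump 1 t"
  by (auto simp: bump_def divide_left_mono intro: order_trans[of _ 0])

lemma test_function_bump:
  fixes R :: real
  assumes g: "real_polynomial_function g"
  defines "\<phi> \<equiv> \<lambda>x::'a::euclidean_space. g (x \<bullet> x) * bump 1 (R\<^sup>2 - x \<bullet> x)"
  shows "test_function \<phi>" "spherically_symmetric \<phi>"
proof -
  have sq: "real_polynomial_function (\<lambda>x::'a. x \<bullet> x)"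
  proof -
    have "real_polynomial_function (\<lambda>x::'a. \<Sum>b\<in>Basis. (x \<bullet> b) * (x \<bullet> b))"
      by (intro real_polynomial_function_sum) (auto intro!: real_polynomial_function.intros(4) real_polynomial_function.intros(1)[OF bounded_linear_inner_left])
    then show ?thesis by (simp flip: euclidean_inner)
  qed
  have gs: "real_polynomial_function (\<lambda>x::'a. g (x \<bullet> x))"
    using real_polynomial_function_compose[OF _ g, of "\<lambda>x::'a. x \<bullet> x"] sq
    by (simp add: o_def real_polynomial_function_eq)
  have rs: "real_polynomial_function (\<lambda>x::'a. R\<^sup>2 - x \<bullet> x)"
    by (intro real_polynomial_function_diff sq real_polynomial_function.intros(2))
  have "k_times_cont_diff k (\<lambda>x::'a. bump 1 (R\<^sup>2 - x \<bullet> x))" for k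
    by (rule k_times_cont_diff_compose[of "range bump"])
      (use bump_derivative k_times_cont_diff_real_polynomial[OF rs] in \<open>auto simp: Bex_def\<close>)
  then have "\<forall>k. k_times_cont_diff k \<phi>"
    unfolding \<phi>_def using k_times_cont_diff_mult[OF k_times_cont_diff_real_polynomial[OF gs]] by blast
  moreover have "{x. \<phi> x \<noteq> 0} \<subseteq> cball 0 \<bar>R\<bar>"
  proof
    fix x assume "x \<in> {x. \<phi> x \<noteq> 0}"
    then have "R\<^sup>2 - x \<bullet> x > 0" by (auto simp: \<phi>_def bump_def split: if_splits)
    then have "(norm x)\<^sup>2 \<le> \<bar>R\<bar>\<^sup>2" by (simp add: power2_norm_eq_inner)
    then have "norm x \<le> \<bar>R\<bar>" by (rule power2_le_imp_le) simp
    then show "x \<in> cball 0 \<bar>R\<bar>" by simp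
  qed
  then have "bounded {x. \<phi> x \<noteq> 0}" by (rule bounded_subset[OF bounded_cball])
  ultimately show "test_function \<phi>" unfolding test_function_def by (simp add: compact_closure)
  show "spherically_symmetric \<phi>"
    unfolding \<phi>_def spherically_symmetric_def by (simp flip: power2_norm_eq_inner)
qed

text \<open>The cutoff \<open>bump 1 (r\<^sup>2 - x \<bullet> x)\<close> is divided out before the Weierstrass approximation in the
  variable \<open>x \<bullet> x\<close>; the maximum with \<open>m\<close> only changes the quotient where \<open>c\<close> vanishes.\<close>

lemma test_function_approx_continuous:
  fixes c :: "'a::euclidean_space \<Rightarrow> real"
  assumes c: "continuous_on UNIV c" "spherically_symmetric c" and R: "R \<ge> 0" "\<And>x. norm x > R \<Longrightarrow> c x = 0"
    and e: "e > 0" and p: "p > 0"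
  shows "\<exists>\<phi>. test_function \<phi> \<and> spherically_symmetric \<phi> \<and> continuous_on UNIV \<phi> \<and>
     (\<integral>\<^sup>+x. ennreal (\<bar>c x - \<phi> x\<bar> powr p) \<partial>lebesgue) < ennreal e"
proof -
  define r where "r = R + 1"
  have rR: "R\<^sup>2 < r\<^sup>2" using R unfolding r_def by (intro power_strict_mono) auto
  define m where "m = bump 1 (r\<^sup>2 - R\<^sup>2)"
  have m: "m > 0" unfolding m_def using rR by (intro bump_bounds) simp
  \<comment> \<open>A fixed unit vector: restricting the radial function c to the ray through b
    gives its profile as a function of s = |x|^2.\<close>
  obtain b :: 'a where b: "norm b = 1" using vector_choose_size[of 1] by auto
  define F where "F s = c (sqrt s *\<^sub>R b) / max m (bump 1 (r\<^sup>2 - s))" for s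
  have bc: "continuous_on UNIV (bump 1)"
    using bump_derivative[of 1] by (auto intro: DERIV_continuous_on has_field_derivative_at_within)
  have Fc: "continuous_on {0..r\<^sup>2} F"
    unfolding F_def using m
    by (intro continuous_on_divide continuous_intros continuous_on_compose2[OF c(1)] continuous_on_compose2[OF bc]) auto
  have Fb: "F (x \<bullet> x) * bump 1 (r\<^sup>2 - x \<bullet> x) = c x" for x
  proof -
    have "norm (sqrt (x \<bullet> x) *\<^sub>R b) = norm x" using b by (simp add: norm_eq_sqrt_inner)
    then have cx: "c (sqrt (x \<bullet> x) *\<^sub>R b) = c x" using c(2) unfolding spherically_symmetric_def by blast
    show ?thesis
    proof (cases "norm x > R")
      case True
      then show ?thesis using R(2)[of x] unfolding F_def cx by simp
    next
      case False
      then have "x \<bullet> x \<le> R\<^sup>2" using R(1) by (simp add: power_mono flip: power2_norm_eq_inner)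
      then have "m \<le> bump 1 (r\<^sup>2 - x \<bullet> x)" unfolding m_def by (intro bump_bounds) simp
      then show ?thesis using m unfolding F_def cx by (simp add: max_def)
    qed
  qed
  define K where "K = enn2real (emeasure lborel (cball (0::'a) r))"
  have K: "emeasure lborel (cball (0::'a) r) = ennreal K" "K \<ge> 0"
    using emeasure_lborel_cball_finite[of "0::'a" r] by (auto simp: K_def)
  \<comment> \<open>A uniform error d on the ball of volume K costs d^p K = e K / (2 (K + 1)), which
    is below e; the summand 1 guards against division by 0.\<close>
  define d where "d = (e / (2 * (K + 1))) powr (1 / p)"
  have d: "d > 0" using e K by (simp add: d_def)
  obtain g where g: "real_polynomial_function g" "\<And>s. s \<in> {0..r\<^sup>2} \<Longrightarrow> \<bar>F s - g s\<bar> < d"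
    using Stone_Weierstrass_real_polynomial_function[OF compact_Icc Fc d] by metis
  define \<phi> where "\<phi> x = g (x \<bullet> x) * bump 1 (r\<^sup>2 - x \<bullet> x)" for x :: 'a
  have \<phi>: "test_function \<phi>" "spherically_symmetric \<phi>"
    using test_function_bump[OF g(1), of r] unfolding \<phi>_def by auto
  have \<phi>c: "continuous_on UNIV \<phi>" using \<phi>(1) unfolding test_function_def by (metis k_times_cont_diff.simps(1))
  have close: "\<bar>c x - \<phi> x\<bar> \<le> d * indicator (cball 0 r) x" for x
  proof -
    have eq: "c x - \<phi> x = (F (x \<bullet> x) - g (x \<bullet> x)) * bump 1 (r\<^sup>2 - x \<bullet> x)"
      unfolding \<phi>_def Fb[symmetric] by (simp add: left_diff_distrib)
    show ?thesis
    proof (cases "x \<bullet> x \<le> r\<^sup>2")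
      case True
      then have "(norm x)\<^sup>2 \<le> r\<^sup>2" by (simp only: power2_norm_eq_inner)
      then have "norm x \<le> r" by (rule power2_le_imp_le) (use R(1) in \<open>simp add: r_def\<close>)
      have "\<bar>F (x \<bullet> x) - g (x \<bullet> x)\<bar> * \<bar>bump 1 (r\<^sup>2 - x \<bullet> x)\<bar> \<le> d * 1"
      proof (rule mult_mono)
        show "\<bar>F (x \<bullet> x) - g (x \<bullet> x)\<bar> \<le> d" using g(2)[of "x \<bullet> x"] True by simp
        show "\<bar>bump 1 (r\<^sup>2 - x \<bullet> x)\<bar> \<le> 1" using bump_bounds(1,2)[of "r\<^sup>2 - x \<bullet> x"] by linarith
      qed (use d in auto)
      then show ?thesis unfolding eq using \<open>norm x \<le> r\<close> by (simp add: abs_mult)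
    next
      case False
      then have "bump 1 (r\<^sup>2 - x \<bullet> x) = 0" by (simp add: bump_def)
      then show ?thesis unfolding eq using d by simp
    qed
  qed
  have "(\<integral>\<^sup>+x. ennreal (\<bar>c x - \<phi> x\<bar> powr p) \<partial>lebesgue) \<le> (\<integral>\<^sup>+x. ennreal (d powr p) * indicator (cball 0 r) x \<partial>(lebesgue :: 'a measure))"
  proof (rule nn_integral_mono)
    fix x :: 'a
    show "ennreal (\<bar>c x - \<phi> x\<bar> powr p) \<le> ennreal (d powr p) * indicator (cball 0 r) x"
      using close[of x] p by (cases "x \<in> cball 0 r") (auto intro!: ennreal_leI powr_mono2)
  qed
  also have "\<dots> = ennreal (d powr p) * emeasure lborel (cball (0::'a) r)"
    by (simp add: nn_integral_cmult_indicator)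
  also have "\<dots> = ennreal (e / (2 * (K + 1)) * K)"
    using p e K by (simp add: d_def powr_powr flip: ennreal_mult)
  also have "\<dots> < ennreal e"
    using K(2) e by (intro ennreal_lessI) (auto simp: field_simps add_nonneg_pos)
  finally show ?thesis using \<phi> \<phi>c by blast
qed

section \<open>Mollification of radial functions by the heat kernel\<close>

lemma heat_convolve_continuous:
  fixes f :: "'a::euclidean_space \<Rightarrow> real"
  assumes t: "t > 0" and f: "integrable lebesgue f"
  shows "continuous_on UNIV (convolve (heat_kernel t) f)"
  unfolding continuous_on_sequentially o_def
proof (intro allI ballI impI)
  fix z and x :: 'a assume "(\<forall>n. z n \<in> UNIV) \<and> z \<longlonglongrightarrow> x"
  then have z: "z \<longlonglongrightarrow> x" by simp
  let ?K = "(4 * pi * t) powr (- real DIM('a) / 2)"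
  note c = conv_kernel.convolve_integrand_measurable[OF heat_conv_kernel(1)[OF t], of f]
  have fm: "f \<in> borel_measurable lebesgue" using f by (rule borel_measurable_integrable)
  have hc: "continuous_on UNIV (heat_kernel t :: 'a \<Rightarrow> real)"
    unfolding heat_kernel_def by (intro continuous_intros) (use t in auto)
  show "(\<lambda>n. convolve (heat_kernel t) f (z n)) \<longlonglongrightarrow> convolve (heat_kernel t) f x"
    unfolding convolve_def
  proof (rule integral_dominated_convergence[where w = "\<lambda>y. ?K * \<bar>f y\<bar>"])
    show "integrable lebesgue (\<lambda>y. ?K * \<bar>f y\<bar>)" using f by simp
    show "AE y in lebesgue. (\<lambda>n. heat_kernel t (z n - y) *\<^sub>R f y) \<longlonglongrightarrow> heat_kernel t (x - y) *\<^sub>R f y"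
      by (intro AE_I2 tendsto_scaleR continuous_on_tendsto_compose[OF hc] tendsto_diff z tendsto_const) auto
    show "AE y in lebesgue. norm (heat_kernel t (z n - y) *\<^sub>R f y) \<le> ?K * \<bar>f y\<bar>" for n
      using heat_kernel_le[OF t, where 'a='a] by (intro AE_I2) (simp add: abs_mult mult_right_mono)
  qed (use c fm in auto)
qed

text \<open>As the kernel has mass 1, the difference is an average of f(x) - f(x + z). Fubini bounds
  its L^1 norm by the kernel average of the translation modulus \<open>\<Omega>\<close>, which tends
  to 0 by the approximate identity.\<close>

lemma heat_convolve_L1_tendsto:
  fixes f :: "'a::euclidean_space \<Rightarrow> real"
  assumes f [measurable]: "f \<in> borel_measurable borel" and fi: "integrable lborel f" and t: "\<And>n. t n > 0" "t \<longlonglongrightarrow> 0"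
    and M: "\<And>x. \<bar>f x\<bar> \<le> M"
  shows "(\<lambda>n. \<integral>\<^sup>+x. ennreal \<bar>f x - convolve (heat_kernel (t n)) f x\<bar> \<partial>lborel) \<longlonglongrightarrow> 0"
    and "\<bar>convolve (heat_kernel (t n)) f x\<bar> \<le> M"
proof -
  have hm [measurable]: "heat_kernel (t n) \<in> borel_measurable (borel :: 'a measure)" for n
    by (rule conv_kernel.kernel_measurable[OF heat_conv_kernel(1)[OF t(1)]])
  have hI: "integrable lborel (heat_kernel (t n) :: 'a \<Rightarrow> real)" for n by (rule heat_kernel_integral(1)[OF t(1)])
  have hb: "\<bar>heat_kernel (t n) z * f y\<bar> \<le> M * heat_kernel (t n) z" for n z y
    using mult_right_mono[OF M[of y] heat_kernel_nonneg[of "t n" z]] by (simp add: abs_mult mult.commute)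
  have conv: "convolve (heat_kernel (t n)) f x = (\<integral>z. heat_kernel (t n) z * f (x + z) \<partial>lborel)" for n x
  proof -
    have "convolve (heat_kernel (t n)) f x = (\<integral>y. heat_kernel (t n) (x - y) * f y \<partial>lborel)"
      by (simp add: conv_kernel.convolve_borel[OF heat_conv_kernel(1)[OF t(1)]])
    also have "\<dots> = (\<integral>z. heat_kernel (t n) (x - (z + x)) * f (z + x) \<partial>lborel)"
      by (rule lborel_integral_shift(1)[symmetric]) measurable
    finally show ?thesis by (simp add: add.commute)
  qed
  have hi: "integrable lborel (\<lambda>z. heat_kernel (t n) z * f (x + z))" for n x
  proof (rule Bochner_Integration.integrable_bound[of _ "\<lambda>z. M * heat_kernel (t n) z"])
    show "integrable lborel (\<lambda>z::'a. M * heat_kernel (t n) z)" by (rule integrable_mult_right[OF hI])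
    show "AE z in lborel. norm (heat_kernel (t n) z * f (x + z)) \<le> norm (M * heat_kernel (t n) z)"
      using hb order_trans[OF abs_ge_zero M] by (intro AE_I2) (simp add: abs_mult)
  qed measurable
  have h1: "(\<integral>z. c * heat_kernel (t n) (z::'a) \<partial>lborel) = c" for c n 
    using heat_kernel_integral(2)[OF t(1), where 'a='a] by simp
  show "\<bar>convolve (heat_kernel (t n)) f x\<bar> \<le> M"
  proof -
    have "\<bar>convolve (heat_kernel (t n)) f x\<bar> \<le> (\<integral>z. \<bar>heat_kernel (t n) z * f (x + z)\<bar> \<partial>lborel)"
      unfolding conv by (rule integral_abs_bound)
    also have "\<dots> \<le> (\<integral>z. M * heat_kernel (t n) (z::'a) \<partial>lborel)"
      using hi[of n x] by (intro integral_mono hb integrable_mult_right hI) auto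
    finally show ?thesis unfolding h1 .
  qed
  define \<Omega> where "\<Omega> z = (\<integral>\<^sup>+x. ennreal \<bar>f (x + z) - f x\<bar> \<partial>lborel)" for z
  have \<Omega>m [measurable]: "\<Omega> \<in> borel_measurable borel" unfolding \<Omega>_def by measurable
  define B where "B = (\<integral>\<^sup>+x. ennreal \<bar>f x\<bar> \<partial>lborel)"
  have B: "B < \<infinity>" using fi unfolding B_def by (simp add: integrable_iff_bounded)
  have \<Omega>B: "\<Omega> z \<le> B + B" for z
  proof -
    have "\<Omega> z \<le> (\<integral>\<^sup>+x. ennreal \<bar>f (x + z)\<bar> + ennreal \<bar>f x\<bar> \<partial>lborel)"
      unfolding \<Omega>_def by (intro nn_integral_mono) (simp flip: ennreal_plus)
    also have "\<dots> = (\<integral>\<^sup>+x. ennreal \<bar>f (x + z)\<bar> \<partial>lborel) + B"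
      unfolding B_def by (intro nn_integral_add) auto
    also have "(\<integral>\<^sup>+x. ennreal \<bar>f (x + z)\<bar> \<partial>lborel) = B"
      unfolding B_def using lborel_nn_integral_shift[of "\<lambda>x. ennreal \<bar>f x\<bar>" z] by (simp add: add.commute)
    finally show ?thesis .
  qed
  have \<Omega>0: "(\<lambda>n. \<Omega> (z n)) \<longlonglongrightarrow> 0" if "z \<longlonglongrightarrow> 0" for z
    using Lp_translation_continuous[OF zero_less_one f _ that] B unfolding \<Omega>_def B_def by simp
  have bound: "(\<integral>\<^sup>+x. ennreal \<bar>f x - convolve (heat_kernel (t n)) f x\<bar> \<partial>lborel) \<le> (\<integral>\<^sup>+z. ennreal (heat_kernel (t n) z) * \<Omega> z \<partial>lborel)" for n
  proof -
    have "ennreal \<bar>f x - convolve (heat_kernel (t n)) f x\<bar> \<le> (\<integral>\<^sup>+z. ennreal (heat_kernel (t n) z) * ennreal \<bar>f (x + z) - f x\<bar> \<partial>lborel)" for x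
    proof -
      have i: "integrable lborel (\<lambda>z. f x * heat_kernel (t n) (z::'a))" by (rule integrable_mult_right[OF hI])
      have "f x - convolve (heat_kernel (t n)) f x = (\<integral>z. f x * heat_kernel (t n) z - heat_kernel (t n) z * f (x + z) \<partial>lborel)"
        unfolding conv using Bochner_Integration.integral_diff[OF i hi[of n x]] h1[of "f x" n] by simp
      also have "ennreal \<bar>\<dots>\<bar> \<le> (\<integral>\<^sup>+z. ennreal (norm (f x * heat_kernel (t n) z - heat_kernel (t n) z * f (x + z))) \<partial>lborel)"
        using integral_norm_bound_ennreal[OF Bochner_Integration.integrable_diff[OF i hi[of n x]]] by simp
      also have "\<dots> = (\<integral>\<^sup>+z. ennreal (heat_kernel (t n) z) * ennreal \<bar>f (x + z) - f x\<bar> \<partial>lborel)"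
      proof (rule nn_integral_cong)
        fix z :: 'a
        have "f x * heat_kernel (t n) z - heat_kernel (t n) z * f (x + z) = heat_kernel (t n) z * (f x - f (x + z))"
          by (simp add: algebra_simps)
        then show "ennreal (norm (f x * heat_kernel (t n) z - heat_kernel (t n) z * f (x + z))) = ennreal (heat_kernel (t n) z) * ennreal \<bar>f (x + z) - f x\<bar>"
          by (simp add: abs_mult ennreal_mult abs_minus_commute)
      qed
      finally show ?thesis .
    qed
    then have "(\<integral>\<^sup>+x. ennreal \<bar>f x - convolve (heat_kernel (t n)) f x\<bar> \<partial>lborel)
        \<le> (\<integral>\<^sup>+x. (\<integral>\<^sup>+z. ennreal (heat_kernel (t n) z) * ennreal \<bar>f (x + z) - f x\<bar> \<partial>lborel) \<partial>lborel)"
      by (rule nn_integral_mono)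
    also have "\<dots> = (\<integral>\<^sup>+z. (\<integral>\<^sup>+x. ennreal (heat_kernel (t n) z) * ennreal \<bar>f (x + z) - f x\<bar> \<partial>lborel) \<partial>lborel)"
      by (rule lborel_pair.Fubini') measurable
    also have "\<dots> = (\<integral>\<^sup>+z. ennreal (heat_kernel (t n) z) * \<Omega> z \<partial>lborel)"
      unfolding \<Omega>_def by (intro nn_integral_cong nn_integral_cmult) measurable
    finally show ?thesis .
  qed
  have "(\<lambda>n. \<integral>\<^sup>+z. ennreal (heat_kernel (t n) z) * \<Omega> z \<partial>lborel) \<longlonglongrightarrow> 0"
    by (rule heat_kernel_approx_identity[OF \<Omega>m \<Omega>B _ \<Omega>0 t]) (use B in auto)
  then show "(\<lambda>n. \<integral>\<^sup>+x. ennreal \<bar>f x - convolve (heat_kernel (t n)) f x\<bar> \<partial>lborel) \<longlonglongrightarrow> 0"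
    by (rule tendsto_0_ennreal_le[where c = 1]) (use bound in auto)
qed

text \<open>A generic continuous approximant is not radial, so u is truncated and then mollified by
  convolution with the radial heat kernel, which keeps symmetry. The mollification error is small in
  L^1, and the uniform bounds of the truncated functions turn this into smallness in L^p. A cutoff
  then gives bounded support, and the continuous radial result is approximated by test
  functions.\<close>

lemma Lp_rad_spherically_symmetric:
  fixes u :: "'a::euclidean_space \<Rightarrow> real"
  assumes p: "p \<ge> 1" and u: "u \<in> Lp_space p" "spherically_symmetric u"
  shows "u \<in> Lp_rad p"
proof -
  have um: "u \<in> borel_measurable lebesgue" and fi: "(\<integral>\<^sup>+x. ennreal (norm (u x) powr p) \<partial>lebesgue) < \<infinity>"
    using u(1) unfolding Lp_space_def by (auto simp: integrable_iff_bounded)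
  have "\<exists>\<phi>. test_function \<phi> \<and> spherically_symmetric \<phi> \<and> Lp_norm p (\<lambda>x. u x - \<phi> x) < e" if e: "e > 0" for e
  proof -
    \<comment> \<open>Three errors of size d, combined by two nested quasi-triangle inequalities,
      total 2^p (1 + 2 * 2^p) d = e^p / 2.\<close>
    define d where "d = e powr p / (2 * (2 powr p * (1 + 2 * 2 powr p)))"
    have d: "d > 0" using e by (simp add: d_def add_pos_pos)
    define F where "F n x = (if norm x \<le> real n \<and> norm (u x) \<le> real n then u x else 0)" for n x
    have "(\<lambda>n. \<integral>\<^sup>+x. ennreal (norm (u x - F n x) powr p) \<partial>lebesgue) \<longlonglongrightarrow> 0"
      unfolding F_def by (rule Lp_truncation[OF um fi])
    then have "\<forall>\<^sub>F n in sequentially. (\<integral>\<^sup>+x. ennreal (norm (u x - F n x) powr p) \<partial>lebesgue) < ennreal d"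
      using d by (intro order_tendstoD) auto
    then obtain N where N: "(\<integral>\<^sup>+x. ennreal (norm (u x - F N x) powr p) \<partial>lebesgue) < ennreal d"
      by (auto simp: eventually_at_top_linorder)
    define f where "f = F N"
    have nm [measurable]: "(norm :: 'a \<Rightarrow> real) \<in> borel_measurable lebesgue"
      by (intro measurable_completion) measurable
    note um [measurable]
    have fm: "f \<in> borel_measurable lebesgue" unfolding f_def F_def by measurable
    have fb: "\<bar>f x\<bar> \<le> real N" for x by (simp add: f_def F_def)
    have f0: "f x = 0" if "norm x > real N" for x using that by (simp add: f_def F_def)
    have fr: "spherically_symmetric f"
      unfolding spherically_symmetric_def
    proof (intro allI impI)
      fix x x' :: 'a assume n: "norm x = norm x'"
      then have "u x = u x'" using u(2) unfolding spherically_symmetric_def by blast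
      then show "f x = f x'" using n by (simp add: f_def F_def)
    qed
    have fint: "integrable lebesgue f"
    proof (rule integrableI_bounded[OF fm])
      have "(\<integral>\<^sup>+x. ennreal (norm (f x)) \<partial>lebesgue) \<le> (\<integral>\<^sup>+x. ennreal (real N) * indicator (cball 0 (real N)) x \<partial>(lebesgue :: 'a measure))"
      proof (rule nn_integral_mono)
        fix x :: 'a
        show "ennreal (norm (f x)) \<le> ennreal (real N) * indicator (cball 0 (real N)) x"
          using fb[of x] f0[of x] by (cases "norm x \<le> real N") (auto intro!: ennreal_leI)
      qed
      also have "\<dots> < \<infinity>" by (rule nn_integral_cball_finite)
      finally show "(\<integral>\<^sup>+x. ennreal (norm (f x)) \<partial>lebesgue) < \<infinity>" .
    qed
    obtain f1 where f1: "f1 \<in> borel_measurable borel" "AE x in lebesgue. f x = f1 x"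
      using borel_rep_euclidean[OF fm] .
    \<comment> \<open>The Borel representative may exceed the bound on a null set; clamping makes it
      bounded at every point, as the mollification lemma requires.\<close>
    define f2 where "f2 x = max (- real N) (min (real N) (f1 x))" for x
    have f2m: "f2 \<in> borel_measurable borel" unfolding f2_def using f1(1) by measurable
    have f2b: "\<bar>f2 x\<bar> \<le> real N" for x by (auto simp: f2_def)
    have f2: "AE x in lebesgue. f x = f2 x"
      using f1(2)
    proof eventually_elim
      case (elim x)
      then show ?case using fb[of x] by (auto simp: f2_def)
    qed
    have f2i: "integrable lborel f2"
    proof -
      have "f2 \<in> borel_measurable lebesgue" using f2m by (intro measurable_completion) simp
      then have "integrable lebesgue f2"
        using integrable_cong_AE[OF fm _ f2] fint by blast
      then show ?thesis using integrable_completion[of f2 lborel] f2m by simp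
    qed
    define t where "t n = inverse (real (Suc n))" for n
    have t: "\<And>n. t n > 0" "t \<longlonglongrightarrow> 0"
      unfolding t_def using LIMSEQ_inverse_real_of_nat by auto
    \<comment> \<open>Both functions are bounded by N, so p - 1 of the p factors of their difference
      are at most 2 N; the summand 1 keeps K positive when N = 0.\<close>
    define K where "K = (2 * real N + 1) powr (p - 1)"
    have K: "K > 0" by (simp add: K_def)
    have "\<forall>\<^sub>F n in sequentially. (\<integral>\<^sup>+x. ennreal \<bar>f2 x - convolve (heat_kernel (t n)) f2 x\<bar> \<partial>lborel) < ennreal (d / K)"
      using heat_convolve_L1_tendsto(1)[OF f2m f2i t f2b] d K by (intro order_tendstoD) auto
    then obtain n where n: "(\<integral>\<^sup>+x. ennreal \<bar>f2 x - convolve (heat_kernel (t n)) f2 x\<bar> \<partial>lborel) < ennreal (d / K)"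
      by (auto simp: eventually_at_top_linorder)
    define c0 where "c0 = convolve (heat_kernel (t n)) f"
    have c0_eq: "c0 = convolve (heat_kernel (t n)) f2"
      unfolding c0_def by (rule conv_kernel.convolve_cong_AE[OF heat_conv_kernel(1)[OF t(1)] fm f2])
    have c0b: "\<bar>c0 x\<bar> \<le> real N" for x
      unfolding c0_eq by (rule heat_convolve_L1_tendsto(2)[OF f2m f2i t f2b])
    have c0c: "continuous_on UNIV c0" unfolding c0_def by (rule heat_convolve_continuous[OF t(1) fint])
    have c0r: "spherically_symmetric c0" unfolding c0_def
      by (rule conv_kernel.convolve_spherically_symmetric[OF heat_conv_kernel(1)[OF t(1)] heat_kernel_norm_cong fm fr])
    have c0m: "c0 \<in> borel_measurable borel" using c0c by (rule borel_measurable_continuous_onI)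
    \<comment> \<open>Convolution with the heat kernel destroys bounded support. The cutoff restores
      it and acts only where f vanishes, so shrinking the mollified function there cannot enlarge
      the error.\<close>
    define \<eta> where "\<eta> x = max 0 (min 1 (real N + 1 - norm x))" for x :: 'a
    define c where "c x = \<eta> x * c0 x" for x
    have cc: "continuous_on UNIV c" unfolding c_def \<eta>_def by (intro continuous_intros c0c)
    have cr: "spherically_symmetric c"
      using c0r unfolding spherically_symmetric_def c_def \<eta>_def by metis
    have c_far: "c x = 0" if "norm x > real N + 1" for x using that by (simp add: c_def \<eta>_def)
    have cm: "c \<in> borel_measurable lebesgue"
      using borel_measurable_continuous_onI[OF cc] by (intro measurable_completion) simp
    have c_close: "\<bar>f x - c x\<bar> \<le> \<bar>f x - c0 x\<bar>" for x
    proof (cases "norm x \<le> real N")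
      case True
      then show ?thesis by (simp add: c_def \<eta>_def)
    next
      case False
      have "\<bar>\<eta> x\<bar> \<le> 1" by (simp add: \<eta>_def)
      then have "\<bar>\<eta> x\<bar> * \<bar>c0 x\<bar> \<le> \<bar>c0 x\<bar>" by (rule mult_left_le_one_le[OF abs_ge_zero abs_ge_zero])
      then show ?thesis using f0[of x] False by (simp add: c_def abs_mult)
    qed
    have pw: "\<bar>f x - c x\<bar> powr p \<le> K * \<bar>f x - c0 x\<bar>" for x
    proof (cases "f x = c x")
      case True
      then show ?thesis using p K by simp
    next
      case False
      have "\<bar>f x - c x\<bar> powr p = \<bar>f x - c x\<bar> powr (p - 1) * \<bar>f x - c x\<bar>"
        using False by (simp add: powr_diff)
      also have "\<dots> \<le> K * \<bar>f x - c0 x\<bar>"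
        unfolding K_def using p c_close[of x] fb[of x] c0b[of x] by (intro mult_mono powr_mono2) auto
      finally show ?thesis .
    qed
    have fc: "(\<integral>\<^sup>+x. ennreal (norm (f x - c x) powr p) \<partial>lebesgue) < ennreal d"
    proof -
      have "(\<integral>\<^sup>+x. ennreal (norm (f x - c x) powr p) \<partial>lebesgue) \<le> (\<integral>\<^sup>+x. ennreal K * ennreal \<bar>f2 x - c0 x\<bar> \<partial>lebesgue)"
      proof (rule nn_integral_mono_AE)
        show "AE x in lebesgue. ennreal (norm (f x - c x) powr p) \<le> ennreal K * ennreal \<bar>f2 x - c0 x\<bar>"
          using f2
        proof eventually_elim
          case (elim x)
          have "ennreal (norm (f x - c x) powr p) \<le> ennreal (K * \<bar>f2 x - c0 x\<bar>)"
            using pw[of x] unfolding elim by (intro ennreal_leI) simp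
          then show ?case using K by (simp add: ennreal_mult)
        qed
      qed
      also have "\<dots> = (\<integral>\<^sup>+x. ennreal K * ennreal \<bar>f2 x - c0 x\<bar> \<partial>lborel)"
        using f2m c0m by (intro nn_integral_completion)
      also have "\<dots> = ennreal K * (\<integral>\<^sup>+x. ennreal \<bar>f2 x - c0 x\<bar> \<partial>lborel)"
        using f2m c0m by (intro nn_integral_cmult) auto
      also have "\<dots> < ennreal K * ennreal (d / K)"
        using n K unfolding c0_eq by (intro ennreal_mult_strict_left_mono) auto
      also have "\<dots> = ennreal d" using K d by (simp flip: ennreal_mult)
      finally show ?thesis .
    qed
    obtain \<phi> where \<phi>: "test_function \<phi>" "spherically_symmetric \<phi>" "continuous_on UNIV \<phi>"
      "(\<integral>\<^sup>+x. ennreal (\<bar>c x - \<phi> x\<bar> powr p) \<partial>lebesgue) < ennreal d"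
      using test_function_approx_continuous[OF cc cr _ c_far d, where p = p and R = "real N + 1"] p by auto
    have \<phi>m: "\<phi> \<in> borel_measurable lebesgue"
      using borel_measurable_continuous_onI[OF \<phi>(3)] by (intro measurable_completion) simp
    have p0: "p > 0" using p by simp
    let ?I = "\<lambda>f::'a \<Rightarrow> real. \<integral>\<^sup>+x. ennreal (norm (f x) powr p) \<partial>lebesgue"
    have "?I (\<lambda>x. u x - \<phi> x) = ?I (\<lambda>x. (u x - f x) + ((f x - c x) + (c x - \<phi> x)))" by simp
    also have "\<dots> \<le> ennreal (2 powr p) * (?I (\<lambda>x. u x - f x) + ?I (\<lambda>x. (f x - c x) + (c x - \<phi> x)))"
      using um fm cm \<phi>m by (intro nn_integral_powr_add_le[OF p0] borel_measurable_diff borel_measurable_add)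
    also have "\<dots> \<le> ennreal (2 powr p) * (ennreal d + ennreal (2 powr p) * (ennreal d + ennreal d))"
    proof (intro mult_left_mono add_mono order_refl)
      have "?I (\<lambda>x. (f x - c x) + (c x - \<phi> x)) \<le> ennreal (2 powr p) * (?I (\<lambda>x. f x - c x) + ?I (\<lambda>x. c x - \<phi> x))"
        using fm cm \<phi>m by (intro nn_integral_powr_add_le[OF p0] borel_measurable_diff)
      also have "\<dots> \<le> ennreal (2 powr p) * (ennreal d + ennreal d)"
        using fc \<phi>(4) by (intro mult_left_mono add_mono) auto
      finally show "?I (\<lambda>x. (f x - c x) + (c x - \<phi> x)) \<le> ennreal (2 powr p) * (ennreal d + ennreal d)" .
    qed (use N in \<open>auto simp: f_def\<close>)
    also have "\<dots> = ennreal (2 powr p * (d + 2 powr p * (d + d)))"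
      using d by (simp only: ennreal_mult ennreal_plus powr_ge_zero add_nonneg_nonneg mult_nonneg_nonneg less_imp_le)
    also have "2 powr p * (d + 2 powr p * (d + d)) = (2 powr p * (1 + 2 * 2 powr p)) * d" by (simp add: algebra_simps)
    also have "\<dots> = e powr p / 2"
    proof -
      have "2 powr p * (1 + 2 * 2 powr p) > (0::real)" by (simp add: add_pos_pos)
      moreover have "K * (x / (2 * K)) = x / 2" if "K > 0" for K x :: real using that by simp
      ultimately show ?thesis unfolding d_def by blast
    qed
    also have "ennreal (e powr p / 2) < ennreal (e powr p)" using e by (intro ennreal_lessI) auto
    finally have "Lp_norm p (\<lambda>x. u x - \<phi> x) < e"
      using um \<phi>m by (intro Lp_norm_less[OF p0 _ e] borel_measurable_diff)
    then show ?thesis using \<phi> by blast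
  qed
  then show ?thesis using u(1) unfolding Lp_rad_def by blast
qed

section \<open>The nonlinear equation\<close>

lemma Lp_norm_le:
  fixes f :: "'a::euclidean_space \<Rightarrow> 'b::{real_normed_vector, second_countable_topology}"
  assumes p: "p > 0" and fm: "f \<in> borel_measurable lebesgue" and e: "e > 0"
    and le: "(\<integral>\<^sup>+x. ennreal (norm (f x) powr p) \<partial>lebesgue) \<le> ennreal (e powr p)"
  shows "f \<in> Lp_space p" "Lp_norm p f \<le> e"
proof -
  let ?I = "\<integral>\<^sup>+x. ennreal (norm (f x) powr p) \<partial>lebesgue"
  have "?I < \<infinity>" using le by (rule le_less_trans) simp
  then show "f \<in> Lp_space p" using fm unfolding Lp_space_def by (auto simp: integrable_iff_bounded)
  have "(\<integral>x. norm (f x) powr p \<partial>lebesgue) = enn2real ?I"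
    using fm by (intro integral_eq_nn_integral AE_I2) auto
  also have "enn2real ?I \<le> e powr p"
    using le by (intro enn2real_leI) auto
  finally have "(\<integral>x. norm (f x) powr p \<partial>lebesgue) powr (1 / p) \<le> (e powr p) powr (1 / p)"
    using p by (intro powr_mono2) auto
  then show "Lp_norm p f \<le> e" using p e by (simp add: Lp_norm_def powr_powr)
qed

lemma sq_norm_le_Lp_norm:
  fixes h :: "'a::euclidean_space \<Rightarrow> real"
  assumes h: "h \<in> Lp_space 2" and \<rho>: "Lp_norm 2 h < \<rho>" "\<rho> > 0"
  shows "sq_norm h \<le> ennreal (\<rho>\<^sup>2)"
proof -
  let ?I = "\<integral>x. norm (h x) powr 2 \<partial>lebesgue"
  have i: "integrable lebesgue (\<lambda>x. norm (h x) powr 2)" using h by (simp add: Lp_space_def)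
  have "sq_norm h = (\<integral>\<^sup>+x. ennreal (norm (h x) powr 2) \<partial>lebesgue)" unfolding sq_norm_def norm_powr_2 ..
  also have "\<dots> = ennreal ?I" using i by (intro nn_integral_eq_integral) auto
  also have "?I \<le> \<rho>\<^sup>2"
  proof (rule ccontr)
    assume "\<not> ?I \<le> \<rho>\<^sup>2"
    then have "(\<rho>\<^sup>2) powr (1 / 2) \<le> ?I powr (1 / 2)" by (intro powr_mono2) auto
    moreover have "(\<rho>\<^sup>2) powr (1 / 2) = \<rho>" using \<rho> by (simp add: powr_half_sqrt)
    ultimately show False using \<rho> by (simp add: Lp_norm_def)
  qed
  then have "ennreal ?I \<le> ennreal (\<rho>\<^sup>2)" by (rule ennreal_leI)
  finally show ?thesis .
qed

text \<open>The hypotheses on \<open>V\<close> only hold for almost every \<open>x\<close>. Since \<open>tame\<close> depends on \<open>V x\<close> alone, resetting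
  \<open>V\<close> to \<open>0\<close> where it fails keeps spherical symmetry, which the choice of an arbitrary null set would not.\<close>

definition tame :: "real \<Rightarrow> real \<Rightarrow> (real \<Rightarrow> real) \<Rightarrow> bool" where
  "tame C r v \<longleftrightarrow> (\<exists>c. \<forall>y. \<bar>v y\<bar> \<le> C * (c + \<bar>y\<bar> powr r)) \<and>
     (\<forall>M. \<exists>L. \<forall>y y'. \<bar>y\<bar> \<le> M \<longrightarrow> \<bar>y'\<bar> \<le> M \<longrightarrow> \<bar>v y - v y'\<bar> \<le> L * \<bar>y - y'\<bar>)"

text \<open>The mean value inequality on [- M, M], where the derivative is at most C (d +
  M^\<delta>). Here c and d stand for |h(x)| and |g(x)| at one fixed x.\<close>

lemma tame_deriv_bound:
  assumes "C > 0" "\<delta> > 0" "\<And>y. v field_differentiable (at y)"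
    and b: "\<And>y. \<bar>v y\<bar> \<le> C * (c + \<bar>y\<bar> powr (1 + \<delta>))" "\<And>y. \<bar>deriv v y\<bar> \<le> C * (d + \<bar>y\<bar> powr \<delta>)"
  shows "tame C (1 + \<delta>) v"
  unfolding tame_def
proof (intro conjI allI)
  show "\<exists>c. \<forall>y. \<bar>v y\<bar> \<le> C * (c + \<bar>y\<bar> powr (1 + \<delta>))" using b(1) by blast
  fix M
  have "\<bar>v y - v y'\<bar> \<le> C * (d + M powr \<delta>) * \<bar>y - y'\<bar>" if "\<bar>y\<bar> \<le> M" "\<bar>y'\<bar> \<le> M" for y y'
  proof -
    have "norm (v y - v y') \<le> C * (d + M powr \<delta>) * norm (y - y')"
    proof (rule field_differentiable_bound[where f' = "deriv v"])
      show "convex {-M..M}" by simp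
      show "(v has_field_derivative deriv v z) (at z within {-M..M})" for z
        using assms(3) by (meson DERIV_deriv_iff_field_differentiable has_field_derivative_at_within)
      show "norm (deriv v z) \<le> C * (d + M powr \<delta>)" if "z \<in> {-M..M}" for z
      proof -
        have "\<bar>z\<bar> powr \<delta> \<le> M powr \<delta>" using that assms(2) by (intro powr_mono2) auto
        then have "C * (d + \<bar>z\<bar> powr \<delta>) \<le> C * (d + M powr \<delta>)" using assms(1) by (intro mult_left_mono) auto
        then show ?thesis using b(2)[of z] by simp
      qed
    qed (use that in auto)
    then show ?thesis by simp
  qed
  then show "\<exists>L. \<forall>y y'. \<bar>y\<bar> \<le> M \<longrightarrow> \<bar>y'\<bar> \<le> M \<longrightarrow> \<bar>v y - v y'\<bar> \<le> L * \<bar>y - y'\<bar>" by blast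
qed

text \<open>The function \<open>h\<close> need not be radial, so it is replaced by the least admissible majorant.\<close>

lemma radial_majorant:
  fixes V :: "'a::euclidean_space \<Rightarrow> real \<Rightarrow> real" and h :: "'a \<Rightarrow> real"
  assumes C: "C > 0" and r: "r > 0"
    and Vrad: "spherically_symmetric V" and Vm: "\<And>y. (\<lambda>x. V x y) \<in> borel_measurable lebesgue"
    and Vc: "\<And>x. continuous_on UNIV (V x)"
    and Vb: "\<And>x. \<exists>c. \<forall>y. \<bar>V x y\<bar> \<le> C * (c + \<bar>y\<bar> powr r)"
    and Vh: "AE x in lebesgue. \<forall>y. \<bar>V x y\<bar> \<le> C * (\<bar>h x\<bar> + \<bar>y\<bar> powr r)"
  shows "\<exists>H. H \<in> borel_measurable lebesgue \<and> spherically_symmetric H \<and> (\<forall>x. H x \<ge> 0) \<and>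
    (\<forall>x y. \<bar>V x y\<bar> \<le> C * (H x + \<bar>y\<bar> powr r)) \<and> (AE x in lebesgue. H x \<le> \<bar>h x\<bar>)"
proof -
  \<comment> \<open>The smallest number that satisfies the growth bound at x. It depends on V(x, .)
    alone, which makes it radial; the rationals make it measurable; \<open>ennreal\<close> cuts
    negative values off at 0.\<close>
  define S where "S x = (SUP s\<in>\<rat>. ennreal (\<bar>V x s\<bar> / C - \<bar>s\<bar> powr r))" for x
  define H where "H x = enn2real (S x)" for x
  have S_le: "S x \<le> ennreal c" if "\<forall>y. \<bar>V x y\<bar> \<le> C * (c + \<bar>y\<bar> powr r)" for x c
    unfolding S_def
  proof (rule SUP_least)
    fix s :: real
    have "\<bar>V x s\<bar> / C \<le> c + \<bar>s\<bar> powr r" using that C by (simp add: field_simps)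
    then show "ennreal (\<bar>V x s\<bar> / C - \<bar>s\<bar> powr r) \<le> ennreal c" by (intro ennreal_leI) simp
  qed
  have S_eq: "S x = ennreal (H x)" for x
  proof -
    obtain c where "\<forall>y. \<bar>V x y\<bar> \<le> C * (c + \<bar>y\<bar> powr r)" using Vb by blast
    from S_le[OF this] have "S x < top" using ennreal_less_top le_less_trans by blast
    then show ?thesis unfolding H_def by simp
  qed
  have H0: "H x \<ge> 0" for x by (simp add: H_def)
  have Hm: "H \<in> borel_measurable lebesgue"
  proof -
    have "(\<lambda>x. ennreal (\<bar>V x s\<bar> / C - \<bar>s\<bar> powr r)) \<in> borel_measurable lebesgue" for s using Vm[of s] by simp
    then have "S \<in> borel_measurable lebesgue"
      unfolding S_def [abs_def] by (intro borel_measurable_SUP countable_rat)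
    then show ?thesis unfolding H_def [abs_def] by simp
  qed
  have Hr: "spherically_symmetric H"
    unfolding spherically_symmetric_def
  proof (intro allI impI)
    fix x x' :: 'a assume "norm x = norm x'"
    then have "V x = V x'" using Vrad unfolding spherically_symmetric_def by blast
    then show "H x = H x'" by (simp add: H_def S_def)
  qed
  have "\<bar>V x y\<bar> \<le> C * (H x + \<bar>y\<bar> powr r)" for x y
  proof (rule continuous_le_on_Rats[where f = "\<lambda>y. \<bar>V x y\<bar>" and g = "\<lambda>y. C * (H x + \<bar>y\<bar> powr r)"])
    show "continuous_on UNIV (\<lambda>y. \<bar>V x y\<bar>)" by (intro continuous_intros Vc)
    show "continuous_on UNIV (\<lambda>y. C * (H x + \<bar>y\<bar> powr r))"
      by (intro continuous_on_mult continuous_on_add continuous_on_const continuous_on_powr' continuous_on_rabs continuous_on_id)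
        (use r in auto)
    fix s :: real assume "s \<in> \<rat>"
    then have "ennreal (\<bar>V x s\<bar> / C - \<bar>s\<bar> powr r) \<le> ennreal (H x)"
      unfolding S_eq[symmetric] S_def by (rule SUP_upper)
    then have "\<bar>V x s\<bar> / C - \<bar>s\<bar> powr r \<le> H x" using H0[of x] by (simp add: ennreal_le_iff)
    then show "\<bar>V x s\<bar> \<le> C * (H x + \<bar>s\<bar> powr r)" using C by (simp add: field_simps)
  qed
  moreover have "AE x in lebesgue. H x \<le> \<bar>h x\<bar>"
    using Vh
  proof eventually_elim
    case (elim x)
    from S_le[OF this] show ?case unfolding S_eq by simp
  qed
  ultimately show ?thesis using Hm Hr H0 by blast
qed

text \<open>The transform of u is that of f times m = 1 / (1 + |\<xi>|^\<gamma> / \<kappa>).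
  Multiplying by 1 / m returns f, which gives membership in the space, and the identity
  |\<xi>|^\<gamma> m = \<kappa> (1 - m) shows that the fractional Laplacian of u is \<kappa> (f -
  u).\<close>

lemma resolvent_fixed_point_solves:
  fixes u f :: "'a::euclidean_space \<Rightarrow> real"
  assumes \<kappa>: "\<kappa> > 0" and \<gamma>: "0 < \<gamma>" "\<gamma> < 1"
    and f: "f \<in> Lp_space 2" and u: "spherically_symmetric u" "u \<in> borel_measurable lebesgue"
    and eq: "AE x in lebesgue. u x = convolve (resolvent_kernel (\<gamma> / 2) (1 / \<kappa>) (1 + 0)) f x"
    and fV: "AE x in lebesgue. f x = V x (u x)"
  shows "(\<lambda>x. complex_of_real (u x)) \<in> H22_rad (\<lambda>t. 1 / \<kappa> * t powr (\<gamma> / 2))"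
    and "solves_equation \<kappa> \<gamma> V u"
proof -
  let ?F = "\<lambda>x. complex_of_real (f x)" and ?u = "\<lambda>x. complex_of_real (u x)"
  let ?m = "\<lambda>\<xi>::'a. 1 / (1 + 1 / \<kappa> * norm \<xi> powr \<gamma>)"
  obtain v where v: "L2_fourier ?F v" using L2_fourier_exists[OF Lp2_of_real[OF f]] by blast
  have \<alpha>: "0 < \<gamma> / 2" "\<gamma> / 2 < 1 / 2" "0 < 1 / \<kappa>" using \<gamma> \<kappa> by auto
  have "L2_fourier (\<lambda>x. complex_of_real (convolve (resolvent_kernel (\<gamma> / 2) (1 / \<kappa>) (1 + 0)) f x)) (\<lambda>\<xi>. complex_of_real (?m \<xi>) * v \<xi>)"
    using res_op_fourier[OF \<alpha> order_refl v] by simp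
  then have uv: "L2_fourier ?u (\<lambda>\<xi>. complex_of_real (?m \<xi>) * v \<xi>)"
    by (rule L2_fourier_cong_AE) (use eq in \<open>auto elim!: eventually_mono\<close>)
  have pos: "1 + 1 / \<kappa> * norm \<xi> powr \<gamma> > 0" for \<xi> :: 'a using \<kappa> by (intro add_pos_nonneg) auto
  have sq: "((norm \<xi>)\<^sup>2) powr (\<gamma> / 2) = norm \<xi> powr \<gamma>" for \<xi> :: 'a
    by (simp add: powr_powr flip: powr_numeral)
  have "complex_of_real (1 + 1 / \<kappa> * ((norm \<xi>)\<^sup>2) powr (\<gamma> / 2)) * (complex_of_real (?m \<xi>) * v \<xi>) = v \<xi>" for \<xi> :: 'a
  proof -
    have "complex_of_real (1 + 1 / \<kappa> * norm \<xi> powr \<gamma>) * complex_of_real (?m \<xi>) = 1"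
      using pos[of \<xi>] by (simp only: of_real_mult[symmetric]) simp
    then show ?thesis unfolding sq mult.assoc[symmetric] by simp
  qed
  then have *: "fourier_multiplier (\<lambda>\<xi>. 1 + 1 / \<kappa> * ((norm \<xi>)\<^sup>2) powr (\<gamma> / 2)) ?u ?F"
    unfolding fourier_multiplier_def using uv v by (intro exI[of _ "\<lambda>\<xi>. complex_of_real (?m \<xi>) * v \<xi>"]) simp
  show "?u \<in> H22_rad (\<lambda>t. 1 / \<kappa> * t powr (\<gamma> / 2))"
  proof -
    have "spherically_symmetric ?u" using u(1) unfolding spherically_symmetric_def by metis
    then show ?thesis
      using L2_fourierD(1)[OF uv] L2_fourierD(1)[OF v] *
      unfolding H22_rad_def H22_def by blast
  qed
  have "L2_fourier (\<lambda>x. complex_of_real \<kappa> * ?F x + complex_of_real (- \<kappa>) * ?u x)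
    (\<lambda>\<xi>. complex_of_real \<kappa> * v \<xi> + complex_of_real (- \<kappa>) * (complex_of_real (?m \<xi>) * v \<xi>))"
    by (rule L2_fourier_linear[OF v uv])
  moreover have "complex_of_real \<kappa> * v \<xi> + complex_of_real (- \<kappa>) * (complex_of_real (?m \<xi>) * v \<xi>)
      = complex_of_real (norm \<xi> powr (2 * (\<gamma> / 2))) * (complex_of_real (?m \<xi>) * v \<xi>)" for \<xi> :: 'a
  proof -
    have m: "\<kappa> - \<kappa> * ?m \<xi> = norm \<xi> powr (2 * (\<gamma> / 2)) * ?m \<xi>" using pos[of \<xi>] \<kappa> by (simp add: field_simps)
    have "complex_of_real \<kappa> * z + complex_of_real (- \<kappa>) * (complex_of_real m * z) = complex_of_real s * (complex_of_real m * z)"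
      if "\<kappa> - \<kappa> * m = s * m" for m s z
    proof -
      have "complex_of_real \<kappa> * z + complex_of_real (- \<kappa>) * (complex_of_real m * z) = complex_of_real (\<kappa> - \<kappa> * m) * z"
        by (simp add: algebra_simps)
      then show ?thesis unfolding that by simp
    qed
    from this[OF m] show ?thesis .
  qed
  ultimately have "fractional_laplacian (\<gamma> / 2) ?u (\<lambda>x. complex_of_real \<kappa> * ?F x + complex_of_real (- \<kappa>) * ?u x)"
    unfolding fractional_laplacian_def fourier_multiplier_def using uv by auto
  moreover have "AE x in lebesgue. complex_of_real (1 / \<kappa>) * (complex_of_real \<kappa> * ?F x + complex_of_real (- \<kappa>) * ?u x)
      = complex_of_real (- u x + V x (u x))"
    using fV by eventually_elim (use \<kappa> in \<open>simp add: field_simps\<close>)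
  ultimately show "solves_equation \<kappa> \<gamma> V u" unfolding solves_equation_def by blast
qed

theorem theorem5p4:
  fixes \<delta> \<gamma> \<kappa> C :: real
  assumes "\<delta> > 0" and "\<kappa> > 0" and "C > 0"
    and "\<gamma> > real DIM('a::euclidean_space) / 2 * (\<delta> / (1 + \<delta>))"
    and "0 < \<gamma>" and "\<gamma> < 1"
  shows "\<exists>\<epsilon> \<rho>. 0 < \<epsilon> \<and> \<epsilon> < 1 \<and> 0 < \<rho> \<and> \<rho> < 1 \<and>
    (\<forall>(V :: 'a \<Rightarrow> real \<Rightarrow> real) (h :: 'a \<Rightarrow> real) (g :: 'a \<Rightarrow> real).
       spherically_symmetric V \<longrightarrow>
       (\<forall>y. (\<lambda>x. V x y) \<in> borel_measurable lebesgue) \<longrightarrow>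
       (\<forall>x y. V x field_differentiable (at y)) \<longrightarrow>
       h \<in> Lp_space 2 \<longrightarrow>
       g \<in> Lp_space (2 * (1 + \<delta>) / \<delta>) \<longrightarrow>
       (AE x in lebesgue. \<forall>y. \<bar>V x y\<bar> \<le> C * (\<bar>h x\<bar> + \<bar>y\<bar> powr (1 + \<delta>)) \<and>
                               \<bar>deriv (V x) y\<bar> \<le> C * (\<bar>g x\<bar> + \<bar>y\<bar> powr \<delta>)) \<longrightarrow>
       Lp_norm 2 h < \<rho> \<longrightarrow>
       (\<exists>u :: 'a \<Rightarrow> real.
          (\<lambda>x. complex_of_real (u x)) \<in> H22_rad (\<lambda>t. 1 / \<kappa> * t powr (\<gamma> / 2)) \<and>
          solves_equation \<kappa> \<gamma> V u \<and>
          u \<in> Lp_rad (2 * (1 + \<delta>)) \<and>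
          Lp_norm (2 * (1 + \<delta>)) u \<le> \<epsilon>))"
proof -
  have \<alpha>: "0 < \<gamma> / 2" "\<gamma> / 2 < 1 / 2" "0 < 1 / \<kappa>" using assms by auto
  \<comment> \<open>The hypothesis on \<gamma> in the form in which the moment of the subordination
    density calls for it.\<close>
  have \<beta>: "real DIM('a) * \<delta> / (4 * (1 + \<delta>)) < \<gamma> / 2" using assms by (simp add: field_simps)
  note \<delta> = assms(1) and \<kappa> = assms(2) and C = assms(3)
  let ?q = "2 * (1 + \<delta>)"
  let ?G = "convolve (resolvent_kernel (\<gamma> / 2) (1 / \<kappa>) (1 + 0)) :: ('a \<Rightarrow> real) \<Rightarrow> 'a \<Rightarrow> real"
  \<comment> \<open>The constants of the barrier are fixed here, before V, h and g are
    introduced.\<close>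
  obtain \<epsilon> \<rho> where \<epsilon>: "0 < \<epsilon>" "\<epsilon> < 1" and \<rho>: "0 < \<rho>" "\<rho> < 1"
    and barrier: "\<And>H::'a \<Rightarrow> real. H \<in> Lp_space 2 \<Longrightarrow> spherically_symmetric H \<Longrightarrow> (\<forall>x. H x \<ge> 0) \<Longrightarrow> sq_norm H \<le> ennreal (\<rho>\<^sup>2) \<Longrightarrow>
      (\<exists>U. U \<in> Lp_space 2 \<and> spherically_symmetric U \<and> (\<forall>x. U x \<ge> 0) \<and>
        (\<lambda>x. C * (H x + U x powr (1 + \<delta>))) \<in> Lp_space 2 \<and>
        (AE x in lebesgue. U x = ?G (\<lambda>x. C * (H x + U x powr (1 + \<delta>))) x) \<and>
        (\<integral>\<^sup>+x. ennreal (U x powr ?q) \<partial>lebesgue) \<le> ennreal (\<epsilon> powr ?q))"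
    using barrier_exists[OF \<alpha> C \<delta> \<beta>] by blast
  have "\<exists>u :: 'a \<Rightarrow> real. (\<lambda>x. complex_of_real (u x)) \<in> H22_rad (\<lambda>t. 1 / \<kappa> * t powr (\<gamma> / 2)) \<and>
      solves_equation \<kappa> \<gamma> V u \<and> u \<in> Lp_rad ?q \<and> Lp_norm ?q u \<le> \<epsilon>"
    if Vrad: "spherically_symmetric V" and Vm: "\<forall>y. (\<lambda>x. V x y) \<in> borel_measurable lebesgue"
      and Vd: "\<forall>x y. V x field_differentiable (at y)" and h: "h \<in> Lp_space 2"
      and bound: "AE x in lebesgue. \<forall>y. \<bar>V x y\<bar> \<le> C * (\<bar>h x\<bar> + \<bar>y\<bar> powr (1 + \<delta>)) \<and>
                               \<bar>deriv (V x) y\<bar> \<le> C * (\<bar>g x\<bar> + \<bar>y\<bar> powr \<delta>)"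
      and small: "Lp_norm 2 h < \<rho>"
    for V :: "'a \<Rightarrow> real \<Rightarrow> real" and h g :: "'a \<Rightarrow> real"
  proof -
    define V' where "V' x = (if tame C (1 + \<delta>) (V x) then V x else (\<lambda>_. 0))" for x
    have VV': "AE x in lebesgue. V x = V' x"
      using bound
    proof eventually_elim
      case (elim x)
      then have "tame C (1 + \<delta>) (V x)"
        using Vd by (intro tame_deriv_bound[OF C \<delta>, where c = "\<bar>h x\<bar>" and d = "\<bar>g x\<bar>"]) auto
      then show ?case by (simp add: V'_def)
    qed
    have V't: "tame C (1 + \<delta>) (V' x)" for x
    proof (cases "tame C (1 + \<delta>) (V x)")
      case False
      have "tame C (1 + \<delta>) (\<lambda>_. 0)"
        unfolding tame_def using C by (intro conjI exI[of _ 0] allI) auto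
      then show ?thesis using False by (simp add: V'_def)
    qed (simp add: V'_def)
    have V'rad: "spherically_symmetric V'"
      unfolding spherically_symmetric_def
    proof (intro allI impI)
      fix x x' :: 'a assume "norm x = norm x'"
      then have "V x = V x'" using Vrad unfolding spherically_symmetric_def by blast
      then show "V' x = V' x'" by (simp add: V'_def)
    qed
    have V'm: "(\<lambda>x. V' x y) \<in> borel_measurable lebesgue" for y
      by (rule borel_measurable_AE[OF Vm[rule_format, of y]]) (use VV' in \<open>auto elim!: eventually_mono\<close>)
    have V'c: "continuous_on UNIV (V' x)" for x
      using Vd unfolding V'_def
      by (auto intro!: continuous_at_imp_continuous_on field_differentiable_imp_continuous_at)
    have V'b: "\<exists>c. \<forall>y. \<bar>V' x y\<bar> \<le> C * (c + \<bar>y\<bar> powr (1 + \<delta>))"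
      and V'l: "\<exists>L. \<forall>y y'. \<bar>y\<bar> \<le> M \<longrightarrow> \<bar>y'\<bar> \<le> M \<longrightarrow> \<bar>V' x y - V' x y'\<bar> \<le> L * \<bar>y - y'\<bar>" for x M
      using V't[of x] unfolding tame_def by auto
    have V'h: "AE x in lebesgue. \<forall>y. \<bar>V' x y\<bar> \<le> C * (\<bar>h x\<bar> + \<bar>y\<bar> powr (1 + \<delta>))"
      using bound VV' by eventually_elim auto
    obtain H where Hm: "H \<in> borel_measurable lebesgue" and Hr: "spherically_symmetric H" and H0: "\<forall>x. H x \<ge> 0"
      and Hb: "\<forall>x y. \<bar>V' x y\<bar> \<le> C * (H x + \<bar>y\<bar> powr (1 + \<delta>))" and Hh: "AE x in lebesgue. H x \<le> \<bar>h x\<bar>"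
      using radial_majorant[OF C _ V'rad V'm V'c V'b V'h] \<delta> by auto
    have "sq_norm H \<le> sq_norm h"
      by (rule sq_norm_mono_AE) (use Hh H0 in \<open>auto elim!: eventually_mono\<close>)
    then have Hs: "sq_norm H \<le> ennreal (\<rho>\<^sup>2)" using sq_norm_le_Lp_norm[OF h small \<rho>(1)] by (rule order_trans)
    then have "H \<in> Lp_space 2" using Hm by (auto simp: Lp_space_2_iff intro: le_less_trans)
    from barrier[OF this Hr H0 Hs] obtain U where U: "U \<in> Lp_space 2" "spherically_symmetric U" "\<And>x. U x \<ge> 0"
      and W: "(\<lambda>x. C * (H x + U x powr (1 + \<delta>))) \<in> Lp_space 2"
      and UW: "AE x in lebesgue. U x = ?G (\<lambda>x. C * (H x + U x powr (1 + \<delta>))) x"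
      and Uq: "(\<integral>\<^sup>+x. ennreal (U x powr ?q) \<partial>lebesgue) \<le> ennreal (\<epsilon> powr ?q)" by blast
    obtain u where um: "u \<in> borel_measurable lebesgue" and ur: "spherically_symmetric u" and uU: "\<And>x. \<bar>u x\<bar> \<le> U x"
      and ueq: "AE x in lebesgue. u x = ?G (\<lambda>y. V' y (u y)) x" and fL: "(\<lambda>y. V' y (u y)) \<in> Lp_space 2"
      using radial_solution[OF \<alpha> C \<delta> U W UW Hr V'rad V'm V'c Hb[rule_format] V'l] by blast
    \<comment> \<open>The equation is an identity almost everywhere, so a solution for the modified
      V' is also one for V. The pointwise bound by U then carries the barrier's L^q bound over to
      u.\<close>
    have "AE x in lebesgue. V' x (u x) = V x (u x)" using VV' by eventually_elim simp
    note sol = resolvent_fixed_point_solves[where V = V, OF \<kappa> assms(5,6) fL ur um ueq this]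
    have "(\<integral>\<^sup>+x. ennreal (norm (u x) powr ?q) \<partial>lebesgue) \<le> (\<integral>\<^sup>+x. ennreal (U x powr ?q) \<partial>lebesgue)"
      using uU \<delta> by (intro nn_integral_mono ennreal_leI powr_mono2) auto
    then have "(\<integral>\<^sup>+x. ennreal (norm (u x) powr ?q) \<partial>lebesgue) \<le> ennreal (\<epsilon> powr ?q)" using Uq by (rule order_trans)
    note uq = Lp_norm_le[OF _ um \<epsilon>(1) this]
    have "u \<in> Lp_rad ?q" using \<delta> by (intro Lp_rad_spherically_symmetric uq ur) auto
    then show ?thesis using sol uq(2) \<delta> by auto
  qed
  then show ?thesis using \<epsilon> \<rho> by blast
qed

end
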